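(* Let $R$ be a commutative ring, let $\mathcal{A}$ and $\mathcal{B}$ be pre-triangulated $R$-linear dg-categories whose homotopy categories $[\mathcal{A}]$ and $[\mathcal{B}]$ are equipped with $t$-structures with respective hearts $\mathcal{A}_0$ and $\mathcal{B}_0$, let $M\colon\mathcal{A}^{\mathrm{op}}\otimes\mathcal{B}\to C(R)$ be a dg-bimodule, and consider the glued dg-category $\mathcal{A}\times_M\mathcal{B}$. Then there is an induced abelian bimodule $$M_0\colon\mathcal{A}_0^{\mathrm{op}}\times\mathcal{B}_0\longrightarrow\mathrm{mod}\text{-}R,\qquad (A,B)\longmapsto H^0(M(A,B)).$$ If the $t$-structures glue, with glued heart $\mathrm{gl}(\mathcal{A}_0,\mathcal{B}_0)\subset[\mathcal{A}\times_M\mathcal{B}]$, then $$\mathrm{gl}(\mathcal{A}_0,\mathcal{B}_0)\simeq\mathcal{A}_0\times_{M_0}\mathcal{B}_0 .$$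
   Context: dg-categories are small, $R$-linear, with additive homotopy category $[-]$; $C(R)$ is the dg-category of cochain complexes of $R$-modules; a dg-bimodule is a dg-functor $M\colon\mathcal{A}^{\mathrm{op}}\otimes\mathcal{B}\to C(R)$. Glued dg-category $\mathcal{A}\times_M\mathcal{B}$: objects are triples $(A,B,\phi)$ with $A\in\mathcal{A}$, $B\in\mathcal{B}$, $\phi\in M^0(A,B)$ closed of degree $0$. Morphism complexes are $\mathrm{Hom}^\bullet((A_1,B_1,\phi_1),(A_2,B_2,\phi_2))=\mathrm{Hom}^\bullet_{\mathcal{A}}(A_1,A_2)\oplus\mathrm{Hom}^\bullet_{\mathcal{B}}(B_1,B_2)\oplus M^{\bullet-1}(A_1,B_2)$ with differential $d(a,b,c)=(d(a),d(b),-d(c)-b\circ\phi_1+\phi_2\circ a)$; composition is $(a_2,b_2,c_2)\circ(a_1,b_1,c_1)=(a_2a_1,\,b_2b_1,\,c_2a_1+(-1)^{\deg b_2}b_2c_1)$; identities are $(\mathrm{id}_A,\mathrm{id}_B,0)$. If $\mathcal{A},\mathcal{B}$ are pre-triangulated, so is $\mathcal{A}\times_M\mathcal{B}$, and via $A\mapsto(A,0,0)$, $B\mapsto(0,B,0)$ there is a semiorthogonal decomposition $[\mathcal{A}\times_M\mathcal{B}]=\langle[\mathcal{A}],[\mathcal{B}]\rangle$ (Kuznetsov–Lunts), where $\mathcal{D}=\langle\mathcal{A}',\mathcal{B}'\rangle$ means $\mathrm{Hom}_{\mathcal{D}}(\mathcal{B}',\mathcal{A}')=0$ and every $E$ fits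 in a triangle $B\to E\to A\to B[1]$ with $A\in\mathcal{A}'$, $B\in\mathcal{B}'$. The $t$-structures glue means: $\mathrm{Hom}_{[\mathcal{A}\times_M\mathcal{B}]}(A,B[i])=0$ for all $A\in\mathcal{A}_0$, $B\in\mathcal{B}_0$, $i\le0$. In that case the extension closure $\mathrm{gl}(\mathcal{A}_0,\mathcal{B}_0)$ of $\mathcal{A}_0$ and $\mathcal{B}_0$ is the heart of a $t$-structure on $[\mathcal{A}\times_M\mathcal{B}]$, called the glued heart. Abelian gluing: an abelian bimodule is an $R$-linear bifunctor $\mathcal{A}_0^{\mathrm{op}}\times\mathcal{B}_0\to\mathrm{mod}\text{-}R$. $\mathcal{A}_0\times_{M_0}\mathcal{B}_0$ has objects triples $(A,B,\mu)$, $A\in\mathcal{A}_0$, $B\in\mathcal{B}_0$, $\mu\in M_0(A,B)$; morphisms $(A,B,\mu)\to(A',B',\mu')$ are pairs $(f\colon A\to A',g\colon B\to B')$ with $M_0(\mathrm{id}_A,g)(\mu)=M_0(f,\mathrm{id}_{B'})(\mu')$; composition is componentwise. *)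

theory Defs
  imports "HOL-Algebra.Module" "HOL-Algebra.AbelCoset"
begin

section \<open>Modules and cochain complexes over a commutative ring\<close>

definition mod_hom :: "'r ring \<Rightarrow> ('r, 'm) module \<Rightarrow> ('r, 'n) module \<Rightarrow> ('m \<Rightarrow> 'n) set" where
  "mod_hom R M N = {f \<in> carrier M \<rightarrow> carrier N.
     (\<forall>x \<in> carrier M. \<forall>y \<in> carrier M. f (x \<oplus>\<^bsub>M\<^esub> y) = f x \<oplus>\<^bsub>N\<^esub> f y) \<and>
     (\<forall>r \<in> carrier R. \<forall>x \<in> carrier M. f (r \<odot>\<^bsub>M\<^esub> x) = r \<odot>\<^bsub>N\<^esub> f x)}"

definition bilinear_map ::
  "'r ring \<Rightarrow> ('r, 'm) module \<Rightarrow> ('r, 'n) module \<Rightarrow> ('r, 'p) module \<Rightarrow> ('m \<Rightarrow> 'n \<Rightarrow> 'p) \<Rightarrow> bool" where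
  "bilinear_map R M N P \<beta> \<longleftrightarrow>
     (\<forall>x \<in> carrier M. (\<lambda>y. \<beta> x y) \<in> mod_hom R N P) \<and>
     (\<forall>y \<in> carrier N. (\<lambda>x. \<beta> x y) \<in> mod_hom R M P)"

text \<open>The library record for modules extends the one for rings; its multiplicative fields carry no
  meaning for a module and are filled with \<^term>\<open>undefined\<close>.\<close>

definition make_module ::
  "'m set \<Rightarrow> ('m \<Rightarrow> 'm \<Rightarrow> 'm) \<Rightarrow> 'm \<Rightarrow> ('r \<Rightarrow> 'm \<Rightarrow> 'm) \<Rightarrow> ('r, 'm) module" where
  "make_module S pl ze sm =
     \<lparr>carrier = S, mult = (\<lambda>_ _. undefined), one = undefined, zero = ze, add = pl, smult = sm\<rparr>"

definition signed :: "('r, 'm) module \<Rightarrow> int \<Rightarrow> 'm \<Rightarrow> 'm" where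
  "signed M n x = (if even n then x else \<ominus>\<^bsub>M\<^esub> x)"

record ('r, 'm) cochain =
  grade :: "int \<Rightarrow> ('r, 'm) module"
  cdiff :: "int \<Rightarrow> 'm \<Rightarrow> 'm"

definition cochain_complex :: "'r ring \<Rightarrow> ('r, 'm) cochain \<Rightarrow> bool" where
  "cochain_complex R K \<longleftrightarrow>
     (\<forall>n. module R (grade K n)) \<and>
     (\<forall>n. cdiff K n \<in> mod_hom R (grade K n) (grade K (n + 1))) \<and>
     (\<forall>n. \<forall>x \<in> carrier (grade K n). cdiff K (n + 1) (cdiff K n x) = \<zero>\<^bsub>grade K (n + 2)\<^esub>)"

definition cocycles :: "('r, 'm) cochain \<Rightarrow> int \<Rightarrow> 'm set" where
  "cocycles K n = {x \<in> carrier (grade K n). cdiff K n x = \<zero>\<^bsub>grade K (n + 1)\<^esub>}"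

definition coboundaries :: "('r, 'm) cochain \<Rightarrow> int \<Rightarrow> 'm set" where
  "coboundaries K n = cdiff K (n - 1) ` carrier (grade K (n - 1))"

definition cohom_class :: "('r, 'm) cochain \<Rightarrow> int \<Rightarrow> 'm \<Rightarrow> 'm set" where
  "cohom_class K n x = coboundaries K n +>\<^bsub>grade K n\<^esub> x"

text \<open>Operations on cohomology classes are written as the union of the classes obtained from all
  representatives; these classes all coincide, so the union is that one class.\<close>

definition cohomology :: "('r, 'm) cochain \<Rightarrow> int \<Rightarrow> ('r, 'm set) module" where
  "cohomology K n = make_module (cohom_class K n ` cocycles K n)
     (\<lambda>\<xi> \<eta>. \<Union>x \<in> \<xi>. \<Union>y \<in> \<eta>. cohom_class K n (x \<oplus>\<^bsub>grade K n\<^esub> y))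
     (cohom_class K n \<zero>\<^bsub>grade K n\<^esub>)
     (\<lambda>r \<xi>. \<Union>x \<in> \<xi>. cohom_class K n (r \<odot>\<^bsub>grade K n\<^esub> x))"


section \<open>Linear categories\<close>

text \<open>In \<open>lcomp C X Y Z g f\<close> the morphisms are \<open>f : X \<rightarrow> Y\<close> and \<open>g : Y \<rightarrow> Z\<close>.\<close>

record ('o, 'r, 'm) lincat =
  lob :: "'o set"
  lhom :: "'o \<Rightarrow> 'o \<Rightarrow> ('r, 'm) module"
  lcomp :: "'o \<Rightarrow> 'o \<Rightarrow> 'o \<Rightarrow> 'm \<Rightarrow> 'm \<Rightarrow> 'm"
  lid :: "'o \<Rightarrow> 'm"

locale linear_category =
  fixes R :: "'r ring" and C :: "('o, 'r, 'm) lincat"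
  assumes base_ring: "cring R"
    and hom_module: "\<lbrakk>X \<in> lob C; Y \<in> lob C\<rbrakk> \<Longrightarrow> module R (lhom C X Y)"
    and comp_bilinear: "\<lbrakk>X \<in> lob C; Y \<in> lob C; Z \<in> lob C\<rbrakk> \<Longrightarrow>
      bilinear_map R (lhom C Y Z) (lhom C X Y) (lhom C X Z) (lcomp C X Y Z)"
    and id_closed: "X \<in> lob C \<Longrightarrow> lid C X \<in> carrier (lhom C X X)"
    and comp_assoc: "\<lbrakk>W \<in> lob C; X \<in> lob C; Y \<in> lob C; Z \<in> lob C;
      f \<in> carrier (lhom C W X); g \<in> carrier (lhom C X Y); h \<in> carrier (lhom C Y Z)\<rbrakk> \<Longrightarrow>
      lcomp C W Y Z h (lcomp C W X Y g f) = lcomp C W X Z (lcomp C X Y Z h g) f"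
    and comp_id_left: "\<lbrakk>X \<in> lob C; Y \<in> lob C; f \<in> carrier (lhom C X Y)\<rbrakk> \<Longrightarrow>
      lcomp C X Y Y (lid C Y) f = f"
    and comp_id_right: "\<lbrakk>X \<in> lob C; Y \<in> lob C; f \<in> carrier (lhom C X Y)\<rbrakk> \<Longrightarrow>
      lcomp C X X Y f (lid C X) = f"

definition full_subcategory :: "('o, 'r, 'm) lincat \<Rightarrow> 'o set \<Rightarrow> ('o, 'r, 'm) lincat" where
  "full_subcategory C S = C\<lparr>lob := S\<rparr>"

definition iso_arrow :: "('o, 'r, 'm) lincat \<Rightarrow> 'o \<Rightarrow> 'o \<Rightarrow> 'm \<Rightarrow> bool" where
  "iso_arrow C X Y f \<longleftrightarrow> X \<in> lob C \<and> Y \<in> lob C \<and> f \<in> carrier (lhom C X Y) \<and>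
     (\<exists>g \<in> carrier (lhom C Y X). lcomp C X Y X g f = lid C X \<and> lcomp C Y X Y f g = lid C Y)"

definition isomorphic :: "('o, 'r, 'm) lincat \<Rightarrow> 'o \<Rightarrow> 'o \<Rightarrow> bool" where
  "isomorphic C X Y \<longleftrightarrow> (\<exists>f. iso_arrow C X Y f)"

definition hom_vanishes :: "('o, 'r, 'm) lincat \<Rightarrow> 'o \<Rightarrow> 'o \<Rightarrow> bool" where
  "hom_vanishes C X Y \<longleftrightarrow> carrier (lhom C X Y) = {\<zero>\<^bsub>lhom C X Y\<^esub>}"

definition zero_object :: "('o, 'r, 'm) lincat \<Rightarrow> 'o \<Rightarrow> bool" where
  "zero_object C Z \<longleftrightarrow> Z \<in> lob C \<and> (\<forall>X \<in> lob C. hom_vanishes C X Z \<and> hom_vanishes C Z X)"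

definition biproduct :: "('o, 'r, 'm) lincat \<Rightarrow> 'o \<Rightarrow> 'o \<Rightarrow> 'o \<Rightarrow> bool" where
  "biproduct C X Y Z \<longleftrightarrow> Z \<in> lob C \<and>
     (\<exists>i \<in> carrier (lhom C X Z). \<exists>j \<in> carrier (lhom C Y Z).
      \<exists>p \<in> carrier (lhom C Z X). \<exists>q \<in> carrier (lhom C Z Y).
        lcomp C X Z X p i = lid C X \<and> lcomp C Y Z Y q j = lid C Y \<and>
        lcomp C X Z Y q i = \<zero>\<^bsub>lhom C X Y\<^esub> \<and> lcomp C Y Z X p j = \<zero>\<^bsub>lhom C Y X\<^esub> \<and>
        lcomp C Z X Z i p \<oplus>\<^bsub>lhom C Z Z\<^esub> lcomp C Z Y Z j q = lid C Z)"

definition additive_category :: "'r ring \<Rightarrow> ('o, 'r, 'm) lincat \<Rightarrow> bool" where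
  "additive_category R C \<longleftrightarrow> linear_category R C \<and> (\<exists>Z. zero_object C Z) \<and>
     (\<forall>X \<in> lob C. \<forall>Y \<in> lob C. \<exists>Z. biproduct C X Y Z)"

record ('o, 'p, 'm, 'n) functor_data =
  fun_ob :: "'o \<Rightarrow> 'p"
  fun_mor :: "'o \<Rightarrow> 'o \<Rightarrow> 'm \<Rightarrow> 'n"

locale linear_functor =
  source: linear_category R C + target: linear_category R D
  for R :: "'r ring" and C :: "('o, 'r, 'm) lincat" and D :: "('p, 'r, 'n) lincat" +
  fixes F :: "('o, 'p, 'm, 'n) functor_data"
  assumes fun_ob_closed: "X \<in> lob C \<Longrightarrow> fun_ob F X \<in> lob D"
    and fun_mor_linear: "\<lbrakk>X \<in> lob C; Y \<in> lob C\<rbrakk> \<Longrightarrow>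
      fun_mor F X Y \<in> mod_hom R (lhom C X Y) (lhom D (fun_ob F X) (fun_ob F Y))"
    and fun_mor_id: "X \<in> lob C \<Longrightarrow> fun_mor F X X (lid C X) = lid D (fun_ob F X)"
    and fun_mor_comp: "\<lbrakk>X \<in> lob C; Y \<in> lob C; Z \<in> lob C;
      f \<in> carrier (lhom C X Y); g \<in> carrier (lhom C Y Z)\<rbrakk> \<Longrightarrow>
      fun_mor F X Z (lcomp C X Y Z g f) =
        lcomp D (fun_ob F X) (fun_ob F Y) (fun_ob F Z) (fun_mor F Y Z g) (fun_mor F X Y f)"

definition id_functor :: "('o, 'o, 'm, 'm) functor_data" where
  "id_functor = \<lparr>fun_ob = (\<lambda>X. X), fun_mor = (\<lambda>X Y f. f)\<rparr>"

definition comp_functor ::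
  "('p, 'q, 'n, 'k) functor_data \<Rightarrow> ('o, 'p, 'm, 'n) functor_data \<Rightarrow> ('o, 'q, 'm, 'k) functor_data" where
  "comp_functor G F = \<lparr>fun_ob = (\<lambda>X. fun_ob G (fun_ob F X)),
     fun_mor = (\<lambda>X Y f. fun_mor G (fun_ob F X) (fun_ob F Y) (fun_mor F X Y f))\<rparr>"

definition natural_iso ::
  "('o, 'r, 'm) lincat \<Rightarrow> ('p, 'r, 'n) lincat \<Rightarrow> ('o, 'p, 'm, 'n) functor_data \<Rightarrow>
   ('o, 'p, 'm, 'n) functor_data \<Rightarrow> ('o \<Rightarrow> 'n) \<Rightarrow> bool" where
  "natural_iso C D F G \<eta> \<longleftrightarrow>
     (\<forall>X \<in> lob C. iso_arrow D (fun_ob F X) (fun_ob G X) (\<eta> X)) \<and>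
     (\<forall>X \<in> lob C. \<forall>Y \<in> lob C. \<forall>f \<in> carrier (lhom C X Y).
        lcomp D (fun_ob F X) (fun_ob F Y) (fun_ob G Y) (\<eta> Y) (fun_mor F X Y f) =
        lcomp D (fun_ob F X) (fun_ob G X) (fun_ob G Y) (fun_mor G X Y f) (\<eta> X))"

definition equivalent_categories ::
  "'r ring \<Rightarrow> ('o, 'r, 'm) lincat \<Rightarrow> ('p, 'r, 'n) lincat \<Rightarrow> bool" where
  "equivalent_categories R C D \<longleftrightarrow> (\<exists>F G \<eta> \<epsilon>. linear_functor R C D F \<and> linear_functor R D C G \<and>
     natural_iso C C id_functor (comp_functor G F) \<eta> \<and>
     natural_iso D D (comp_functor F G) id_functor \<epsilon>)"


section \<open>Dg-categories\<close>

text \<open>In \<open>dg_comp A X Y Z q p g f\<close> the morphisms are \<open>f : X \<rightarrow> Y\<close> of degree \<open>p\<close> and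
  \<open>g : Y \<rightarrow> Z\<close> of degree \<open>q\<close>. The degrees are arguments because the carriers of
  different graded pieces may overlap in the ambient type.\<close>

record ('o, 'r, 'm) dgcat =
  dg_ob :: "'o set"
  dg_hom :: "'o \<Rightarrow> 'o \<Rightarrow> ('r, 'm) cochain"
  dg_comp :: "'o \<Rightarrow> 'o \<Rightarrow> 'o \<Rightarrow> int \<Rightarrow> int \<Rightarrow> 'm \<Rightarrow> 'm \<Rightarrow> 'm"
  dg_id :: "'o \<Rightarrow> 'm"

abbreviation dg_mor :: "('o, 'r, 'm) dgcat \<Rightarrow> 'o \<Rightarrow> 'o \<Rightarrow> int \<Rightarrow> 'm set" where
  "dg_mor A X Y n \<equiv> carrier (grade (dg_hom A X Y) n)"

locale dg_category =
  fixes R :: "'r ring" and A :: "('o, 'r, 'm) dgcat"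
  assumes base_ring: "cring R"
    and hom_complex: "\<lbrakk>X \<in> dg_ob A; Y \<in> dg_ob A\<rbrakk> \<Longrightarrow> cochain_complex R (dg_hom A X Y)"
    and comp_bilinear: "\<lbrakk>X \<in> dg_ob A; Y \<in> dg_ob A; Z \<in> dg_ob A\<rbrakk> \<Longrightarrow>
      bilinear_map R (grade (dg_hom A Y Z) q) (grade (dg_hom A X Y) p)
        (grade (dg_hom A X Z) (q + p)) (dg_comp A X Y Z q p)"
    and leibniz: "\<lbrakk>X \<in> dg_ob A; Y \<in> dg_ob A; Z \<in> dg_ob A; f \<in> dg_mor A X Y p; g \<in> dg_mor A Y Z q\<rbrakk> \<Longrightarrow>
      cdiff (dg_hom A X Z) (q + p) (dg_comp A X Y Z q p g f) =
        dg_comp A X Y Z (q + 1) p (cdiff (dg_hom A Y Z) q g) f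
        \<oplus>\<^bsub>grade (dg_hom A X Z) (q + p + 1)\<^esub>
        signed (grade (dg_hom A X Z) (q + p + 1)) q
          (dg_comp A X Y Z q (p + 1) g (cdiff (dg_hom A X Y) p f))"
    and comp_assoc: "\<lbrakk>W \<in> dg_ob A; X \<in> dg_ob A; Y \<in> dg_ob A; Z \<in> dg_ob A;
      f \<in> dg_mor A W X p; g \<in> dg_mor A X Y q; h \<in> dg_mor A Y Z r\<rbrakk> \<Longrightarrow>
      dg_comp A W Y Z r (q + p) h (dg_comp A W X Y q p g f) =
      dg_comp A W X Z (r + q) p (dg_comp A X Y Z r q h g) f"
    and id_closed: "X \<in> dg_ob A \<Longrightarrow> dg_id A X \<in> cocycles (dg_hom A X X) 0"
    and comp_id_left: "\<lbrakk>X \<in> dg_ob A; Y \<in> dg_ob A; f \<in> dg_mor A X Y p\<rbrakk> \<Longrightarrow>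
      dg_comp A X Y Y 0 p (dg_id A Y) f = f"
    and comp_id_right: "\<lbrakk>X \<in> dg_ob A; Y \<in> dg_ob A; f \<in> dg_mor A X Y p\<rbrakk> \<Longrightarrow>
      dg_comp A X X Y p 0 f (dg_id A X) = f"

definition homotopy_category :: "('o, 'r, 'm) dgcat \<Rightarrow> ('o, 'r, 'm set) lincat" where
  "homotopy_category A = \<lparr>
     lob = dg_ob A,
     lhom = (\<lambda>X Y. cohomology (dg_hom A X Y) 0),
     lcomp = (\<lambda>X Y Z \<beta> \<alpha>. \<Union>g \<in> \<beta>. \<Union>f \<in> \<alpha>.
       cohom_class (dg_hom A X Z) 0 (dg_comp A X Y Z 0 0 g f)),
     lid = (\<lambda>X. cohom_class (dg_hom A X X) 0 (dg_id A X))\<rparr>"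

definition opposite :: "('o, 'r, 'm) dgcat \<Rightarrow> ('o, 'r, 'm) dgcat" where
  "opposite A = \<lparr>
     dg_ob = dg_ob A,
     dg_hom = (\<lambda>X Y. dg_hom A Y X),
     dg_comp = (\<lambda>X Y Z q p g f.
       signed (grade (dg_hom A Z X) (q + p)) (q * p) (dg_comp A Z Y X p q f g)),
     dg_id = dg_id A\<rparr>"

text \<open>The dg-category \<open>C(R)\<close>. A morphism \<open>f : K \<rightarrow> L\<close> of degree \<open>n\<close> is a family of linear maps
  \<open>f i\<close> from the \<open>i\<close>-th piece of \<open>K\<close> to the \<open>(i + n)\<close>-th piece of \<open>L\<close>, made extensional so that
  equality of morphisms is equality of functions.\<close>

definition complex_hom_module ::
  "'r ring \<Rightarrow> ('r, 'x) cochain \<Rightarrow> ('r, 'x) cochain \<Rightarrow> int \<Rightarrow> ('r, int \<Rightarrow> 'x \<Rightarrow> 'x) module" where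
  "complex_hom_module R K L n = make_module
     {f. \<forall>i. f i \<in> mod_hom R (grade K i) (grade L (i + n)) \<inter> extensional (carrier (grade K i))}
     (\<lambda>f g i. \<lambda>x \<in> carrier (grade K i). f i x \<oplus>\<^bsub>grade L (i + n)\<^esub> g i x)
     (\<lambda>i. \<lambda>x \<in> carrier (grade K i). \<zero>\<^bsub>grade L (i + n)\<^esub>)
     (\<lambda>r f i. \<lambda>x \<in> carrier (grade K i). r \<odot>\<^bsub>grade L (i + n)\<^esub> f i x)"

definition complex_hom ::
  "'r ring \<Rightarrow> ('r, 'x) cochain \<Rightarrow> ('r, 'x) cochain \<Rightarrow> ('r, int \<Rightarrow> 'x \<Rightarrow> 'x) cochain" where
  "complex_hom R K L = \<lparr>
     grade = complex_hom_module R K L,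
     cdiff = (\<lambda>n f i. \<lambda>x \<in> carrier (grade K i).
       cdiff L (i + n) (f i x) \<ominus>\<^bsub>grade L (i + n + 1)\<^esub>
       signed (grade L (i + n + 1)) n (f (i + 1) (cdiff K i x)))\<rparr>"

definition dg_complexes ::
  "'r ring \<Rightarrow> (('r, 'x) cochain, 'r, int \<Rightarrow> 'x \<Rightarrow> 'x) dgcat" where
  "dg_complexes R = \<lparr>
     dg_ob = {K. cochain_complex R K},
     dg_hom = complex_hom R,
     dg_comp = (\<lambda>K L N q p g f i. \<lambda>x \<in> carrier (grade K i). g (i + p) (f i x)),
     dg_id = (\<lambda>K i. \<lambda>x \<in> carrier (grade K i). x)\<rparr>"

text \<open>A dg-functor \<open>A \<otimes> B \<rightarrow> C\<close>. The morphism complexes of \<open>A \<otimes> B\<close> are tensor products over the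
  base ring, so by their universal property the action on morphisms is a family of bilinear maps
  \<open>(f, g) \<mapsto> F(f \<otimes> g)\<close>. Compatibility with differential and composition is stated on the
  generators \<open>f \<otimes> g\<close>, where \<open>d(f \<otimes> g) = df \<otimes> g + (-1)^|f| f \<otimes> dg\<close> and
  \<open>(f' \<otimes> g')(f \<otimes> g) = (-1)^(|g'||f|) f'f \<otimes> g'g\<close>. In \<open>bf_mor F X X' Y Y' p q f g\<close> the morphisms
  are \<open>f : X \<rightarrow> X'\<close> in \<open>A\<close> of degree \<open>p\<close> and \<open>g : Y \<rightarrow> Y'\<close> in \<open>B\<close> of degree \<open>q\<close>.\<close>

record ('a, 'b, 'c, 'm, 'n, 'k) bifunctor_data =
  bf_ob :: "'a \<Rightarrow> 'b \<Rightarrow> 'c"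
  bf_mor :: "'a \<Rightarrow> 'a \<Rightarrow> 'b \<Rightarrow> 'b \<Rightarrow> int \<Rightarrow> int \<Rightarrow> 'm \<Rightarrow> 'n \<Rightarrow> 'k"

locale dg_bifunctor =
  fixes R :: "'r ring" and A :: "('a, 'r, 'm) dgcat" and B :: "('b, 'r, 'n) dgcat"
    and C :: "('c, 'r, 'k) dgcat" and F :: "('a, 'b, 'c, 'm, 'n, 'k) bifunctor_data"
  assumes bf_ob_closed: "\<lbrakk>X \<in> dg_ob A; Y \<in> dg_ob B\<rbrakk> \<Longrightarrow> bf_ob F X Y \<in> dg_ob C"
    and bf_mor_bilinear: "\<lbrakk>X \<in> dg_ob A; X' \<in> dg_ob A; Y \<in> dg_ob B; Y' \<in> dg_ob B\<rbrakk> \<Longrightarrow>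
      bilinear_map R (grade (dg_hom A X X') p) (grade (dg_hom B Y Y') q)
        (grade (dg_hom C (bf_ob F X Y) (bf_ob F X' Y')) (p + q)) (bf_mor F X X' Y Y' p q)"
    and bf_mor_diff: "\<lbrakk>X \<in> dg_ob A; X' \<in> dg_ob A; Y \<in> dg_ob B; Y' \<in> dg_ob B;
      f \<in> dg_mor A X X' p; g \<in> dg_mor B Y Y' q\<rbrakk> \<Longrightarrow>
      cdiff (dg_hom C (bf_ob F X Y) (bf_ob F X' Y')) (p + q) (bf_mor F X X' Y Y' p q f g) =
        bf_mor F X X' Y Y' (p + 1) q (cdiff (dg_hom A X X') p f) g
        \<oplus>\<^bsub>grade (dg_hom C (bf_ob F X Y) (bf_ob F X' Y')) (p + q + 1)\<^esub>
        signed (grade (dg_hom C (bf_ob F X Y) (bf_ob F X' Y')) (p + q + 1)) p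
          (bf_mor F X X' Y Y' p (q + 1) f (cdiff (dg_hom B Y Y') q g))"
    and bf_mor_id: "\<lbrakk>X \<in> dg_ob A; Y \<in> dg_ob B\<rbrakk> \<Longrightarrow>
      bf_mor F X X Y Y 0 0 (dg_id A X) (dg_id B Y) = dg_id C (bf_ob F X Y)"
    and bf_mor_comp: "\<lbrakk>X \<in> dg_ob A; X' \<in> dg_ob A; X'' \<in> dg_ob A;
      Y \<in> dg_ob B; Y' \<in> dg_ob B; Y'' \<in> dg_ob B;
      f \<in> dg_mor A X X' p; f' \<in> dg_mor A X' X'' p';
      g \<in> dg_mor B Y Y' q; g' \<in> dg_mor B Y' Y'' q'\<rbrakk> \<Longrightarrow>
      dg_comp C (bf_ob F X Y) (bf_ob F X' Y') (bf_ob F X'' Y'') (p' + q') (p + q)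
          (bf_mor F X' X'' Y' Y'' p' q' f' g') (bf_mor F X X' Y Y' p q f g) =
        signed (grade (dg_hom C (bf_ob F X Y) (bf_ob F X'' Y'')) (p' + q' + p + q)) (q' * p)
          (bf_mor F X X'' Y Y'' (p' + p) (q' + q)
            (dg_comp A X X' X'' p' p f' f) (dg_comp B Y Y' Y'' q' q g' g))"

type_synonym ('a, 'b, 'r, 'm, 'n, 'x) bimodule_data =
  "('a, 'b, ('r, 'x) cochain, 'm, 'n, int \<Rightarrow> 'x \<Rightarrow> 'x) bifunctor_data"

definition dg_bimodule ::
  "'r ring \<Rightarrow> ('a, 'r, 'm) dgcat \<Rightarrow> ('b, 'r, 'n) dgcat \<Rightarrow> ('a, 'b, 'r, 'm, 'n, 'x) bimodule_data \<Rightarrow> bool" where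
  "dg_bimodule R A B M \<longleftrightarrow> dg_bifunctor R (opposite A) B (dg_complexes R) M"

text \<open>The left action \<open>b \<circ> c\<close> of \<open>b : Y \<rightarrow> Y'\<close> of degree \<open>q\<close> on \<open>c\<close> in degree \<open>n\<close> of \<open>M(X, Y)\<close>, and
  the right action \<open>c \<circ> a\<close> of \<open>a : X \<rightarrow> X'\<close> of degree \<open>p\<close> on \<open>c\<close> in degree \<open>n\<close> of \<open>M(X', Y)\<close>. The
  Koszul sign \<open>(-1)^(np)\<close> turns the left action of the opposite category into a right action,
  with \<open>(c \<circ> a') \<circ> a = c \<circ> (a'a)\<close> and \<open>d(c \<circ> a) = dc \<circ> a + (-1)^n c \<circ> da\<close>.\<close>

definition left_act ::
  "('a, 'r, 'm) dgcat \<Rightarrow> ('a, 'b, 'r, 'm, 'n, 'x) bimodule_data \<Rightarrow>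
   'a \<Rightarrow> 'b \<Rightarrow> 'b \<Rightarrow> int \<Rightarrow> int \<Rightarrow> 'n \<Rightarrow> 'x \<Rightarrow> 'x" where
  "left_act A M X Y Y' q n b c = bf_mor M X X Y Y' 0 q (dg_id A X) b n c"

definition right_act ::
  "('b, 'r, 'n) dgcat \<Rightarrow> ('a, 'b, 'r, 'm, 'n, 'x) bimodule_data \<Rightarrow>
   'a \<Rightarrow> 'a \<Rightarrow> 'b \<Rightarrow> int \<Rightarrow> int \<Rightarrow> 'x \<Rightarrow> 'm \<Rightarrow> 'x" where
  "right_act B M X X' Y n p c a =
     signed (grade (bf_ob M X Y) (n + p)) (n * p) (bf_mor M X' X Y Y p 0 a (dg_id B Y) n c)"


section \<open>The glued dg-category\<close>

definition module_sum :: "('r, 'm) module \<Rightarrow> ('r, 'n) module \<Rightarrow> ('r, 'm \<times> 'n) module" where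
  "module_sum M N = make_module (carrier M \<times> carrier N)
     (\<lambda>(x, y) (x', y'). (x \<oplus>\<^bsub>M\<^esub> x', y \<oplus>\<^bsub>N\<^esub> y'))
     (\<zero>\<^bsub>M\<^esub>, \<zero>\<^bsub>N\<^esub>)
     (\<lambda>r (x, y). (r \<odot>\<^bsub>M\<^esub> x, r \<odot>\<^bsub>N\<^esub> y))"

definition glued_hom ::
  "('a, 'r, 'm) dgcat \<Rightarrow> ('b, 'r, 'n) dgcat \<Rightarrow> ('a, 'b, 'r, 'm, 'n, 'x) bimodule_data \<Rightarrow>
   'a \<times> 'b \<times> 'x \<Rightarrow> 'a \<times> 'b \<times> 'x \<Rightarrow> ('r, 'm \<times> 'n \<times> 'x) cochain" where
  "glued_hom A B M = (\<lambda>(X1, Y1, \<phi>1) (X2, Y2, \<phi>2). \<lparr>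
     grade = (\<lambda>n. module_sum (grade (dg_hom A X1 X2) n)
       (module_sum (grade (dg_hom B Y1 Y2) n) (grade (bf_ob M X1 Y2) (n - 1)))),
     cdiff = (\<lambda>n (a, b, c).
       (cdiff (dg_hom A X1 X2) n a,
        cdiff (dg_hom B Y1 Y2) n b,
        \<ominus>\<^bsub>grade (bf_ob M X1 Y2) n\<^esub> cdiff (bf_ob M X1 Y2) (n - 1) c
        \<ominus>\<^bsub>grade (bf_ob M X1 Y2) n\<^esub> left_act A M X1 Y1 Y2 n 0 b \<phi>1
        \<oplus>\<^bsub>grade (bf_ob M X1 Y2) n\<^esub> right_act B M X1 X2 Y2 0 n \<phi>2 a))\<rparr>)"

definition glued ::
  "('a, 'r, 'm) dgcat \<Rightarrow> ('b, 'r, 'n) dgcat \<Rightarrow> ('a, 'b, 'r, 'm, 'n, 'x) bimodule_data \<Rightarrow>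
   ('a \<times> 'b \<times> 'x, 'r, 'm \<times> 'n \<times> 'x) dgcat" where
  "glued A B M = \<lparr>
     dg_ob = {(X, Y, \<phi>). X \<in> dg_ob A \<and> Y \<in> dg_ob B \<and> \<phi> \<in> cocycles (bf_ob M X Y) 0},
     dg_hom = glued_hom A B M,
     dg_comp = (\<lambda>(X1, Y1, \<phi>1) (X2, Y2, \<phi>2) (X3, Y3, \<phi>3) q p (a2, b2, c2) (a1, b1, c1).
       (dg_comp A X1 X2 X3 q p a2 a1,
        dg_comp B Y1 Y2 Y3 q p b2 b1,
        right_act B M X1 X2 Y3 (q - 1) p c2 a1
        \<oplus>\<^bsub>grade (bf_ob M X1 Y3) (q + p - 1)\<^esub>
        signed (grade (bf_ob M X1 Y3) (q + p - 1)) q (left_act A M X1 Y2 Y3 q (p - 1) b2 c1))),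
     dg_id = (\<lambda>(X, Y, \<phi>). (dg_id A X, dg_id B Y, \<zero>\<^bsub>grade (bf_ob M X Y) (-1)\<^esub>))\<rparr>"

text \<open>The images of a class of objects under \<open>X \<mapsto> (X, 0, 0)\<close> and \<open>Y \<mapsto> (0, Y, 0)\<close>, where \<open>0\<close> ranges
  over all zero objects of the respective homotopy category.\<close>

definition glue_left ::
  "('b, 'r, 'n) dgcat \<Rightarrow> ('a, 'b, 'r, 'm, 'n, 'x) bimodule_data \<Rightarrow> 'a set \<Rightarrow> ('a \<times> 'b \<times> 'x) set" where
  "glue_left B M S = {(X, Z, \<zero>\<^bsub>grade (bf_ob M X Z) 0\<^esub>) | X Z.
     X \<in> S \<and> zero_object (homotopy_category B) Z}"

definition glue_right ::
  "('a, 'r, 'm) dgcat \<Rightarrow> ('a, 'b, 'r, 'm, 'n, 'x) bimodule_data \<Rightarrow> 'b set \<Rightarrow> ('a \<times> 'b \<times> 'x) set" where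
  "glue_right A M S = {(Z, Y, \<zero>\<^bsub>grade (bf_ob M Z Y) 0\<^esub>) | Z Y.
     Y \<in> S \<and> zero_object (homotopy_category A) Z}"


section \<open>Twisted complexes and pre-triangulated dg-categories\<close>

text \<open>One-sided twisted complexes following Bondal and Kapranov: a finite formal sum of shifted
  objects \<open>X_i[r_i]\<close> with a strictly triangular matrix \<open>q\<close>, whose entry \<open>q i j : X_i[r_i] \<rightarrow> X_j[r_j]\<close>
  has degree \<open>1\<close>, subject to the Maurer--Cartan equation \<open>dq + q\<^sup>2 = 0\<close>. A morphism
  \<open>X[r] \<rightarrow> Y[s]\<close> of degree \<open>n\<close> is a morphism \<open>X \<rightarrow> Y\<close> of degree \<open>n + s - r\<close>, on which the
  differential acts as \<open>(-1)^s d\<close>. Composition involves no signs. Matrices of morphisms are indexed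
  source first and are \<^term>\<open>undefined\<close> outside their range.\<close>

record ('o, 'm) twisted =
  tw_terms :: "('o \<times> int) list"
  tw_mat :: "nat \<Rightarrow> nat \<Rightarrow> 'm"

abbreviation tw_len :: "('o, 'm) twisted \<Rightarrow> nat" where
  "tw_len E \<equiv> length (tw_terms E)"

abbreviation tw_obj :: "('o, 'm) twisted \<Rightarrow> nat \<Rightarrow> 'o" where
  "tw_obj E i \<equiv> fst (tw_terms E ! i)"

abbreviation tw_deg :: "('o, 'm) twisted \<Rightarrow> nat \<Rightarrow> int" where
  "tw_deg E i \<equiv> snd (tw_terms E ! i)"

definition tw_entry ::
  "('o, 'r, 'm) dgcat \<Rightarrow> int \<Rightarrow> ('o, 'm) twisted \<Rightarrow> ('o, 'm) twisted \<Rightarrow> nat \<Rightarrow> nat \<Rightarrow> ('r, 'm) module" where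
  "tw_entry A n E F i j = grade (dg_hom A (tw_obj E i) (tw_obj F j)) (n + tw_deg F j - tw_deg E i)"

definition tw_matrix ::
  "('o, 'm) twisted \<Rightarrow> ('o, 'm) twisted \<Rightarrow> (nat \<Rightarrow> nat \<Rightarrow> 'm) \<Rightarrow> nat \<Rightarrow> nat \<Rightarrow> 'm" where
  "tw_matrix E F h = (\<lambda>i j. if i < tw_len E \<and> j < tw_len F then h i j else undefined)"

definition tw_comp ::
  "('o, 'r, 'm) dgcat \<Rightarrow> ('o, 'm) twisted \<Rightarrow> ('o, 'm) twisted \<Rightarrow> ('o, 'm) twisted \<Rightarrow> int \<Rightarrow> int \<Rightarrow>
   (nat \<Rightarrow> nat \<Rightarrow> 'm) \<Rightarrow> (nat \<Rightarrow> nat \<Rightarrow> 'm) \<Rightarrow> nat \<Rightarrow> nat \<Rightarrow> 'm" where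
  "tw_comp A E F G q p g f = tw_matrix E G (\<lambda>i k.
     finsum (tw_entry A (q + p) E G i k)
       (\<lambda>j. dg_comp A (tw_obj E i) (tw_obj F j) (tw_obj G k)
         (q + tw_deg G k - tw_deg F j) (p + tw_deg F j - tw_deg E i) (g j k) (f i j))
       {..<tw_len F})"

definition tw_base_diff ::
  "('o, 'r, 'm) dgcat \<Rightarrow> ('o, 'm) twisted \<Rightarrow> ('o, 'm) twisted \<Rightarrow> int \<Rightarrow>
   (nat \<Rightarrow> nat \<Rightarrow> 'm) \<Rightarrow> nat \<Rightarrow> nat \<Rightarrow> 'm" where
  "tw_base_diff A E F n f = tw_matrix E F (\<lambda>i j.
     signed (tw_entry A (n + 1) E F i j) (tw_deg F j)
       (cdiff (dg_hom A (tw_obj E i) (tw_obj F j)) (n + tw_deg F j - tw_deg E i) (f i j)))"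

definition twisted_complexes :: "('o, 'r, 'm) dgcat \<Rightarrow> ('o, 'm) twisted set" where
  "twisted_complexes A = {E.
     (\<forall>i < tw_len E. tw_obj E i \<in> dg_ob A) \<and>
     (\<forall>i < tw_len E. \<forall>j < tw_len E. tw_mat E i j \<in> carrier (tw_entry A 1 E E i j)) \<and>
     (\<forall>i < tw_len E. \<forall>j \<le> i. tw_mat E i j = \<zero>\<^bsub>tw_entry A 1 E E i j\<^esub>) \<and>
     (\<forall>i < tw_len E. \<forall>j < tw_len E.
        tw_base_diff A E E 1 (tw_mat E) i j \<oplus>\<^bsub>tw_entry A 2 E E i j\<^esub>
        tw_comp A E E E 1 1 (tw_mat E) (tw_mat E) i j = \<zero>\<^bsub>tw_entry A 2 E E i j\<^esub>)}"

definition tw_hom_module ::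
  "('o, 'r, 'm) dgcat \<Rightarrow> ('o, 'm) twisted \<Rightarrow> ('o, 'm) twisted \<Rightarrow> int \<Rightarrow> ('r, nat \<Rightarrow> nat \<Rightarrow> 'm) module" where
  "tw_hom_module A E F n = make_module
     {f. (\<forall>i < tw_len E. \<forall>j < tw_len F. f i j \<in> carrier (tw_entry A n E F i j)) \<and> tw_matrix E F f = f}
     (\<lambda>f g. tw_matrix E F (\<lambda>i j. f i j \<oplus>\<^bsub>tw_entry A n E F i j\<^esub> g i j))
     (tw_matrix E F (\<lambda>i j. \<zero>\<^bsub>tw_entry A n E F i j\<^esub>))
     (\<lambda>r f. tw_matrix E F (\<lambda>i j. r \<odot>\<^bsub>tw_entry A n E F i j\<^esub> f i j))"

definition tw_hom ::
  "('o, 'r, 'm) dgcat \<Rightarrow> ('o, 'm) twisted \<Rightarrow> ('o, 'm) twisted \<Rightarrow> ('r, nat \<Rightarrow> nat \<Rightarrow> 'm) cochain" where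
  "tw_hom A E F = \<lparr>
     grade = tw_hom_module A E F,
     cdiff = (\<lambda>n f. tw_matrix E F (\<lambda>i j.
       tw_base_diff A E F n f i j
       \<oplus>\<^bsub>tw_entry A (n + 1) E F i j\<^esub> tw_comp A E F F 1 n (tw_mat F) f i j
       \<ominus>\<^bsub>tw_entry A (n + 1) E F i j\<^esub>
         signed (tw_entry A (n + 1) E F i j) n (tw_comp A E E F n 1 f (tw_mat E) i j)))\<rparr>"

definition pretr :: "('o, 'r, 'm) dgcat \<Rightarrow> (('o, 'm) twisted, 'r, nat \<Rightarrow> nat \<Rightarrow> 'm) dgcat" where
  "pretr A = \<lparr>
     dg_ob = twisted_complexes A,
     dg_hom = tw_hom A,
     dg_comp = tw_comp A,
     dg_id = (\<lambda>E. tw_matrix E E (\<lambda>i j.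
       if i = j then dg_id A (tw_obj E i) else \<zero>\<^bsub>tw_entry A 0 E E i j\<^esub>))\<rparr>"

definition tw_shift :: "('o, 'r, 'm) dgcat \<Rightarrow> 'o \<Rightarrow> int \<Rightarrow> ('o, 'm) twisted" where
  "tw_shift A X n = \<lparr>tw_terms = [(X, n)], tw_mat = (\<lambda>i j. \<zero>\<^bsub>grade (dg_hom A X X) 1\<^esub>)\<rparr>"

text \<open>The functor \<open>[A] \<rightarrow> [Pre-Tr A]\<close> sending \<open>X\<close> to the twisted complex \<open>X[0]\<close> is fully faithful
  for every \<open>A\<close>; pre-triangulated means that it is an equivalence, i.e. essentially surjective.\<close>

definition pretriangulated :: "('o, 'r, 'm) dgcat \<Rightarrow> bool" where
  "pretriangulated A \<longleftrightarrow> (\<forall>E \<in> twisted_complexes A. \<exists>X \<in> dg_ob A.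
     isomorphic (homotopy_category (pretr A)) (tw_shift A X 0) E)"


section \<open>Shifts, triangles and t-structures on the homotopy category\<close>

text \<open>The triangulated structure of \<open>[A]\<close> is the one transported from \<open>[Pre-Tr A]\<close>. The class of all
  objects of \<open>[A]\<close> isomorphic to \<open>X[n]\<close> for some \<open>X\<close> in \<open>S\<close>:\<close>

definition shift_class :: "('o, 'r, 'm) dgcat \<Rightarrow> int \<Rightarrow> 'o set \<Rightarrow> 'o set" where
  "shift_class A n S = {Y \<in> dg_ob A. \<exists>X \<in> S.
     isomorphic (homotopy_category (pretr A)) (tw_shift A Y 0) (tw_shift A X n)}"

text \<open>The cone of a closed \<open>f : X \<rightarrow> Y\<close> of degree \<open>0\<close> is \<open>X[1] \<oplus> Y\<close> twisted by \<open>f\<close>.\<close>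

definition tw_cone :: "('o, 'r, 'm) dgcat \<Rightarrow> 'o \<Rightarrow> 'o \<Rightarrow> 'm \<Rightarrow> ('o, 'm) twisted" where
  "tw_cone A X Y f = (let T = [(X, 1), (Y, 0)] in
     \<lparr>tw_terms = T, tw_mat = (\<lambda>i j. if i = 0 \<and> j = 1 then f
        else \<zero>\<^bsub>grade (dg_hom A (fst (T ! i)) (fst (T ! j))) (1 + snd (T ! j) - snd (T ! i))\<^esub>)\<rparr>)"

definition cone_incl :: "('o, 'r, 'm) dgcat \<Rightarrow> 'o \<Rightarrow> 'o \<Rightarrow> 'm \<Rightarrow> nat \<Rightarrow> nat \<Rightarrow> 'm" where
  "cone_incl A X Y f = tw_matrix (tw_shift A Y 0) (tw_cone A X Y f)
     (\<lambda>i j. if j = 0 then \<zero>\<^bsub>grade (dg_hom A Y X) 1\<^esub> else dg_id A Y)"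

definition cone_proj :: "('o, 'r, 'm) dgcat \<Rightarrow> 'o \<Rightarrow> 'o \<Rightarrow> 'm \<Rightarrow> nat \<Rightarrow> nat \<Rightarrow> 'm" where
  "cone_proj A X Y f = tw_matrix (tw_cone A X Y f) (tw_shift A X 1)
     (\<lambda>i j. if i = 0 then dg_id A X else \<zero>\<^bsub>grade (dg_hom A Y X) 1\<^esub>)"

text \<open>The class in \<open>[Pre-Tr A]\<close> of a morphism \<open>E \<rightarrow> F\<close> given by its matrix, and of the morphism
  \<open>X \<rightarrow> Y[n]\<close> given by a closed morphism \<open>X \<rightarrow> Y\<close> of degree \<open>n\<close>.\<close>

definition tw_class ::
  "('o, 'r, 'm) dgcat \<Rightarrow> ('o, 'm) twisted \<Rightarrow> ('o, 'm) twisted \<Rightarrow> (nat \<Rightarrow> nat \<Rightarrow> 'm) \<Rightarrow>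
   (nat \<Rightarrow> nat \<Rightarrow> 'm) set" where
  "tw_class A E F m = cohom_class (tw_hom A E F) 0 m"

definition tw_single ::
  "('o, 'r, 'm) dgcat \<Rightarrow> 'o \<Rightarrow> 'o \<Rightarrow> int \<Rightarrow> 'm \<Rightarrow> (nat \<Rightarrow> nat \<Rightarrow> 'm) set" where
  "tw_single A X Y n f = (let E = tw_shift A X 0; F = tw_shift A Y n in
     tw_class A E F (tw_matrix E F (\<lambda>i j. f)))"

text \<open>The triangle \<open>X \<rightarrow> Y \<rightarrow> Z \<rightarrow> X[1]\<close> in \<open>[A]\<close>, given by closed morphisms \<open>f\<close>, \<open>g\<close> of degree \<open>0\<close> and
  \<open>h : Z \<rightarrow> X\<close> of degree \<open>1\<close>, is distinguished if it is isomorphic in \<open>[Pre-Tr A]\<close> to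
  \<open>X \<rightarrow> Y \<rightarrow> Cone(f) \<rightarrow> X[1]\<close> by an isomorphism that is the identity on \<open>X\<close> and \<open>Y\<close>.\<close>

definition distinguished ::
  "('o, 'r, 'm) dgcat \<Rightarrow> 'o \<Rightarrow> 'o \<Rightarrow> 'o \<Rightarrow> 'm \<Rightarrow> 'm \<Rightarrow> 'm \<Rightarrow> bool" where
  "distinguished A X Y Z f g h \<longleftrightarrow>
     X \<in> dg_ob A \<and> Y \<in> dg_ob A \<and> Z \<in> dg_ob A \<and>
     f \<in> cocycles (dg_hom A X Y) 0 \<and> g \<in> cocycles (dg_hom A Y Z) 0 \<and> h \<in> cocycles (dg_hom A Z X) 1 \<and>
     (let H = homotopy_category (pretr A); X1 = tw_shift A X 1; Y0 = tw_shift A Y 0;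
          Z0 = tw_shift A Z 0; K = tw_cone A X Y f
      in \<exists>\<theta>. iso_arrow H Z0 K \<theta> \<and>
           lcomp H Y0 Z0 K \<theta> (tw_single A Y Z 0 g) = tw_class A Y0 K (cone_incl A X Y f) \<and>
           lcomp H Z0 K X1 (tw_class A K X1 (cone_proj A X Y f)) \<theta> = tw_single A Z X 1 h)"

definition triangle :: "('o, 'r, 'm) dgcat \<Rightarrow> 'o \<Rightarrow> 'o \<Rightarrow> 'o \<Rightarrow> bool" where
  "triangle A X Y Z \<longleftrightarrow> (\<exists>f g h. distinguished A X Y Z f g h)"

text \<open>\<open>L\<close> and \<open>G\<close> are the object classes of the strictly full subcategories \<open>D\<^sup>\<le>\<^sup>0\<close> and \<open>D\<^sup>\<ge>\<^sup>0\<close> of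
  \<open>[A]\<close>; the class of objects of \<open>D\<^sup>\<ge>\<^sup>1\<close> is \<open>shift_class A (-1) G\<close>.\<close>

definition t_structure :: "('o, 'r, 'm) dgcat \<Rightarrow> 'o set \<Rightarrow> 'o set \<Rightarrow> bool" where
  "t_structure A L G \<longleftrightarrow>
     L \<subseteq> dg_ob A \<and> G \<subseteq> dg_ob A \<and>
     (\<forall>X Y. isomorphic (homotopy_category A) X Y \<longrightarrow> (X \<in> L \<longrightarrow> Y \<in> L) \<and> (X \<in> G \<longrightarrow> Y \<in> G)) \<and>
     shift_class A 1 L \<subseteq> L \<and> shift_class A (-1) G \<subseteq> G \<and>
     (\<forall>X \<in> L. \<forall>Y \<in> shift_class A (-1) G. hom_vanishes (homotopy_category A) X Y) \<and>
     (\<forall>E \<in> dg_ob A. \<exists>X \<in> L. \<exists>Y \<in> shift_class A (-1) G. triangle A X E Y)"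

definition heart :: "'o set \<Rightarrow> 'o set \<Rightarrow> 'o set" where
  "heart L G = L \<inter> G"

text \<open>Closure under isomorphism is the case \<open>Z = 0\<close> of the second rule.\<close>

inductive_set extension_closure :: "('o, 'r, 'm) dgcat \<Rightarrow> 'o set \<Rightarrow> 'o set"
  for A :: "('o, 'r, 'm) dgcat" and S :: "'o set" where
  base: "X \<in> S \<Longrightarrow> X \<in> extension_closure A S"
| extension: "\<lbrakk>X \<in> extension_closure A S; Z \<in> extension_closure A S; triangle A X Y Z\<rbrakk> \<Longrightarrow>
    Y \<in> extension_closure A S"

definition t_structures_glue ::
  "('a, 'r, 'm) dgcat \<Rightarrow> ('b, 'r, 'n) dgcat \<Rightarrow> ('a, 'b, 'r, 'm, 'n, 'x) bimodule_data \<Rightarrow>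
   'a set \<Rightarrow> 'b set \<Rightarrow> bool" where
  "t_structures_glue A B M A0 B0 \<longleftrightarrow>
     (\<forall>P \<in> glue_left B M A0. \<forall>Q \<in> glue_right A M B0. \<forall>i \<le> 0.
      \<forall>Q' \<in> shift_class (glued A B M) i {Q}. hom_vanishes (homotopy_category (glued A B M)) P Q')"

definition glued_heart ::
  "('a, 'r, 'm) dgcat \<Rightarrow> ('b, 'r, 'n) dgcat \<Rightarrow> ('a, 'b, 'r, 'm, 'n, 'x) bimodule_data \<Rightarrow>
   'a set \<Rightarrow> 'b set \<Rightarrow> ('a \<times> 'b \<times> 'x, 'r, ('m \<times> 'n \<times> 'x) set) lincat" where
  "glued_heart A B M A0 B0 = full_subcategory (homotopy_category (glued A B M))
     (extension_closure (glued A B M) (glue_left B M A0 \<union> glue_right A M B0))"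


section \<open>Abelian bimodules and their gluing\<close>

text \<open>In \<open>ab_mor N X X' Y Y' f g\<close> the morphisms are \<open>f : X \<rightarrow> X'\<close> in \<open>C\<close> and \<open>g : Y \<rightarrow> Y'\<close> in \<open>D\<close>; the
  result maps \<open>N(X', Y)\<close> to \<open>N(X, Y')\<close>.\<close>

record ('a, 'b, 'r, 'm, 'n, 'x) abelian_bimodule_data =
  ab_ob :: "'a \<Rightarrow> 'b \<Rightarrow> ('r, 'x) module"
  ab_mor :: "'a \<Rightarrow> 'a \<Rightarrow> 'b \<Rightarrow> 'b \<Rightarrow> 'm \<Rightarrow> 'n \<Rightarrow> 'x \<Rightarrow> 'x"

locale abelian_bimodule =
  source_op: linear_category R C + source: linear_category R D
  for R :: "'r ring" and C :: "('a, 'r, 'm) lincat" and D :: "('b, 'r, 'n) lincat" +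
  fixes N :: "('a, 'b, 'r, 'm, 'n, 'x) abelian_bimodule_data"
  assumes ab_module: "\<lbrakk>X \<in> lob C; Y \<in> lob D\<rbrakk> \<Longrightarrow> module R (ab_ob N X Y)"
    and ab_mor_hom: "\<lbrakk>X \<in> lob C; X' \<in> lob C; Y \<in> lob D; Y' \<in> lob D;
      f \<in> carrier (lhom C X X'); g \<in> carrier (lhom D Y Y')\<rbrakk> \<Longrightarrow>
      ab_mor N X X' Y Y' f g \<in> mod_hom R (ab_ob N X' Y) (ab_ob N X Y')"
    and ab_mor_bilinear: "\<lbrakk>X \<in> lob C; X' \<in> lob C; Y \<in> lob D; Y' \<in> lob D;
      \<mu> \<in> carrier (ab_ob N X' Y)\<rbrakk> \<Longrightarrow>
      bilinear_map R (lhom C X X') (lhom D Y Y') (ab_ob N X Y') (\<lambda>f g. ab_mor N X X' Y Y' f g \<mu>)"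
    and ab_mor_id: "\<lbrakk>X \<in> lob C; Y \<in> lob D; \<mu> \<in> carrier (ab_ob N X Y)\<rbrakk> \<Longrightarrow>
      ab_mor N X X Y Y (lid C X) (lid D Y) \<mu> = \<mu>"
    and ab_mor_comp: "\<lbrakk>X \<in> lob C; X' \<in> lob C; X'' \<in> lob C; Y \<in> lob D; Y' \<in> lob D; Y'' \<in> lob D;
      f \<in> carrier (lhom C X X'); f' \<in> carrier (lhom C X' X'');
      g \<in> carrier (lhom D Y Y'); g' \<in> carrier (lhom D Y' Y''); \<mu> \<in> carrier (ab_ob N X'' Y)\<rbrakk> \<Longrightarrow>
      ab_mor N X X'' Y Y'' (lcomp C X X' X'' f' f) (lcomp D Y Y' Y'' g' g) \<mu> =
        ab_mor N X X' Y' Y'' f g' (ab_mor N X' X'' Y Y' f' g \<mu>)"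

definition abelian_glued ::
  "('a, 'r, 'm) lincat \<Rightarrow> ('b, 'r, 'n) lincat \<Rightarrow> ('a, 'b, 'r, 'm, 'n, 'x) abelian_bimodule_data \<Rightarrow>
   ('a \<times> 'b \<times> 'x, 'r, 'm \<times> 'n) lincat" where
  "abelian_glued C D N = \<lparr>
     lob = {(X, Y, \<mu>). X \<in> lob C \<and> Y \<in> lob D \<and> \<mu> \<in> carrier (ab_ob N X Y)},
     lhom = (\<lambda>(X, Y, \<mu>) (X', Y', \<mu>'). (module_sum (lhom C X X') (lhom D Y Y'))\<lparr>carrier :=
       {(f, g). f \<in> carrier (lhom C X X') \<and> g \<in> carrier (lhom D Y Y') \<and>
          ab_mor N X X Y Y' (lid C X) g \<mu> = ab_mor N X X' Y' Y' f (lid D Y') \<mu>'}\<rparr>),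
     lcomp = (\<lambda>(X, Y, \<mu>) (X', Y', \<mu>') (X'', Y'', \<mu>'') (f', g') (f, g).
       (lcomp C X X' X'' f' f, lcomp D Y Y' Y'' g' g)),
     lid = (\<lambda>(X, Y, \<mu>). (lid C X, lid D Y))\<rparr>"

text \<open>The bimodule \<open>(X, Y) \<mapsto> H\<^sup>0(M(X, Y))\<close> on homotopy categories, on which the classes of \<open>f\<close> and
  \<open>g\<close> act by the class of \<open>M(f, g)\<close>.\<close>

definition H0_bimodule ::
  "('a, 'b, 'r, 'm, 'n, 'x) bimodule_data \<Rightarrow>
   ('a, 'b, 'r, 'm set, 'n set, 'x set) abelian_bimodule_data" where
  "H0_bimodule M = \<lparr>
     ab_ob = (\<lambda>X Y. cohomology (bf_ob M X Y) 0),
     ab_mor = (\<lambda>X X' Y Y' \<alpha> \<beta> \<xi>. \<Union>f \<in> \<alpha>. \<Union>g \<in> \<beta>. \<Union>x \<in> \<xi>.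
       cohom_class (bf_ob M X Y') 0 (bf_mor M X' X Y Y' 0 0 f g 0 x))\<rparr>"

end

theory Submission
  imports Defs
begin

text \<open>A distinguished triangle is recorded by the components of an isomorphism between its third object
  and the cone, together with the homotopies. The projections from the glued category to \<open>A\<close> and \<open>B\<close>
  transport such data; an aisle of a t-structure is the orthogonal of the other one, so hearts are closed
  under extensions. Conversely \<open>(X, Y, \<phi>)\<close> is an extension of \<open>(X, 0, 0)\<close> by \<open>(0, Y, 0)\<close>. Hence the
  objects of the glued heart are exactly the triples with \<open>X\<close> and \<open>Y\<close> in the hearts, and the equivalence
  is \<open>(X, Y, \<phi>) \<mapsto> (X, Y, [\<phi>])\<close>, \<open>[(a, b, c)] \<mapsto> ([a], [b])\<close>. It is full because two classes \<open>[a]\<close>,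
  \<open>[b]\<close> are compatible precisely if some \<open>c\<close> makes \<open>(a, b, c)\<close> closed, and faithful because gluing in
  degree \<open>0\<close> says that \<open>H\<^sup>-\<^sup>1(M(X, Y))\<close> vanishes.\<close>

text \<open>Triangles in \<open>[A]\<close> are defined through twisted complexes, so they become
  accessible only once \<open>pretr A\<close> is known to be a dg-category. This is split into two
  independent facts: matrices of morphisms without a twist form a dg-category, and deforming the
  differential of any dg-category by Maurer-Cartan elements preserves the dg-laws, so the signs of
  the twist are checked without matrix entries. Afterwards shifts are largely traded for degrees: a
  morphism \<open>X -> Y[n]\<close> is a closed morphism of degree \<open>n\<close>, vanishing of
  Hom means that cocycles are coboundaries, and the exact-sequence arguments produce explicit
  primitives out of the cone data. Degree \<open>-1\<close> recurs for two reasons. Orthogonality of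
  the aisles reads \<open>H^-1(Hom(X, Y)) = 0\<close> for \<open>X\<close> in the lower and
  \<open>Y\<close> in the upper one. In the glued category the component in \<open>M\<close> sits
  one degree lower, so the ambiguity of \<open>c\<close> in a closed \<open>(a, b, c)\<close> of
  degree \<open>0\<close> is measured by \<open>H^-1(M)\<close>, which is where faithfulness could
  fail.\<close>

section \<open>Modules\<close>

text \<open>Rewriting an equation with these rules moves all subtracted terms to the other side, after
  which both sides are sums that agree up to associativity and commutativity.\<close>

context abelian_group
begin

lemma a_inv_as_diff: "x \<in> carrier G \<Longrightarrow> \<ominus> x = \<zero> \<ominus> x"
  by (simp add: a_minus_def)

lemma add_diff: "\<lbrakk>x \<in> carrier G; y \<in> carrier G; z \<in> carrier G\<rbrakk> \<Longrightarrow> x \<oplus> (y \<ominus> z) = (x \<oplus> y) \<ominus> z"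
  by (simp add: a_minus_def a_assoc)

lemma diff_add: "\<lbrakk>x \<in> carrier G; y \<in> carrier G; z \<in> carrier G\<rbrakk> \<Longrightarrow> (x \<ominus> y) \<oplus> z = (x \<oplus> z) \<ominus> y"
  by (simp add: a_minus_def a_ac)

lemma diff_diff1: "\<lbrakk>x \<in> carrier G; y \<in> carrier G; z \<in> carrier G\<rbrakk> \<Longrightarrow> (x \<ominus> y) \<ominus> z = x \<ominus> (y \<oplus> z)"
  by (simp add: a_minus_def minus_add a_ac)

lemma diff_diff2: "\<lbrakk>x \<in> carrier G; y \<in> carrier G; z \<in> carrier G\<rbrakk> \<Longrightarrow> x \<ominus> (y \<ominus> z) = (x \<oplus> z) \<ominus> y"
  by (simp add: a_minus_def minus_add a_ac)

lemma diff_eq: "\<lbrakk>x \<in> carrier G; y \<in> carrier G; z \<in> carrier G\<rbrakk> \<Longrightarrow> x \<ominus> y = z \<longleftrightarrow> x = z \<oplus> y"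
  by (metis a_minus_def a_assoc a_inv_closed l_neg r_neg r_zero)

lemma eq_diff: "\<lbrakk>x \<in> carrier G; y \<in> carrier G; z \<in> carrier G\<rbrakk> \<Longrightarrow> z = x \<ominus> y \<longleftrightarrow> z \<oplus> y = x"
  by (metis diff_eq)

lemma diff_zero: "x \<in> carrier G \<Longrightarrow> x \<ominus> \<zero> = x"
  by (simp add: a_minus_def)

lemmas group_closed = a_closed zero_closed a_inv_closed minus_closed

lemmas group_simps = group_closed a_assoc a_comm a_lcomm l_zero r_zero
  a_inv_as_diff add_diff diff_add diff_diff1 diff_diff2 diff_eq eq_diff diff_zero

end

lemma (in module) is_module: "module R M" ..

lemma module_abelian_group: "module R M \<Longrightarrow> abelian_group M"
  by (simp add: module_def)

lemma mod_hom_closed: "\<lbrakk>f \<in> mod_hom R M N; x \<in> carrier M\<rbrakk> \<Longrightarrow> f x \<in> carrier N"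
  by (auto simp: mod_hom_def)

lemma mod_hom_add:
  "\<lbrakk>f \<in> mod_hom R M N; x \<in> carrier M; y \<in> carrier M\<rbrakk> \<Longrightarrow> f (x \<oplus>\<^bsub>M\<^esub> y) = f x \<oplus>\<^bsub>N\<^esub> f y"
  by (auto simp: mod_hom_def)

lemma mod_hom_smult:
  "\<lbrakk>f \<in> mod_hom R M N; r \<in> carrier R; x \<in> carrier M\<rbrakk> \<Longrightarrow> f (r \<odot>\<^bsub>M\<^esub> x) = r \<odot>\<^bsub>N\<^esub> f x"
  by (auto simp: mod_hom_def)

lemma mod_hom_zero:
  assumes "module R M" "module R N" "f \<in> mod_hom R M N"
  shows "f \<zero>\<^bsub>M\<^esub> = \<zero>\<^bsub>N\<^esub>"
proof -
  interpret M: module R M by fact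
  interpret N: module R N by fact
  have "f (\<zero>\<^bsub>R\<^esub> \<odot>\<^bsub>M\<^esub> \<zero>\<^bsub>M\<^esub>) = \<zero>\<^bsub>R\<^esub> \<odot>\<^bsub>N\<^esub> f \<zero>\<^bsub>M\<^esub>"
    using assms(3) by (intro mod_hom_smult) auto
  then show ?thesis using mod_hom_closed[OF assms(3)] by simp
qed

lemma mod_hom_neg:
  assumes "module R M" "module R N" "f \<in> mod_hom R M N" "x \<in> carrier M"
  shows "f (\<ominus>\<^bsub>M\<^esub> x) = \<ominus>\<^bsub>N\<^esub> f x"
proof -
  interpret M: module R M by fact
  interpret N: module R N by fact
  have "f (\<ominus>\<^bsub>M\<^esub> x) \<oplus>\<^bsub>N\<^esub> f x = f (\<ominus>\<^bsub>M\<^esub> x \<oplus>\<^bsub>M\<^esub> x)"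
    using assms by (simp add: mod_hom_add)
  also have "\<dots> = \<zero>\<^bsub>N\<^esub>"
    using assms by (simp add: M.l_neg mod_hom_zero)
  finally show ?thesis
    using assms by (simp add: N.minus_equality[symmetric] mod_hom_closed)
qed

lemma mod_hom_diff:
  assumes "module R M" "module R N" "f \<in> mod_hom R M N" "x \<in> carrier M" "y \<in> carrier M"
  shows "f (x \<ominus>\<^bsub>M\<^esub> y) = f x \<ominus>\<^bsub>N\<^esub> f y"
proof -
  interpret M: module R M by fact
  show ?thesis using assms by (simp add: a_minus_def mod_hom_add mod_hom_neg)
qed

lemma mod_homI:
  assumes "\<And>x. x \<in> carrier M \<Longrightarrow> f x \<in> carrier N"
    and "\<And>x y. \<lbrakk>x \<in> carrier M; y \<in> carrier M\<rbrakk> \<Longrightarrow> f (x \<oplus>\<^bsub>M\<^esub> y) = f x \<oplus>\<^bsub>N\<^esub> f y"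
    and "\<And>r x. \<lbrakk>r \<in> carrier R; x \<in> carrier M\<rbrakk> \<Longrightarrow> f (r \<odot>\<^bsub>M\<^esub> x) = r \<odot>\<^bsub>N\<^esub> f x"
  shows "f \<in> mod_hom R M N"
  using assms by (auto simp: mod_hom_def)

lemma bilinear_mapI:
  assumes "\<And>x y. \<lbrakk>x \<in> carrier M; y \<in> carrier N\<rbrakk> \<Longrightarrow> \<beta> x y \<in> carrier P"
    and "\<And>x x' y. \<lbrakk>x \<in> carrier M; x' \<in> carrier M; y \<in> carrier N\<rbrakk> \<Longrightarrow>
      \<beta> (x \<oplus>\<^bsub>M\<^esub> x') y = \<beta> x y \<oplus>\<^bsub>P\<^esub> \<beta> x' y"
    and "\<And>x y y'. \<lbrakk>x \<in> carrier M; y \<in> carrier N; y' \<in> carrier N\<rbrakk> \<Longrightarrow>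
      \<beta> x (y \<oplus>\<^bsub>N\<^esub> y') = \<beta> x y \<oplus>\<^bsub>P\<^esub> \<beta> x y'"
    and "\<And>r x y. \<lbrakk>r \<in> carrier R; x \<in> carrier M; y \<in> carrier N\<rbrakk> \<Longrightarrow> \<beta> (r \<odot>\<^bsub>M\<^esub> x) y = r \<odot>\<^bsub>P\<^esub> \<beta> x y"
    and "\<And>r x y. \<lbrakk>r \<in> carrier R; x \<in> carrier M; y \<in> carrier N\<rbrakk> \<Longrightarrow> \<beta> x (r \<odot>\<^bsub>N\<^esub> y) = r \<odot>\<^bsub>P\<^esub> \<beta> x y"
  shows "bilinear_map R M N P \<beta>"
  using assms by (auto simp: bilinear_map_def mod_hom_def)

lemma bilinear_mapD:
  assumes "bilinear_map R M N P \<beta>"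
  shows "\<And>x. x \<in> carrier M \<Longrightarrow> \<beta> x \<in> mod_hom R N P"
    and "\<And>y. y \<in> carrier N \<Longrightarrow> (\<lambda>x. \<beta> x y) \<in> mod_hom R M P"
  using assms by (auto simp: bilinear_map_def)

lemma make_module_simps [simp]:
  "carrier (make_module S pl ze sm) = S"
  "add (make_module S pl ze sm) = pl"
  "zero (make_module S pl ze sm) = ze"
  "smult (make_module S pl ze sm) = sm"
  by (simp_all add: make_module_def)

lemma signed_closed: "\<lbrakk>module R M; x \<in> carrier M\<rbrakk> \<Longrightarrow> signed M n x \<in> carrier M"
  by (simp add: signed_def abelian_group.a_inv_closed module_abelian_group)

section \<open>Cohomology\<close>

locale complex_of_modules =
  fixes R :: "'r ring" and K :: "('r, 'm) cochain"
  assumes complex: "cochain_complex R K"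
begin

lemma grade_module: "module R (grade K n)"
  using complex by (simp add: cochain_complex_def)

sublocale grade: module R "grade K n" for n
  by (rule grade_module)

lemma diff_hom: "cdiff K n \<in> mod_hom R (grade K n) (grade K (n + 1))"
  using complex by (simp add: cochain_complex_def)

lemma diff_hom': "cdiff K (n - 1) \<in> mod_hom R (grade K (n - 1)) (grade K n)"
  using diff_hom[of "n - 1"] by simp

lemma diff_diff: "x \<in> carrier (grade K n) \<Longrightarrow> cdiff K (n + 1) (cdiff K n x) = \<zero>\<^bsub>grade K (n + 2)\<^esub>"
  using complex by (simp add: cochain_complex_def)

lemma cocycles_carrier: "x \<in> cocycles K n \<Longrightarrow> x \<in> carrier (grade K n)"
  by (simp add: cocycles_def)

lemma coboundary_carrier: "x \<in> coboundaries K n \<Longrightarrow> x \<in> carrier (grade K n)"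
  using mod_hom_closed[OF diff_hom'] by (auto simp: coboundaries_def)

lemma zero_cocycle: "\<zero>\<^bsub>grade K n\<^esub> \<in> cocycles K n"
  using mod_hom_zero[OF grade_module grade_module diff_hom] by (simp add: cocycles_def)

lemma add_cocycle:
  "\<lbrakk>x \<in> cocycles K n; y \<in> cocycles K n\<rbrakk> \<Longrightarrow> x \<oplus>\<^bsub>grade K n\<^esub> y \<in> cocycles K n"
  by (simp add: cocycles_def mod_hom_add[OF diff_hom])

lemma neg_cocycle: "x \<in> cocycles K n \<Longrightarrow> \<ominus>\<^bsub>grade K n\<^esub> x \<in> cocycles K n"
  by (simp add: cocycles_def mod_hom_neg[OF grade_module grade_module diff_hom])

lemma smult_cocycle:
  "\<lbrakk>r \<in> carrier R; x \<in> cocycles K n\<rbrakk> \<Longrightarrow> r \<odot>\<^bsub>grade K n\<^esub> x \<in> cocycles K n"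
  by (simp add: cocycles_def mod_hom_smult[OF diff_hom])

lemma zero_coboundary: "\<zero>\<^bsub>grade K n\<^esub> \<in> coboundaries K n"
  unfolding coboundaries_def
  by (rule image_eqI[of _ _ "\<zero>\<^bsub>grade K (n - 1)\<^esub>"])
    (simp_all add: mod_hom_zero[OF grade_module grade_module diff_hom'])

lemma add_coboundary:
  assumes "x \<in> coboundaries K n" "y \<in> coboundaries K n"
  shows "x \<oplus>\<^bsub>grade K n\<^esub> y \<in> coboundaries K n"
proof -
  obtain v w where "v \<in> carrier (grade K (n - 1))" "x = cdiff K (n - 1) v"
    "w \<in> carrier (grade K (n - 1))" "y = cdiff K (n - 1) w"
    using assms by (auto simp: coboundaries_def)
  then show ?thesis unfolding coboundaries_def
    by (intro image_eqI[of _ _ "v \<oplus>\<^bsub>grade K (n - 1)\<^esub> w"])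
      (simp_all add: mod_hom_add[OF diff_hom'])
qed

lemma neg_coboundary:
  assumes "x \<in> coboundaries K n"
  shows "\<ominus>\<^bsub>grade K n\<^esub> x \<in> coboundaries K n"
proof -
  obtain v where "v \<in> carrier (grade K (n - 1))" "x = cdiff K (n - 1) v"
    using assms by (auto simp: coboundaries_def)
  then show ?thesis unfolding coboundaries_def
    by (intro image_eqI[of _ _ "\<ominus>\<^bsub>grade K (n - 1)\<^esub> v"])
      (simp_all add: mod_hom_neg[OF grade_module grade_module diff_hom'])
qed

lemma diff_coboundary:
  "\<lbrakk>x \<in> coboundaries K n; y \<in> coboundaries K n\<rbrakk> \<Longrightarrow> x \<ominus>\<^bsub>grade K n\<^esub> y \<in> coboundaries K n"
  by (simp add: a_minus_def add_coboundary neg_coboundary)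

lemma signed_coboundary:
  "x \<in> coboundaries K n \<Longrightarrow> signed (grade K n) m x \<in> coboundaries K n"
  by (simp add: signed_def neg_coboundary)

lemma smult_coboundary:
  assumes "r \<in> carrier R" "x \<in> coboundaries K n"
  shows "r \<odot>\<^bsub>grade K n\<^esub> x \<in> coboundaries K n"
proof -
  obtain v where "v \<in> carrier (grade K (n - 1))" "x = cdiff K (n - 1) v"
    using assms by (auto simp: coboundaries_def)
  then show ?thesis unfolding coboundaries_def using assms
    by (intro image_eqI[of _ _ "r \<odot>\<^bsub>grade K (n - 1)\<^esub> v"])
      (simp_all add: mod_hom_smult[OF diff_hom'])
qed

lemma coboundary_cocycle: "x \<in> coboundaries K n \<Longrightarrow> x \<in> cocycles K n"
  using diff_diff[of _ "n - 1"] by (auto simp: cocycles_def coboundary_carrier coboundaries_def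
      mod_hom_closed[OF diff_hom'] algebra_simps)

lemma coboundaryI: "\<lbrakk>w \<in> carrier (grade K m); m = n - 1\<rbrakk> \<Longrightarrow> cdiff K m w \<in> coboundaries K n"
  by (auto simp: coboundaries_def)

lemma cohom_class_mem: "y \<in> cohom_class K n x \<longleftrightarrow> (\<exists>b \<in> coboundaries K n. y = b \<oplus>\<^bsub>grade K n\<^esub> x)"
  by (simp add: cohom_class_def a_r_coset_def')

lemma cohom_class_memI:
  "\<lbrakk>b \<in> coboundaries K n; y = b \<oplus>\<^bsub>grade K n\<^esub> x\<rbrakk> \<Longrightarrow> y \<in> cohom_class K n x"
  by (auto simp: cohom_class_mem)

lemma cohom_class_self: "x \<in> carrier (grade K n) \<Longrightarrow> x \<in> cohom_class K n x"
  using zero_coboundary by (intro cohom_class_memI[of "\<zero>\<^bsub>grade K n\<^esub>"]) simp_all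

lemma cohom_class_cocycle: "\<lbrakk>y \<in> cohom_class K n x; x \<in> cocycles K n\<rbrakk> \<Longrightarrow> y \<in> cocycles K n"
  by (auto simp: cohom_class_mem add_cocycle coboundary_cocycle)

lemma cohom_class_cong:
  assumes "y \<in> cohom_class K n x" "x \<in> carrier (grade K n)"
  shows "cohom_class K n y = cohom_class K n x"
proof -
  obtain b where b: "b \<in> coboundaries K n" "y = b \<oplus>\<^bsub>grade K n\<^esub> x"
    using assms by (auto simp: cohom_class_mem)
  note [simp] = coboundary_carrier
  have "z \<in> cohom_class K n y \<longleftrightarrow> z \<in> cohom_class K n x" for z
  proof
    assume "z \<in> cohom_class K n y"
    then obtain c where c: "c \<in> coboundaries K n" "z = c \<oplus>\<^bsub>grade K n\<^esub> y"
      by (auto simp: cohom_class_mem)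
    then show "z \<in> cohom_class K n x" using b assms
      by (intro cohom_class_memI[of "c \<oplus>\<^bsub>grade K n\<^esub> b"]) (simp_all add: add_coboundary grade.a_assoc)
  next
    assume "z \<in> cohom_class K n x"
    then obtain c where c: "c \<in> coboundaries K n" "z = c \<oplus>\<^bsub>grade K n\<^esub> x"
      by (auto simp: cohom_class_mem)
    then show "z \<in> cohom_class K n y" using b assms
      by (intro cohom_class_memI[of "c \<ominus>\<^bsub>grade K n\<^esub> b"])
        (simp_all add: diff_coboundary grade.group_simps)
  qed
  then show ?thesis by blast
qed

lemma cohom_class_eq_iff:
  assumes "x \<in> carrier (grade K n)" "y \<in> carrier (grade K n)"
  shows "cohom_class K n x = cohom_class K n y \<longleftrightarrow> x \<ominus>\<^bsub>grade K n\<^esub> y \<in> coboundaries K n"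
proof
  assume "cohom_class K n x = cohom_class K n y"
  then have "x \<in> cohom_class K n y" using cohom_class_self assms by blast
  then obtain b where b: "b \<in> coboundaries K n" "x = b \<oplus>\<^bsub>grade K n\<^esub> y"
    by (auto simp: cohom_class_mem)
  then have "x \<ominus>\<^bsub>grade K n\<^esub> y = b" using assms by (simp add: grade.group_simps coboundary_carrier)
  with b show "x \<ominus>\<^bsub>grade K n\<^esub> y \<in> coboundaries K n" by simp
next
  assume "x \<ominus>\<^bsub>grade K n\<^esub> y \<in> coboundaries K n"
  then show "cohom_class K n x = cohom_class K n y" using assms
    by (intro cohom_class_cong cohom_class_memI[of "x \<ominus>\<^bsub>grade K n\<^esub> y"]) (simp_all add: grade.group_simps)
qed

lemma cohom_class_eqI:
  assumes "b \<in> coboundaries K n" "x = b \<oplus>\<^bsub>grade K n\<^esub> y" "y \<in> carrier (grade K n)"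
  shows "cohom_class K n x = cohom_class K n y"
  using assms by (intro cohom_class_cong cohom_class_memI)

text \<open>Operations on classes are unions over representatives. A class contains its
  representative, hence is nonempty, so such a union is the common value of its members; computing
  an operation reduces to independence of representatives.\<close>

lemma UN_cohom_class:
  assumes "x \<in> carrier (grade K n)" "\<And>y. y \<in> cohom_class K n x \<Longrightarrow> F y = S"
  shows "(\<Union>y \<in> cohom_class K n x. F y) = S"
  using assms(2) cohom_class_self[OF assms(1)] by blast

lemma cohomology_carrier: "carrier (cohomology K n) = cohom_class K n ` cocycles K n"
  by (simp add: cohomology_def)

lemma cohomology_zero: "\<zero>\<^bsub>cohomology K n\<^esub> = cohom_class K n \<zero>\<^bsub>grade K n\<^esub>"
  by (simp add: cohomology_def)

lemma cohomology_add:
  assumes x: "x \<in> carrier (grade K n)" and y: "y \<in> carrier (grade K n)"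
  shows "cohom_class K n x \<oplus>\<^bsub>cohomology K n\<^esub> cohom_class K n y = cohom_class K n (x \<oplus>\<^bsub>grade K n\<^esub> y)"
  unfolding cohomology_def make_module_simps
proof (intro UN_cohom_class x y)
  fix x' y' assume "x' \<in> cohom_class K n x" "y' \<in> cohom_class K n y"
  then obtain b c where "b \<in> coboundaries K n" "x' = b \<oplus>\<^bsub>grade K n\<^esub> x"
    "c \<in> coboundaries K n" "y' = c \<oplus>\<^bsub>grade K n\<^esub> y" by (auto simp: cohom_class_mem)
  then show "cohom_class K n (x' \<oplus>\<^bsub>grade K n\<^esub> y') = cohom_class K n (x \<oplus>\<^bsub>grade K n\<^esub> y)"
    using x y by (intro cohom_class_eqI[of "b \<oplus>\<^bsub>grade K n\<^esub> c"])
      (simp_all add: add_coboundary coboundary_carrier grade.a_ac)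
qed

lemma cohomology_smult:
  assumes r: "r \<in> carrier R" and x: "x \<in> carrier (grade K n)"
  shows "r \<odot>\<^bsub>cohomology K n\<^esub> cohom_class K n x = cohom_class K n (r \<odot>\<^bsub>grade K n\<^esub> x)"
  unfolding cohomology_def make_module_simps
proof (intro UN_cohom_class x)
  fix x' assume "x' \<in> cohom_class K n x"
  then obtain b where "b \<in> coboundaries K n" "x' = b \<oplus>\<^bsub>grade K n\<^esub> x"
    by (auto simp: cohom_class_mem)
  then show "cohom_class K n (r \<odot>\<^bsub>grade K n\<^esub> x') = cohom_class K n (r \<odot>\<^bsub>grade K n\<^esub> x)"
    using r x by (intro cohom_class_eqI[of "r \<odot>\<^bsub>grade K n\<^esub> b"])
      (simp_all add: smult_coboundary coboundary_carrier grade.smult_r_distr)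
qed

lemma cohomology_module: "module R (cohomology K n)"
proof (rule moduleI)
  note [simp] = cohomology_carrier cohomology_zero cohomology_add cohomology_smult
    cocycles_carrier zero_cocycle add_cocycle neg_cocycle smult_cocycle
  show "cring R" using grade_module by (simp add: module_def)
  show "abelian_group (cohomology K n)"
  proof (rule abelian_groupI)
    fix \<xi> assume "\<xi> \<in> carrier (cohomology K n)"
    then obtain x where "x \<in> cocycles K n" "\<xi> = cohom_class K n x" by auto
    then show "\<exists>\<eta> \<in> carrier (cohomology K n). \<eta> \<oplus>\<^bsub>cohomology K n\<^esub> \<xi> = \<zero>\<^bsub>cohomology K n\<^esub>"
      by (intro bexI[of _ "cohom_class K n (\<ominus>\<^bsub>grade K n\<^esub> x)"]) (simp_all add: grade.l_neg)
  qed (auto simp: grade.a_ac)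
qed (auto simp: cohomology_carrier cohomology_smult cohomology_add smult_cocycle add_cocycle
    cocycles_carrier grade.smult_l_distr grade.smult_r_distr grade.smult_assoc1)

end

section \<open>The homotopy category of a dg-category\<close>

context dg_category
begin

lemma hom_complex_of_modules:
  "\<lbrakk>X \<in> dg_ob A; Y \<in> dg_ob A\<rbrakk> \<Longrightarrow> complex_of_modules R (dg_hom A X Y)"
  by (simp add: complex_of_modules_def hom_complex)

lemmas hom_module = complex_of_modules.grade_module[OF hom_complex_of_modules]
lemmas hom_abelian_group = module_abelian_group[OF hom_module]
lemmas hom_group_closed = abelian_group.group_closed[OF hom_abelian_group]
lemmas hom_group_simps = abelian_group.group_simps[OF hom_abelian_group]

lemma comp_closed:
  "\<lbrakk>X \<in> dg_ob A; Y \<in> dg_ob A; Z \<in> dg_ob A; g \<in> dg_mor A Y Z q; f \<in> dg_mor A X Y p; s = q + p\<rbrakk> \<Longrightarrow>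
    dg_comp A X Y Z q p g f \<in> dg_mor A X Z s"
  using mod_hom_closed[OF bilinear_mapD(1)[OF comp_bilinear]] by blast

lemma diff_closed:
  "\<lbrakk>X \<in> dg_ob A; Y \<in> dg_ob A; f \<in> dg_mor A X Y n; s = n + 1\<rbrakk> \<Longrightarrow> cdiff (dg_hom A X Y) n f \<in> dg_mor A X Y s"
  using mod_hom_closed[OF complex_of_modules.diff_hom[OF hom_complex_of_modules]] by blast

lemmas comp_mod_hom1 = bilinear_mapD(2)[OF comp_bilinear]
lemmas comp_mod_hom2 = bilinear_mapD(1)[OF comp_bilinear]

lemmas comp_linear_left = mod_hom_add[OF comp_mod_hom1]
  mod_hom_diff[OF hom_module hom_module comp_mod_hom1] mod_hom_neg[OF hom_module hom_module comp_mod_hom1]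
  mod_hom_zero[OF hom_module hom_module comp_mod_hom1] mod_hom_smult[OF comp_mod_hom1]

lemmas comp_linear_right = mod_hom_add[OF comp_mod_hom2]
  mod_hom_diff[OF hom_module hom_module comp_mod_hom2] mod_hom_neg[OF hom_module hom_module comp_mod_hom2]
  mod_hom_zero[OF hom_module hom_module comp_mod_hom2] mod_hom_smult[OF comp_mod_hom2]

lemmas diff_mod_hom = complex_of_modules.diff_hom[OF hom_complex_of_modules]
lemmas diff_linear = mod_hom_add[OF diff_mod_hom]
  mod_hom_diff[OF hom_module hom_module diff_mod_hom] mod_hom_neg[OF hom_module hom_module diff_mod_hom]
  mod_hom_zero[OF hom_module hom_module diff_mod_hom] mod_hom_smult[OF diff_mod_hom]

lemma diff_diff:
  "\<lbrakk>X \<in> dg_ob A; Y \<in> dg_ob A; f \<in> dg_mor A X Y p; s = p + 1\<rbrakk> \<Longrightarrow>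
    cdiff (dg_hom A X Y) s (cdiff (dg_hom A X Y) p f) = \<zero>\<^bsub>grade (dg_hom A X Y) (p + 2)\<^esub>"
  using complex_of_modules.diff_diff[OF hom_complex_of_modules] by simp

lemma comp_assoc':
  "\<lbrakk>W \<in> dg_ob A; X \<in> dg_ob A; Y \<in> dg_ob A; Z \<in> dg_ob A;
    f \<in> dg_mor A W X p; g \<in> dg_mor A X Y q; h \<in> dg_mor A Y Z r; s = r + q\<rbrakk> \<Longrightarrow>
    dg_comp A W X Z s p (dg_comp A X Y Z r q h g) f =
    dg_comp A W Y Z r (q + p) h (dg_comp A W X Y q p g f)"
  by (simp add: comp_assoc)

lemma comp_cocycle:
  assumes "X \<in> dg_ob A" "Y \<in> dg_ob A" "Z \<in> dg_ob A"
    "g \<in> cocycles (dg_hom A Y Z) q" "f \<in> cocycles (dg_hom A X Y) p" "s = q + p"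
  shows "dg_comp A X Y Z q p g f \<in> cocycles (dg_hom A X Z) s"
proof -
  have "cdiff (dg_hom A X Z) (q + p) (dg_comp A X Y Z q p g f) = \<zero>\<^bsub>grade (dg_hom A X Z) (q + p + 1)\<^esub>"
    using assms by (subst leibniz)
      (auto simp: cocycles_def comp_linear_left comp_linear_right signed_def hom_group_simps algebra_simps)
  then show ?thesis using assms by (auto simp: cocycles_def comp_closed)
qed

text \<open>For closed \<open>f\<close> the Leibniz rule gives
  \<open>d(w f) = (d w) f\<close>.\<close>

lemma comp_coboundary_left:
  assumes "X \<in> dg_ob A" "Y \<in> dg_ob A" "Z \<in> dg_ob A"
    "g \<in> coboundaries (dg_hom A Y Z) q" "f \<in> cocycles (dg_hom A X Y) p" "s = q + p"
  shows "dg_comp A X Y Z q p g f \<in> coboundaries (dg_hom A X Z) s"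
proof -
  obtain w where w: "w \<in> dg_mor A Y Z (q - 1)" "g = cdiff (dg_hom A Y Z) (q - 1) w"
    using assms by (auto simp: coboundaries_def)
  have "cdiff (dg_hom A X Z) (q - 1 + p) (dg_comp A X Y Z (q - 1) p w f) = dg_comp A X Y Z q p g f"
    using assms w by (subst leibniz)
      (auto simp: cocycles_def comp_linear_right comp_closed diff_closed signed_def hom_group_simps algebra_simps)
  moreover have "dg_comp A X Y Z (q - 1) p w f \<in> dg_mor A X Z (q - 1 + p)"
    using assms w by (auto simp: cocycles_def comp_closed)
  moreover have "q - 1 + p = s - 1" using assms by simp
  ultimately show ?thesis unfolding coboundaries_def by (metis image_eqI)
qed

text \<open>For closed \<open>g\<close> of degree \<open>q\<close> the Leibniz rule gives
  \<open>d(g w) = (-1)^q g (d w)\<close>; the sign is removed because coboundaries are closed under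
  negation.\<close>

lemma comp_coboundary_right:
  assumes "X \<in> dg_ob A" "Y \<in> dg_ob A" "Z \<in> dg_ob A"
    "g \<in> cocycles (dg_hom A Y Z) q" "f \<in> coboundaries (dg_hom A X Y) p" "s = q + p"
  shows "dg_comp A X Y Z q p g f \<in> coboundaries (dg_hom A X Z) s"
proof -
  interpret H: complex_of_modules R "dg_hom A X Z" using assms by (simp add: hom_complex_of_modules)
  obtain w where w: "w \<in> dg_mor A X Y (p - 1)" "f = cdiff (dg_hom A X Y) (p - 1) w"
    using assms by (auto simp: coboundaries_def)
  have gf: "dg_comp A X Y Z q p g f \<in> dg_mor A X Z (q + p)"
    using assms w by (auto simp: cocycles_def comp_closed diff_closed)
  have eq: "cdiff (dg_hom A X Z) (q + (p - 1)) (dg_comp A X Y Z q (p - 1) g w) =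
      signed (grade (dg_hom A X Z) (q + p)) q (dg_comp A X Y Z q p g f)"
    using assms w gf by (subst leibniz)
      (auto simp: cocycles_def comp_linear_left comp_closed diff_closed signed_def H.grade.l_zero algebra_simps)
  have "cdiff (dg_hom A X Z) (q + (p - 1)) (dg_comp A X Y Z q (p - 1) g w) \<in> coboundaries (dg_hom A X Z) (q + p)"
    using assms w by (intro H.coboundaryI[where m = "q + (p - 1)"]) (auto simp: cocycles_def comp_closed)
  from H.signed_coboundary[OF this, of q] show ?thesis
    using gf assms(6) by (simp add: eq signed_def H.grade.minus_minus split: if_splits)
qed

lemma homotopy_category_simps [simp]:
  "lob (homotopy_category A) = dg_ob A"
  "lhom (homotopy_category A) X Y = cohomology (dg_hom A X Y) 0"
  "lid (homotopy_category A) X = cohom_class (dg_hom A X X) 0 (dg_id A X)"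
  by (simp_all add: homotopy_category_def)

lemma homotopy_comp:
  assumes ob: "X \<in> dg_ob A" "Y \<in> dg_ob A" "Z \<in> dg_ob A"
    and g: "g \<in> cocycles (dg_hom A Y Z) 0" and f: "f \<in> cocycles (dg_hom A X Y) 0"
  shows "lcomp (homotopy_category A) X Y Z (cohom_class (dg_hom A Y Z) 0 g) (cohom_class (dg_hom A X Y) 0 f) =
    cohom_class (dg_hom A X Z) 0 (dg_comp A X Y Z 0 0 g f)"
proof -
  interpret YZ: complex_of_modules R "dg_hom A Y Z" using ob by (simp add: hom_complex_of_modules)
  interpret XY: complex_of_modules R "dg_hom A X Y" using ob by (simp add: hom_complex_of_modules)
  interpret XZ: complex_of_modules R "dg_hom A X Z" using ob by (simp add: hom_complex_of_modules)
  note [simp] = YZ.cocycles_carrier XY.cocycles_carrier XZ.cocycles_carrier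
    YZ.coboundary_carrier XY.coboundary_carrier
  show ?thesis
    unfolding homotopy_category_def lincat.simps
  proof (intro YZ.UN_cohom_class XY.UN_cohom_class)
    fix g' f' assume g': "g' \<in> cohom_class (dg_hom A Y Z) 0 g" and f': "f' \<in> cohom_class (dg_hom A X Y) 0 f"
    obtain b where b: "b \<in> coboundaries (dg_hom A Y Z) 0" "g' = b \<oplus>\<^bsub>grade (dg_hom A Y Z) 0\<^esub> g"
      using g' by (auto simp: YZ.cohom_class_mem)
    obtain c where c: "c \<in> coboundaries (dg_hom A X Y) 0" "f' = c \<oplus>\<^bsub>grade (dg_hom A X Y) 0\<^esub> f"
      using f' by (auto simp: XY.cohom_class_mem)
    have f'Z: "f' \<in> cocycles (dg_hom A X Y) 0" using XY.cohom_class_cocycle f f' by blast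
    \<comment> \<open>Expanding \<open>g'\<close> first keeps \<open>f'\<close> in one correction
      and \<open>g\<close> in the other, so each is a product of a coboundary and a cocycle and no
      product of two corrections appears.\<close>
    have eq: "dg_comp A X Y Z 0 0 g' f' = (dg_comp A X Y Z 0 0 b f' \<oplus>\<^bsub>grade (dg_hom A X Z) 0\<^esub>
        dg_comp A X Y Z 0 0 g c) \<oplus>\<^bsub>grade (dg_hom A X Z) 0\<^esub> dg_comp A X Y Z 0 0 g f"
      using ob b c f g f'Z
      by (simp add: comp_linear_left comp_linear_right comp_closed hom_group_simps)
    show "cohom_class (dg_hom A X Z) 0 (dg_comp A X Y Z 0 0 g' f') =
        cohom_class (dg_hom A X Z) 0 (dg_comp A X Y Z 0 0 g f)"
    proof (rule XZ.cohom_class_eqI[OF XZ.add_coboundary eq])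
      show "dg_comp A X Y Z 0 0 b f' \<in> coboundaries (dg_hom A X Z) 0"
        using ob b(1) f'Z by (rule comp_coboundary_left) simp
      show "dg_comp A X Y Z 0 0 g c \<in> coboundaries (dg_hom A X Z) 0"
        using ob g c(1) by (rule comp_coboundary_right) simp
      show "dg_comp A X Y Z 0 0 g f \<in> dg_mor A X Z 0"
        using ob f g by (simp add: comp_closed)
    qed
  qed (use f g in simp_all)
qed

lemma homotopy_category_linear: "linear_category R (homotopy_category A)"
proof (rule linear_category.intro)
  show "cring R" by (rule base_ring)
next
  fix X Y assume "X \<in> lob (homotopy_category A)" "Y \<in> lob (homotopy_category A)"
  then show "module R (lhom (homotopy_category A) X Y)"
    by (simp add: complex_of_modules.cohomology_module[OF hom_complex_of_modules])
next
  fix X Y Z assume ob: "X \<in> lob (homotopy_category A)" "Y \<in> lob (homotopy_category A)" "Z \<in> lob (homotopy_category A)"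
  then interpret YZ: complex_of_modules R "dg_hom A Y Z" by (simp add: hom_complex_of_modules)
  from ob interpret XY: complex_of_modules R "dg_hom A X Y" by (simp add: hom_complex_of_modules)
  from ob interpret XZ: complex_of_modules R "dg_hom A X Z" by (simp add: hom_complex_of_modules)
  show "bilinear_map R (lhom (homotopy_category A) Y Z) (lhom (homotopy_category A) X Y)
     (lhom (homotopy_category A) X Z) (lcomp (homotopy_category A) X Y Z)"
    using ob by (intro bilinear_mapI)
      (auto simp: XY.cohomology_carrier YZ.cohomology_carrier XZ.cohomology_carrier homotopy_comp
        comp_cocycle XY.cohomology_add YZ.cohomology_add XZ.cohomology_add XY.add_cocycle YZ.add_cocycle
        XY.cocycles_carrier YZ.cocycles_carrier comp_linear_left comp_linear_right comp_closed
        XY.cohomology_smult YZ.cohomology_smult XZ.cohomology_smult XY.smult_cocycle YZ.smult_cocycle)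
next
  fix X assume "X \<in> lob (homotopy_category A)"
  then show "lid (homotopy_category A) X \<in> carrier (lhom (homotopy_category A) X X)"
    by (simp add: id_closed complex_of_modules.cohomology_carrier[OF hom_complex_of_modules])
next
  fix W X Y Z f g h
  assume ob: "W \<in> lob (homotopy_category A)" "X \<in> lob (homotopy_category A)" "Y \<in> lob (homotopy_category A)" "Z \<in> lob (homotopy_category A)"
    and "f \<in> carrier (lhom (homotopy_category A) W X)" "g \<in> carrier (lhom (homotopy_category A) X Y)"
      "h \<in> carrier (lhom (homotopy_category A) Y Z)"
  then obtain a b c where "a \<in> cocycles (dg_hom A W X) 0" "b \<in> cocycles (dg_hom A X Y) 0"
    "c \<in> cocycles (dg_hom A Y Z) 0" "f = cohom_class (dg_hom A W X) 0 a"
    "g = cohom_class (dg_hom A X Y) 0 b" "h = cohom_class (dg_hom A Y Z) 0 c"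
    by (auto simp: complex_of_modules.cohomology_carrier[OF hom_complex_of_modules])
  moreover from this have "a \<in> dg_mor A W X 0" "b \<in> dg_mor A X Y 0" "c \<in> dg_mor A Y Z 0"
    by (auto simp: cocycles_def)
  moreover note comp_assoc[of W X Y Z a 0 b 0 c 0]
  ultimately show "lcomp (homotopy_category A) W Y Z h (lcomp (homotopy_category A) W X Y g f) =
      lcomp (homotopy_category A) W X Z (lcomp (homotopy_category A) X Y Z h g) f"
    using ob by (simp add: homotopy_comp comp_cocycle)
next
  fix X Y f assume "X \<in> lob (homotopy_category A)" "Y \<in> lob (homotopy_category A)"
    "f \<in> carrier (lhom (homotopy_category A) X Y)"
  then show "lcomp (homotopy_category A) X Y Y (lid (homotopy_category A) Y) f = f"
    "lcomp (homotopy_category A) X X Y f (lid (homotopy_category A) X) = f"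
    by (auto simp: complex_of_modules.cohomology_carrier[OF hom_complex_of_modules] homotopy_comp
        id_closed comp_id_left comp_id_right complex_of_modules.cocycles_carrier[OF hom_complex_of_modules])
qed

end

lemma linear_category_full_subcategory:
  assumes "linear_category R C" "S \<subseteq> lob C"
  shows "linear_category R (full_subcategory C S)"
proof -
  interpret C: linear_category R C by fact
  have S: "X \<in> lob C" if "X \<in> S" for X using that assms(2) by blast
  show ?thesis unfolding full_subcategory_def
    by (rule linear_category.intro) (simp_all add: C.base_ring C.hom_module C.comp_bilinear C.id_closed C.comp_assoc
        C.comp_id_left C.comp_id_right S)
qed

lemma full_subcategory_simps [simp]:
  "lob (full_subcategory C S) = S"
  "lhom (full_subcategory C S) = lhom C"
  "lcomp (full_subcategory C S) = lcomp C"
  "lid (full_subcategory C S) = lid C"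
  by (simp_all add: full_subcategory_def)

section \<open>Equivalences of linear categories\<close>

lemma (in linear_category) comp_closed:
  "\<lbrakk>X \<in> lob C; Y \<in> lob C; Z \<in> lob C; g \<in> carrier (lhom C Y Z); f \<in> carrier (lhom C X Y)\<rbrakk> \<Longrightarrow>
    lcomp C X Y Z g f \<in> carrier (lhom C X Z)"
  using mod_hom_closed[OF bilinear_mapD(1)[OF comp_bilinear]] by blast

text \<open>Since the functor is onto on objects, a section \<open>G\<close> on objects gives a quasi-inverse with
  \<open>F \<circ> G = id\<close>.\<close>

lemma (in linear_functor) equivalenceI:
  assumes surj: "\<And>Y. Y \<in> lob D \<Longrightarrow> \<exists>X \<in> lob C. fun_ob F X = Y"
    and ff: "\<And>X Y. \<lbrakk>X \<in> lob C; Y \<in> lob C\<rbrakk> \<Longrightarrow>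
      bij_betw (fun_mor F X Y) (carrier (lhom C X Y)) (carrier (lhom D (fun_ob F X) (fun_ob F Y)))"
  shows "equivalent_categories R C D"
proof -
  obtain g where g [simp]: "\<And>Y. Y \<in> lob D \<Longrightarrow> g Y \<in> lob C" "\<And>Y. Y \<in> lob D \<Longrightarrow> fun_ob F (g Y) = Y"
    using surj by metis
  define iF where "iF X Y = inv_into (carrier (lhom C X Y)) (fun_mor F X Y)" for X Y
  have image: "fun_mor F X Y ` carrier (lhom C X Y) = carrier (lhom D (fun_ob F X) (fun_ob F Y))"
    if "X \<in> lob C" "Y \<in> lob C" for X Y
    using ff[OF that] by (simp add: bij_betw_def)
  have iF1 [simp]: "iF X Y k \<in> carrier (lhom C X Y)"
    and iF2 [simp]: "fun_mor F X Y (iF X Y k) = k"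
    if "X \<in> lob C" "Y \<in> lob C" "k \<in> carrier (lhom D (fun_ob F X) (fun_ob F Y))" for X Y k
    using that(3) unfolding iF_def image[OF that(1,2), symmetric] by (fact inv_into_into, fact f_inv_into_f)
  have inj: "f = f'" if "fun_mor F X Y f = fun_mor F X Y f'" "X \<in> lob C" "Y \<in> lob C"
    "f \<in> carrier (lhom C X Y)" "f' \<in> carrier (lhom C X Y)" for X Y f f'
    using ff[OF that(2,3)] that unfolding bij_betw_def inj_on_def by blast
  define G where "G = \<lparr>fun_ob = g, fun_mor = (\<lambda>X Y. iF (g X) (g Y))\<rparr>"
  \<comment> \<open>Here \<open>F (g (F X)) = F X\<close>, so the identity of \<open>F X\<close>
    lies in the image of Hom from \<open>X\<close> to \<open>g (F X)\<close>; its preimage is the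
    unit. Equations between morphisms of \<open>C\<close> are verified after applying
    \<open>F\<close>, which is injective on morphisms.\<close>
  define \<eta> where "\<eta> X = iF X (g (fun_ob F X)) (lid D (fun_ob F X))" for X
  define \<epsilon> where "\<epsilon> = lid D"
  note [simp] = fun_ob_closed source.comp_closed target.comp_closed source.id_closed target.id_closed fun_mor_id
    fun_mor_comp source.comp_id_left source.comp_id_right target.comp_id_left target.comp_id_right
  have F [simp]: "fun_mor F X Y f \<in> carrier (lhom D (fun_ob F X) (fun_ob F Y))"
    if "X \<in> lob C" "Y \<in> lob C" "f \<in> carrier (lhom C X Y)" for X Y f
    using mod_hom_closed[OF fun_mor_linear] that by blast
  note [simp] = mod_hom_add[OF fun_mor_linear] mod_hom_smult[OF fun_mor_linear]
  note [simp] = abelian_group.group_closed(1)[OF module_abelian_group[OF source.hom_module]]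
    abelian_group.group_closed(1)[OF module_abelian_group[OF target.hom_module]]
    module.smult_closed[OF source.hom_module] module.smult_closed[OF target.hom_module]
  have "linear_functor R D C G"
  proof
    fix X Y assume [simp]: "X \<in> lob D" "Y \<in> lob D"
    show "fun_mor G X Y \<in> mod_hom R (lhom D X Y) (lhom C (fun_ob G X) (fun_ob G Y))"
      by (rule mod_homI) (auto simp: G_def intro!: inj[where X = "g X" and Y = "g Y"])
  next
    fix X assume "X \<in> lob D"
    then show "fun_mor G X X (lid D X) = lid C (fun_ob G X)"
      by (auto simp: G_def intro!: inj[where X = "g X" and Y = "g X"])
  next
    fix X Y Z h k assume "X \<in> lob D" "Y \<in> lob D" "Z \<in> lob D" "h \<in> carrier (lhom D X Y)" "k \<in> carrier (lhom D Y Z)"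
    then show "fun_mor G X Z (lcomp D X Y Z k h) =
        lcomp C (fun_ob G X) (fun_ob G Y) (fun_ob G Z) (fun_mor G Y Z k) (fun_mor G X Y h)"
      by (auto simp: G_def intro!: inj[where X = "g X" and Y = "g Z"])
  qed (auto simp: G_def)
  moreover have "natural_iso D D (comp_functor F G) id_functor \<epsilon>"
    by (auto simp: natural_iso_def iso_arrow_def G_def id_functor_def comp_functor_def \<epsilon>_def
        intro!: bexI[of _ "lid D _"])
  moreover have "natural_iso C C id_functor (comp_functor G F) \<eta>"
  proof -
    have "iso_arrow C X (g (fun_ob F X)) (\<eta> X)" if [simp]: "X \<in> lob C" for X
    proof -
      let ?Y = "g (fun_ob F X)" and ?k = "iF (g (fun_ob F X)) X (lid D (fun_ob F X))"
      have "lcomp C X ?Y X ?k (\<eta> X) = lid C X"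
        by (rule inj[where X = X and Y = X]) (simp_all add: \<eta>_def)
      moreover have "lcomp C ?Y X ?Y (\<eta> X) ?k = lid C ?Y"
        by (rule inj[where X = ?Y and Y = ?Y]) (simp_all add: \<eta>_def)
      moreover have "?k \<in> carrier (lhom C ?Y X)" "\<eta> X \<in> carrier (lhom C X ?Y)"
        by (simp_all add: \<eta>_def)
      ultimately show ?thesis unfolding iso_arrow_def by auto
    qed
    moreover have "lcomp C X Y (g (fun_ob F Y)) (\<eta> Y) f =
        lcomp C X (g (fun_ob F X)) (g (fun_ob F Y)) (iF (g (fun_ob F X)) (g (fun_ob F Y)) (fun_mor F X Y f)) (\<eta> X)"
      if "X \<in> lob C" "Y \<in> lob C" "f \<in> carrier (lhom C X Y)" for X Y f
      by (rule inj[where X = X and Y = "g (fun_ob F Y)"]) (use that in \<open>simp_all add: \<eta>_def\<close>)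
    ultimately show ?thesis
      by (simp add: natural_iso_def G_def id_functor_def comp_functor_def)
  qed
  ultimately show ?thesis
    unfolding equivalent_categories_def using linear_functor_axioms by blast
qed

section \<open>Dg-bimodules\<close>

lemma signed_simps:
  "even n \<Longrightarrow> signed M n x = x"
  "odd n \<Longrightarrow> signed M n x = \<ominus>\<^bsub>M\<^esub> x"
  by (simp_all add: signed_def)

lemma signed_cong: "even n = even m \<Longrightarrow> signed M n x = signed M m x"
  by (simp add: signed_def)

lemma signed_signed: "\<lbrakk>module R M; x \<in> carrier M\<rbrakk> \<Longrightarrow> signed M n (signed M m x) = signed M (n + m) x"
  by (simp add: signed_def abelian_group.minus_minus module_abelian_group)

lemma mod_hom_signed:
  "\<lbrakk>module R M; module R N; f \<in> mod_hom R M N; x \<in> carrier M\<rbrakk> \<Longrightarrow> f (signed M n x) = signed N n (f x)"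
  by (simp add: signed_def mod_hom_neg)

lemma signed_mod_hom:
  assumes "module R N" "f \<in> mod_hom R M N"
  shows "(\<lambda>x. signed N n (f x)) \<in> mod_hom R M N"
proof -
  interpret N: module R N by fact
  show ?thesis using mod_hom_closed[OF assms(2)]
    by (intro mod_homI) (simp_all add: signed_def mod_hom_add[OF assms(2)] mod_hom_smult[OF assms(2)]
        N.minus_add N.smult_r_minus)
qed

text \<open>The results are restricted to the carrier because the components of a morphism of
  complexes are required to be extensional.\<close>

lemma mod_hom_pointwise:
  assumes M: "module R M" and N: "module R N" and f: "f \<in> mod_hom R M N"
  shows "g \<in> mod_hom R M N \<Longrightarrow> (\<lambda>x \<in> carrier M. f x \<oplus>\<^bsub>N\<^esub> g x) \<in> mod_hom R M N"
    and "(\<lambda>x \<in> carrier M. \<ominus>\<^bsub>N\<^esub> f x) \<in> mod_hom R M N"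
    and "(\<lambda>x \<in> carrier M. \<zero>\<^bsub>N\<^esub>) \<in> mod_hom R M N"
proof -
  interpret M: module R M by fact
  interpret N: module R N by fact
  note [simp] = mod_hom_closed[OF f] mod_hom_add[OF f] mod_hom_smult[OF f]
  show "(\<lambda>x \<in> carrier M. \<ominus>\<^bsub>N\<^esub> f x) \<in> mod_hom R M N"
    by (rule mod_homI) (simp_all add: N.minus_add N.smult_r_minus)
  show "(\<lambda>x \<in> carrier M. \<zero>\<^bsub>N\<^esub>) \<in> mod_hom R M N"
    by (rule mod_homI) simp_all
  assume g: "g \<in> mod_hom R M N"
  note [simp] = mod_hom_closed[OF g] mod_hom_add[OF g] mod_hom_smult[OF g]
  show "(\<lambda>x \<in> carrier M. f x \<oplus>\<^bsub>N\<^esub> g x) \<in> mod_hom R M N"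
    by (rule mod_homI) (simp_all add: N.smult_r_distr N.a_ac)
qed

lemma complex_hom_module_simps [simp]:
  "carrier (complex_hom_module R K L n) =
    {f. \<forall>i. f i \<in> mod_hom R (grade K i) (grade L (i + n)) \<inter> extensional (carrier (grade K i))}"
  "F \<oplus>\<^bsub>complex_hom_module R K L n\<^esub> G =
    (\<lambda>i. \<lambda>x \<in> carrier (grade K i). F i x \<oplus>\<^bsub>grade L (i + n)\<^esub> G i x)"
  "\<zero>\<^bsub>complex_hom_module R K L n\<^esub> = (\<lambda>i. \<lambda>x \<in> carrier (grade K i). \<zero>\<^bsub>grade L (i + n)\<^esub>)"
  "r \<odot>\<^bsub>complex_hom_module R K L n\<^esub> F =
    (\<lambda>i. \<lambda>x \<in> carrier (grade K i). r \<odot>\<^bsub>grade L (i + n)\<^esub> F i x)"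
  by (simp_all add: complex_hom_module_def)

text \<open>Negation is defined only as the inverse in the additive group, so the pointwise formula
  follows from the group laws for families of maps and uniqueness of inverses. It is what allows the
  signs in the dg-functor equations of \<open>M\<close> to be evaluated at an element.\<close>

lemma complex_hom_neg:
  assumes "cochain_complex R K" "cochain_complex R L" "F \<in> carrier (complex_hom_module R K L n)"
  shows "\<ominus>\<^bsub>complex_hom_module R K L n\<^esub> F = (\<lambda>i. \<lambda>x \<in> carrier (grade K i). \<ominus>\<^bsub>grade L (i + n)\<^esub> F i x)"
proof -
  interpret K: complex_of_modules R K by unfold_locales fact
  interpret L: complex_of_modules R L by unfold_locales fact
  have F: "F i x \<in> carrier (grade L (i + n))"
    if "F \<in> carrier (complex_hom_module R K L n)" "x \<in> carrier (grade K i)" for F i x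
    using that mod_hom_closed[of "F i" R "grade K i" "grade L (i + n)" x] by auto
  have neg: "(\<lambda>i. \<lambda>x \<in> carrier (grade K i). \<ominus>\<^bsub>grade L (i + n)\<^esub> F i x) \<in> carrier (complex_hom_module R K L n)"
    if "F \<in> carrier (complex_hom_module R K L n)" for F
    using that mod_hom_pointwise(2)[OF K.grade_module L.grade_module] by auto
  have inv: "(\<lambda>i. \<lambda>x \<in> carrier (grade K i). \<ominus>\<^bsub>grade L (i + n)\<^esub> F i x) \<oplus>\<^bsub>complex_hom_module R K L n\<^esub> F =
      \<zero>\<^bsub>complex_hom_module R K L n\<^esub>" if "F \<in> carrier (complex_hom_module R K L n)" for F
    using F[OF that] by (auto simp: fun_eq_iff L.grade.l_neg)
  have "abelian_group (complex_hom_module R K L n)"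
  proof (rule abelian_groupI)
    fix F G assume FG: "F \<in> carrier (complex_hom_module R K L n)" "G \<in> carrier (complex_hom_module R K L n)"
    then show "F \<oplus>\<^bsub>complex_hom_module R K L n\<^esub> G \<in> carrier (complex_hom_module R K L n)"
      using mod_hom_pointwise(1)[OF K.grade_module L.grade_module] by auto
    show "F \<oplus>\<^bsub>complex_hom_module R K L n\<^esub> G = G \<oplus>\<^bsub>complex_hom_module R K L n\<^esub> F"
      using F[OF FG(1)] F[OF FG(2)] by (auto simp: fun_eq_iff L.grade.a_comm)
  next
    fix F G H assume FGH: "F \<in> carrier (complex_hom_module R K L n)" "G \<in> carrier (complex_hom_module R K L n)"
      "H \<in> carrier (complex_hom_module R K L n)"
    show "F \<oplus>\<^bsub>complex_hom_module R K L n\<^esub> G \<oplus>\<^bsub>complex_hom_module R K L n\<^esub> H =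
        F \<oplus>\<^bsub>complex_hom_module R K L n\<^esub> (G \<oplus>\<^bsub>complex_hom_module R K L n\<^esub> H)"
      using F[OF FGH(1)] F[OF FGH(2)] F[OF FGH(3)] by (auto simp: fun_eq_iff L.grade.a_assoc)
  next
    show "\<zero>\<^bsub>complex_hom_module R K L n\<^esub> \<in> carrier (complex_hom_module R K L n)"
      by (auto intro!: mod_homI)
  next
    fix F assume "F \<in> carrier (complex_hom_module R K L n)"
    then show "\<zero>\<^bsub>complex_hom_module R K L n\<^esub> \<oplus>\<^bsub>complex_hom_module R K L n\<^esub> F = F"
      using F by (auto simp: fun_eq_iff extensional_def)
  next
    fix F assume F': "F \<in> carrier (complex_hom_module R K L n)"
    show "\<exists>G \<in> carrier (complex_hom_module R K L n).
        G \<oplus>\<^bsub>complex_hom_module R K L n\<^esub> F = \<zero>\<^bsub>complex_hom_module R K L n\<^esub>"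
      using inv[OF F'] neg[OF F'] by blast
  qed
  then show ?thesis
    using abelian_group.minus_equality[OF _ inv[OF assms(3)] assms(3) neg[OF assms(3)]] by simp
qed

locale dg_bimodule_data =
  A: dg_category R A + B: dg_category R B
  for R :: "'r ring" and A :: "('a, 'r, 'm) dgcat" and B :: "('b, 'r, 'n) dgcat" +
  fixes M :: "('a, 'b, 'r, 'm, 'n, 'x) bimodule_data"
  assumes bimodule: "dg_bimodule R A B M"
begin

sublocale bifun: dg_bifunctor R "opposite A" B "dg_complexes R" M
  using bimodule by (simp add: dg_bimodule_def)

lemma opposite_simps [simp]:
  "dg_ob (opposite A) = dg_ob A"
  "dg_hom (opposite A) X X' = dg_hom A X' X"
  "dg_id (opposite A) = dg_id A"
  "dg_comp (opposite A) X Y Z q p g f =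
    signed (grade (dg_hom A Z X) (q + p)) (q * p) (dg_comp A Z Y X p q f g)"
  by (simp_all add: opposite_def)

lemma dg_complexes_simps [simp]:
  "dg_ob (dg_complexes R) = {K. cochain_complex R K}"
  "grade (dg_hom (dg_complexes R) K L) = complex_hom_module R K L"
  "cdiff (dg_hom (dg_complexes R) K L) n f = (\<lambda>i. \<lambda>x \<in> carrier (grade K i).
       cdiff L (i + n) (f i x) \<ominus>\<^bsub>grade L (i + n + 1)\<^esub>
       signed (grade L (i + n + 1)) n (f (i + 1) (cdiff K i x)))"
  "dg_comp (dg_complexes R) K L N q p g f = (\<lambda>i. \<lambda>x \<in> carrier (grade K i). g (i + p) (f i x))"
  "dg_id (dg_complexes R) K = (\<lambda>i. \<lambda>x \<in> carrier (grade K i). x)"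
  by (simp_all add: dg_complexes_def complex_hom_def)

lemma M_cochain_complex: "\<lbrakk>X \<in> dg_ob A; Y \<in> dg_ob B\<rbrakk> \<Longrightarrow> cochain_complex R (bf_ob M X Y)"
  using bifun.bf_ob_closed by simp

lemma M_complex: "\<lbrakk>X \<in> dg_ob A; Y \<in> dg_ob B\<rbrakk> \<Longrightarrow> complex_of_modules R (bf_ob M X Y)"
  by (simp add: complex_of_modules_def M_cochain_complex)

lemmas M_module = complex_of_modules.grade_module[OF M_complex]
lemmas M_abelian_group = module_abelian_group[OF M_module]
lemmas M_group_closed = abelian_group.group_closed[OF M_abelian_group]
lemmas M_group_simps = abelian_group.group_simps[OF M_abelian_group]
lemmas M_diff_mod_hom = complex_of_modules.diff_hom[OF M_complex]
lemmas M_diff_linear = mod_hom_add[OF M_diff_mod_hom]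
  mod_hom_diff[OF M_module M_module M_diff_mod_hom] mod_hom_neg[OF M_module M_module M_diff_mod_hom]
  mod_hom_zero[OF M_module M_module M_diff_mod_hom] mod_hom_smult[OF M_diff_mod_hom]

lemma M_diff_closed:
  "\<lbrakk>X \<in> dg_ob A; Y \<in> dg_ob B; c \<in> carrier (grade (bf_ob M X Y) n); s = n + 1\<rbrakk> \<Longrightarrow>
    cdiff (bf_ob M X Y) n c \<in> carrier (grade (bf_ob M X Y) s)"
  using mod_hom_closed[OF M_diff_mod_hom] by blast

lemma M_diff_diff:
  "\<lbrakk>X \<in> dg_ob A; Y \<in> dg_ob B; c \<in> carrier (grade (bf_ob M X Y) n); s = n + 1\<rbrakk> \<Longrightarrow>
    cdiff (bf_ob M X Y) s (cdiff (bf_ob M X Y) n c) = \<zero>\<^bsub>grade (bf_ob M X Y) (n + 2)\<^esub>"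
  using complex_of_modules.diff_diff[OF M_complex] by simp

context
  fixes X X' Y Y'
  assumes ob: "X \<in> dg_ob A" "X' \<in> dg_ob A" "Y \<in> dg_ob B" "Y' \<in> dg_ob B"
begin

lemma bf_mor_closed:
  assumes "f \<in> dg_mor A X' X p" "g \<in> dg_mor B Y Y' q"
  shows "bf_mor M X X' Y Y' p q f g \<in> carrier (complex_hom_module R (bf_ob M X Y) (bf_ob M X' Y') (p + q))"
  using mod_hom_closed[OF bilinear_mapD(1)[OF bifun.bf_mor_bilinear]] assms ob
  by (simp del: complex_hom_module_simps)

lemma bf_mor_mod_hom:
  assumes "f \<in> dg_mor A X' X p" "g \<in> dg_mor B Y Y' q" "s = n + (p + q)"
  shows "bf_mor M X X' Y Y' p q f g n \<in> mod_hom R (grade (bf_ob M X Y) n) (grade (bf_ob M X' Y') s)"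
  using bf_mor_closed[OF assms(1,2)] assms(3) by simp

lemma bf_mor_mod_hom_first:
  assumes g: "g \<in> dg_mor B Y Y' q" and c: "c \<in> carrier (grade (bf_ob M X Y) n)" and s: "s = n + (p + q)"
  shows "(\<lambda>f. bf_mor M X X' Y Y' p q f g n c) \<in> mod_hom R (grade (dg_hom A X' X) p) (grade (bf_ob M X' Y') s)"
proof -
  have "(\<lambda>f. bf_mor M X X' Y Y' p q f g) \<in> mod_hom R (grade (dg_hom A X' X) p)
      (complex_hom_module R (bf_ob M X Y) (bf_ob M X' Y') (p + q))"
    using bilinear_mapD(2)[OF bifun.bf_mor_bilinear, of X X' Y Y' g q p] ob g by simp
  note L = mod_hom_add[OF this] mod_hom_smult[OF this]
  show ?thesis unfolding s
    using c by (intro mod_homI) (simp_all add: L mod_hom_closed[OF bf_mor_mod_hom] g)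
qed

lemma bf_mor_mod_hom_second:
  assumes f: "f \<in> dg_mor A X' X p" and c: "c \<in> carrier (grade (bf_ob M X Y) n)" and s: "s = n + (p + q)"
  shows "(\<lambda>g. bf_mor M X X' Y Y' p q f g n c) \<in> mod_hom R (grade (dg_hom B Y Y') q) (grade (bf_ob M X' Y') s)"
proof -
  have "bf_mor M X X' Y Y' p q f \<in> mod_hom R (grade (dg_hom B Y Y') q)
      (complex_hom_module R (bf_ob M X Y) (bf_ob M X' Y') (p + q))"
    using bilinear_mapD(1)[OF bifun.bf_mor_bilinear, of X X' Y Y' f p q] ob f by simp
  note L = mod_hom_add[OF this] mod_hom_smult[OF this]
  show ?thesis unfolding s
    using c by (intro mod_homI) (simp_all add: L mod_hom_closed[OF bf_mor_mod_hom] f)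
qed

text \<open>The left side is the differential \<open>d F - (-1)^(p+q) F d\<close> of the Hom complex
  in \<open>C(R)\<close>, evaluated at \<open>c\<close>; the right side is the image of the
  differential of the tensor product.\<close>

lemma bf_mor_diff_apply:
  assumes f: "f \<in> dg_mor A X' X p" and g: "g \<in> dg_mor B Y Y' q"
    and c: "c \<in> carrier (grade (bf_ob M X Y) n)"
  shows "cdiff (bf_ob M X' Y') (n + (p + q)) (bf_mor M X X' Y Y' p q f g n c)
      \<ominus>\<^bsub>grade (bf_ob M X' Y') (n + (p + q) + 1)\<^esub>
      signed (grade (bf_ob M X' Y') (n + (p + q) + 1)) (p + q)
        (bf_mor M X X' Y Y' p q f g (n + 1) (cdiff (bf_ob M X Y) n c)) =
    bf_mor M X X' Y Y' (p + 1) q (cdiff (dg_hom A X' X) p f) g n c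
      \<oplus>\<^bsub>grade (bf_ob M X' Y') (n + (p + q) + 1)\<^esub>
      signed (grade (bf_ob M X' Y') (n + (p + q) + 1)) p
        (bf_mor M X X' Y Y' p (q + 1) f (cdiff (dg_hom B Y Y') q g) n c)"
proof -
  let ?N = "complex_hom_module R (bf_ob M X Y) (bf_ob M X' Y') (p + q + 1)"
  have F: "bf_mor M X X' Y Y' p (q + 1) f (cdiff (dg_hom B Y Y') q g) \<in> carrier ?N"
    using bf_mor_closed[OF f B.diff_closed[OF ob(3,4) g]] by (simp add: algebra_simps del: complex_hom_module_simps)
  have sg: "signed ?N p (bf_mor M X X' Y Y' p (q + 1) f (cdiff (dg_hom B Y Y') q g)) n c =
      signed (grade (bf_ob M X' Y') (n + (p + q) + 1)) p
        (bf_mor M X X' Y Y' p (q + 1) f (cdiff (dg_hom B Y Y') q g) n c)"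
    using complex_hom_neg[OF M_cochain_complex M_cochain_complex F] ob c
    by (simp add: signed_def add.assoc del: complex_hom_module_simps)
  show ?thesis
    using fun_cong[OF fun_cong[OF bifun.bf_mor_diff[of X X' Y Y' f p g q]], of n c] ob f g c sg
    by (simp add: add.assoc)
qed

end

text \<open>The exponent collects two Koszul signs: \<open>q' * p\<close> from interchanging
  \<open>g'\<close> with \<open>f\<close> in the tensor product, and \<open>p' * p\<close> from
  reversing composition in the opposite category.\<close>

lemma bf_mor_comp_apply:
  assumes ob: "X \<in> dg_ob A" "X' \<in> dg_ob A" "X'' \<in> dg_ob A" "Y \<in> dg_ob B" "Y' \<in> dg_ob B" "Y'' \<in> dg_ob B"
    and f: "f \<in> dg_mor A X' X p" "f' \<in> dg_mor A X'' X' p'"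
    and g: "g \<in> dg_mor B Y Y' q" "g' \<in> dg_mor B Y' Y'' q'"
    and c: "c \<in> carrier (grade (bf_ob M X Y) n)" and s: "s = n + (p + q)" and t: "t = s + (p' + q')"
  shows "bf_mor M X' X'' Y' Y'' p' q' f' g' s (bf_mor M X X' Y Y' p q f g n c) =
    signed (grade (bf_ob M X'' Y'') t) (q' * p + p' * p)
      (bf_mor M X X'' Y Y'' (p' + p) (q' + q) (dg_comp A X'' X' X p p' f f')
        (dg_comp B Y Y' Y'' q' q g' g) n c)"
proof -
  define h where "h = dg_comp A X'' X' X p p' f f'"
  define k where "k = dg_comp B Y Y' Y'' q' q g' g"
  let ?hs = "signed (grade (dg_hom A X'' X) (p' + p)) (p' * p) h"
  let ?N = "complex_hom_module R (bf_ob M X Y) (bf_ob M X'' Y'') (p' + q' + p + q)"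
  have h: "h \<in> dg_mor A X'' X (p' + p)" and k: "k \<in> dg_mor B Y Y'' (q' + q)"
    unfolding h_def k_def using ob f g by (auto intro!: A.comp_closed B.comp_closed)
  have hs: "?hs \<in> dg_mor A X'' X (p' + p)"
    using h ob by (intro signed_closed[OF A.hom_module])
  have idx: "p' + q' + p + q = (p' + p) + (q' + q)" "t = n + ((p' + p) + (q' + q))"
    using s t by simp_all
  have F: "bf_mor M X X'' Y Y'' (p' + p) (q' + q) ?hs k \<in> carrier ?N"
    unfolding idx using ob bf_mor_closed[of X X'' Y Y'', OF _ _ _ _ hs k] by blast
  have "bf_mor M X' X'' Y' Y'' p' q' f' g' s (bf_mor M X X' Y Y' p q f g n c) =
      signed ?N (q' * p) (bf_mor M X X'' Y Y'' (p' + p) (q' + q) ?hs k) n c"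
    using fun_cong[OF fun_cong[OF bifun.bf_mor_comp[of X X' X'' Y Y' Y'' f p f' p' g q g' q']], of n c] ob f g c s
    by (simp add: h_def k_def)
  also have "\<dots> = signed (grade (bf_ob M X'' Y'') t) (q' * p) (bf_mor M X X'' Y Y'' (p' + p) (q' + q) ?hs k n c)"
  proof -
    have "n + (p' + q' + p + q) = t" using s t by simp
    then have "(\<ominus>\<^bsub>?N\<^esub> bf_mor M X X'' Y Y'' (p' + p) (q' + q) ?hs k) n c =
        \<ominus>\<^bsub>grade (bf_ob M X'' Y'') t\<^esub> bf_mor M X X'' Y Y'' (p' + p) (q' + q) ?hs k n c"
      using complex_hom_neg[OF M_cochain_complex M_cochain_complex F] ob c by simp
    then show ?thesis by (cases "even (q' * p)") (simp_all only: signed_simps not_False_eq_True)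
  qed
  also have "bf_mor M X X'' Y Y'' (p' + p) (q' + q) ?hs k n c =
      signed (grade (bf_ob M X'' Y'') t) (p' * p) (bf_mor M X X'' Y Y'' (p' + p) (q' + q) h k n c)"
    using mod_hom_neg[OF A.hom_module M_module bf_mor_mod_hom_first[of X X'' Y Y'' k "q' + q" c n t "p' + p"], of h] ob h k c idx
    by (simp add: signed_def)
  also have "bf_mor M X X'' Y Y'' (p' + p) (q' + q) h k n c \<in> carrier (grade (bf_ob M X'' Y'') t)"
    using mod_hom_closed[OF bf_mor_mod_hom[of X X'' Y Y'' h "p' + p" k "q' + q" t n]] ob h k c idx by simp
  then have "signed (grade (bf_ob M X'' Y'') t) (q' * p)
      (signed (grade (bf_ob M X'' Y'') t) (p' * p) (bf_mor M X X'' Y Y'' (p' + p) (q' + q) h k n c)) =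
    signed (grade (bf_ob M X'' Y'') t) (q' * p + p' * p) (bf_mor M X X'' Y Y'' (p' + p) (q' + q) h k n c)"
    using ob by (simp add: signed_def M_group_closed abelian_group.minus_minus[OF M_abelian_group])
  finally show ?thesis by (simp add: h_def k_def)
qed

end

lemma signed_zero: "module R M \<Longrightarrow> signed M n \<zero>\<^bsub>M\<^esub> = \<zero>\<^bsub>M\<^esub>"
proof -
  assume "module R M"
  then interpret M: module R M .
  show ?thesis by (simp add: signed_def)
qed

section \<open>The left action of \<open>B\<close> and the right action of \<open>A\<close> on
  \<open>M\<close>\<close>

context dg_bimodule_data
begin

lemma A_id: "X \<in> dg_ob A \<Longrightarrow> dg_id A X \<in> dg_mor A X X 0"
  using A.id_closed by (auto simp: cocycles_def)

lemma B_id: "Y \<in> dg_ob B \<Longrightarrow> dg_id B Y \<in> dg_mor B Y Y 0"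
  using B.id_closed by (auto simp: cocycles_def)

lemma left_mod_hom:
  assumes "X \<in> dg_ob A" "Y \<in> dg_ob B" "Y' \<in> dg_ob B" "b \<in> dg_mor B Y Y' q" "s = q + n"
  shows "left_act A M X Y Y' q n b \<in> mod_hom R (grade (bf_ob M X Y) n) (grade (bf_ob M X Y') s)"
  unfolding left_act_def using assms by (intro bf_mor_mod_hom) (auto intro: A_id)

lemma left_mod_hom_scalar:
  assumes "X \<in> dg_ob A" "Y \<in> dg_ob B" "Y' \<in> dg_ob B" "c \<in> carrier (grade (bf_ob M X Y) n)" "s = q + n"
  shows "(\<lambda>b. left_act A M X Y Y' q n b c) \<in> mod_hom R (grade (dg_hom B Y Y') q) (grade (bf_ob M X Y') s)"
  unfolding left_act_def using assms by (intro bf_mor_mod_hom_second) (auto intro: A_id)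

lemma right_mod_hom:
  assumes "X \<in> dg_ob A" "X' \<in> dg_ob A" "Y \<in> dg_ob B" "a \<in> dg_mor A X X' p" "s = n + p"
  shows "(\<lambda>c. right_act B M X X' Y n p c a) \<in> mod_hom R (grade (bf_ob M X' Y) n) (grade (bf_ob M X Y) s)"
  unfolding right_act_def assms(5) using assms
  by (intro signed_mod_hom[OF M_module] bf_mor_mod_hom) (auto intro: B_id)

lemma right_mod_hom_scalar:
  assumes "X \<in> dg_ob A" "X' \<in> dg_ob A" "Y \<in> dg_ob B" "c \<in> carrier (grade (bf_ob M X' Y) n)" "s = n + p"
  shows "right_act B M X X' Y n p c \<in> mod_hom R (grade (dg_hom A X X') p) (grade (bf_ob M X Y) s)"
  unfolding right_act_def assms(5) using assms
  by (intro signed_mod_hom[OF M_module] bf_mor_mod_hom_first) (auto intro: B_id)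

lemma left_closed:
  "\<lbrakk>X \<in> dg_ob A; Y \<in> dg_ob B; Y' \<in> dg_ob B; b \<in> dg_mor B Y Y' q;
    c \<in> carrier (grade (bf_ob M X Y) n); s = q + n\<rbrakk> \<Longrightarrow>
    left_act A M X Y Y' q n b c \<in> carrier (grade (bf_ob M X Y') s)"
  using mod_hom_closed[OF left_mod_hom] by blast

lemma right_closed:
  "\<lbrakk>X \<in> dg_ob A; X' \<in> dg_ob A; Y \<in> dg_ob B; c \<in> carrier (grade (bf_ob M X' Y) n);
    a \<in> dg_mor A X X' p; s = n + p\<rbrakk> \<Longrightarrow>
    right_act B M X X' Y n p c a \<in> carrier (grade (bf_ob M X Y) s)"
  using mod_hom_closed[OF right_mod_hom] by blast

lemmas left_linear = mod_hom_add[OF left_mod_hom[OF _ _ _ _ refl]]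
  mod_hom_diff[OF M_module M_module left_mod_hom[OF _ _ _ _ refl]]
  mod_hom_neg[OF M_module M_module left_mod_hom[OF _ _ _ _ refl]]
  mod_hom_zero[OF M_module M_module left_mod_hom[OF _ _ _ _ refl]]
  mod_hom_smult[OF left_mod_hom[OF _ _ _ _ refl]]
  mod_hom_add[OF left_mod_hom_scalar[OF _ _ _ _ refl]]
  mod_hom_diff[OF B.hom_module M_module left_mod_hom_scalar[OF _ _ _ _ refl]]
  mod_hom_neg[OF B.hom_module M_module left_mod_hom_scalar[OF _ _ _ _ refl]]
  mod_hom_zero[OF B.hom_module M_module left_mod_hom_scalar[OF _ _ _ _ refl]]
  mod_hom_smult[OF left_mod_hom_scalar[OF _ _ _ _ refl]]

lemmas right_linear = mod_hom_add[OF right_mod_hom[OF _ _ _ _ refl]]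
  mod_hom_diff[OF M_module M_module right_mod_hom[OF _ _ _ _ refl]]
  mod_hom_neg[OF M_module M_module right_mod_hom[OF _ _ _ _ refl]]
  mod_hom_zero[OF M_module M_module right_mod_hom[OF _ _ _ _ refl]]
  mod_hom_smult[OF right_mod_hom[OF _ _ _ _ refl]]
  mod_hom_add[OF right_mod_hom_scalar[OF _ _ _ _ refl]]
  mod_hom_diff[OF A.hom_module M_module right_mod_hom_scalar[OF _ _ _ _ refl]]
  mod_hom_neg[OF A.hom_module M_module right_mod_hom_scalar[OF _ _ _ _ refl]]
  mod_hom_zero[OF A.hom_module M_module right_mod_hom_scalar[OF _ _ _ _ refl]]
  mod_hom_smult[OF right_mod_hom_scalar[OF _ _ _ _ refl]]

lemma id_act:
  assumes "X \<in> dg_ob A" "Y \<in> dg_ob B" "c \<in> carrier (grade (bf_ob M X Y) n)"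
  shows "left_act A M X Y Y 0 n (dg_id B Y) c = c" and "right_act B M X X Y n 0 c (dg_id A X) = c"
  using assms bifun.bf_mor_id[of X Y] by (simp_all add: left_act_def right_act_def signed_def)

lemma left_left:
  assumes "X \<in> dg_ob A" "Y \<in> dg_ob B" "Y' \<in> dg_ob B" "Y'' \<in> dg_ob B"
    "b \<in> dg_mor B Y Y' q" "b' \<in> dg_mor B Y' Y'' q'" "c \<in> carrier (grade (bf_ob M X Y) n)" "s = q + n" "t = q' + q"
  shows "left_act A M X Y Y'' t n (dg_comp B Y Y' Y'' q' q b' b) c =
    left_act A M X Y' Y'' q' s b' (left_act A M X Y Y' q n b c)"
  using bf_mor_comp_apply[of X X X Y Y' Y'' "dg_id A X" 0 "dg_id A X" 0 b q b' q' c n s "s + q'"] assms A_id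
  by (simp add: left_act_def A.comp_id_left signed_def)

lemma right_right:
  assumes ob: "X \<in> dg_ob A" "X' \<in> dg_ob A" "X'' \<in> dg_ob A" "Y \<in> dg_ob B"
    and a: "a \<in> dg_mor A X X' p" "a' \<in> dg_mor A X' X'' p'"
    and c: "c \<in> carrier (grade (bf_ob M X'' Y) n)" and s: "s = n + p'" and t: "t = p' + p"
  shows "right_act B M X X' Y s p (right_act B M X' X'' Y n p' c a') a =
    right_act B M X X'' Y n t c (dg_comp A X X' X'' p' p a' a)"
proof -
  let ?N = "grade (bf_ob M X Y) (n + p' + p)"
  define F where "F = bf_mor M X' X Y Y p 0 a (dg_id B Y) s"
  define x where "x = bf_mor M X'' X' Y Y p' 0 a' (dg_id B Y) n c"
  have F: "F \<in> mod_hom R (grade (bf_ob M X' Y) s) ?N"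
    unfolding F_def using ob a s by (intro bf_mor_mod_hom) (auto intro: B_id)
  have x: "x \<in> carrier (grade (bf_ob M X' Y) s)"
    unfolding x_def using ob a c s by (intro mod_hom_closed[OF bf_mor_mod_hom]) (auto intro: B_id)
  have Fx: "F x = signed ?N (p * p') (bf_mor M X'' X Y Y t 0 (dg_comp A X X' X'' p' p a' a) (dg_id B Y) n c)"
    unfolding F_def x_def
    using bf_mor_comp_apply[of X'' X' X Y Y Y a' p' a p "dg_id B Y" 0 "dg_id B Y" 0 c n s "n + p' + p"] ob a c s t B_id
    by (simp add: B.comp_id_left add.commute)
  have y: "bf_mor M X'' X Y Y t 0 (dg_comp A X X' X'' p' p a' a) (dg_id B Y) n c \<in> carrier ?N"
    using ob a c t by (intro mod_hom_closed[OF bf_mor_mod_hom]) (auto intro: B_id A.comp_closed)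
  have "right_act B M X X' Y s p (right_act B M X' X'' Y n p' c a') a =
      signed ?N (s * p) (F (signed (grade (bf_ob M X' Y) s) (n * p') x))"
    by (simp add: right_act_def F_def x_def s)
  also have "\<dots> = signed ?N (s * p + (n * p' + p * p'))
      (bf_mor M X'' X Y Y t 0 (dg_comp A X X' X'' p' p a' a) (dg_id B Y) n c)"
    using ob x y mod_hom_closed[OF F x]
    by (simp add: mod_hom_signed[OF M_module M_module F] Fx signed_signed[OF M_module] signed_closed[OF M_module])
  \<comment> \<open>With \<open>s = n + p'\<close> and \<open>t = p' + p\<close> the two exponents
    differ by \<open>2 p p'\<close>.\<close>
  also have "\<dots> = signed ?N (n * t) (bf_mor M X'' X Y Y t 0 (dg_comp A X X' X'' p' p a' a) (dg_id B Y) n c)"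
    by (rule signed_cong) (auto simp: s t algebra_simps)
  finally show ?thesis by (simp add: right_act_def t add.assoc)
qed

text \<open>Both sides are compared with the joint action \<open>z\<close> of \<open>a\<close> and
  \<open>b\<close> on \<open>c\<close>. Acting by \<open>a\<close> first costs the Koszul sign
  \<open>(-1)^(np)\<close> and the interchange sign \<open>(-1)^(qp)\<close>; acting by
  \<open>b\<close> first raises the degree to \<open>q + n\<close>, and the Koszul sign alone is
  \<open>(-1)^((q+n)p)\<close>.\<close>

lemma right_left:
  assumes ob: "X \<in> dg_ob A" "X' \<in> dg_ob A" "Y \<in> dg_ob B" "Y' \<in> dg_ob B"
    and a: "a \<in> dg_mor A X X' p" and b: "b \<in> dg_mor B Y Y' q"
    and c: "c \<in> carrier (grade (bf_ob M X' Y) n)" and s: "s = q + n" and t: "t = n + p"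
  shows "right_act B M X X' Y' s p (left_act A M X' Y Y' q n b c) a =
    left_act A M X Y Y' q t b (right_act B M X X' Y n p c a)"
proof -
  let ?N = "grade (bf_ob M X Y') (q + n + p)"
  define x where "x = bf_mor M X' X Y Y p 0 a (dg_id B Y) n c"
  define z where "z = bf_mor M X' X Y Y' p q a b n c"
  have L: "left_act A M X Y Y' q t b \<in> mod_hom R (grade (bf_ob M X Y) t) ?N"
    using ob b t by (intro left_mod_hom) auto
  have x: "x \<in> carrier (grade (bf_ob M X Y) t)"
    unfolding x_def using ob a c t by (intro mod_hom_closed[OF bf_mor_mod_hom]) (auto intro: B_id)
  have z: "z \<in> carrier ?N"
    unfolding z_def using ob a b c by (intro mod_hom_closed[OF bf_mor_mod_hom]) auto
  have 1: "left_act A M X Y Y' q t b x = signed ?N (q * p) z"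
    unfolding x_def z_def left_act_def
    using bf_mor_comp_apply[of X' X X Y Y Y' a p "dg_id A X" 0 "dg_id B Y" 0 b q c n t "q + n + p"] ob a b c t A_id B_id
    by (simp add: A.comp_id_right B.comp_id_right)
  have 2: "right_act B M X X' Y' s p (left_act A M X' Y Y' q n b c) a = signed ?N (s * p) z"
    unfolding z_def left_act_def right_act_def
    using bf_mor_comp_apply[of X' X' X Y Y' Y' "dg_id A X'" 0 a p b q "dg_id B Y'" 0 c n s "q + n + p"] ob a b c s A_id B_id
    by (simp add: A.comp_id_left B.comp_id_left signed_def)
  have "left_act A M X Y Y' q t b (right_act B M X X' Y n p c a) = signed ?N (n * p + q * p) z"
    using ob x z by (simp add: right_act_def x_def[symmetric] t[symmetric] mod_hom_signed[OF M_module M_module L]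
        1 signed_signed[OF M_module])
  also have "\<dots> = signed ?N (s * p) z" by (rule signed_cong) (auto simp: s)
  finally show ?thesis by (simp add: 2)
qed

text \<open>The dg-functor equation is used for \<open>id\<close> and \<open>b\<close>. Since
  \<open>d(id) = 0\<close>, one summand on its right vanishes, and the sign \<open>(-1)^q\<close> is
  the one in the differential of the Hom complex.\<close>

lemma diff_left:
  assumes ob: "X \<in> dg_ob A" "Y \<in> dg_ob B" "Y' \<in> dg_ob B"
    and b: "b \<in> dg_mor B Y Y' q" and c: "c \<in> carrier (grade (bf_ob M X Y) n)" and s: "s = q + n"
  shows "cdiff (bf_ob M X Y') s (left_act A M X Y Y' q n b c) =
    left_act A M X Y Y' (q + 1) n (cdiff (dg_hom B Y Y') q b) c \<oplus>\<^bsub>grade (bf_ob M X Y') (s + 1)\<^esub>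
    signed (grade (bf_ob M X Y') (s + 1)) q (left_act A M X Y Y' q (n + 1) b (cdiff (bf_ob M X Y) n c))"
proof -
  have 0: "bf_mor M X X Y Y' 1 q \<zero>\<^bsub>grade (dg_hom A X X) 1\<^esub> b n c = \<zero>\<^bsub>grade (bf_ob M X Y') (s + 1)\<^esub>"
    using mod_hom_zero[OF A.hom_module M_module bf_mor_mod_hom_first[of X X Y Y' b q c n "s + 1" 1]] ob b c s by simp
  have d: "left_act A M X Y Y' q n b c \<in> carrier (grade (bf_ob M X Y') s)"
    "left_act A M X Y Y' (q + 1) n (cdiff (dg_hom B Y Y') q b) c \<in> carrier (grade (bf_ob M X Y') (s + 1))"
    "left_act A M X Y Y' q (n + 1) b (cdiff (bf_ob M X Y) n c) \<in> carrier (grade (bf_ob M X Y') (s + 1))"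
    using ob b c s by (auto intro!: left_closed B.diff_closed M_diff_closed)
  note d' = M_diff_closed[OF ob(1) ob(3) d(1) refl] signed_closed[OF M_module[OF ob(1) ob(3)] d(3), of q]
  have eq: "cdiff (bf_ob M X Y') s (left_act A M X Y Y' q n b c) \<ominus>\<^bsub>grade (bf_ob M X Y') (s + 1)\<^esub>
      signed (grade (bf_ob M X Y') (s + 1)) q (left_act A M X Y Y' q (n + 1) b (cdiff (bf_ob M X Y) n c)) =
      left_act A M X Y Y' (q + 1) n (cdiff (dg_hom B Y Y') q b) c"
    using bf_mor_diff_apply[of X X Y Y' "dg_id A X" 0 b q c n] ob b c A_id A.id_closed[of X] 0 d s
    by (simp add: left_act_def cocycles_def signed_simps(1) M_group_simps(8) add.commute)
  then show ?thesis using d d' ob by (simp add: M_group_simps)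
qed

text \<open>Acting by \<open>a\<close> with \<open>id\<close> on \<open>B\<close>, the Hom complex
  puts \<open>(-1)^p\<close> in front of the term with \<open>dc\<close>. Multiplication by the
  Koszul sign \<open>(-1)^(np)\<close> turns this into \<open>(-1)^((n+1)p)\<close>, the Koszul sign
  of \<open>dc\<close> acted on by \<open>a\<close>, and leaves
  \<open>(-1)^(np) = (-1)^n (-1)^(n(p+1))\<close> at the term with \<open>da\<close>.\<close>

lemma diff_right:
  assumes ob: "X \<in> dg_ob A" "X' \<in> dg_ob A" "Y \<in> dg_ob B"
    and a: "a \<in> dg_mor A X X' p" and c: "c \<in> carrier (grade (bf_ob M X' Y) n)" and s: "s = n + p"
  shows "cdiff (bf_ob M X Y) s (right_act B M X X' Y n p c a) =
    right_act B M X X' Y (n + 1) p (cdiff (bf_ob M X' Y) n c) a \<oplus>\<^bsub>grade (bf_ob M X Y) (s + 1)\<^esub>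
    signed (grade (bf_ob M X Y) (s + 1)) n (right_act B M X X' Y n (p + 1) c (cdiff (dg_hom A X X') p a))"
proof -
  let ?N = "grade (bf_ob M X Y) (s + 1)"
  define x where "x = bf_mor M X' X Y Y p 0 a (dg_id B Y) n c"
  define y where "y = bf_mor M X' X Y Y p 0 a (dg_id B Y) (n + 1) (cdiff (bf_ob M X' Y) n c)"
  define z where "z = bf_mor M X' X Y Y (p + 1) 0 (cdiff (dg_hom A X X') p a) (dg_id B Y) n c"
  have 0: "bf_mor M X' X Y Y p 1 a \<zero>\<^bsub>grade (dg_hom B Y Y) 1\<^esub> n c = \<zero>\<^bsub>?N\<^esub>"
    using mod_hom_zero[OF B.hom_module M_module bf_mor_mod_hom_second[of X' X Y Y a p c n "s + 1" 1]] ob a c s by simp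
  have x: "x \<in> carrier (grade (bf_ob M X Y) s)" and yz [simp]: "y \<in> carrier ?N" "z \<in> carrier ?N"
    unfolding x_def y_def z_def using ob a c s
    by (auto intro!: mod_hom_closed[OF bf_mor_mod_hom] B_id A.diff_closed M_diff_closed)
  have dx: "cdiff (bf_ob M X Y) s x \<in> carrier ?N" using ob x by (auto intro: M_diff_closed)
  have "cdiff (bf_ob M X Y) s x \<ominus>\<^bsub>?N\<^esub> signed ?N p y = z"
    using bf_mor_diff_apply[of X' X Y Y a p "dg_id B Y" 0 c n] ob a c s B_id B.id_closed[of Y] 0 yz
    by (simp add: cocycles_def x_def y_def z_def M_group_simps(9) signed_zero[OF M_module])
  then have dx_eq: "cdiff (bf_ob M X Y) s x = z \<oplus>\<^bsub>?N\<^esub> signed ?N p y"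
    using dx ob by (simp add: M_group_simps signed_closed[OF M_module])
  have "cdiff (bf_ob M X Y) s (right_act B M X X' Y n p c a) = signed ?N (n * p) (cdiff (bf_ob M X Y) s x)"
    using ob x mod_hom_signed[OF M_module M_module M_diff_mod_hom, where x = x and n = "n * p"]
    by (simp add: right_act_def x_def s)
  also have "\<dots> = signed ?N (n * p) z \<oplus>\<^bsub>?N\<^esub> signed ?N (n * p + p) y"
    using ob unfolding dx_eq signed_def
    by (auto simp: abelian_group.minus_add[OF M_abelian_group] abelian_group.minus_minus[OF M_abelian_group] M_group_closed)
  also have "signed ?N (n * p + p) y = right_act B M X X' Y (n + 1) p (cdiff (bf_ob M X' Y) n c) a"
    by (simp add: right_act_def y_def s algebra_simps)
  also have "signed ?N (n * p) z = signed ?N n (right_act B M X X' Y n (p + 1) c (cdiff (dg_hom A X X') p a))"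
  proof -
    have "signed ?N n (signed ?N (n * (p + 1)) z) = signed ?N (n + n * (p + 1)) z"
      using ob yz(2) by (intro signed_signed[OF M_module])
    also have "\<dots> = signed ?N (n * p) z" by (rule signed_cong) auto
    finally show ?thesis by (simp add: right_act_def z_def[symmetric] s add.assoc[symmetric])
  qed
  finally show ?thesis
    using ob a c s by (simp add: M_group_simps(6) signed_closed[OF M_module] right_closed A.diff_closed M_diff_closed)
qed

end

section \<open>Cocycles and coboundaries under the two actions, and the bimodule
  \<open>H^0(M)\<close>\<close>

context dg_bimodule_data
begin

lemma left_cocycle:
  assumes "X \<in> dg_ob A" "Y \<in> dg_ob B" "Y' \<in> dg_ob B"
    and "b \<in> cocycles (dg_hom B Y Y') 0" "c \<in> cocycles (bf_ob M X Y) 0"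
  shows "left_act A M X Y Y' 0 0 b c \<in> cocycles (bf_ob M X Y') 0"
  using assms diff_left[of X Y Y' b 0 c 0 0]
  by (auto simp: cocycles_def left_closed signed_simps(1) M_group_simps(2,8) left_linear right_linear)

lemma left_coboundary:
  assumes "X \<in> dg_ob A" "Y \<in> dg_ob B" "Y' \<in> dg_ob B"
    and "b \<in> coboundaries (dg_hom B Y Y') 0" "c \<in> cocycles (bf_ob M X Y) 0"
  shows "left_act A M X Y Y' 0 0 b c \<in> coboundaries (bf_ob M X Y') 0"
proof -
  obtain w where w: "w \<in> dg_mor B Y Y' (-1)" "b = cdiff (dg_hom B Y Y') (-1) w"
    using assms by (auto simp: coboundaries_def)
  have "cdiff (bf_ob M X Y') (-1) (left_act A M X Y Y' (-1) 0 w c) = left_act A M X Y Y' 0 0 b c"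
    using assms w diff_left[of X Y Y' w "-1" c 0 "-1"]
    by (simp add: cocycles_def left_closed B.diff_closed signed_zero[OF M_module] M_group_simps(9) left_linear right_linear)
  then show ?thesis using assms w
    unfolding coboundaries_def by (auto simp: cocycles_def left_closed intro!: image_eqI[where x = "left_act A M X Y Y' (-1) 0 w c"])
qed

lemma left_coboundary':
  assumes "X \<in> dg_ob A" "Y \<in> dg_ob B" "Y' \<in> dg_ob B"
    and "b \<in> cocycles (dg_hom B Y Y') 0" "c \<in> coboundaries (bf_ob M X Y) 0"
  shows "left_act A M X Y Y' 0 0 b c \<in> coboundaries (bf_ob M X Y') 0"
proof -
  obtain w where w: "w \<in> carrier (grade (bf_ob M X Y) (-1))" "c = cdiff (bf_ob M X Y) (-1) w"
    using assms by (auto simp: coboundaries_def)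
  have "cdiff (bf_ob M X Y') (-1) (left_act A M X Y Y' 0 (-1) b w) = left_act A M X Y Y' 0 0 b c"
    using assms w diff_left[of X Y Y' b 0 w "-1" "-1"]
    by (simp add: cocycles_def left_closed M_diff_closed signed_simps(1) M_group_simps(8) left_linear right_linear)
  then show ?thesis using assms w
    unfolding coboundaries_def by (auto simp: cocycles_def left_closed intro!: image_eqI[where x = "left_act A M X Y Y' 0 (-1) b w"])
qed

lemma right_cocycle:
  assumes "X \<in> dg_ob A" "X' \<in> dg_ob A" "Y \<in> dg_ob B"
    and "c \<in> cocycles (bf_ob M X' Y) 0" "a \<in> cocycles (dg_hom A X X') 0"
  shows "right_act B M X X' Y 0 0 c a \<in> cocycles (bf_ob M X Y) 0"
  using assms diff_right[of X X' Y a 0 c 0 0]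
  by (auto simp: cocycles_def right_closed signed_simps(1) M_group_simps(2,8) left_linear right_linear)

lemma right_coboundary:
  assumes "X \<in> dg_ob A" "X' \<in> dg_ob A" "Y \<in> dg_ob B"
    and "c \<in> cocycles (bf_ob M X' Y) 0" "a \<in> coboundaries (dg_hom A X X') 0"
  shows "right_act B M X X' Y 0 0 c a \<in> coboundaries (bf_ob M X Y) 0"
proof -
  obtain w where w: "w \<in> dg_mor A X X' (-1)" "a = cdiff (dg_hom A X X') (-1) w"
    using assms by (auto simp: coboundaries_def)
  have "cdiff (bf_ob M X Y) (-1) (right_act B M X X' Y 0 (-1) c w) = right_act B M X X' Y 0 0 c a"
    using assms w diff_right[of X X' Y w "-1" c 0 "-1"]
    by (simp add: cocycles_def right_closed A.diff_closed signed_simps(1) M_group_simps(8) left_linear right_linear)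
  then show ?thesis using assms w
    unfolding coboundaries_def by (auto simp: cocycles_def right_closed intro!: image_eqI[where x = "right_act B M X X' Y 0 (-1) c w"])
qed

lemma right_coboundary':
  assumes "X \<in> dg_ob A" "X' \<in> dg_ob A" "Y \<in> dg_ob B"
    and "c \<in> coboundaries (bf_ob M X' Y) 0" "a \<in> cocycles (dg_hom A X X') 0"
  shows "right_act B M X X' Y 0 0 c a \<in> coboundaries (bf_ob M X Y) 0"
proof -
  obtain w where w: "w \<in> carrier (grade (bf_ob M X' Y) (-1))" "c = cdiff (bf_ob M X' Y) (-1) w"
    using assms by (auto simp: coboundaries_def)
  have "cdiff (bf_ob M X Y) (-1) (right_act B M X X' Y (-1) 0 w a) = right_act B M X X' Y 0 0 c a"
    using assms w diff_right[of X X' Y a 0 w "-1" "-1"]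
    by (simp add: cocycles_def right_closed M_diff_closed signed_zero[OF M_module] M_group_simps(9) left_linear right_linear)
  then show ?thesis using assms w
    unfolding coboundaries_def by (auto simp: cocycles_def right_closed intro!: image_eqI[where x = "right_act B M X X' Y (-1) 0 w a"])
qed

text \<open>In degree \<open>0\<close> all Koszul signs are trivial, so the joint action is the
  composite of the one-sided ones, for which closedness and exactness are already known.\<close>

lemma bf_mor_degree_zero:
  assumes "X \<in> dg_ob A" "X' \<in> dg_ob A" "Y \<in> dg_ob B" "Y' \<in> dg_ob B"
    "a \<in> dg_mor A X X' 0" "b \<in> dg_mor B Y Y' 0" "c \<in> carrier (grade (bf_ob M X' Y) 0)"
  shows "bf_mor M X' X Y Y' 0 0 a b 0 c = left_act A M X Y Y' 0 0 b (right_act B M X X' Y 0 0 c a)"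
  using bf_mor_comp_apply[of X' X X Y Y Y' a 0 "dg_id A X" 0 "dg_id B Y" 0 b 0 c 0 0 0] assms A_id B_id
  by (simp add: left_act_def right_act_def signed_simps(1) A.comp_id_right B.comp_id_right)

lemma H0_bimodule_ob [simp]: "ab_ob (H0_bimodule M) X Y = cohomology (bf_ob M X Y) 0"
  by (simp add: H0_bimodule_def)

lemma H0_bimodule_mor:
  assumes ob: "X \<in> dg_ob A" "X' \<in> dg_ob A" "Y \<in> dg_ob B" "Y' \<in> dg_ob B"
    and a: "a \<in> cocycles (dg_hom A X X') 0" and b: "b \<in> cocycles (dg_hom B Y Y') 0"
    and c: "c \<in> cocycles (bf_ob M X' Y) 0"
  shows "ab_mor (H0_bimodule M) X X' Y Y' (cohom_class (dg_hom A X X') 0 a) (cohom_class (dg_hom B Y Y') 0 b)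
      (cohom_class (bf_ob M X' Y) 0 c) =
    cohom_class (bf_ob M X Y') 0 (left_act A M X Y Y' 0 0 b (right_act B M X X' Y 0 0 c a))"
proof -
  interpret HA: complex_of_modules R "dg_hom A X X'" using ob by (simp add: A.hom_complex_of_modules)
  interpret HB: complex_of_modules R "dg_hom B Y Y'" using ob by (simp add: B.hom_complex_of_modules)
  interpret M1: complex_of_modules R "bf_ob M X' Y" using ob by (simp add: M_complex)
  interpret M2: complex_of_modules R "bf_ob M X Y'" using ob by (simp add: M_complex)
  interpret M3: complex_of_modules R "bf_ob M X Y" using ob by (simp add: M_complex)
  note [simp] = HA.cocycles_carrier HB.cocycles_carrier M1.cocycles_carrier M2.cocycles_carrier M3.cocycles_carrier
    HA.coboundary_carrier HB.coboundary_carrier M1.coboundary_carrier M3.coboundary_carrier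
  show ?thesis
    unfolding H0_bimodule_def abelian_bimodule_data.simps
  proof (intro HA.UN_cohom_class HB.UN_cohom_class M1.UN_cohom_class)
    fix a' b' c' assume a': "a' \<in> cohom_class (dg_hom A X X') 0 a"
      and b': "b' \<in> cohom_class (dg_hom B Y Y') 0 b" and c': "c' \<in> cohom_class (bf_ob M X' Y) 0 c"
    have Z: "a' \<in> cocycles (dg_hom A X X') 0" "b' \<in> cocycles (dg_hom B Y Y') 0" "c' \<in> cocycles (bf_ob M X' Y) 0"
      using HA.cohom_class_cocycle[OF a' a] HB.cohom_class_cocycle[OF b' b] M1.cohom_class_cocycle[OF c' c] by auto
    obtain u where u: "u \<in> coboundaries (dg_hom A X X') 0" "a' = u \<oplus>\<^bsub>grade (dg_hom A X X') 0\<^esub> a"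
      using a' by (auto simp: HA.cohom_class_mem)
    obtain v where v: "v \<in> coboundaries (dg_hom B Y Y') 0" "b' = v \<oplus>\<^bsub>grade (dg_hom B Y Y') 0\<^esub> b"
      using b' by (auto simp: HB.cohom_class_mem)
    obtain w where w: "w \<in> coboundaries (bf_ob M X' Y) 0" "c' = w \<oplus>\<^bsub>grade (bf_ob M X' Y) 0\<^esub> c"
      using c' by (auto simp: M1.cohom_class_mem)
    \<comment> \<open>The change \<open>c' a' - c a\<close>, written as \<open>w a' + c u\<close>:
      with \<open>a'\<close> in the first and \<open>c\<close> in the second term each is a product
      of a coboundary and a cocycle.\<close>
    define t where "t = right_act B M X X' Y 0 0 w a' \<oplus>\<^bsub>grade (bf_ob M X Y) 0\<^esub> right_act B M X X' Y 0 0 c u"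
    have t: "t \<in> coboundaries (bf_ob M X Y) 0"
      unfolding t_def using ob Z u w c by (intro M3.add_coboundary right_coboundary right_coboundary')
    have r: "right_act B M X X' Y 0 0 c a \<in> cocycles (bf_ob M X Y) 0"
      and r': "right_act B M X X' Y 0 0 c' a' \<in> cocycles (bf_ob M X Y) 0"
      using ob Z a c by (auto intro: right_cocycle)
    have "right_act B M X X' Y 0 0 c' a' = right_act B M X X' Y 0 0 w a' \<oplus>\<^bsub>grade (bf_ob M X Y) 0\<^esub> right_act B M X X' Y 0 0 c a'"
      unfolding w(2) using ob Z w c by (simp add: right_linear)
    also have "right_act B M X X' Y 0 0 c a' = right_act B M X X' Y 0 0 c u \<oplus>\<^bsub>grade (bf_ob M X Y) 0\<^esub> right_act B M X X' Y 0 0 c a"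
      unfolding u(2) using ob a u c by (simp add: right_linear)
    finally have rr: "right_act B M X X' Y 0 0 c' a' = t \<oplus>\<^bsub>grade (bf_ob M X Y) 0\<^esub> right_act B M X X' Y 0 0 c a"
      unfolding t_def using ob Z u w c a by (simp add: right_closed M3.grade.a_assoc)
    let ?r = "right_act B M X X' Y 0 0 c a" and ?r' = "right_act B M X X' Y 0 0 c' a'"
    have "left_act A M X Y Y' 0 0 b' ?r' = left_act A M X Y Y' 0 0 v ?r' \<oplus>\<^bsub>grade (bf_ob M X Y') 0\<^esub> left_act A M X Y Y' 0 0 b ?r'"
      unfolding v(2) using ob b v r' by (simp add: left_linear)
    also have "left_act A M X Y Y' 0 0 b ?r' = left_act A M X Y Y' 0 0 b t \<oplus>\<^bsub>grade (bf_ob M X Y') 0\<^esub> left_act A M X Y Y' 0 0 b ?r"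
      unfolding rr using ob b t r by (simp add: left_linear)
    finally have "left_act A M X Y Y' 0 0 b' ?r' =
        (left_act A M X Y Y' 0 0 v ?r' \<oplus>\<^bsub>grade (bf_ob M X Y') 0\<^esub> left_act A M X Y Y' 0 0 b t)
        \<oplus>\<^bsub>grade (bf_ob M X Y') 0\<^esub> left_act A M X Y Y' 0 0 b ?r"
      using ob b v t r r' by (simp add: left_closed M2.grade.a_assoc)
    then have "cohom_class (bf_ob M X Y') 0 (left_act A M X Y Y' 0 0 b' ?r') =
        cohom_class (bf_ob M X Y') 0 (left_act A M X Y Y' 0 0 b ?r)"
      using ob b v t r r'
      by (intro M2.cohom_class_eqI[OF M2.add_coboundary[OF left_coboundary left_coboundary']]) (auto intro: left_closed)
    then show "cohom_class (bf_ob M X Y') 0 (bf_mor M X' X Y Y' 0 0 a' b' 0 c') =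
        cohom_class (bf_ob M X Y') 0 (left_act A M X Y Y' 0 0 b (right_act B M X X' Y 0 0 c a))"
      using ob Z by (simp add: bf_mor_degree_zero)
  qed (use a b c in simp_all)
qed

lemma H0_abelian_bimodule:
  "abelian_bimodule R (homotopy_category A) (homotopy_category B) (H0_bimodule M)"
proof -
  note [simp] = complex_of_modules.cohomology_carrier[OF A.hom_complex_of_modules]
    complex_of_modules.cohomology_carrier[OF B.hom_complex_of_modules]
    complex_of_modules.cohomology_carrier[OF M_complex]
    complex_of_modules.cohomology_add[OF A.hom_complex_of_modules]
    complex_of_modules.cohomology_add[OF B.hom_complex_of_modules]
    complex_of_modules.cohomology_add[OF M_complex]
    complex_of_modules.cohomology_smult[OF A.hom_complex_of_modules]
    complex_of_modules.cohomology_smult[OF B.hom_complex_of_modules]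
    complex_of_modules.cohomology_smult[OF M_complex]
    complex_of_modules.cocycles_carrier[OF A.hom_complex_of_modules]
    complex_of_modules.cocycles_carrier[OF B.hom_complex_of_modules]
    complex_of_modules.cocycles_carrier[OF M_complex]
    complex_of_modules.add_cocycle[OF A.hom_complex_of_modules]
    complex_of_modules.add_cocycle[OF B.hom_complex_of_modules]
    complex_of_modules.add_cocycle[OF M_complex]
    complex_of_modules.smult_cocycle[OF A.hom_complex_of_modules]
    complex_of_modules.smult_cocycle[OF B.hom_complex_of_modules]
    complex_of_modules.smult_cocycle[OF M_complex]
    H0_bimodule_mor left_cocycle right_cocycle
  show ?thesis
  proof (intro abelian_bimodule.intro abelian_bimodule_axioms.intro A.homotopy_category_linear B.homotopy_category_linear)
    fix X Y assume "X \<in> lob (homotopy_category A)" "Y \<in> lob (homotopy_category B)"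
    then show "module R (ab_ob (H0_bimodule M) X Y)"
      by (simp add: complex_of_modules.cohomology_module[OF M_complex])
  next
    fix X X' Y Y' f g
    assume "X \<in> lob (homotopy_category A)" "X' \<in> lob (homotopy_category A)" "Y \<in> lob (homotopy_category B)"
      "Y' \<in> lob (homotopy_category B)" "f \<in> carrier (lhom (homotopy_category A) X X')"
      "g \<in> carrier (lhom (homotopy_category B) Y Y')"
    then show "ab_mor (H0_bimodule M) X X' Y Y' f g \<in> mod_hom R (ab_ob (H0_bimodule M) X' Y) (ab_ob (H0_bimodule M) X Y')"
      by (intro mod_homI) (auto simp: left_linear right_linear)
  next
    fix X X' Y Y' \<mu>
    assume "X \<in> lob (homotopy_category A)" "X' \<in> lob (homotopy_category A)" "Y \<in> lob (homotopy_category B)"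
      "Y' \<in> lob (homotopy_category B)" "\<mu> \<in> carrier (ab_ob (H0_bimodule M) X' Y)"
    then show "bilinear_map R (lhom (homotopy_category A) X X') (lhom (homotopy_category B) Y Y')
        (ab_ob (H0_bimodule M) X Y') (\<lambda>f g. ab_mor (H0_bimodule M) X X' Y Y' f g \<mu>)"
      by (intro bilinear_mapI) (auto simp: left_linear right_linear)
  next
    fix X Y \<mu>
    assume "X \<in> lob (homotopy_category A)" "Y \<in> lob (homotopy_category B)" "\<mu> \<in> carrier (ab_ob (H0_bimodule M) X Y)"
    then show "ab_mor (H0_bimodule M) X X Y Y (lid (homotopy_category A) X) (lid (homotopy_category B) Y) \<mu> = \<mu>"
      by (auto simp: id_act A.id_closed B.id_closed)
  next
    fix X X' X'' Y Y' Y'' f f' g g' \<mu>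
    assume ob: "X \<in> lob (homotopy_category A)" "X' \<in> lob (homotopy_category A)" "X'' \<in> lob (homotopy_category A)"
      "Y \<in> lob (homotopy_category B)" "Y' \<in> lob (homotopy_category B)" "Y'' \<in> lob (homotopy_category B)"
      and "f \<in> carrier (lhom (homotopy_category A) X X')" "f' \<in> carrier (lhom (homotopy_category A) X' X'')"
        "g \<in> carrier (lhom (homotopy_category B) Y Y')" "g' \<in> carrier (lhom (homotopy_category B) Y' Y'')"
        "\<mu> \<in> carrier (ab_ob (H0_bimodule M) X'' Y)"
    then obtain a a' b b' c where "a \<in> cocycles (dg_hom A X X') 0" "f = cohom_class (dg_hom A X X') 0 a"
      "a' \<in> cocycles (dg_hom A X' X'') 0" "f' = cohom_class (dg_hom A X' X'') 0 a'"
      "b \<in> cocycles (dg_hom B Y Y') 0" "g = cohom_class (dg_hom B Y Y') 0 b"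
      "b' \<in> cocycles (dg_hom B Y' Y'') 0" "g' = cohom_class (dg_hom B Y' Y'') 0 b'"
      "c \<in> cocycles (bf_ob M X'' Y) 0" "\<mu> = cohom_class (bf_ob M X'' Y) 0 c"
      by auto
    \<comment> \<open>Both sides are brought to the form \<open>b' (b ((c a') a))\<close>; on the
      right this moves \<open>a\<close> past \<open>b\<close> by \<open>right_left\<close>.\<close>
    moreover from this ob have "left_act A M X Y Y'' 0 0 (dg_comp B Y Y' Y'' 0 0 b' b) (right_act B M X X'' Y 0 0 c (dg_comp A X X' X'' 0 0 a' a)) =
      left_act A M X Y' Y'' 0 0 b' (right_act B M X X' Y' 0 0 (left_act A M X' Y Y' 0 0 b (right_act B M X' X'' Y 0 0 c a')) a)"
      by (simp add: right_right[of X X' X'' Y a 0 a' 0 c 0 0 0, symmetric] left_left[where s = 0] right_left[where t = 0] right_closed)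
    ultimately show "ab_mor (H0_bimodule M) X X'' Y Y'' (lcomp (homotopy_category A) X X' X'' f' f)
        (lcomp (homotopy_category B) Y Y' Y'' g' g) \<mu> =
      ab_mor (H0_bimodule M) X X' Y' Y'' f g' (ab_mor (H0_bimodule M) X' X'' Y Y' f' g \<mu>)"
      using ob by (simp add: A.homotopy_comp B.homotopy_comp A.comp_cocycle B.comp_cocycle)
  qed
qed

end

lemma abelian_bimodule_full_subcategory:
  assumes "abelian_bimodule R C D N" "S \<subseteq> lob C" "T \<subseteq> lob D"
  shows "abelian_bimodule R (full_subcategory C S) (full_subcategory D T) N"
proof -
  interpret N: abelian_bimodule R C D N by fact
  have ST: "X \<in> S \<Longrightarrow> X \<in> lob C" "Y \<in> T \<Longrightarrow> Y \<in> lob D" for X Y using assms by auto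
  show ?thesis
    by (intro abelian_bimodule.intro abelian_bimodule_axioms.intro linear_category_full_subcategory assms
        N.source_op.linear_category_axioms N.source.linear_category_axioms)
      (simp_all add: ST N.ab_module N.ab_mor_hom N.ab_mor_bilinear N.ab_mor_id N.ab_mor_comp)
qed

section \<open>The glued dg-category\<close>

lemma module_sum_simps [simp]:
  "carrier (module_sum M N) = carrier M \<times> carrier N"
  "(x, y) \<oplus>\<^bsub>module_sum M N\<^esub> (x', y') = (x \<oplus>\<^bsub>M\<^esub> x', y \<oplus>\<^bsub>N\<^esub> y')"
  "\<zero>\<^bsub>module_sum M N\<^esub> = (\<zero>\<^bsub>M\<^esub>, \<zero>\<^bsub>N\<^esub>)"
  "r \<odot>\<^bsub>module_sum M N\<^esub> (x, y) = (r \<odot>\<^bsub>M\<^esub> x, r \<odot>\<^bsub>N\<^esub> y)"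
  by (simp_all add: module_sum_def)

lemma module_sum_module:
  assumes "module R M" "module R N"
  shows "module R (module_sum M N)"
proof -
  interpret M: module R M by fact
  interpret N: module R N by fact
  show ?thesis
  proof (rule moduleI)
    show "abelian_group (module_sum M N)"
    proof (rule abelian_groupI)
      fix x assume "x \<in> carrier (module_sum M N)"
      then show "\<exists>y \<in> carrier (module_sum M N). y \<oplus>\<^bsub>module_sum M N\<^esub> x = \<zero>\<^bsub>module_sum M N\<^esub>"
        by (intro bexI[of _ "(\<ominus>\<^bsub>M\<^esub> fst x, \<ominus>\<^bsub>N\<^esub> snd x)"]) (auto simp: M.l_neg N.l_neg)
    qed (auto simp: M.a_ac N.a_ac)
  qed (auto simp: M.R.is_cring M.smult_l_distr N.smult_l_distr M.smult_r_distr N.smult_r_distr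
      M.smult_assoc1 N.smult_assoc1)
qed

lemma module_sum_neg:
  assumes "module R M" "module R N" "x \<in> carrier M" "y \<in> carrier N"
  shows "\<ominus>\<^bsub>module_sum M N\<^esub> (x, y) = (\<ominus>\<^bsub>M\<^esub> x, \<ominus>\<^bsub>N\<^esub> y)"
proof -
  interpret M: module R M by fact
  interpret N: module R N by fact
  interpret S: module R "module_sum M N" by (rule module_sum_module) fact+
  show ?thesis using assms by (intro S.minus_equality) (simp_all add: M.l_neg N.l_neg)
qed

lemma module_sum_signed:
  assumes "module R M" "module R N" "x \<in> carrier M" "y \<in> carrier N"
  shows "signed (module_sum M N) n (x, y) = (signed M n x, signed N n y)"
  using module_sum_neg[OF assms] by (simp add: signed_def)

context dg_bimodule_data
begin

abbreviation "GL \<equiv> glued A B M"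

lemma glued_simps [simp]:
  "(X, Y, \<phi>) \<in> dg_ob GL \<longleftrightarrow> X \<in> dg_ob A \<and> Y \<in> dg_ob B \<and> \<phi> \<in> cocycles (bf_ob M X Y) 0"
  "grade (dg_hom GL (X1, Y1, \<phi>1) (X2, Y2, \<phi>2)) n = module_sum (grade (dg_hom A X1 X2) n)
     (module_sum (grade (dg_hom B Y1 Y2) n) (grade (bf_ob M X1 Y2) (n - 1)))"
  "cdiff (dg_hom GL (X1, Y1, \<phi>1) (X2, Y2, \<phi>2)) n (a, b, c) =
     (cdiff (dg_hom A X1 X2) n a,
      cdiff (dg_hom B Y1 Y2) n b,
      \<ominus>\<^bsub>grade (bf_ob M X1 Y2) n\<^esub> cdiff (bf_ob M X1 Y2) (n - 1) c
      \<ominus>\<^bsub>grade (bf_ob M X1 Y2) n\<^esub> left_act A M X1 Y1 Y2 n 0 b \<phi>1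
      \<oplus>\<^bsub>grade (bf_ob M X1 Y2) n\<^esub> right_act B M X1 X2 Y2 0 n \<phi>2 a)"
  "dg_comp GL (X1, Y1, \<phi>1) (X2, Y2, \<phi>2) (X3, Y3, \<phi>3) q p (a2, b2, c2) (a1, b1, c1) =
     (dg_comp A X1 X2 X3 q p a2 a1,
      dg_comp B Y1 Y2 Y3 q p b2 b1,
      right_act B M X1 X2 Y3 (q - 1) p c2 a1
      \<oplus>\<^bsub>grade (bf_ob M X1 Y3) (q + p - 1)\<^esub>
      signed (grade (bf_ob M X1 Y3) (q + p - 1)) q (left_act A M X1 Y2 Y3 q (p - 1) b2 c1))"
  "dg_id GL (X, Y, \<phi>) = (dg_id A X, dg_id B Y, \<zero>\<^bsub>grade (bf_ob M X Y) (-1)\<^esub>)"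
  by (simp_all add: glued_def glued_hom_def)

lemma glued_hom_module:
  assumes "(X1, Y1, \<phi>1) \<in> dg_ob GL" "(X2, Y2, \<phi>2) \<in> dg_ob GL"
  shows "module R (grade (dg_hom GL (X1, Y1, \<phi>1) (X2, Y2, \<phi>2)) n)"
  using assms by (simp add: module_sum_module A.hom_module B.hom_module M_module)

lemma M_neg_smult:
  "\<lbrakk>X \<in> dg_ob A; Y \<in> dg_ob B; r \<in> carrier R; c \<in> carrier (grade (bf_ob M X Y) n)\<rbrakk> \<Longrightarrow>
    r \<odot>\<^bsub>grade (bf_ob M X Y) n\<^esub> (\<ominus>\<^bsub>grade (bf_ob M X Y) n\<^esub> c) = \<ominus>\<^bsub>grade (bf_ob M X Y) n\<^esub> (r \<odot>\<^bsub>grade (bf_ob M X Y) n\<^esub> c)"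
  using module.smult_r_minus[OF M_module] by blast

text \<open>For the square of the differential only the component in \<open>M\<close> is in
  question. As \<open>\<phi>1\<close> and \<open>\<phi>2\<close> are closed,
  \<open>d(b \<phi>1) = (db) \<phi>1\<close> and \<open>d(\<phi>2 a) = \<phi>2 (da)\<close>; these
  cancel the action terms of the outer differential, applied to \<open>da\<close> and
  \<open>db\<close>.\<close>

lemma glued_hom_complex:
  assumes X: "(X1, Y1, \<phi>1) \<in> dg_ob GL" and Y: "(X2, Y2, \<phi>2) \<in> dg_ob GL"
  shows "cochain_complex R (dg_hom GL (X1, Y1, \<phi>1) (X2, Y2, \<phi>2))"
  unfolding cochain_complex_def
proof (intro conjI allI ballI)
  have ob: "X1 \<in> dg_ob A" "X2 \<in> dg_ob A" "Y1 \<in> dg_ob B" "Y2 \<in> dg_ob B"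
    and \<phi>: "\<phi>1 \<in> carrier (grade (bf_ob M X1 Y1) 0)" "\<phi>2 \<in> carrier (grade (bf_ob M X2 Y2) 0)"
    and d\<phi>: "cdiff (bf_ob M X1 Y1) 0 \<phi>1 = \<zero>\<^bsub>grade (bf_ob M X1 Y1) 1\<^esub>" "cdiff (bf_ob M X2 Y2) 0 \<phi>2 = \<zero>\<^bsub>grade (bf_ob M X2 Y2) 1\<^esub>"
    using X Y by (auto simp: cocycles_def)
  note [simp] = ob \<phi> d\<phi> M_diff_closed left_closed right_closed M_group_closed M_diff_linear A.diff_linear B.diff_linear
    A.diff_closed B.diff_closed left_linear right_linear
  fix n
  show "module R (grade (dg_hom GL (X1, Y1, \<phi>1) (X2, Y2, \<phi>2)) n)"
    using X Y by (rule glued_hom_module)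
  show "cdiff (dg_hom GL (X1, Y1, \<phi>1) (X2, Y2, \<phi>2)) n \<in>
      mod_hom R (grade (dg_hom GL (X1, Y1, \<phi>1) (X2, Y2, \<phi>2)) n) (grade (dg_hom GL (X1, Y1, \<phi>1) (X2, Y2, \<phi>2)) (n + 1))"
  proof (rule mod_homI; clarsimp)
    fix a b c a' b' c'
    assume "a \<in> dg_mor A X1 X2 n" "b \<in> dg_mor B Y1 Y2 n" "c \<in> carrier (grade (bf_ob M X1 Y2) (n - 1))"
      "a' \<in> dg_mor A X1 X2 n" "b' \<in> dg_mor B Y1 Y2 n" "c' \<in> carrier (grade (bf_ob M X1 Y2) (n - 1))"
    then show "\<ominus>\<^bsub>grade (bf_ob M X1 Y2) n\<^esub> (cdiff (bf_ob M X1 Y2) (n - 1) c \<oplus>\<^bsub>grade (bf_ob M X1 Y2) n\<^esub>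
          cdiff (bf_ob M X1 Y2) (n - 1) c') \<ominus>\<^bsub>grade (bf_ob M X1 Y2) n\<^esub>
        (left_act A M X1 Y1 Y2 n 0 b \<phi>1 \<oplus>\<^bsub>grade (bf_ob M X1 Y2) n\<^esub> left_act A M X1 Y1 Y2 n 0 b' \<phi>1) \<oplus>\<^bsub>grade (bf_ob M X1 Y2) n\<^esub>
        (right_act B M X1 X2 Y2 0 n \<phi>2 a \<oplus>\<^bsub>grade (bf_ob M X1 Y2) n\<^esub> right_act B M X1 X2 Y2 0 n \<phi>2 a') =
      \<ominus>\<^bsub>grade (bf_ob M X1 Y2) n\<^esub> cdiff (bf_ob M X1 Y2) (n - 1) c \<ominus>\<^bsub>grade (bf_ob M X1 Y2) n\<^esub>
        left_act A M X1 Y1 Y2 n 0 b \<phi>1 \<oplus>\<^bsub>grade (bf_ob M X1 Y2) n\<^esub> right_act B M X1 X2 Y2 0 n \<phi>2 a \<oplus>\<^bsub>grade (bf_ob M X1 Y2) n\<^esub>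
      (\<ominus>\<^bsub>grade (bf_ob M X1 Y2) n\<^esub> cdiff (bf_ob M X1 Y2) (n - 1) c' \<ominus>\<^bsub>grade (bf_ob M X1 Y2) n\<^esub>
        left_act A M X1 Y1 Y2 n 0 b' \<phi>1 \<oplus>\<^bsub>grade (bf_ob M X1 Y2) n\<^esub> right_act B M X1 X2 Y2 0 n \<phi>2 a')"
      by (simp add: M_group_simps)
  next
    fix r a b c
    assume "r \<in> carrier R" "a \<in> dg_mor A X1 X2 n" "b \<in> dg_mor B Y1 Y2 n" "c \<in> carrier (grade (bf_ob M X1 Y2) (n - 1))"
    then show "\<ominus>\<^bsub>grade (bf_ob M X1 Y2) n\<^esub> (r \<odot>\<^bsub>grade (bf_ob M X1 Y2) n\<^esub> cdiff (bf_ob M X1 Y2) (n - 1) c) \<ominus>\<^bsub>grade (bf_ob M X1 Y2) n\<^esub>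
        r \<odot>\<^bsub>grade (bf_ob M X1 Y2) n\<^esub> left_act A M X1 Y1 Y2 n 0 b \<phi>1 \<oplus>\<^bsub>grade (bf_ob M X1 Y2) n\<^esub>
        r \<odot>\<^bsub>grade (bf_ob M X1 Y2) n\<^esub> right_act B M X1 X2 Y2 0 n \<phi>2 a =
      r \<odot>\<^bsub>grade (bf_ob M X1 Y2) n\<^esub> (\<ominus>\<^bsub>grade (bf_ob M X1 Y2) n\<^esub> cdiff (bf_ob M X1 Y2) (n - 1) c \<ominus>\<^bsub>grade (bf_ob M X1 Y2) n\<^esub>
        left_act A M X1 Y1 Y2 n 0 b \<phi>1 \<oplus>\<^bsub>grade (bf_ob M X1 Y2) n\<^esub> right_act B M X1 X2 Y2 0 n \<phi>2 a)"
      by (simp add: a_minus_def module.smult_r_distr[OF M_module] M_neg_smult)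
  qed
  fix x assume "x \<in> dg_mor GL (X1, Y1, \<phi>1) (X2, Y2, \<phi>2) n"
  then obtain a b c where x: "x = (a, b, c)" and
    abc [simp]: "a \<in> dg_mor A X1 X2 n" "b \<in> dg_mor B Y1 Y2 n" "c \<in> carrier (grade (bf_ob M X1 Y2) (n - 1))"
    by auto
  have L: "cdiff (bf_ob M X1 Y2) n (left_act A M X1 Y1 Y2 n 0 b \<phi>1) =
      left_act A M X1 Y1 Y2 (n + 1) 0 (cdiff (dg_hom B Y1 Y2) n b) \<phi>1"
    using diff_left[of X1 Y1 Y2 b n \<phi>1 0 n] by (simp add: signed_zero[OF M_module] M_group_simps(9))
  have Rr: "cdiff (bf_ob M X1 Y2) n (right_act B M X1 X2 Y2 0 n \<phi>2 a) =
      right_act B M X1 X2 Y2 0 (n + 1) \<phi>2 (cdiff (dg_hom A X1 X2) n a)"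
    using diff_right[of X1 X2 Y2 a n \<phi>2 0 n] by (simp add: signed_simps(1) add.commute[of 1 n] M_group_simps(8))
  have dd: "cdiff (bf_ob M X1 Y2) n (cdiff (bf_ob M X1 Y2) (n - 1) c) = \<zero>\<^bsub>grade (bf_ob M X1 Y2) (n + 1)\<^esub>"
    using M_diff_diff[of X1 Y2 c "n - 1" n] by (simp add: add.commute[of 1 n])
  show "cdiff (dg_hom GL (X1, Y1, \<phi>1) (X2, Y2, \<phi>2)) (n + 1) (cdiff (dg_hom GL (X1, Y1, \<phi>1) (X2, Y2, \<phi>2)) n x) =
      \<zero>\<^bsub>grade (dg_hom GL (X1, Y1, \<phi>1) (X2, Y2, \<phi>2)) (n + 2)\<^esub>"
    by (simp add: x L Rr dd A.diff_diff B.diff_diff M_group_simps add.commute[of 1 n])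
qed

lemma glued_dg_category: "dg_category R GL"
proof (rule dg_category.intro)
  show "cring R" by (rule A.base_ring)
next
  fix X Y assume "X \<in> dg_ob GL" "Y \<in> dg_ob GL"
  then show "cochain_complex R (dg_hom GL X Y)"
    by (cases X; cases Y) (simp only: glued_hom_complex)
next
  fix X Y Z and q p :: int assume XYZ: "X \<in> dg_ob GL" "Y \<in> dg_ob GL" "Z \<in> dg_ob GL"
  obtain X1 Y1 \<phi>1 X2 Y2 \<phi>2 X3 Y3 \<phi>3 where X: "X = (X1, Y1, \<phi>1)" "Y = (X2, Y2, \<phi>2)" "Z = (X3, Y3, \<phi>3)"
    by (metis prod_cases3)
  note [simp] = left_closed right_closed M_group_closed left_linear right_linear A.comp_closed B.comp_closed
    A.comp_linear_left A.comp_linear_right B.comp_linear_left B.comp_linear_right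
    module.smult_r_distr[OF M_module] M_neg_smult module.smult_closed[OF M_module]
  have [simp]: "q - 1 + p = q + p - 1" "q + (p - 1) = q + p - 1" by simp_all
  show "bilinear_map R (grade (dg_hom GL Y Z) q) (grade (dg_hom GL X Y) p) (grade (dg_hom GL X Z) (q + p))
      (dg_comp GL X Y Z q p)"
    using XYZ unfolding X
    by (intro bilinear_mapI; cases "even q") (auto simp: M_group_simps abelian_group.minus_add[OF M_abelian_group] signed_def simp del: M_group_simps(10))
next
  fix X Y Z f p g q
  assume XYZ: "X \<in> dg_ob GL" "Y \<in> dg_ob GL" "Z \<in> dg_ob GL" and f: "f \<in> dg_mor GL X Y p" and g: "g \<in> dg_mor GL Y Z q"
  obtain X1 Y1 \<phi>1 X2 Y2 \<phi>2 X3 Y3 \<phi>3 where X: "X = (X1, Y1, \<phi>1)" "Y = (X2, Y2, \<phi>2)" "Z = (X3, Y3, \<phi>3)"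
    by (metis prod_cases3)
  obtain a1 b1 c1 a2 b2 c2 where fg: "f = (a1, b1, c1)" "g = (a2, b2, c2)"
    by (metis prod_cases3)
  have ob: "X1 \<in> dg_ob A" "X2 \<in> dg_ob A" "X3 \<in> dg_ob A" "Y1 \<in> dg_ob B" "Y2 \<in> dg_ob B" "Y3 \<in> dg_ob B"
    and \<phi>: "\<phi>1 \<in> carrier (grade (bf_ob M X1 Y1) 0)" "\<phi>2 \<in> carrier (grade (bf_ob M X2 Y2) 0)" "\<phi>3 \<in> carrier (grade (bf_ob M X3 Y3) 0)"
    using XYZ by (auto simp: X cocycles_def)
  have abc: "a1 \<in> dg_mor A X1 X2 p" "b1 \<in> dg_mor B Y1 Y2 p" "c1 \<in> carrier (grade (bf_ob M X1 Y2) (p - 1))"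
    "a2 \<in> dg_mor A X2 X3 q" "b2 \<in> dg_mor B Y2 Y3 q" "c2 \<in> carrier (grade (bf_ob M X2 Y3) (q - 1))"
    using f g by (auto simp: X fg)
  \<comment> \<open>Degrees are arguments of the actions and of the graded pieces, so equal integers
    have to be brought to one common form before terms can match.\<close>
  have idx: "q - 1 + p = q + p - 1" "q + (p - 1) = q + p - 1" "q + p - 1 + 1 = q + p" "p + q = q + p"
    "q + p + 1 - 1 = q + p" "q + 1 + p - 1 = q + p" "q + (p + 1) - 1 = q + p" "q + (p + 1) = q + p + 1"
    "q + 1 + p = q + p + 1" "q + 1 - 1 = q" "p + 1 - 1 = p" "q - 1 + 1 = q" "p - 1 + 1 = p" by simp_all
  let ?N = "grade (bf_ob M X1 Y3) (q + p)"
  \<comment> \<open>The seven products in the component in \<open>M\<close>. The product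
    \<open>t7\<close> of \<open>b2\<close>, \<open>\<phi>2\<close> and \<open>a1\<close> occurs
    twice on the right side of the Leibniz rule, with opposite signs; this is how the datum
    \<open>\<phi>2\<close> of the middle object drops out.\<close>
  define t1 where "t1 = right_act B M X1 X2 Y3 q p (cdiff (bf_ob M X2 Y3) (q - 1) c2) a1"
  define t2 where "t2 = right_act B M X1 X2 Y3 (q - 1) (p + 1) c2 (cdiff (dg_hom A X1 X2) p a1)"
  define t3 where "t3 = left_act A M X1 Y2 Y3 (q + 1) (p - 1) (cdiff (dg_hom B Y2 Y3) q b2) c1"
  define t4 where "t4 = left_act A M X1 Y2 Y3 q p b2 (cdiff (bf_ob M X1 Y2) (p - 1) c1)"
  define t5 where "t5 = left_act A M X1 Y2 Y3 q p b2 (left_act A M X1 Y1 Y2 p 0 b1 \<phi>1)"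
  define t6 where "t6 = right_act B M X1 X2 Y3 q p (right_act B M X2 X3 Y3 0 q \<phi>3 a2) a1"
  define t7 where "t7 = left_act A M X1 Y2 Y3 q p b2 (right_act B M X1 X2 Y2 0 p \<phi>2 a1)"
  have t [simp]: "t1 \<in> carrier ?N" "t2 \<in> carrier ?N" "t3 \<in> carrier ?N" "t4 \<in> carrier ?N" "t5 \<in> carrier ?N"
    "t6 \<in> carrier ?N" "t7 \<in> carrier ?N"
    unfolding t1_def t2_def t3_def t4_def t5_def t6_def t7_def using ob \<phi> abc
    by (auto intro!: left_closed right_closed M_diff_closed A.diff_closed B.diff_closed)
  have e1: "cdiff (bf_ob M X1 Y3) (q + p - 1) (right_act B M X1 X2 Y3 (q - 1) p c2 a1) = t1 \<oplus>\<^bsub>?N\<^esub> signed ?N (q - 1) t2"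
    using diff_right[of X1 X2 Y3 a1 p c2 "q - 1" "q + p - 1"] ob abc by (simp add: t1_def t2_def idx)
  have e2: "cdiff (bf_ob M X1 Y3) (q + p - 1) (left_act A M X1 Y2 Y3 q (p - 1) b2 c1) = t3 \<oplus>\<^bsub>?N\<^esub> signed ?N q t4"
    using diff_left[of X1 Y2 Y3 b2 q c1 "p - 1" "q + p - 1"] ob abc by (simp add: t3_def t4_def idx)
  have e5: "left_act A M X1 Y1 Y3 (q + p) 0 (dg_comp B Y1 Y2 Y3 q p b2 b1) \<phi>1 = t5"
    using ob abc \<phi> by (simp add: t5_def left_left[where s = p])
  have e6: "right_act B M X1 X3 Y3 0 (q + p) \<phi>3 (dg_comp A X1 X2 X3 q p a2 a1) = t6"
    using ob abc \<phi> by (simp add: t6_def right_right[where t = "q + p"])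
  have e7: "right_act B M X1 X2 Y3 q p (left_act A M X2 Y2 Y3 q 0 b2 \<phi>2) a1 = t7"
    using ob abc \<phi> by (simp add: t7_def right_left[where t = p])
  note cl = ob abc \<phi> left_closed right_closed M_diff_closed M_group_closed signed_closed[OF M_module]
  have r1: "right_act B M X1 X2 Y3 q p (\<ominus>\<^bsub>grade (bf_ob M X2 Y3) q\<^esub> cdiff (bf_ob M X2 Y3) (q - 1) c2
      \<ominus>\<^bsub>grade (bf_ob M X2 Y3) q\<^esub> left_act A M X2 Y2 Y3 q 0 b2 \<phi>2
      \<oplus>\<^bsub>grade (bf_ob M X2 Y3) q\<^esub> right_act B M X2 X3 Y3 0 q \<phi>3 a2) a1 =
      \<ominus>\<^bsub>?N\<^esub> t1 \<ominus>\<^bsub>?N\<^esub> t7 \<oplus>\<^bsub>?N\<^esub> t6"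
    unfolding t1_def t6_def e7[symmetric] by (simp add: cl right_linear)
  have r2: "left_act A M X1 Y2 Y3 q p b2 (\<ominus>\<^bsub>grade (bf_ob M X1 Y2) p\<^esub> cdiff (bf_ob M X1 Y2) (p - 1) c1
      \<ominus>\<^bsub>grade (bf_ob M X1 Y2) p\<^esub> left_act A M X1 Y1 Y2 p 0 b1 \<phi>1
      \<oplus>\<^bsub>grade (bf_ob M X1 Y2) p\<^esub> right_act B M X1 X2 Y2 0 p \<phi>2 a1) =
      \<ominus>\<^bsub>?N\<^esub> t4 \<ominus>\<^bsub>?N\<^esub> t5 \<oplus>\<^bsub>?N\<^esub> t7"
    unfolding t4_def t5_def t7_def by (simp add: cl left_linear)
  have l1: "cdiff (bf_ob M X1 Y3) (q + p - 1) (right_act B M X1 X2 Y3 (q - 1) p c2 a1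
      \<oplus>\<^bsub>grade (bf_ob M X1 Y3) (q + p - 1)\<^esub>
      signed (grade (bf_ob M X1 Y3) (q + p - 1)) q (left_act A M X1 Y2 Y3 q (p - 1) b2 c1)) =
      t1 \<oplus>\<^bsub>?N\<^esub> signed ?N (q - 1) t2 \<oplus>\<^bsub>?N\<^esub> signed ?N q (t3 \<oplus>\<^bsub>?N\<^esub> signed ?N q t4)"
    using mod_hom_signed[OF M_module M_module M_diff_mod_hom,
        where x = "left_act A M X1 Y2 Y3 q (p - 1) b2 c1" and n = q]
    by (simp add: M_diff_linear cl e1 e2 idx)
  have key: "\<ominus>\<^bsub>?N\<^esub> (t1 \<oplus>\<^bsub>?N\<^esub> signed ?N (q - 1) t2 \<oplus>\<^bsub>?N\<^esub> signed ?N q (t3 \<oplus>\<^bsub>?N\<^esub> signed ?N q t4))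
      \<ominus>\<^bsub>?N\<^esub> t5 \<oplus>\<^bsub>?N\<^esub> t6 =
      \<ominus>\<^bsub>?N\<^esub> t1 \<ominus>\<^bsub>?N\<^esub> t7 \<oplus>\<^bsub>?N\<^esub> t6 \<oplus>\<^bsub>?N\<^esub> signed ?N (q + 1) t3
      \<oplus>\<^bsub>?N\<^esub> signed ?N q (t2 \<oplus>\<^bsub>?N\<^esub> signed ?N q (\<ominus>\<^bsub>?N\<^esub> t4 \<ominus>\<^bsub>?N\<^esub> t5 \<oplus>\<^bsub>?N\<^esub> t7))"
    using ob by (cases "even q") (simp_all add: M_group_simps signed_simps)
  show "cdiff (dg_hom GL X Z) (q + p) (dg_comp GL X Y Z q p g f) =
        dg_comp GL X Y Z (q + 1) p (cdiff (dg_hom GL Y Z) q g) f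
        \<oplus>\<^bsub>grade (dg_hom GL X Z) (q + p + 1)\<^esub>
        signed (grade (dg_hom GL X Z) (q + p + 1)) q
          (dg_comp GL X Y Z q (p + 1) g (cdiff (dg_hom GL X Y) p f))"
    unfolding X fg
    using ob abc r1 r2 key
    by (simp add: A.leibniz B.leibniz idx l1 e5 e6 t2_def[symmetric] t3_def[symmetric]
        module_sum_signed[OF A.hom_module module_sum_module[OF B.hom_module M_module]]
        module_sum_signed[OF B.hom_module M_module] A.comp_closed A.diff_closed B.comp_closed B.diff_closed
        M_group_closed signed_closed[OF M_module])
next
  fix W X Y Z f p g q h r
  assume WXYZ: "W \<in> dg_ob GL" "X \<in> dg_ob GL" "Y \<in> dg_ob GL" "Z \<in> dg_ob GL" and
    fgh: "f \<in> dg_mor GL W X p" "g \<in> dg_mor GL X Y q" "h \<in> dg_mor GL Y Z r"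
  obtain X0 Y0 \<phi>0 X1 Y1 \<phi>1 X2 Y2 \<phi>2 X3 Y3 \<phi>3
    where X: "W = (X0, Y0, \<phi>0)" "X = (X1, Y1, \<phi>1)" "Y = (X2, Y2, \<phi>2)" "Z = (X3, Y3, \<phi>3)"
    by (metis prod_cases3)
  obtain a1 b1 c1 a2 b2 c2 a3 b3 c3 where f: "f = (a1, b1, c1)" "g = (a2, b2, c2)" "h = (a3, b3, c3)"
    by (metis prod_cases3)
  have ob: "X0 \<in> dg_ob A" "X1 \<in> dg_ob A" "X2 \<in> dg_ob A" "X3 \<in> dg_ob A"
    "Y0 \<in> dg_ob B" "Y1 \<in> dg_ob B" "Y2 \<in> dg_ob B" "Y3 \<in> dg_ob B"
    using WXYZ by (auto simp: X)
  have abc: "a1 \<in> dg_mor A X0 X1 p" "b1 \<in> dg_mor B Y0 Y1 p" "c1 \<in> carrier (grade (bf_ob M X0 Y1) (p - 1))"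
    "a2 \<in> dg_mor A X1 X2 q" "b2 \<in> dg_mor B Y1 Y2 q" "c2 \<in> carrier (grade (bf_ob M X1 Y2) (q - 1))"
    "a3 \<in> dg_mor A X2 X3 r" "b3 \<in> dg_mor B Y2 Y3 r" "c3 \<in> carrier (grade (bf_ob M X2 Y3) (r - 1))"
    using fgh by (auto simp: X f)
  have idx: "r - 1 + (q + p) = r + q + p - 1" "r + (q + p - 1) = r + q + p - 1" "r + (q + p) - 1 = r + q + p - 1"
    "r + q - 1 + p = r + q + p - 1" "r - 1 + q = r + q - 1" "q - 1 + p = q + p - 1" "r + (q - 1) = r + q - 1"
    "q + (p - 1) = q + p - 1" "r + q + (p - 1) = r + q + p - 1" by simp_all
  let ?N = "grade (bf_ob M X0 Y3) (r + q + p - 1)"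
  define t1 where "t1 = right_act B M X0 X2 Y3 (r - 1) (q + p) c3 (dg_comp A X0 X1 X2 q p a2 a1)"
  define t2 where "t2 = left_act A M X0 Y2 Y3 r (q + p - 1) b3 (right_act B M X0 X1 Y2 (q - 1) p c2 a1)"
  define t3 where "t3 = left_act A M X0 Y2 Y3 r (q + p - 1) b3 (left_act A M X0 Y1 Y2 q (p - 1) b2 c1)"
  have t [simp]: "t1 \<in> carrier ?N" "t2 \<in> carrier ?N" "t3 \<in> carrier ?N"
    unfolding t1_def t2_def t3_def using ob abc by (auto intro!: left_closed right_closed A.comp_closed)
  note cl = ob abc left_closed right_closed M_group_closed signed_closed[OF M_module]
  have e1: "right_act B M X0 X1 Y3 (r + q - 1) p (right_act B M X1 X2 Y3 (r - 1) q c3 a2) a1 = t1"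
    using ob abc by (simp add: t1_def right_right[where t = "q + p"])
  have e2: "right_act B M X0 X1 Y3 (r + q - 1) p (left_act A M X1 Y2 Y3 r (q - 1) b3 c2) a1 = t2"
    using ob abc by (simp add: t2_def right_left[where t = "q + p - 1"])
  have e3: "left_act A M X0 Y1 Y3 (r + q) (p - 1) (dg_comp B Y1 Y2 Y3 r q b3 b2) c1 = t3"
    using ob abc by (simp add: t3_def left_left[where s = "q + p - 1"])
  have l: "left_act A M X0 Y2 Y3 r (q + p - 1) b3 (right_act B M X0 X1 Y2 (q - 1) p c2 a1
      \<oplus>\<^bsub>grade (bf_ob M X0 Y2) (q + p - 1)\<^esub> signed (grade (bf_ob M X0 Y2) (q + p - 1)) q (left_act A M X0 Y1 Y2 q (p - 1) b2 c1)) =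
      t2 \<oplus>\<^bsub>?N\<^esub> signed ?N q t3"
    unfolding t2_def t3_def by (cases "even q") (simp_all add: cl left_linear signed_simps idx)
  have rr: "right_act B M X0 X1 Y3 (r + q - 1) p (right_act B M X1 X2 Y3 (r - 1) q c3 a2
      \<oplus>\<^bsub>grade (bf_ob M X1 Y3) (r + q - 1)\<^esub> signed (grade (bf_ob M X1 Y3) (r + q - 1)) r (left_act A M X1 Y2 Y3 r (q - 1) b3 c2)) a1 =
      t1 \<oplus>\<^bsub>?N\<^esub> signed ?N r t2"
    unfolding e1[symmetric] e2[symmetric] by (cases "even r") (simp_all add: cl right_linear signed_simps idx)
  \<comment> \<open>The signs \<open>(-1)^r\<close> and \<open>(-1)^q\<close> of the nested
    composition combine to \<open>(-1)^(r+q)\<close>, the sign belonging to the product of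
    \<open>b3\<close> and \<open>b2\<close>.\<close>
  have "t1 \<oplus>\<^bsub>?N\<^esub> signed ?N r (t2 \<oplus>\<^bsub>?N\<^esub> signed ?N q t3) =
      t1 \<oplus>\<^bsub>?N\<^esub> signed ?N r t2 \<oplus>\<^bsub>?N\<^esub> signed ?N (r + q) t3"
    using ob by (cases "even r"; cases "even q") (simp_all add: M_group_simps signed_simps)
  then show "dg_comp GL W Y Z r (q + p) h (dg_comp GL W X Y q p g f) =
      dg_comp GL W X Z (r + q) p (dg_comp GL X Y Z r q h g) f"
    using ob abc l rr by (simp add: X f A.comp_assoc B.comp_assoc t1_def[symmetric] e3 idx)
next
  fix X assume "X \<in> dg_ob GL"
  then show "dg_id GL X \<in> cocycles (dg_hom GL X X) 0"
    using A.id_closed B.id_closed by (cases X)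
      (auto simp: cocycles_def M_group_closed M_diff_linear id_act M_group_simps)
next
  fix X Y f p assume "X \<in> dg_ob GL" "Y \<in> dg_ob GL" "f \<in> dg_mor GL X Y p"
  then show "dg_comp GL X Y Y 0 p (dg_id GL Y) f = f" "dg_comp GL X X Y p 0 f (dg_id GL X) = f"
    by (cases X; cases Y; cases f; auto simp: A.comp_id_left A.comp_id_right B.comp_id_left B.comp_id_right
        right_linear left_linear id_act signed_simps(1) signed_zero[OF M_module] M_group_simps(8,9))+
qed

end

section \<open>Finite sums in modules\<close>

text \<open>This interchange is the summation step in associativity of matrix products.\<close>

lemma (in abelian_monoid) finsum_swap:
  assumes "finite J" "finite K" "\<And>j k. \<lbrakk>j \<in> J; k \<in> K\<rbrakk> \<Longrightarrow> h j k \<in> carrier G"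
  shows "(\<Oplus>j\<in>J. \<Oplus>k\<in>K. h j k) = (\<Oplus>k\<in>K. \<Oplus>j\<in>J. h j k)"
  using assms(1,3)
proof (induction J rule: finite_induct)
  case empty
  then show ?case by simp
next
  case (insert x J)
  have "(\<Oplus>j\<in>insert x J. \<Oplus>k\<in>K. h j k) = (\<Oplus>k\<in>K. h x k) \<oplus> (\<Oplus>j\<in>J. \<Oplus>k\<in>K. h j k)"
    using insert by (intro finsum_insert) (auto intro!: finsum_closed)
  also have "\<dots> = (\<Oplus>k\<in>K. h x k) \<oplus> (\<Oplus>k\<in>K. \<Oplus>j\<in>J. h j k)"
    using insert by simp
  also have "\<dots> = (\<Oplus>k\<in>K. h x k \<oplus> (\<Oplus>j\<in>J. h j k))"
    using insert assms(2) by (intro finsum_addf[symmetric]) (auto intro!: finsum_closed)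
  also have "\<dots> = (\<Oplus>k\<in>K. \<Oplus>j\<in>insert x J. h j k)"
    using insert by (intro finsum_cong') (auto intro!: finsum_closed finsum_insert[symmetric])
  finally show ?case .
qed

lemma mod_hom_finsum:
  assumes M: "module R M" and N: "module R N" and F: "F \<in> mod_hom R M N"
    and "finite J" "\<And>j. j \<in> J \<Longrightarrow> h j \<in> carrier M"
  shows "F (finsum M h J) = finsum N (\<lambda>j. F (h j)) J"
proof -
  interpret M: module R M by fact
  interpret N: module R N by fact
  show ?thesis using assms(4,5)
  proof (induction J rule: finite_induct)
    case empty
    then show ?case by (simp add: mod_hom_zero[OF M N F])
  next
    case (insert x J)
    have "F (finsum M h (insert x J)) = F (h x \<oplus>\<^bsub>M\<^esub> finsum M h J)"
      using insert by (subst M.finsum_insert) auto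
    also have "\<dots> = F (h x) \<oplus>\<^bsub>N\<^esub> finsum N (\<lambda>j. F (h j)) J"
      using insert by (subst mod_hom_add[OF F]) (auto intro!: M.finsum_closed)
    also have "\<dots> = finsum N (\<lambda>j. F (h j)) (insert x J)"
      using insert mod_hom_closed[OF F] by (intro N.finsum_insert[symmetric]) auto
    finally show ?case .
  qed
qed

lemma signed_in_mod_hom: "module R N \<Longrightarrow> signed N n \<in> mod_hom R N N"
  using signed_mod_hom[of R N "\<lambda>x. x" N n] by (simp add: mod_hom_def)

section \<open>Matrices of morphisms\<close>

text \<open>The field \<open>tw_mat\<close> is left unrestricted, so that the calculus of matrices
  can be set up before any Maurer-Cartan equation is imposed.\<close>

definition tw_pre :: "('o, 'r, 'm) dgcat \<Rightarrow> ('o, 'm) twisted set" where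
  "tw_pre A = {E. \<forall>i < tw_len E. tw_obj E i \<in> dg_ob A}"

text \<open>The dg-category of formal sums of shifted objects, in which the twist is ignored. Its
  differential is the first summand of the differential of twisted complexes.\<close>

definition tw_free :: "('o, 'r, 'm) dgcat \<Rightarrow> (('o, 'm) twisted, 'r, nat \<Rightarrow> nat \<Rightarrow> 'm) dgcat" where
  "tw_free A = (pretr A)\<lparr>dg_ob := tw_pre A,
     dg_hom := \<lambda>E F. \<lparr>grade = tw_hom_module A E F, cdiff = tw_base_diff A E F\<rparr>\<rparr>"

lemma tw_free_simps [simp]:
  "dg_ob (tw_free A) = tw_pre A"
  "grade (dg_hom (tw_free A) E F) = tw_hom_module A E F"
  "cdiff (dg_hom (tw_free A) E F) = tw_base_diff A E F"
  "dg_comp (tw_free A) = tw_comp A"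
  "dg_id (tw_free A) = dg_id (pretr A)"
  by (simp_all add: tw_free_def pretr_def)

lemma tw_hom_module_simps [simp]:
  "carrier (tw_hom_module A E F n) =
    {f. (\<forall>i < tw_len E. \<forall>j < tw_len F. f i j \<in> carrier (tw_entry A n E F i j)) \<and> tw_matrix E F f = f}"
  "f \<oplus>\<^bsub>tw_hom_module A E F n\<^esub> g = tw_matrix E F (\<lambda>i j. f i j \<oplus>\<^bsub>tw_entry A n E F i j\<^esub> g i j)"
  "\<zero>\<^bsub>tw_hom_module A E F n\<^esub> = tw_matrix E F (\<lambda>i j. \<zero>\<^bsub>tw_entry A n E F i j\<^esub>)"
  "r \<odot>\<^bsub>tw_hom_module A E F n\<^esub> f = tw_matrix E F (\<lambda>i j. r \<odot>\<^bsub>tw_entry A n E F i j\<^esub> f i j)"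
  by (simp_all add: tw_hom_module_def)

lemma tw_matrix_apply [simp]: "\<lbrakk>i < tw_len E; j < tw_len F\<rbrakk> \<Longrightarrow> tw_matrix E F h i j = h i j"
  by (simp add: tw_matrix_def)

lemma tw_matrix_idem [simp]: "tw_matrix E F (tw_matrix E F h) = tw_matrix E F h"
  by (auto simp: tw_matrix_def fun_eq_iff)

lemma tw_matrix_cong:
  "(\<And>i j. \<lbrakk>i < tw_len E; j < tw_len F\<rbrakk> \<Longrightarrow> h i j = h' i j) \<Longrightarrow> tw_matrix E F h = tw_matrix E F h'"
  by (auto simp: tw_matrix_def fun_eq_iff)

text \<open>Matrices are functions on all pairs of naturals; only after both sides are normalised to
  \<open>undefined\<close> outside the range do equal entries give equal functions.\<close>

lemma tw_matrix_eqI: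
  "\<lbrakk>tw_matrix E F h = h; tw_matrix E F h' = h'; \<And>i j. \<lbrakk>i < tw_len E; j < tw_len F\<rbrakk> \<Longrightarrow> h i j = h' i j\<rbrakk> \<Longrightarrow> h = h'"
  using tw_matrix_cong by metis

lemma tw_hom_memI:
  "\<lbrakk>\<And>i j. \<lbrakk>i < tw_len E; j < tw_len F\<rbrakk> \<Longrightarrow> f i j \<in> carrier (tw_entry A n E F i j); tw_matrix E F f = f\<rbrakk> \<Longrightarrow>
    f \<in> carrier (tw_hom_module A E F n)"
  by simp

lemma tw_hom_memD:
  "\<lbrakk>f \<in> carrier (tw_hom_module A E F n); i < tw_len E; j < tw_len F\<rbrakk> \<Longrightarrow> f i j \<in> carrier (tw_entry A n E F i j)"
  by simp

context dg_category
begin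

lemma tw_entry_module: "\<lbrakk>E \<in> tw_pre A; F \<in> tw_pre A; i < tw_len E; j < tw_len F\<rbrakk> \<Longrightarrow> module R (tw_entry A n E F i j)"
  by (simp add: tw_entry_def tw_pre_def hom_module)

lemmas tw_entry_abelian_group = module_abelian_group[OF tw_entry_module]
lemmas tw_entry_group_closed = abelian_group.group_closed[OF tw_entry_abelian_group]
lemmas tw_entry_group_simps = abelian_group.group_simps[OF tw_entry_abelian_group]

lemma tw_hom_module_module:
  assumes EF: "E \<in> tw_pre A" "F \<in> tw_pre A"
  shows "module R (tw_hom_module A E F n)"
proof (rule moduleI)
  note [simp] = tw_entry_group_closed[OF EF] module.smult_closed[OF tw_entry_module[OF EF]]
  show "cring R" by (rule base_ring)
  show "abelian_group (tw_hom_module A E F n)"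
  proof (rule abelian_groupI)
    fix f assume f: "f \<in> carrier (tw_hom_module A E F n)"
    show "\<exists>g \<in> carrier (tw_hom_module A E F n). g \<oplus>\<^bsub>tw_hom_module A E F n\<^esub> f = \<zero>\<^bsub>tw_hom_module A E F n\<^esub>"
    proof (rule bexI)
      show "tw_matrix E F (\<lambda>i j. \<ominus>\<^bsub>tw_entry A n E F i j\<^esub> f i j) \<in> carrier (tw_hom_module A E F n)"
        using tw_hom_memD[OF f] by (intro tw_hom_memI) simp_all
      show "tw_matrix E F (\<lambda>i j. \<ominus>\<^bsub>tw_entry A n E F i j\<^esub> f i j) \<oplus>\<^bsub>tw_hom_module A E F n\<^esub> f = \<zero>\<^bsub>tw_hom_module A E F n\<^esub>"
        unfolding tw_hom_module_simps
        by (rule tw_matrix_cong) (simp add: abelian_group.l_neg[OF tw_entry_abelian_group[OF EF]] tw_hom_memD[OF f])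
    qed
  next
    fix f assume f: "f \<in> carrier (tw_hom_module A E F n)"
    show "\<zero>\<^bsub>tw_hom_module A E F n\<^esub> \<oplus>\<^bsub>tw_hom_module A E F n\<^esub> f = f"
      by (rule tw_matrix_eqI[of E F]) (use f in \<open>simp_all add: tw_entry_group_simps(8)[OF EF]\<close>)
  qed (auto intro!: tw_matrix_cong simp: tw_entry_group_simps(5-7)[OF EF])
next
  fix f assume f: "f \<in> carrier (tw_hom_module A E F n)"
  show "\<one>\<^bsub>R\<^esub> \<odot>\<^bsub>tw_hom_module A E F n\<^esub> f = f"
    by (rule tw_matrix_eqI[of E F]) (use f in \<open>simp_all add: module.smult_one[OF tw_entry_module[OF EF]]\<close>)
qed (auto intro!: tw_matrix_cong simp: module.smult_l_distr[OF tw_entry_module[OF EF]]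
    module.smult_r_distr[OF tw_entry_module[OF EF]] module.smult_assoc1[OF tw_entry_module[OF EF]]
    tw_entry_group_closed[OF EF] module.smult_closed[OF tw_entry_module[OF EF]] cring.cring_simprules[OF base_ring])

lemma tw_hom_neg:
  assumes EF: "E \<in> tw_pre A" "F \<in> tw_pre A" and f: "f \<in> carrier (tw_hom_module A E F n)"
  shows "\<ominus>\<^bsub>tw_hom_module A E F n\<^esub> f = tw_matrix E F (\<lambda>i j. \<ominus>\<^bsub>tw_entry A n E F i j\<^esub> f i j)"
proof -
  interpret N: module R "tw_hom_module A E F n" using EF by (rule tw_hom_module_module)
  show ?thesis
    by (rule N.minus_equality[OF _ f])
      (use f in \<open>auto intro!: tw_matrix_cong simp: abelian_group.l_neg[OF tw_entry_abelian_group[OF EF]] tw_entry_group_closed[OF EF]\<close>)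
qed

lemma tw_hom_signed:
  assumes "E \<in> tw_pre A" "F \<in> tw_pre A" "f \<in> carrier (tw_hom_module A E F n)" "i < tw_len E" "j < tw_len F"
  shows "signed (tw_hom_module A E F n) m f i j = signed (tw_entry A n E F i j) m (f i j)"
  using assms tw_hom_neg[OF assms(1-3)] by (simp add: signed_def)

text \<open>The shift of the middle summand \<open>j\<close> cancels in the sum of the two degrees,
  so the products for all \<open>j\<close> lie in one module and can be added.\<close>

lemma tw_term_bilinear:
  assumes "E \<in> tw_pre A" "F \<in> tw_pre A" "G \<in> tw_pre A" "i < tw_len E" "j < tw_len F" "k < tw_len G" "s = q + p"
  shows "bilinear_map R (tw_entry A q F G j k) (tw_entry A p E F i j) (tw_entry A s E G i k)
    (dg_comp A (tw_obj E i) (tw_obj F j) (tw_obj G k) (q + tw_deg G k - tw_deg F j) (p + tw_deg F j - tw_deg E i))"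
  using comp_bilinear[of "tw_obj E i" "tw_obj F j" "tw_obj G k" "q + tw_deg G k - tw_deg F j" "p + tw_deg F j - tw_deg E i"] assms
  by (simp add: tw_entry_def tw_pre_def algebra_simps)

abbreviation "tw_term E F G q p g f i j k \<equiv>
  dg_comp A (tw_obj E i) (tw_obj F j) (tw_obj G k) (q + tw_deg G k - tw_deg F j) (p + tw_deg F j - tw_deg E i) (g j k) (f i j)"

lemma tw_term_closed:
  assumes "E \<in> tw_pre A" "F \<in> tw_pre A" "G \<in> tw_pre A" "i < tw_len E" "j < tw_len F" "k < tw_len G"
    "g \<in> carrier (tw_hom_module A F G q)" "f \<in> carrier (tw_hom_module A E F p)" "s = q + p"
  shows "tw_term E F G q p g f i j k \<in> carrier (tw_entry A s E G i k)"
  using mod_hom_closed[OF bilinear_mapD(1)[OF tw_term_bilinear[OF assms(1-6,9)]], of "g j k" "f i j"] assms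
  by simp

lemma tw_comp_apply:
  assumes "i < tw_len E" "k < tw_len G"
  shows "tw_comp A E F G q p g f i k = (\<Oplus>\<^bsub>tw_entry A (q + p) E G i k\<^esub> j\<in>{..<tw_len F}. tw_term E F G q p g f i j k)"
  using assms by (simp add: tw_comp_def)

lemma tw_comp_matrix [simp]: "tw_matrix E G (tw_comp A E F G q p g f) = tw_comp A E F G q p g f"
  by (simp add: tw_comp_def)

lemma tw_comp_closed:
  assumes EFG: "E \<in> tw_pre A" "F \<in> tw_pre A" "G \<in> tw_pre A"
    and gf: "g \<in> carrier (tw_hom_module A F G q)" "f \<in> carrier (tw_hom_module A E F p)" and s: "s = q + p"
  shows "tw_comp A E F G q p g f \<in> carrier (tw_hom_module A E G s)"
proof (rule tw_hom_memI)
  fix i k assume ik: "i < tw_len E" "k < tw_len G"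
  interpret N: module R "tw_entry A (q + p) E G i k" using EFG ik by (intro tw_entry_module)
  show "tw_comp A E F G q p g f i k \<in> carrier (tw_entry A s E G i k)"
    unfolding s tw_comp_apply[OF ik] using tw_term_closed[OF EFG ik(1) _ ik(2) gf refl]
    by (intro N.finsum_closed) auto
qed simp

lemma tw_comp_bilinear:
  assumes EFG: "E \<in> tw_pre A" "F \<in> tw_pre A" "G \<in> tw_pre A"
  shows "bilinear_map R (tw_hom_module A F G q) (tw_hom_module A E F p) (tw_hom_module A E G (q + p)) (tw_comp A E F G q p)"
proof -
  interpret FG: module R "tw_hom_module A F G q" using EFG(2,3) by (rule tw_hom_module_module)
  interpret EF: module R "tw_hom_module A E F p" using EFG(1,2) by (rule tw_hom_module_module)
  interpret EG: module R "tw_hom_module A E G (q + p)" using EFG(1,3) by (rule tw_hom_module_module)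
  have bil: "bilinear_map R (tw_entry A q F G j k) (tw_entry A p E F i j) (tw_entry A (q + p) E G i k)
    (dg_comp A (tw_obj E i) (tw_obj F j) (tw_obj G k) (q + tw_deg G k - tw_deg F j) (p + tw_deg F j - tw_deg E i))"
    if "i < tw_len E" "j < tw_len F" "k < tw_len G" for i j k
    using EFG that by (intro tw_term_bilinear refl)
  show ?thesis
  proof (rule bilinear_mapI)
    fix g f assume "g \<in> carrier (tw_hom_module A F G q)" "f \<in> carrier (tw_hom_module A E F p)"
    then show "tw_comp A E F G q p g f \<in> carrier (tw_hom_module A E G (q + p))"
      using EFG by (intro tw_comp_closed) auto
  next
    fix g g' f
    assume gf: "g \<in> carrier (tw_hom_module A F G q)" "g' \<in> carrier (tw_hom_module A F G q)" "f \<in> carrier (tw_hom_module A E F p)"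
    show "tw_comp A E F G q p (g \<oplus>\<^bsub>tw_hom_module A F G q\<^esub> g') f =
        tw_comp A E F G q p g f \<oplus>\<^bsub>tw_hom_module A E G (q + p)\<^esub> tw_comp A E F G q p g' f"
    proof (rule tw_matrix_eqI[of E G])
      fix i k assume ik: "i < tw_len E" "k < tw_len G"
      interpret N: module R "tw_entry A (q + p) E G i k" using EFG ik by (intro tw_entry_module)
      have tc: "tw_term E F G q p g f i j k \<in> carrier (tw_entry A (q + p) E G i k)"
        "tw_term E F G q p g' f i j k \<in> carrier (tw_entry A (q + p) E G i k)" if "j < tw_len F" for j
        using tw_term_closed[OF EFG ik(1) that ik(2) gf(1,3) refl] tw_term_closed[OF EFG ik(1) that ik(2) gf(2,3) refl] by auto
      have "tw_comp A E F G q p (g \<oplus>\<^bsub>tw_hom_module A F G q\<^esub> g') f i k =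
          (\<Oplus>\<^bsub>tw_entry A (q + p) E G i k\<^esub> j\<in>{..<tw_len F}. tw_term E F G q p g f i j k \<oplus>\<^bsub>tw_entry A (q + p) E G i k\<^esub> tw_term E F G q p g' f i j k)"
        unfolding tw_comp_apply[OF ik]
      proof (intro N.finsum_cong' refl Pi_I)
        fix j assume "j \<in> {..<tw_len F}"
        then show "tw_term E F G q p (g \<oplus>\<^bsub>tw_hom_module A F G q\<^esub> g') f i j k =
            tw_term E F G q p g f i j k \<oplus>\<^bsub>tw_entry A (q + p) E G i k\<^esub> tw_term E F G q p g' f i j k"
          using mod_hom_add[OF bilinear_mapD(2)[OF bil[OF ik(1) _ ik(2)]], of j "f i j" "g j k" "g' j k"] ik gf by simp
      qed (use tc in simp)
      also have "\<dots> = tw_comp A E F G q p g f i k \<oplus>\<^bsub>tw_entry A (q + p) E G i k\<^esub> tw_comp A E F G q p g' f i k"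
        unfolding tw_comp_apply[OF ik] by (intro N.finsum_addf) (use tc in auto)
      finally show "tw_comp A E F G q p (g \<oplus>\<^bsub>tw_hom_module A F G q\<^esub> g') f i k =
          (tw_comp A E F G q p g f \<oplus>\<^bsub>tw_hom_module A E G (q + p)\<^esub> tw_comp A E F G q p g' f) i k"
        using ik by simp
    qed simp_all
  next
    fix g f f'
    assume gf: "g \<in> carrier (tw_hom_module A F G q)" "f \<in> carrier (tw_hom_module A E F p)" "f' \<in> carrier (tw_hom_module A E F p)"
    show "tw_comp A E F G q p g (f \<oplus>\<^bsub>tw_hom_module A E F p\<^esub> f') =
        tw_comp A E F G q p g f \<oplus>\<^bsub>tw_hom_module A E G (q + p)\<^esub> tw_comp A E F G q p g f'"
    proof (rule tw_matrix_eqI[of E G])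
      fix i k assume ik: "i < tw_len E" "k < tw_len G"
      interpret N: module R "tw_entry A (q + p) E G i k" using EFG ik by (intro tw_entry_module)
      have tc: "tw_term E F G q p g f i j k \<in> carrier (tw_entry A (q + p) E G i k)"
        "tw_term E F G q p g f' i j k \<in> carrier (tw_entry A (q + p) E G i k)" if "j < tw_len F" for j
        using tw_term_closed[OF EFG ik(1) that ik(2) gf(1,2) refl] tw_term_closed[OF EFG ik(1) that ik(2) gf(1,3) refl] by auto
      have "tw_comp A E F G q p g (f \<oplus>\<^bsub>tw_hom_module A E F p\<^esub> f') i k =
          (\<Oplus>\<^bsub>tw_entry A (q + p) E G i k\<^esub> j\<in>{..<tw_len F}. tw_term E F G q p g f i j k \<oplus>\<^bsub>tw_entry A (q + p) E G i k\<^esub> tw_term E F G q p g f' i j k)"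
        unfolding tw_comp_apply[OF ik]
      proof (intro N.finsum_cong' refl Pi_I)
        fix j assume "j \<in> {..<tw_len F}"
        then show "tw_term E F G q p g (f \<oplus>\<^bsub>tw_hom_module A E F p\<^esub> f') i j k =
            tw_term E F G q p g f i j k \<oplus>\<^bsub>tw_entry A (q + p) E G i k\<^esub> tw_term E F G q p g f' i j k"
          using mod_hom_add[OF bilinear_mapD(1)[OF bil[OF ik(1) _ ik(2)]], of j "g j k" "f i j" "f' i j"] ik gf by simp
      qed (use tc in simp)
      also have "\<dots> = tw_comp A E F G q p g f i k \<oplus>\<^bsub>tw_entry A (q + p) E G i k\<^esub> tw_comp A E F G q p g f' i k"
        unfolding tw_comp_apply[OF ik] by (intro N.finsum_addf) (use tc in auto)
      finally show "tw_comp A E F G q p g (f \<oplus>\<^bsub>tw_hom_module A E F p\<^esub> f') i k =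
          (tw_comp A E F G q p g f \<oplus>\<^bsub>tw_hom_module A E G (q + p)\<^esub> tw_comp A E F G q p g f') i k"
        using ik by simp
    qed simp_all
  next
    fix r g f
    assume gf: "r \<in> carrier R" "g \<in> carrier (tw_hom_module A F G q)" "f \<in> carrier (tw_hom_module A E F p)"
    have eq: "(\<Oplus>\<^bsub>tw_entry A (q + p) E G i k\<^esub> j\<in>{..<tw_len F}. r \<odot>\<^bsub>tw_entry A (q + p) E G i k\<^esub> tw_term E F G q p g f i j k) =
        (r \<odot>\<^bsub>tw_hom_module A E G (q + p)\<^esub> tw_comp A E F G q p g f) i k" if ik: "i < tw_len E" "k < tw_len G" for i k
    proof -
      interpret N: module R "tw_entry A (q + p) E G i k" using EFG ik by (intro tw_entry_module)
      have "tw_term E F G q p g f i j k \<in> carrier (tw_entry A (q + p) E G i k)" if "j < tw_len F" for j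
        using tw_term_closed[OF EFG ik(1) that ik(2) gf(2,3) refl] .
      then show ?thesis using ik gf(1)
        by (simp add: tw_comp_apply) (intro N.finsum_smult_ldistr[symmetric]; simp)
    qed
    show "tw_comp A E F G q p (r \<odot>\<^bsub>tw_hom_module A F G q\<^esub> g) f = r \<odot>\<^bsub>tw_hom_module A E G (q + p)\<^esub> tw_comp A E F G q p g f"
    proof (rule tw_matrix_eqI[of E G])
      fix i k assume ik: "i < tw_len E" "k < tw_len G"
      interpret N: module R "tw_entry A (q + p) E G i k" using EFG ik by (intro tw_entry_module)
      show "tw_comp A E F G q p (r \<odot>\<^bsub>tw_hom_module A F G q\<^esub> g) f i k =
          (r \<odot>\<^bsub>tw_hom_module A E G (q + p)\<^esub> tw_comp A E F G q p g f) i k"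
        unfolding eq[OF ik, symmetric] tw_comp_apply[OF ik]
      proof (intro N.finsum_cong' refl Pi_I)
        fix j assume "j \<in> {..<tw_len F}"
        then show "tw_term E F G q p (r \<odot>\<^bsub>tw_hom_module A F G q\<^esub> g) f i j k = r \<odot>\<^bsub>tw_entry A (q + p) E G i k\<^esub> tw_term E F G q p g f i j k"
          using mod_hom_smult[OF bilinear_mapD(2)[OF bil[OF ik(1) _ ik(2)]], of j "f i j" r "g j k"] ik gf by simp
      next
        fix j assume "j \<in> {..<tw_len F}"
        then show "r \<odot>\<^bsub>tw_entry A (q + p) E G i k\<^esub> tw_term E F G q p g f i j k \<in> carrier (tw_entry A (q + p) E G i k)"
          using tw_term_closed[OF EFG ik(1) _ ik(2) gf(2,3) refl] gf(1) by simp
      qed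
    qed simp_all
    show "tw_comp A E F G q p g (r \<odot>\<^bsub>tw_hom_module A E F p\<^esub> f) = r \<odot>\<^bsub>tw_hom_module A E G (q + p)\<^esub> tw_comp A E F G q p g f"
    proof (rule tw_matrix_eqI[of E G])
      fix i k assume ik: "i < tw_len E" "k < tw_len G"
      interpret N: module R "tw_entry A (q + p) E G i k" using EFG ik by (intro tw_entry_module)
      show "tw_comp A E F G q p g (r \<odot>\<^bsub>tw_hom_module A E F p\<^esub> f) i k =
          (r \<odot>\<^bsub>tw_hom_module A E G (q + p)\<^esub> tw_comp A E F G q p g f) i k"
        unfolding eq[OF ik, symmetric] tw_comp_apply[OF ik]
      proof (intro N.finsum_cong' refl Pi_I)
        fix j assume "j \<in> {..<tw_len F}"
        then show "tw_term E F G q p g (r \<odot>\<^bsub>tw_hom_module A E F p\<^esub> f) i j k = r \<odot>\<^bsub>tw_entry A (q + p) E G i k\<^esub> tw_term E F G q p g f i j k"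
          using mod_hom_smult[OF bilinear_mapD(1)[OF bil[OF ik(1) _ ik(2)]], of j "g j k" r "f i j"] ik gf by simp
      next
        fix j assume "j \<in> {..<tw_len F}"
        then show "r \<odot>\<^bsub>tw_entry A (q + p) E G i k\<^esub> tw_term E F G q p g f i j k \<in> carrier (tw_entry A (q + p) E G i k)"
          using tw_term_closed[OF EFG ik(1) _ ik(2) gf(2,3) refl] gf(1) by simp
      qed
    qed simp_all
  qed
qed

end

context dg_category
begin

lemma tw_comp_assoc:
  assumes EFGH: "E \<in> tw_pre A" "F \<in> tw_pre A" "G \<in> tw_pre A" "H \<in> tw_pre A"
    and f: "f \<in> carrier (tw_hom_module A E F p)" and g: "g \<in> carrier (tw_hom_module A F G q)"
    and h: "h \<in> carrier (tw_hom_module A G H r)"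
  shows "tw_comp A E G H r (q + p) h (tw_comp A E F G q p g f) = tw_comp A E F H (r + q) p (tw_comp A F G H r q h g) f"
proof (rule tw_matrix_eqI[of E H])
  fix i l assume il: "i < tw_len E" "l < tw_len H"
  let ?N = "tw_entry A (r + (q + p)) E H i l"
  have N': "?N = tw_entry A (r + q + p) E H i l" by (simp add: add.assoc)
  interpret N: module R ?N using EFGH il by (intro tw_entry_module)
  \<comment> \<open>\<open>t\<close> and \<open>t'\<close> are the two bracketings of the triple
    product through \<open>j\<close> and \<open>k\<close>; linearity turns both sides into double
    sums of them, in opposite orders of summation.\<close>
  define t where "t j k = dg_comp A (tw_obj E i) (tw_obj G k) (tw_obj H l) (r + tw_deg H l - tw_deg G k) (q + p + tw_deg G k - tw_deg E i)
    (h k l) (tw_term E F G q p g f i j k)" for j k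
  define t' where "t' j k = dg_comp A (tw_obj E i) (tw_obj F j) (tw_obj H l) (r + q + tw_deg H l - tw_deg F j) (p + tw_deg F j - tw_deg E i)
    (tw_term F G H r q h g j k l) (f i j)" for j k
  have h1: "dg_comp A (tw_obj E i) (tw_obj G k) (tw_obj H l) (r + tw_deg H l - tw_deg G k) (q + p + tw_deg G k - tw_deg E i) (h k l)
      \<in> mod_hom R (tw_entry A (q + p) E G i k) ?N" if "k < tw_len G" for k
    by (rule bilinear_mapD(1)[OF tw_term_bilinear]) (use EFGH il that h in auto)
  have f1: "(\<lambda>x. dg_comp A (tw_obj E i) (tw_obj F j) (tw_obj H l) (r + q + tw_deg H l - tw_deg F j) (p + tw_deg F j - tw_deg E i) x (f i j))
      \<in> mod_hom R (tw_entry A (r + q) F H j l) ?N" if "j < tw_len F" for j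
    by (rule bilinear_mapD(2)[OF tw_term_bilinear]) (use EFGH il that f in auto)
  have tgf: "tw_term E F G q p g f i j k \<in> carrier (tw_entry A (q + p) E G i k)" if "j < tw_len F" "k < tw_len G" for j k
    using tw_term_closed[OF EFGH(1-3) il(1) that g f refl] .
  have thg: "tw_term F G H r q h g j k l \<in> carrier (tw_entry A (r + q) F H j l)" if "j < tw_len F" "k < tw_len G" for j k
    using tw_term_closed[OF EFGH(2-4) that il(2) h g refl] .
  have tt: "t j k = t' j k" if "j < tw_len F" "k < tw_len G" for j k
    using comp_assoc[of "tw_obj E i" "tw_obj F j" "tw_obj G k" "tw_obj H l" "f i j" "p + tw_deg F j - tw_deg E i"
        "g j k" "q + tw_deg G k - tw_deg F j" "h k l" "r + tw_deg H l - tw_deg G k"] EFGH il that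
      tw_hom_memD[OF f il(1) that(1)] tw_hom_memD[OF g that] tw_hom_memD[OF h that(2) il(2)]
    by (simp add: t_def t'_def tw_pre_def tw_entry_def algebra_simps)
  have t: "t j k \<in> carrier ?N" if "j < tw_len F" "k < tw_len G" for j k
    unfolding t_def using mod_hom_closed[OF h1] tgf that by blast
  have "tw_comp A E G H r (q + p) h (tw_comp A E F G q p g f) i l = (\<Oplus>\<^bsub>?N\<^esub> k\<in>{..<tw_len G}. \<Oplus>\<^bsub>?N\<^esub> j\<in>{..<tw_len F}. t j k)"
    unfolding tw_comp_apply[OF il]
  proof (intro N.finsum_cong' refl Pi_I)
    fix k assume "k \<in> {..<tw_len G}"
    then have k: "k < tw_len G" by simp
    show "tw_term E G H r (q + p) h (tw_comp A E F G q p g f) i k l = (\<Oplus>\<^bsub>?N\<^esub> j\<in>{..<tw_len F}. t j k)"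
      using mod_hom_finsum[OF tw_entry_module[OF EFGH(1,3) il(1) k] N.is_module h1[OF k], of "{..<tw_len F}" "\<lambda>j. tw_term E F G q p g f i j k"] k il tgf
      by (simp add: tw_comp_apply t_def)
  qed (use t in \<open>auto intro!: N.finsum_closed\<close>)
  also have "\<dots> = (\<Oplus>\<^bsub>?N\<^esub> j\<in>{..<tw_len F}. \<Oplus>\<^bsub>?N\<^esub> k\<in>{..<tw_len G}. t j k)"
    by (rule N.finsum_swap) (use t in auto)
  also have "\<dots> = tw_comp A E F H (r + q) p (tw_comp A F G H r q h g) f i l"
    unfolding tw_comp_apply[OF il] N'[symmetric]
  proof (intro N.finsum_cong'[symmetric] refl Pi_I)
    fix j assume "j \<in> {..<tw_len F}"
    then have j: "j < tw_len F" by simp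
    have "tw_term E F H (r + q) p (tw_comp A F G H r q h g) f i j l = (\<Oplus>\<^bsub>?N\<^esub> k\<in>{..<tw_len G}. t' j k)"
      using mod_hom_finsum[OF tw_entry_module[OF EFGH(2,4) j il(2)] N.is_module f1[OF j], of "{..<tw_len G}" "\<lambda>k. tw_term F G H r q h g j k l"] j il thg
      by (simp add: tw_comp_apply t'_def)
    also have "\<dots> = (\<Oplus>\<^bsub>?N\<^esub> k\<in>{..<tw_len G}. t j k)"
      by (rule N.finsum_cong') (use j t tt in auto)
    finally show "tw_term E F H (r + q) p (tw_comp A F G H r q h g) f i j l = (\<Oplus>\<^bsub>?N\<^esub> k\<in>{..<tw_len G}. t j k)" .
  qed (use t in \<open>auto intro!: N.finsum_closed\<close>)
  finally show "tw_comp A E G H r (q + p) h (tw_comp A E F G q p g f) i l = tw_comp A E F H (r + q) p (tw_comp A F G H r q h g) f i l" .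
qed simp_all

lemma tw_base_diff_apply:
  "\<lbrakk>i < tw_len E; j < tw_len F\<rbrakk> \<Longrightarrow> tw_base_diff A E F n f i j =
    signed (tw_entry A (n + 1) E F i j) (tw_deg F j) (cdiff (dg_hom A (tw_obj E i) (tw_obj F j)) (n + tw_deg F j - tw_deg E i) (f i j))"
  by (simp add: tw_base_diff_def)

lemma tw_base_diff_matrix [simp]: "tw_matrix E F (tw_base_diff A E F n f) = tw_base_diff A E F n f"
  by (simp add: tw_base_diff_def)

lemma tw_entry_diff_mod_hom:
  assumes "E \<in> tw_pre A" "F \<in> tw_pre A" "i < tw_len E" "j < tw_len F"
  shows "cdiff (dg_hom A (tw_obj E i) (tw_obj F j)) (n + tw_deg F j - tw_deg E i) \<in>
    mod_hom R (tw_entry A n E F i j) (tw_entry A (n + 1) E F i j)"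
  using diff_mod_hom[of "tw_obj E i" "tw_obj F j" "n + tw_deg F j - tw_deg E i"] assms
  by (simp add: tw_entry_def tw_pre_def algebra_simps)

lemma tw_free_complex:
  assumes EF: "E \<in> tw_pre A" "F \<in> tw_pre A"
  shows "cochain_complex R (dg_hom (tw_free A) E F)"
  unfolding cochain_complex_def tw_free_simps
proof (intro conjI allI ballI)
  fix n
  show "module R (tw_hom_module A E F n)" using EF by (rule tw_hom_module_module)
  note D = tw_entry_diff_mod_hom[OF EF] and M = tw_entry_module[OF EF]
  note S = signed_mod_hom[OF M D]
  have S': "(\<lambda>x. signed (tw_entry A (n + 1) E F i j) (tw_deg F j) (cdiff (dg_hom A (tw_obj E i) (tw_obj F j)) (n + tw_deg F j - tw_deg E i) x))
      \<in> mod_hom R (tw_entry A n E F i j) (tw_entry A (n + 1) E F i j)" if "i < tw_len E" "j < tw_len F" for i j n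
    using that by (intro S)
  have cl: "tw_base_diff A E F n f \<in> carrier (tw_hom_module A E F (n + 1))" if f: "f \<in> carrier (tw_hom_module A E F n)" for f
    by (rule tw_hom_memI) (use mod_hom_closed[OF S'] tw_hom_memD[OF f] in \<open>simp_all add: tw_base_diff_apply\<close>)
  show "tw_base_diff A E F n \<in> mod_hom R (tw_hom_module A E F n) (tw_hom_module A E F (n + 1))"
  proof (rule mod_homI)
    fix f g assume f: "f \<in> carrier (tw_hom_module A E F n)" and g: "g \<in> carrier (tw_hom_module A E F n)"
    show "tw_base_diff A E F n (f \<oplus>\<^bsub>tw_hom_module A E F n\<^esub> g) =
        tw_base_diff A E F n f \<oplus>\<^bsub>tw_hom_module A E F (n + 1)\<^esub> tw_base_diff A E F n g"
      by (rule tw_matrix_eqI[of E F])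
        (use mod_hom_add[OF S'] tw_hom_memD[OF f] tw_hom_memD[OF g] in \<open>simp_all add: tw_base_diff_apply\<close>)
  next
    fix r f assume r: "r \<in> carrier R" and f: "f \<in> carrier (tw_hom_module A E F n)"
    show "tw_base_diff A E F n (r \<odot>\<^bsub>tw_hom_module A E F n\<^esub> f) = r \<odot>\<^bsub>tw_hom_module A E F (n + 1)\<^esub> tw_base_diff A E F n f"
      by (rule tw_matrix_eqI[of E F])
        (use mod_hom_smult[OF S'] tw_hom_memD[OF f] r in \<open>simp_all add: tw_base_diff_apply\<close>)
  qed (fact cl)
  fix f assume f: "f \<in> carrier (tw_hom_module A E F n)"
  show "tw_base_diff A E F (n + 1) (tw_base_diff A E F n f) = \<zero>\<^bsub>tw_hom_module A E F (n + 2)\<^esub>"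
  proof (rule tw_matrix_eqI[of E F])
    fix i j assume ij: "i < tw_len E" "j < tw_len F"
    let ?d = "\<lambda>n. cdiff (dg_hom A (tw_obj E i) (tw_obj F j)) (n + tw_deg F j - tw_deg E i)"
    have "?d (n + 1) (?d n (f i j)) = \<zero>\<^bsub>tw_entry A (n + 2) E F i j\<^esub>"
      using diff_diff[of "tw_obj E i" "tw_obj F j" "f i j" "n + tw_deg F j - tw_deg E i" "n + 1 + tw_deg F j - tw_deg E i"]
        tw_hom_memD[OF f ij] EF ij by (simp add: tw_entry_def tw_pre_def algebra_simps)
    moreover have "?d (n + 1) (signed (tw_entry A (n + 1) E F i j) (tw_deg F j) (?d n (f i j))) =
        signed (tw_entry A (n + 1 + 1) E F i j) (tw_deg F j) (?d (n + 1) (?d n (f i j)))"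
      using ij mod_hom_closed[OF D tw_hom_memD[OF f]] by (intro mod_hom_signed[OF M M D]) auto
    ultimately show "tw_base_diff A E F (n + 1) (tw_base_diff A E F n f) i j = \<zero>\<^bsub>tw_hom_module A E F (n + 2)\<^esub> i j"
      using ij by (simp add: tw_base_diff_apply signed_zero[OF M] add.commute[of 2 n])
  qed simp_all
qed

text \<open>An entry is differentiated with the sign of its target shift. In the term with
  \<open>df\<close> the sign \<open>(-1)^(s_k)\<close> of the target meets
  \<open>(-1)^(q + s_k - s_j)\<close> from the degree of the entry of \<open>g\<close>. What remains
  is \<open>(-1)^q (-1)^(s_j)\<close>, and \<open>(-1)^(s_j)\<close> is exactly the sign in the
  differential of \<open>f\<close>.\<close>

lemma tw_base_diff_leibniz:
  assumes EFG: "E \<in> tw_pre A" "F \<in> tw_pre A" "G \<in> tw_pre A"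
    and f: "f \<in> carrier (tw_hom_module A E F p)" and g: "g \<in> carrier (tw_hom_module A F G q)"
  shows "tw_base_diff A E G (q + p) (tw_comp A E F G q p g f) =
    tw_comp A E F G (q + 1) p (tw_base_diff A F G q g) f \<oplus>\<^bsub>tw_hom_module A E G (q + p + 1)\<^esub>
    signed (tw_hom_module A E G (q + p + 1)) q (tw_comp A E F G q (p + 1) g (tw_base_diff A E F p f))"
proof (rule tw_matrix_eqI[of E G])
  have df: "tw_base_diff A E F p f \<in> carrier (tw_hom_module A E F (p + 1))"
    and dg: "tw_base_diff A F G q g \<in> carrier (tw_hom_module A F G (q + 1))"
    using mod_hom_closed[OF complex_of_modules.diff_hom[of R "dg_hom (tw_free A) E F" p], of f]
      mod_hom_closed[OF complex_of_modules.diff_hom[of R "dg_hom (tw_free A) F G" q], of g]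
      tw_free_complex EFG f g by (simp_all add: complex_of_modules_def del: tw_hom_module_simps)
  have gdf: "tw_comp A E F G q (p + 1) g (tw_base_diff A E F p f) \<in> carrier (tw_hom_module A E G (q + p + 1))"
    using EFG g df by (intro tw_comp_closed) auto
  fix i k assume ik: "i < tw_len E" "k < tw_len G"
  let ?N = "tw_entry A (q + p + 1) E G i k" and ?L = "tw_entry A (q + p) E G i k"
  interpret N: module R ?N using EFG ik by (intro tw_entry_module)
  interpret L: module R ?L using EFG ik by (intro tw_entry_module)
  let ?D = "\<lambda>x. signed ?N (tw_deg G k) (cdiff (dg_hom A (tw_obj E i) (tw_obj G k)) (q + p + tw_deg G k - tw_deg E i) x)"
  have D: "?D \<in> mod_hom R ?L ?N"
    by (rule signed_mod_hom[OF N.is_module tw_entry_diff_mod_hom[OF EFG(1,3) ik, of "q + p"]])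
  have t: "tw_term E F G q p g f i j k \<in> carrier ?L"
    and t1: "tw_term E F G (q + 1) p (tw_base_diff A F G q g) f i j k \<in> carrier ?N"
    and t2: "tw_term E F G q (p + 1) g (tw_base_diff A E F p f) i j k \<in> carrier ?N" if "j < tw_len F" for j
    using tw_term_closed[OF EFG ik(1) that ik(2) g f refl] tw_term_closed[OF EFG ik(1) that ik(2) dg f, of "q + p + 1"]
      tw_term_closed[OF EFG ik(1) that ik(2) g df, of "q + p + 1"] by simp_all
  have t2': "signed ?N q (tw_term E F G q (p + 1) g (tw_base_diff A E F p f) i j k) \<in> carrier ?N" if "j < tw_len F" for j
    using signed_closed[OF N.is_module] t2 that by blast
  have main: "?D (tw_term E F G q p g f i j k) =
      tw_term E F G (q + 1) p (tw_base_diff A F G q g) f i j k \<oplus>\<^bsub>?N\<^esub>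
      signed ?N q (tw_term E F G q (p + 1) g (tw_base_diff A E F p f) i j k)" if j: "j < tw_len F" for j
  proof -
    let ?c = "\<lambda>q p. dg_comp A (tw_obj E i) (tw_obj F j) (tw_obj G k) (q + tw_deg G k - tw_deg F j) (p + tw_deg F j - tw_deg E i)"
    let ?dg = "cdiff (dg_hom A (tw_obj F j) (tw_obj G k)) (q + tw_deg G k - tw_deg F j) (g j k)"
    let ?df = "cdiff (dg_hom A (tw_obj E i) (tw_obj F j)) (p + tw_deg F j - tw_deg E i) (f i j)"
    have ob: "tw_obj E i \<in> dg_ob A" "tw_obj F j \<in> dg_ob A" "tw_obj G k \<in> dg_ob A"
      using EFG ik j by (auto simp: tw_pre_def)
    have dg': "?dg \<in> carrier (tw_entry A (q + 1) F G j k)" and df': "?df \<in> carrier (tw_entry A (p + 1) E F i j)"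
      using mod_hom_closed[OF tw_entry_diff_mod_hom[OF EFG(2,3) j ik(2)] tw_hom_memD[OF g j ik(2)]]
        mod_hom_closed[OF tw_entry_diff_mod_hom[OF EFG(1,2) ik(1) j] tw_hom_memD[OF f ik(1) j]] by simp_all
    have b1: "(\<lambda>x. ?c (q + 1) p x (f i j)) \<in> mod_hom R (tw_entry A (q + 1) F G j k) ?N"
      by (rule bilinear_mapD(2)[OF tw_term_bilinear]) (use EFG ik j f in auto)
    have b2: "?c q (p + 1) (g j k) \<in> mod_hom R (tw_entry A (p + 1) E F i j) ?N"
      by (rule bilinear_mapD(1)[OF tw_term_bilinear]) (use EFG ik j g in auto)
    have c: "?c (q + 1) p ?dg (f i j) \<in> carrier ?N" "?c q (p + 1) (g j k) ?df \<in> carrier ?N"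
      using mod_hom_closed[OF b1 dg'] mod_hom_closed[OF b2 df'] .
    have "cdiff (dg_hom A (tw_obj E i) (tw_obj G k)) (q + p + tw_deg G k - tw_deg E i) (?c q p (g j k) (f i j)) =
        ?c (q + 1) p ?dg (f i j) \<oplus>\<^bsub>?N\<^esub> signed ?N (q + tw_deg G k - tw_deg F j) (?c q (p + 1) (g j k) ?df)"
    proof -
      have idx: "q + tw_deg G k - tw_deg F j + (p + tw_deg F j - tw_deg E i) = q + p + tw_deg G k - tw_deg E i"
        "q + p + tw_deg G k - tw_deg E i + 1 = q + p + 1 + tw_deg G k - tw_deg E i"
        "q + tw_deg G k - tw_deg F j + 1 = q + 1 + tw_deg G k - tw_deg F j"
        "p + tw_deg F j - tw_deg E i + 1 = p + 1 + tw_deg F j - tw_deg E i" by simp_all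
      show ?thesis
        using leibniz[of "tw_obj E i" "tw_obj F j" "tw_obj G k" "f i j" "p + tw_deg F j - tw_deg E i" "g j k" "q + tw_deg G k - tw_deg F j"]
          ob tw_hom_memD[OF f ik(1) j] tw_hom_memD[OF g j ik(2)] unfolding tw_entry_def idx by blast
    qed
    then have "?D (?c q p (g j k) (f i j)) = signed ?N (tw_deg G k) (?c (q + 1) p ?dg (f i j)) \<oplus>\<^bsub>?N\<^esub>
        signed ?N (tw_deg G k + (q + tw_deg G k - tw_deg F j)) (?c q (p + 1) (g j k) ?df)"
      using c mod_hom_add[OF signed_in_mod_hom[OF N.is_module]] by (simp add: signed_closed[OF N.is_module] signed_signed[OF N.is_module])
    also have "signed ?N (tw_deg G k) (?c (q + 1) p ?dg (f i j)) = ?c (q + 1) p (tw_base_diff A F G q g j k) (f i j)"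
      using mod_hom_signed[OF tw_entry_module[OF EFG(2,3) j ik(2)] N.is_module b1 dg'] ik j by (simp add: tw_base_diff_apply)
    also have "signed ?N (tw_deg G k + (q + tw_deg G k - tw_deg F j)) (?c q (p + 1) (g j k) ?df) =
        signed ?N (q + tw_deg F j) (?c q (p + 1) (g j k) ?df)"
      by (rule signed_cong) auto
    also have "\<dots> = signed ?N q (?c q (p + 1) (g j k) (tw_base_diff A E F p f i j))"
      using mod_hom_signed[OF tw_entry_module[OF EFG(1,2) ik(1) j] N.is_module b2 df'] ik j c
      by (simp add: tw_base_diff_apply signed_signed[OF N.is_module])
    finally show ?thesis .
  qed
  have "tw_base_diff A E G (q + p) (tw_comp A E F G q p g f) i k =
      (\<Oplus>\<^bsub>?N\<^esub> j\<in>{..<tw_len F}. ?D (tw_term E F G q p g f i j k))"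
    using mod_hom_finsum[OF L.is_module N.is_module D, of "{..<tw_len F}" "\<lambda>j. tw_term E F G q p g f i j k"] ik t
    by (simp add: tw_base_diff_apply tw_comp_apply)
  also have "\<dots> = (\<Oplus>\<^bsub>?N\<^esub> j\<in>{..<tw_len F}. tw_term E F G (q + 1) p (tw_base_diff A F G q g) f i j k \<oplus>\<^bsub>?N\<^esub>
      signed ?N q (tw_term E F G q (p + 1) g (tw_base_diff A E F p f) i j k))"
    by (rule N.finsum_cong') (use main t1 t2' in auto)
  also have "\<dots> = (\<Oplus>\<^bsub>?N\<^esub> j\<in>{..<tw_len F}. tw_term E F G (q + 1) p (tw_base_diff A F G q g) f i j k) \<oplus>\<^bsub>?N\<^esub>
      (\<Oplus>\<^bsub>?N\<^esub> j\<in>{..<tw_len F}. signed ?N q (tw_term E F G q (p + 1) g (tw_base_diff A E F p f) i j k))"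
    by (rule N.finsum_addf) (use t1 t2' in auto)
  also have "(\<Oplus>\<^bsub>?N\<^esub> j\<in>{..<tw_len F}. signed ?N q (tw_term E F G q (p + 1) g (tw_base_diff A E F p f) i j k)) =
      signed ?N q (\<Oplus>\<^bsub>?N\<^esub> j\<in>{..<tw_len F}. tw_term E F G q (p + 1) g (tw_base_diff A E F p f) i j k)"
    by (rule mod_hom_finsum[OF N.is_module N.is_module signed_in_mod_hom[OF N.is_module], symmetric]) (use t2 in auto)
  also have "(\<Oplus>\<^bsub>?N\<^esub> j\<in>{..<tw_len F}. tw_term E F G (q + 1) p (tw_base_diff A F G q g) f i j k) =
      tw_comp A E F G (q + 1) p (tw_base_diff A F G q g) f i k"
    using ik by (simp add: tw_comp_apply algebra_simps)
  also have "(\<Oplus>\<^bsub>?N\<^esub> j\<in>{..<tw_len F}. tw_term E F G q (p + 1) g (tw_base_diff A E F p f) i j k) =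
      tw_comp A E F G q (p + 1) g (tw_base_diff A E F p f) i k"
    using ik by (simp add: tw_comp_apply algebra_simps)
  finally show "tw_base_diff A E G (q + p) (tw_comp A E F G q p g f) i k =
    (tw_comp A E F G (q + 1) p (tw_base_diff A F G q g) f \<oplus>\<^bsub>tw_hom_module A E G (q + p + 1)\<^esub>
    signed (tw_hom_module A E G (q + p + 1)) q (tw_comp A E F G q (p + 1) g (tw_base_diff A E F p f))) i k"
    using ik tw_hom_signed[OF EFG(1,3) gdf ik] by simp
qed simp_all

end

declare tw_hom_module_simps [simp del]

context dg_category
begin

lemma tw_comp_apply':
  assumes "i < tw_len E" "k < tw_len G" "s = q + p"
  shows "tw_comp A E F G q p g f i k = (\<Oplus>\<^bsub>tw_entry A s E G i k\<^esub> j\<in>{..<tw_len F}. tw_term E F G q p g f i j k)"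
  using tw_comp_apply[OF assms(1,2)] assms(3) by simp

lemma tw_id_apply:
  "\<lbrakk>i < tw_len E; j < tw_len E\<rbrakk> \<Longrightarrow> dg_id (pretr A) E i j = (if i = j then dg_id A (tw_obj E i) else \<zero>\<^bsub>tw_entry A 0 E E i j\<^esub>)"
  by (simp add: pretr_def)

lemma tw_id_matrix [simp]: "tw_matrix E E (dg_id (pretr A) E) = dg_id (pretr A) E"
  by (simp add: pretr_def)

lemma id_degree_zero: "X \<in> dg_ob A \<Longrightarrow> dg_id A X \<in> dg_mor A X X 0"
  using id_closed by (auto simp: cocycles_def)

lemma tw_id_closed:
  assumes E: "E \<in> tw_pre A"
  shows "dg_id (pretr A) E \<in> carrier (tw_hom_module A E E 0)"
  by (rule tw_hom_memI) (use E id_degree_zero tw_entry_group_closed(2)[OF E E] in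
      \<open>auto simp: tw_id_apply, auto simp: tw_entry_def tw_pre_def\<close>)

lemma tw_id_left:
  assumes E: "E \<in> tw_pre A" and F: "F \<in> tw_pre A" and f: "f \<in> carrier (tw_hom_module A E F p)"
  shows "tw_comp A E F F 0 p (dg_id (pretr A) F) f = f"
proof (rule tw_matrix_eqI[of E F])
  fix i k assume ik: "i < tw_len E" "k < tw_len F"
  interpret N: module R "tw_entry A p E F i k" using E F ik by (rule tw_entry_module)
  have "tw_comp A E F F 0 p (dg_id (pretr A) F) f i k = (\<Oplus>\<^bsub>tw_entry A p E F i k\<^esub> j\<in>{..<tw_len F}. if k = j then f i j else \<zero>\<^bsub>tw_entry A p E F i k\<^esub>)"
    unfolding tw_comp_apply'[OF ik, of p 0 p, OF add_0[symmetric]]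
  proof (intro N.finsum_cong' refl Pi_I)
    fix j assume "j \<in> {..<tw_len F}"
    then have j: "j < tw_len F" by simp
    note fij = tw_hom_memD[OF f ik(1) j]
    show "tw_term E F F 0 p (dg_id (pretr A) F) f i j k = (if k = j then f i j else \<zero>\<^bsub>tw_entry A p E F i k\<^esub>)"
    proof (cases "k = j")
      case True
      then show ?thesis using fij j E F ik by (simp add: tw_id_apply tw_entry_def tw_pre_def comp_id_left)
    next
      case False
      then show ?thesis
        using mod_hom_zero[OF tw_entry_module[OF F F j ik(2)] N.is_module bilinear_mapD(2)[OF tw_term_bilinear[OF E F F ik(1) j ik(2)] fij], of 0] j ik
        by (auto simp: tw_id_apply)
    qed
  qed (use ik tw_hom_memD[OF f] in auto)
  also have "\<dots> = f i k"
  proof -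
    have "(\<lambda>j. if k = j then f i j else \<zero>\<^bsub>tw_entry A p E F i k\<^esub>) \<in> {..<tw_len F} \<rightarrow> carrier (tw_entry A p E F i k)"
      using tw_hom_memD[OF f ik] by auto
    from N.finsum_singleton[OF _ _ this, of k] ik show ?thesis by (simp cong: if_cong)
  qed
  finally show "tw_comp A E F F 0 p (dg_id (pretr A) F) f i k = f i k" .
qed (use f in \<open>simp_all add: tw_hom_module_simps\<close>)

lemma tw_id_right:
  assumes E: "E \<in> tw_pre A" and F: "F \<in> tw_pre A" and f: "f \<in> carrier (tw_hom_module A E F p)"
  shows "tw_comp A E E F p 0 f (dg_id (pretr A) E) = f"
proof (rule tw_matrix_eqI[of E F])
  fix i k assume ik: "i < tw_len E" "k < tw_len F"
  interpret N: module R "tw_entry A p E F i k" using E F ik by (rule tw_entry_module)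
  have "tw_comp A E E F p 0 f (dg_id (pretr A) E) i k = (\<Oplus>\<^bsub>tw_entry A p E F i k\<^esub> j\<in>{..<tw_len E}. if i = j then f j k else \<zero>\<^bsub>tw_entry A p E F i k\<^esub>)"
    unfolding tw_comp_apply'[OF ik, of p p 0, OF add_0_right[symmetric]]
  proof (intro N.finsum_cong' refl Pi_I)
    fix j assume "j \<in> {..<tw_len E}"
    then have j: "j < tw_len E" by simp
    note fjk = tw_hom_memD[OF f j ik(2)]
    show "tw_term E E F p 0 f (dg_id (pretr A) E) i j k = (if i = j then f j k else \<zero>\<^bsub>tw_entry A p E F i k\<^esub>)"
    proof (cases "i = j")
      case True
      then show ?thesis using fjk j E F ik by (simp add: tw_id_apply tw_entry_def tw_pre_def comp_id_right)
    next
      case False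
      then show ?thesis
        using mod_hom_zero[OF tw_entry_module[OF E E ik(1) j] N.is_module bilinear_mapD(1)[OF tw_term_bilinear[OF E E F ik(1) j ik(2)] fjk], of 0] j ik
        by (auto simp: tw_id_apply)
    qed
  qed (use ik tw_hom_memD[OF f] in auto)
  also have "\<dots> = f i k"
  proof -
    have "(\<lambda>j. if i = j then f j k else \<zero>\<^bsub>tw_entry A p E F i k\<^esub>) \<in> {..<tw_len E} \<rightarrow> carrier (tw_entry A p E F i k)"
      using tw_hom_memD[OF f ik] by auto
    from N.finsum_singleton[OF _ _ this, of i] ik show ?thesis by (simp cong: if_cong)
  qed
  finally show "tw_comp A E E F p 0 f (dg_id (pretr A) E) i k = f i k" .
qed (use f in \<open>simp_all add: tw_hom_module_simps\<close>)

lemma tw_id_diff: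
  assumes E: "E \<in> tw_pre A"
  shows "tw_base_diff A E E 0 (dg_id (pretr A) E) = \<zero>\<^bsub>tw_hom_module A E E 1\<^esub>"
proof (rule tw_matrix_eqI[of E E])
  fix i j assume ij: "i < tw_len E" "j < tw_len E"
  interpret N: module R "tw_entry A 1 E E i j" using E E ij by (rule tw_entry_module)
  have "cdiff (dg_hom A (tw_obj E i) (tw_obj E j)) (0 + tw_deg E j - tw_deg E i) (dg_id (pretr A) E i j) = \<zero>\<^bsub>tw_entry A 1 E E i j\<^esub>"
    using ij E id_closed[of "tw_obj E i"] mod_hom_zero[OF tw_entry_module[OF E E ij] tw_entry_module[OF E E ij] tw_entry_diff_mod_hom[OF E E ij], of 0]
    by (cases "i = j") (auto simp: tw_id_apply cocycles_def tw_entry_def tw_pre_def)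
  then show "tw_base_diff A E E 0 (dg_id (pretr A) E) i j = \<zero>\<^bsub>tw_hom_module A E E 1\<^esub> i j"
    using ij by (simp add: tw_base_diff_apply tw_hom_module_simps signed_zero[OF N.is_module])
qed (simp_all add: tw_hom_module_simps)

lemma tw_free_dg_category: "dg_category R (tw_free A)"
proof (rule dg_category.intro)
  show "cring R" by (rule base_ring)
next
  fix E assume "E \<in> dg_ob (tw_free A)"
  then show "dg_id (tw_free A) E \<in> cocycles (dg_hom (tw_free A) E E) 0"
    by (simp add: cocycles_def tw_id_closed tw_id_diff)
qed (simp_all add: tw_free_complex tw_comp_bilinear tw_base_diff_leibniz tw_comp_assoc tw_id_left tw_id_right)

section \<open>Twisting the differential\<close>

text \<open>The deformed differential \<open>f -> df + y f - (-1)^n f x\<close> for endomorphisms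
  \<open>x\<close>, \<open>y\<close> of degree \<open>1\<close>. Applied to \<open>tw_free A\<close>
  and the twists it yields the differential of twisted complexes, while its laws can be proved in an
  arbitrary dg-category.\<close>

definition twisted_diff :: "'o \<Rightarrow> 'o \<Rightarrow> 'm \<Rightarrow> 'm \<Rightarrow> int \<Rightarrow> 'm \<Rightarrow> 'm" where
  "twisted_diff X Y x y n f = cdiff (dg_hom A X Y) n f
    \<oplus>\<^bsub>grade (dg_hom A X Y) (n + 1)\<^esub> dg_comp A X Y Y 1 n y f
    \<ominus>\<^bsub>grade (dg_hom A X Y) (n + 1)\<^esub> signed (grade (dg_hom A X Y) (n + 1)) n (dg_comp A X X Y n 1 f x)"

lemma twisted_diff_closed:
  assumes "X \<in> dg_ob A" "Y \<in> dg_ob A" "x \<in> dg_mor A X X 1" "y \<in> dg_mor A Y Y 1" "f \<in> dg_mor A X Y n" "s = n + 1"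
  shows "twisted_diff X Y x y n f \<in> dg_mor A X Y s"
  using assms by (simp add: twisted_diff_def hom_group_closed diff_closed comp_closed signed_closed[OF hom_module])

lemma twisted_diff_mod_hom:
  assumes ob: "X \<in> dg_ob A" "Y \<in> dg_ob A" and xy: "x \<in> dg_mor A X X 1" "y \<in> dg_mor A Y Y 1"
  shows "twisted_diff X Y x y n \<in> mod_hom R (grade (dg_hom A X Y) n) (grade (dg_hom A X Y) (n + 1))"
proof (rule mod_homI)
  note [simp] = ob xy hom_group_closed diff_closed comp_closed signed_closed[OF hom_module] diff_linear comp_linear_left comp_linear_right
    add.commute[of 1 n]
  show "twisted_diff X Y x y n f \<in> dg_mor A X Y (n + 1)" if "f \<in> dg_mor A X Y n" for f
    using that by (simp add: twisted_diff_closed)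
  show "twisted_diff X Y x y n (f \<oplus>\<^bsub>grade (dg_hom A X Y) n\<^esub> g) =
      twisted_diff X Y x y n f \<oplus>\<^bsub>grade (dg_hom A X Y) (n + 1)\<^esub> twisted_diff X Y x y n g"
    if "f \<in> dg_mor A X Y n" "g \<in> dg_mor A X Y n" for f g
    using that by (cases "even n") (simp_all add: twisted_diff_def signed_simps hom_group_simps)
  show "twisted_diff X Y x y n (r \<odot>\<^bsub>grade (dg_hom A X Y) n\<^esub> f) = r \<odot>\<^bsub>grade (dg_hom A X Y) (n + 1)\<^esub> twisted_diff X Y x y n f"
    if "r \<in> carrier R" "f \<in> dg_mor A X Y n" for r f
    using that mod_hom_smult[OF signed_in_mod_hom[OF hom_module], of X Y r "dg_comp A X X Y n 1 f x" "n + 1" n]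
    by (simp add: twisted_diff_def a_minus_def module.smult_r_distr[OF hom_module] module.smult_r_minus[OF hom_module])
qed

text \<open>The endomorphism \<open>y\<close> of the middle object cancels: it contributes
  \<open>-(-1)^q (g y) f\<close> through \<open>g\<close> and \<open>(-1)^q g (y f)\<close> through
  \<open>f\<close>.\<close>

lemma twisted_diff_leibniz:
  assumes ob: "X \<in> dg_ob A" "Y \<in> dg_ob A" "Z \<in> dg_ob A"
    and xyz: "x \<in> dg_mor A X X 1" "y \<in> dg_mor A Y Y 1" "z \<in> dg_mor A Z Z 1"
    and f: "f \<in> dg_mor A X Y p" and g: "g \<in> dg_mor A Y Z q"
  shows "twisted_diff X Z x z (q + p) (dg_comp A X Y Z q p g f) =
    dg_comp A X Y Z (q + 1) p (twisted_diff Y Z y z q g) f \<oplus>\<^bsub>grade (dg_hom A X Z) (q + p + 1)\<^esub>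
    signed (grade (dg_hom A X Z) (q + p + 1)) q (dg_comp A X Y Z q (p + 1) g (twisted_diff X Y x y p f))"
proof -
  let ?N = "grade (dg_hom A X Z) (q + p + 1)"
  have [simp]: "q + 1 + p = q + p + 1" "q + (p + 1) = q + p + 1" "1 + q = q + 1" "1 + p = p + 1" "1 + (q + p) = q + p + 1" by simp_all
  note cl [simp] = ob xyz f g hom_group_closed diff_closed comp_closed signed_closed[OF hom_module]
  define t1 where "t1 = dg_comp A X Y Z (q + 1) p (cdiff (dg_hom A Y Z) q g) f"
  define t2 where "t2 = dg_comp A X Y Z q (p + 1) g (cdiff (dg_hom A X Y) p f)"
  define t3 where "t3 = dg_comp A X Z Z 1 (q + p) z (dg_comp A X Y Z q p g f)"
  define t4 where "t4 = dg_comp A X Y Z q (p + 1) g (dg_comp A X Y Y 1 p y f)"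
  define t5 where "t5 = dg_comp A X Y Z q (p + 1) g (dg_comp A X X Y p 1 f x)"
  have t [simp]: "t1 \<in> carrier ?N" "t2 \<in> carrier ?N" "t3 \<in> carrier ?N" "t4 \<in> carrier ?N" "t5 \<in> carrier ?N"
    by (simp_all add: t1_def t2_def t3_def t4_def t5_def)
  have e3: "dg_comp A X Y Z (q + 1) p (dg_comp A Y Z Z 1 q z g) f = t3"
    using comp_assoc'[of X Y Z Z f p g q z 1 "q + 1"] by (simp add: t3_def)
  have e4: "dg_comp A X Y Z (q + 1) p (dg_comp A Y Y Z q 1 g y) f = t4"
    using comp_assoc'[of X Y Y Z f p y 1 g q "q + 1"] by (simp add: t4_def)
  have e5: "dg_comp A X X Z (q + p) 1 (dg_comp A X Y Z q p g f) x = t5"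
    using comp_assoc'[of X X Y Z x 1 f p g q "q + p"] by (simp add: t5_def)
  show ?thesis
    by (cases "even q"; cases "even p")
      (simp_all add: twisted_diff_def leibniz t1_def[symmetric] t2_def[symmetric] t3_def[symmetric] e3 e4 e5
        comp_linear_left comp_linear_right signed_simps t4_def[symmetric] t5_def[symmetric] hom_group_simps)
qed

text \<open>All mixed terms cancel in pairs and leave \<open>(dy + y y) f - f (dx + x x)\<close>,
  which the Maurer-Cartan equations annihilate.\<close>

lemma twisted_diff_square:
  assumes ob: "X \<in> dg_ob A" "Y \<in> dg_ob A" and xy: "x \<in> dg_mor A X X 1" "y \<in> dg_mor A Y Y 1" and f: "f \<in> dg_mor A X Y n"
    and mc: "cdiff (dg_hom A X X) 1 x \<oplus>\<^bsub>grade (dg_hom A X X) 2\<^esub> dg_comp A X X X 1 1 x x = \<zero>\<^bsub>grade (dg_hom A X X) 2\<^esub>"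
      "cdiff (dg_hom A Y Y) 1 y \<oplus>\<^bsub>grade (dg_hom A Y Y) 2\<^esub> dg_comp A Y Y Y 1 1 y y = \<zero>\<^bsub>grade (dg_hom A Y Y) 2\<^esub>"
  shows "twisted_diff X Y x y (n + 1) (twisted_diff X Y x y n f) = \<zero>\<^bsub>grade (dg_hom A X Y) (n + 2)\<^esub>"
proof -
  let ?N = "grade (dg_hom A X Y) (n + 2)"
  have [simp]: "1 + n = n + 1" "2 + n = n + 2" "n + 1 + 1 = n + 2" "1 + (n + 1) = n + 2" by simp_all
  note cl [simp] = ob xy f hom_group_closed diff_closed comp_closed signed_closed[OF hom_module]
  define t1 where "t1 = dg_comp A X Y Y 1 (n + 1) y (cdiff (dg_hom A X Y) n f)"
  define t2 where "t2 = dg_comp A X X Y (n + 1) 1 (cdiff (dg_hom A X Y) n f) x"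
  define t3 where "t3 = dg_comp A X Y Y 1 (n + 1) y (dg_comp A X X Y n 1 f x)"
  define u where "u = dg_comp A X Y Y 2 n (cdiff (dg_hom A Y Y) 1 y) f"
  define u' where "u' = dg_comp A X Y Y 2 n (dg_comp A Y Y Y 1 1 y y) f"
  define v where "v = dg_comp A X X Y n 2 f (cdiff (dg_hom A X X) 1 x)"
  define v' where "v' = dg_comp A X X Y n 2 f (dg_comp A X X X 1 1 x x)"
  have t [simp]: "t1 \<in> carrier ?N" "t2 \<in> carrier ?N" "t3 \<in> carrier ?N" "u \<in> carrier ?N" "v \<in> carrier ?N"
    "u' \<in> carrier ?N" "v' \<in> carrier ?N"
    by (simp_all add: t1_def t2_def t3_def u_def v_def u'_def v'_def)
  have "u \<oplus>\<^bsub>?N\<^esub> u' = \<zero>\<^bsub>?N\<^esub>"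
    using comp_linear_left(1)[of X Y Y f n "cdiff (dg_hom A Y Y) 1 y" 2 "dg_comp A Y Y Y 1 1 y y", symmetric]
    by (simp add: u_def u'_def mc comp_linear_left)
  \<comment> \<open>The Maurer-Cartan equations are used in solved form, expressing the quadratic
    terms \<open>u'\<close> and \<open>v'\<close> through \<open>u\<close> and
    \<open>v\<close>.\<close>
  then have u': "u' = \<zero>\<^bsub>?N\<^esub> \<ominus>\<^bsub>?N\<^esub> u" by (simp add: hom_group_simps)
  have "v \<oplus>\<^bsub>?N\<^esub> v' = \<zero>\<^bsub>?N\<^esub>"
    using comp_linear_right(1)[of X X Y f n "cdiff (dg_hom A X X) 1 x" 2 "dg_comp A X X X 1 1 x x", symmetric]
    by (simp add: v_def v'_def mc comp_linear_right)
  then have v': "v' = \<zero>\<^bsub>?N\<^esub> \<ominus>\<^bsub>?N\<^esub> v" by (simp add: hom_group_simps)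
  have e1: "cdiff (dg_hom A X Y) (n + 1) (dg_comp A X Y Y 1 n y f) = u \<ominus>\<^bsub>?N\<^esub> t1"
    using leibniz[of X Y Y f n y 1] by (simp add: u_def t1_def signed_simps a_minus_def)
  have e2: "cdiff (dg_hom A X Y) (n + 1) (dg_comp A X X Y n 1 f x) = t2 \<oplus>\<^bsub>?N\<^esub> signed ?N n v"
    using leibniz[of X X Y x 1 f n] by (simp add: v_def t2_def)
  have e3: "dg_comp A X X Y (n + 1) 1 (dg_comp A X Y Y 1 n y f) x = t3"
    using comp_assoc'[of X X Y Y x 1 f n y 1 "n + 1"] by (simp add: t3_def)
  have e4: "dg_comp A X Y Y 1 (n + 1) y (dg_comp A X Y Y 1 n y f) = u'"
    using comp_assoc'[of X Y Y Y f n y 1 y 1 2] by (simp add: u'_def)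
  have e5: "dg_comp A X X Y (n + 1) 1 (dg_comp A X X Y n 1 f x) x = v'"
    using comp_assoc'[of X X X Y x 1 x 1 f n "n + 1"] by (simp add: v'_def)
  have d0: "cdiff (dg_hom A X Y) (n + 1) (cdiff (dg_hom A X Y) n f) = \<zero>\<^bsub>?N\<^esub>"
    using diff_diff[of X Y f n "n + 1"] by simp
  show ?thesis
    by (cases "even n")
      (simp_all add: twisted_diff_def comp_linear_left comp_linear_right diff_linear signed_simps e1 e2 e3 e4 e5 d0
        t1_def[symmetric] t2_def[symmetric] t3_def[symmetric] hom_group_simps u' v')
qed

end

section \<open>The dg-category of twisted complexes\<close>

context dg_category
begin

text \<open>Membership in \<open>twisted_complexes A\<close> constrains \<open>tw_mat\<close> only
  inside its range, whereas morphisms are \<open>undefined\<close> outside; normalisation makes the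
  twist an endomorphism of degree \<open>1\<close> in \<open>tw_free A\<close>.\<close>

abbreviation tw_q :: "('o, 'm) twisted \<Rightarrow> nat \<Rightarrow> nat \<Rightarrow> 'm" where
  "tw_q E \<equiv> tw_matrix E E (tw_mat E)"

lemma twisted_complexes_pre: "E \<in> twisted_complexes A \<Longrightarrow> E \<in> tw_pre A"
  by (simp add: twisted_complexes_def tw_pre_def)

lemma tw_q_closed: "E \<in> twisted_complexes A \<Longrightarrow> tw_q E \<in> carrier (tw_hom_module A E E 1)"
  by (rule tw_hom_memI) (simp_all add: twisted_complexes_def)

text \<open>Matrix products see only entries inside the range, so \<open>tw_mat\<close> may be
  exchanged for its normalised form.\<close>

lemma tw_comp_cong:
  assumes EFG: "E \<in> tw_pre A" "F \<in> tw_pre A" "G \<in> tw_pre A"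
    and gf: "g \<in> carrier (tw_hom_module A F G q)" "f \<in> carrier (tw_hom_module A E F p)"
    and eq: "\<And>j k. \<lbrakk>j < tw_len F; k < tw_len G\<rbrakk> \<Longrightarrow> g' j k = g j k" "\<And>i j. \<lbrakk>i < tw_len E; j < tw_len F\<rbrakk> \<Longrightarrow> f' i j = f i j"
  shows "tw_comp A E F G q p g' f' = tw_comp A E F G q p g f"
proof (rule tw_matrix_eqI[of E G])
  fix i k assume ik: "i < tw_len E" "k < tw_len G"
  interpret N: module R "tw_entry A (q + p) E G i k" using EFG ik by (intro tw_entry_module)
  show "tw_comp A E F G q p g' f' i k = tw_comp A E F G q p g f i k"
    unfolding tw_comp_apply[OF ik]
  proof (intro N.finsum_cong' refl Pi_I)
    fix j assume j: "j \<in> {..<tw_len F}"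
    then show "tw_term E F G q p g f i j k \<in> carrier (tw_entry A (q + p) E G i k)"
      using tw_term_closed[OF EFG ik(1) _ ik(2) gf refl] by simp
    show "tw_term E F G q p g' f' i j k = tw_term E F G q p g f i j k"
      using j ik eq by simp
  qed
qed simp_all

lemma tw_q_maurer_cartan:
  assumes E: "E \<in> twisted_complexes A"
  shows "tw_base_diff A E E 1 (tw_q E) \<oplus>\<^bsub>tw_hom_module A E E 2\<^esub> tw_comp A E E E 1 1 (tw_q E) (tw_q E) = \<zero>\<^bsub>tw_hom_module A E E 2\<^esub>"
proof (rule tw_matrix_eqI[of E E])
  note E' = twisted_complexes_pre[OF E]
  have c: "tw_comp A E E E 1 1 (tw_mat E) (tw_mat E) = tw_comp A E E E 1 1 (tw_q E) (tw_q E)"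
    by (rule tw_comp_cong[OF E' E' E' tw_q_closed[OF E] tw_q_closed[OF E]]) simp_all
  fix i j assume ij: "i < tw_len E" "j < tw_len E"
  have "tw_base_diff A E E 1 (tw_mat E) i j \<oplus>\<^bsub>tw_entry A 2 E E i j\<^esub>
        tw_comp A E E E 1 1 (tw_mat E) (tw_mat E) i j = \<zero>\<^bsub>tw_entry A 2 E E i j\<^esub>"
    using E ij by (simp add: twisted_complexes_def)
  then show "(tw_base_diff A E E 1 (tw_q E) \<oplus>\<^bsub>tw_hom_module A E E 2\<^esub> tw_comp A E E E 1 1 (tw_q E) (tw_q E)) i j =
      \<zero>\<^bsub>tw_hom_module A E E 2\<^esub> i j"
    using ij by (simp add: tw_hom_module_simps c tw_base_diff_apply)
qed (simp_all add: tw_hom_module_simps)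

interpretation U: dg_category R "tw_free A"
  by (rule tw_free_dg_category)

text \<open>This identifies \<open>pretr A\<close> as a deformation of \<open>tw_free A\<close>,
  through which the laws of \<open>twisted_diff\<close> become laws of twisted complexes.\<close>

lemma tw_hom_diff:
  assumes E: "E \<in> twisted_complexes A" and F: "F \<in> twisted_complexes A" and f: "f \<in> carrier (tw_hom_module A E F n)"
  shows "cdiff (tw_hom A E F) n f = U.twisted_diff E F (tw_q E) (tw_q F) n f"
proof (rule tw_matrix_eqI[of E F])
  note E' = twisted_complexes_pre[OF E] and F' = twisted_complexes_pre[OF F]
  interpret N: module R "tw_hom_module A E F (n + 1)" using E' F' by (rule tw_hom_module_module)
  have c: "tw_comp A E F F 1 n (tw_mat F) f = tw_comp A E F F 1 n (tw_q F) f"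
      "tw_comp A E E F n 1 f (tw_mat E) = tw_comp A E E F n 1 f (tw_q E)"
    by (rule tw_comp_cong[OF E' F' F' tw_q_closed[OF F] f]; simp) (rule tw_comp_cong[OF E' E' F' f tw_q_closed[OF E]]; simp)
  have cl: "tw_base_diff A E F n f \<in> carrier (tw_hom_module A E F (n + 1))" "tw_comp A E F F 1 n (tw_q F) f \<in> carrier (tw_hom_module A E F (n + 1))"
    "tw_comp A E E F n 1 f (tw_q E) \<in> carrier (tw_hom_module A E F (n + 1))"
    using U.diff_closed[of E F f n "n + 1"] tw_comp_closed[OF E' F' F' tw_q_closed[OF F] f, of "n + 1"]
      tw_comp_closed[OF E' E' F' f tw_q_closed[OF E]] E' F' f by simp_all
  have sc: "signed (tw_hom_module A E F (n + 1)) n (tw_comp A E E F n 1 f (tw_q E)) \<in> carrier (tw_hom_module A E F (n + 1))"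
    using cl by (intro signed_closed[OF N.is_module])
  fix i j assume ij: "i < tw_len E" "j < tw_len F"
  show "cdiff (tw_hom A E F) n f i j = U.twisted_diff E F (tw_q E) (tw_q F) n f i j"
    using ij by (simp add: tw_hom_def c U.twisted_diff_def a_minus_def tw_hom_neg[OF E' F' sc] tw_hom_signed[OF E' F' cl(3)] tw_hom_module_simps)
next
  show "tw_matrix E F (cdiff (tw_hom A E F) n f) = cdiff (tw_hom A E F) n f"
    by (simp add: tw_hom_def)
  have "U.twisted_diff E F (tw_q E) (tw_q F) n f \<in> carrier (tw_hom_module A E F (n + 1))"
    using U.twisted_diff_closed[of E F "tw_q E" "tw_q F" f n] tw_q_closed E F f twisted_complexes_pre by simp
  then show "tw_matrix E F (U.twisted_diff E F (tw_q E) (tw_q F) n f) = U.twisted_diff E F (tw_q E) (tw_q F) n f"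
    by (simp add: tw_hom_module_simps)
qed

lemma pretr_simps [simp]:
  "dg_ob (pretr A) = twisted_complexes A"
  "dg_hom (pretr A) = tw_hom A"
  "dg_comp (pretr A) = tw_comp A"
  "grade (tw_hom A E F) = tw_hom_module A E F"
  by (simp_all add: pretr_def tw_hom_def)

lemma pretr_dg_category: "dg_category R (pretr A)"
proof (rule dg_category.intro)
  note P = twisted_complexes_pre and Q = tw_q_closed
  show "cring R" by (rule base_ring)
  {
    fix E F assume EF: "E \<in> dg_ob (pretr A)" "F \<in> dg_ob (pretr A)"
    have "cdiff (tw_hom A E F) n \<in> mod_hom R (tw_hom_module A E F n) (tw_hom_module A E F (n + 1))" for n
    proof -
      interpret N: module R "tw_hom_module A E F n" using EF P by (intro tw_hom_module_module) simp_all
      have L: "U.twisted_diff E F (tw_q E) (tw_q F) n \<in> mod_hom R (tw_hom_module A E F n) (tw_hom_module A E F (n + 1))"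
        using U.twisted_diff_mod_hom[of E F "tw_q E" "tw_q F" n] EF P Q by simp
      show ?thesis
        by (rule mod_homI) (use EF mod_hom_closed[OF L] mod_hom_add[OF L] mod_hom_smult[OF L] in \<open>simp_all add: tw_hom_diff\<close>)
    qed
    moreover have "cdiff (tw_hom A E F) (n + 1) (cdiff (tw_hom A E F) n f) = \<zero>\<^bsub>tw_hom_module A E F (n + 2)\<^esub>"
      if "f \<in> carrier (tw_hom_module A E F n)" for n f
      using EF that P Q U.twisted_diff_square[of E F "tw_q E" "tw_q F" f n] tw_q_maurer_cartan
        U.twisted_diff_closed[of E F "tw_q E" "tw_q F" f n "n + 1"] by (simp add: tw_hom_diff)
    ultimately show "cochain_complex R (dg_hom (pretr A) E F)"
      using EF P by (simp add: cochain_complex_def tw_hom_module_module)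
  }
  {
    fix E F G p q assume "E \<in> dg_ob (pretr A)" "F \<in> dg_ob (pretr A)" "G \<in> dg_ob (pretr A)"
    then show "bilinear_map R (grade (dg_hom (pretr A) F G) q) (grade (dg_hom (pretr A) E F) p) (grade (dg_hom (pretr A) E G) (q + p)) (dg_comp (pretr A) E F G q p)"
      using P by (simp add: tw_comp_bilinear)
  }
  {
    fix E F G f p g q assume EFG: "E \<in> dg_ob (pretr A)" "F \<in> dg_ob (pretr A)" "G \<in> dg_ob (pretr A)"
      and f: "f \<in> dg_mor (pretr A) E F p" and g: "g \<in> dg_mor (pretr A) F G q"
    then show "cdiff (dg_hom (pretr A) E G) (q + p) (dg_comp (pretr A) E F G q p g f) =
        dg_comp (pretr A) E F G (q + 1) p (cdiff (dg_hom (pretr A) F G) q g) f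
        \<oplus>\<^bsub>grade (dg_hom (pretr A) E G) (q + p + 1)\<^esub>
        signed (grade (dg_hom (pretr A) E G) (q + p + 1)) q
          (dg_comp (pretr A) E F G q (p + 1) g (cdiff (dg_hom (pretr A) E F) p f))"
      using U.twisted_diff_leibniz[of E F G "tw_q E" "tw_q F" "tw_q G" f p g q] P Q tw_comp_closed[of E F G g q f p "q + p"]
      by (simp add: tw_hom_diff)
  }
  {
    fix E F G H f p g q h r
    assume "E \<in> dg_ob (pretr A)" "F \<in> dg_ob (pretr A)" "G \<in> dg_ob (pretr A)" "H \<in> dg_ob (pretr A)"
      "f \<in> dg_mor (pretr A) E F p" "g \<in> dg_mor (pretr A) F G q" "h \<in> dg_mor (pretr A) G H r"
    then show "dg_comp (pretr A) E G H r (q + p) h (dg_comp (pretr A) E F G q p g f) =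
      dg_comp (pretr A) E F H (r + q) p (dg_comp (pretr A) F G H r q h g) f"
      using P by (simp add: tw_comp_assoc)
  }
  {
    fix E assume E: "E \<in> dg_ob (pretr A)"
    then interpret N: module R "tw_hom_module A E E 1" using P by (intro tw_hom_module_module) simp_all
    have "U.twisted_diff E E (tw_q E) (tw_q E) 0 (dg_id (pretr A) E) = \<zero>\<^bsub>tw_hom_module A E E 1\<^esub>"
      using E P[of E] Q[of E] by (simp add: U.twisted_diff_def tw_id_diff tw_id_left tw_id_right signed_simps N.group_simps)
    then show "dg_id (pretr A) E \<in> cocycles (dg_hom (pretr A) E E) 0"
      using E P[of E] by (simp add: cocycles_def tw_id_closed tw_hom_diff)
  }
  {
    fix E F f p assume "E \<in> dg_ob (pretr A)" "F \<in> dg_ob (pretr A)" "f \<in> dg_mor (pretr A) E F p"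
    then show "dg_comp (pretr A) E F F 0 p (dg_id (pretr A) F) f = f" "dg_comp (pretr A) E E F p 0 f (dg_id (pretr A) E) = f"
      using P by (simp_all add: tw_id_left tw_id_right)
  }
qed

section \<open>Shifts\<close>

lemma iso_arrow_homotopyD:
  assumes "iso_arrow (homotopy_category A) X Y \<alpha>"
  obtains u v where "X \<in> dg_ob A" "Y \<in> dg_ob A" "u \<in> cocycles (dg_hom A X Y) 0" "v \<in> cocycles (dg_hom A Y X) 0"
    "\<alpha> = cohom_class (dg_hom A X Y) 0 u"
    "dg_comp A X Y X 0 0 v u \<in> cohom_class (dg_hom A X X) 0 (dg_id A X)"
    "dg_comp A Y X Y 0 0 u v \<in> cohom_class (dg_hom A Y Y) 0 (dg_id A Y)"
proof -
  have ob: "X \<in> dg_ob A" "Y \<in> dg_ob A" using assms by (auto simp: iso_arrow_def)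
  note coh = complex_of_modules.cohomology_carrier[OF hom_complex_of_modules]
  obtain u v where uv: "u \<in> cocycles (dg_hom A X Y) 0" "v \<in> cocycles (dg_hom A Y X) 0" "\<alpha> = cohom_class (dg_hom A X Y) 0 u"
    "cohom_class (dg_hom A X X) 0 (dg_comp A X Y X 0 0 v u) = cohom_class (dg_hom A X X) 0 (dg_id A X)"
    "cohom_class (dg_hom A Y Y) 0 (dg_comp A Y X Y 0 0 u v) = cohom_class (dg_hom A Y Y) 0 (dg_id A Y)"
    using assms ob by (auto simp: iso_arrow_def coh homotopy_comp)
  have "dg_comp A X Y X 0 0 v u \<in> dg_mor A X X 0" "dg_comp A Y X Y 0 0 u v \<in> dg_mor A Y Y 0"
    using ob uv by (auto simp: cocycles_def comp_closed)
  then show thesis using that[OF ob uv(1-3)] complex_of_modules.cohom_class_self[OF hom_complex_of_modules] ob uv(4,5) by blast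
qed

lemma iso_arrow_homotopyI:
  assumes ob: "X \<in> dg_ob A" "Y \<in> dg_ob A" and uv: "u \<in> cocycles (dg_hom A X Y) 0" "v \<in> cocycles (dg_hom A Y X) 0"
    "dg_comp A X Y X 0 0 v u \<in> cohom_class (dg_hom A X X) 0 (dg_id A X)"
    "dg_comp A Y X Y 0 0 u v \<in> cohom_class (dg_hom A Y Y) 0 (dg_id A Y)"
  shows "iso_arrow (homotopy_category A) X Y (cohom_class (dg_hom A X Y) 0 u)"
proof -
  note coh = complex_of_modules.cohomology_carrier[OF hom_complex_of_modules]
  have "cohom_class (dg_hom A X X) 0 (dg_comp A X Y X 0 0 v u) = cohom_class (dg_hom A X X) 0 (dg_id A X)"
    "cohom_class (dg_hom A Y Y) 0 (dg_comp A Y X Y 0 0 u v) = cohom_class (dg_hom A Y Y) 0 (dg_id A Y)"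
    using complex_of_modules.cohom_class_cong[OF hom_complex_of_modules] ob uv id_degree_zero by blast+
  then show ?thesis unfolding iso_arrow_def
    using ob uv by (auto simp: coh homotopy_comp intro!: bexI[of _ "cohom_class (dg_hom A Y X) 0 v"])
qed

text \<open>Says that \<open>X\<close> is isomorphic to \<open>Y[n]\<close>, phrased inside
  \<open>A\<close>: a morphism \<open>X -> Y[n]\<close> is a closed morphism of degree
  \<open>n\<close>, and its inverse has degree \<open>-n\<close>.\<close>

definition shift_iso :: "int \<Rightarrow> 'o \<Rightarrow> 'o \<Rightarrow> bool" where
  "shift_iso n X Y \<longleftrightarrow> X \<in> dg_ob A \<and> Y \<in> dg_ob A \<and>
    (\<exists>u \<in> cocycles (dg_hom A X Y) n. \<exists>v \<in> cocycles (dg_hom A Y X) (- n).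
      dg_comp A X Y X (- n) n v u \<in> cohom_class (dg_hom A X X) 0 (dg_id A X) \<and>
      dg_comp A Y X Y n (- n) u v \<in> cohom_class (dg_hom A Y Y) 0 (dg_id A Y))"

lemma shift_iso_isomorphic: "shift_iso 0 X Y \<Longrightarrow> isomorphic (homotopy_category A) X Y"
  unfolding shift_iso_def isomorphic_def using iso_arrow_homotopyI[of X Y] by auto

lemma shift_iso_sym: "shift_iso n X Y \<Longrightarrow> shift_iso (- n) Y X"
  unfolding shift_iso_def by auto

text \<open>Reassociate to \<open>v (v' u') u\<close> and write \<open>v' u' = b' + id\<close> with
  exact \<open>b'\<close>: the result is \<open>v b' u + v u\<close>, whose first summand is exact
  and whose second is homotopic to the identity.\<close>

lemma conjugate_identity:
  assumes ob: "X \<in> dg_ob A" "Y \<in> dg_ob A" "Z \<in> dg_ob A"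
    and u: "u \<in> cocycles (dg_hom A X Y) m" and v: "v \<in> cocycles (dg_hom A Y X) l"
    and u': "u' \<in> cocycles (dg_hom A Y Z) n" and v': "v' \<in> cocycles (dg_hom A Z Y) k"
    and kl: "k + n = 0" "l + m = 0" "s = l + k" "t = n + m"
    and vu: "dg_comp A X Y X l m v u \<in> cohom_class (dg_hom A X X) 0 (dg_id A X)"
    and vu': "dg_comp A Y Z Y k n v' u' \<in> cohom_class (dg_hom A Y Y) 0 (dg_id A Y)"
  shows "dg_comp A X Z X s t (dg_comp A Z Y X l k v v') (dg_comp A X Y Z n m u' u) \<in> cohom_class (dg_hom A X X) 0 (dg_id A X)"
proof -
  interpret XX: complex_of_modules R "dg_hom A X X" using ob by (simp add: hom_complex_of_modules)
  interpret YY: complex_of_modules R "dg_hom A Y Y" using ob by (simp add: hom_complex_of_modules)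
  have c: "u \<in> dg_mor A X Y m" "v \<in> dg_mor A Y X l" "u' \<in> dg_mor A Y Z n" "v' \<in> dg_mor A Z Y k"
    using u v u' v' by (auto simp: cocycles_def)
  obtain b where b: "b \<in> coboundaries (dg_hom A X X) 0" "dg_comp A X Y X l m v u = b \<oplus>\<^bsub>grade (dg_hom A X X) 0\<^esub> dg_id A X"
    using vu by (auto simp: XX.cohom_class_mem)
  obtain b' where b': "b' \<in> coboundaries (dg_hom A Y Y) 0" "dg_comp A Y Z Y k n v' u' = b' \<oplus>\<^bsub>grade (dg_hom A Y Y) 0\<^esub> dg_id A Y"
    using vu' by (auto simp: YY.cohom_class_mem)
  have b'u: "dg_comp A X Y Y 0 m b' u \<in> coboundaries (dg_hom A X Y) m"
    using ob u b' by (intro comp_coboundary_left) auto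
  have vb'u: "dg_comp A X Y X l m v (dg_comp A X Y Y 0 m b' u) \<in> coboundaries (dg_hom A X X) 0"
    by (rule comp_coboundary_right[OF ob(1,2,1) v b'u]) (use kl in simp)
  have "dg_comp A X Z X s t (dg_comp A Z Y X l k v v') (dg_comp A X Y Z n m u' u) =
      dg_comp A X Y X l m v (dg_comp A X Y Y 0 m (dg_comp A Y Z Y k n v' u') u)"
    using comp_assoc'[of X Z Y X "dg_comp A X Y Z n m u' u" t v' k v l s] comp_assoc[of X Y Z Y u m u' n v' k] ob c kl
    by (simp add: comp_closed) (simp add: add.assoc[symmetric])
  also have "\<dots> = dg_comp A X Y X l m v (dg_comp A X Y Y 0 m b' u) \<oplus>\<^bsub>grade (dg_hom A X X) 0\<^esub> dg_comp A X Y X l m v u"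
    using ob b' c kl YY.coboundary_carrier[OF b'(1)] id_degree_zero[of Y]
    by (simp add: comp_linear_left comp_linear_right comp_closed comp_id_left)
  also have "\<dots> = (dg_comp A X Y X l m v (dg_comp A X Y Y 0 m b' u) \<oplus>\<^bsub>grade (dg_hom A X X) 0\<^esub> b) \<oplus>\<^bsub>grade (dg_hom A X X) 0\<^esub> dg_id A X"
    using b XX.coboundary_carrier[OF b(1)] XX.coboundary_carrier[OF vb'u] id_degree_zero[OF ob(1)] by (simp add: XX.grade.a_assoc)
  finally show ?thesis
    using XX.add_coboundary[OF vb'u b(1)] by (auto simp: XX.cohom_class_mem)
qed

lemma shift_iso_trans:
  assumes "shift_iso m X Y" "shift_iso n Y Z"
  shows "shift_iso (n + m) X Z"
proof -
  have ob: "X \<in> dg_ob A" "Y \<in> dg_ob A" "Z \<in> dg_ob A" using assms by (auto simp: shift_iso_def)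
  obtain u v where u: "u \<in> cocycles (dg_hom A X Y) m" and v: "v \<in> cocycles (dg_hom A Y X) (- m)"
    and vu: "dg_comp A X Y X (- m) m v u \<in> cohom_class (dg_hom A X X) 0 (dg_id A X)"
    and uv: "dg_comp A Y X Y m (- m) u v \<in> cohom_class (dg_hom A Y Y) 0 (dg_id A Y)"
    using assms(1) by (auto simp: shift_iso_def)
  obtain u' v' where u': "u' \<in> cocycles (dg_hom A Y Z) n" and v': "v' \<in> cocycles (dg_hom A Z Y) (- n)"
    and vu': "dg_comp A Y Z Y (- n) n v' u' \<in> cohom_class (dg_hom A Y Y) 0 (dg_id A Y)"
    and uv': "dg_comp A Z Y Z n (- n) u' v' \<in> cohom_class (dg_hom A Z Z) 0 (dg_id A Z)"
    using assms(2) by (auto simp: shift_iso_def)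
  have "dg_comp A X Z X (- m - n) (n + m) (dg_comp A Z Y X (- m) (- n) v v') (dg_comp A X Y Z n m u' u) \<in> cohom_class (dg_hom A X X) 0 (dg_id A X)"
    using ob u v u' v' vu vu' by (intro conjugate_identity[where Y = Y]) auto
  moreover have "dg_comp A Z X Z (n + m) (- m - n) (dg_comp A X Y Z n m u' u) (dg_comp A Z Y X (- m) (- n) v v') \<in> cohom_class (dg_hom A Z Z) 0 (dg_id A Z)"
    using ob u v u' v' uv uv' by (intro conjugate_identity[where Y = Y]) auto
  moreover have "dg_comp A X Y Z n m u' u \<in> cocycles (dg_hom A X Z) (n + m)" "dg_comp A Z Y X (- m) (- n) v v' \<in> cocycles (dg_hom A Z X) (- m - n)"
    using ob u v u' v' by (auto intro: comp_cocycle)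
  ultimately show ?thesis using ob unfolding shift_iso_def by (auto simp: algebra_simps)
qed

end

section \<open>Shifts and cones as twisted complexes\<close>

lemma tw_shift_simps [simp]:
  "tw_terms (tw_shift A X n) = [(X, n)]"
  "tw_mat (tw_shift A X n) i j = \<zero>\<^bsub>grade (dg_hom A X X) 1\<^esub>"
  by (simp_all add: tw_shift_def)

lemma tw_cone_simps [simp]:
  "tw_terms (tw_cone A X E f) = [(X, 1), (E, 0)]"
  "tw_mat (tw_cone A X E f) 0 0 = \<zero>\<^bsub>grade (dg_hom A X X) 1\<^esub>"
  "tw_mat (tw_cone A X E f) 0 (Suc 0) = f"
  "tw_mat (tw_cone A X E f) (Suc 0) 0 = \<zero>\<^bsub>grade (dg_hom A E X) 2\<^esub>"
  "tw_mat (tw_cone A X E f) (Suc 0) (Suc 0) = \<zero>\<^bsub>grade (dg_hom A E E) 1\<^esub>"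
  by (simp_all add: tw_cone_def Let_def)

lemma all_less_2: "(\<forall>i < Suc (Suc 0). P i) \<longleftrightarrow> P 0 \<and> P (Suc 0)"
  by (auto simp: less_Suc_eq)

context dg_category
begin

lemma tw_comp_apply_1:
  assumes "E \<in> tw_pre A" "F \<in> tw_pre A" "G \<in> tw_pre A" "g \<in> carrier (tw_hom_module A F G q)" "f \<in> carrier (tw_hom_module A E F p)"
    and "i < tw_len E" "k < tw_len G" "tw_len F = Suc 0"
  shows "tw_comp A E F G q p g f i k = tw_term E F G q p g f i 0 k"
proof -
  interpret N: module R "tw_entry A (q + p) E G i k" using assms by (intro tw_entry_module)
  have "tw_term E F G q p g f i 0 k \<in> carrier (tw_entry A (q + p) E G i k)"
    using assms by (intro tw_term_closed) auto
  then show ?thesis using assms by (simp add: tw_comp_apply lessThan_Suc)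
qed

lemma tw_comp_apply_2:
  assumes "E \<in> tw_pre A" "F \<in> tw_pre A" "G \<in> tw_pre A" "g \<in> carrier (tw_hom_module A F G q)" "f \<in> carrier (tw_hom_module A E F p)"
    and "i < tw_len E" "k < tw_len G" "tw_len F = Suc (Suc 0)"
  shows "tw_comp A E F G q p g f i k = tw_term E F G q p g f i 0 k \<oplus>\<^bsub>tw_entry A (q + p) E G i k\<^esub> tw_term E F G q p g f i (Suc 0) k"
proof -
  interpret N: module R "tw_entry A (q + p) E G i k" using assms by (intro tw_entry_module)
  have "tw_term E F G q p g f i 0 k \<in> carrier (tw_entry A (q + p) E G i k)"
    "tw_term E F G q p g f i (Suc 0) k \<in> carrier (tw_entry A (q + p) E G i k)"
    using assms by (intro tw_term_closed; auto)+
  then show ?thesis using assms by (simp add: tw_comp_apply lessThan_Suc N.a_comm)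
qed

lemma tw_diff_apply:
  assumes "E \<in> twisted_complexes A" "F \<in> twisted_complexes A" "f \<in> carrier (tw_hom_module A E F n)"
    and ij: "i < tw_len E" "j < tw_len F"
  shows "cdiff (tw_hom A E F) n f i j = tw_base_diff A E F n f i j
    \<oplus>\<^bsub>tw_entry A (n + 1) E F i j\<^esub> tw_comp A E F F 1 n (tw_q F) f i j
    \<ominus>\<^bsub>tw_entry A (n + 1) E F i j\<^esub> signed (tw_entry A (n + 1) E F i j) n (tw_comp A E E F n 1 f (tw_q E) i j)"
proof -
  note E' = twisted_complexes_pre[OF assms(1)] and F' = twisted_complexes_pre[OF assms(2)]
  have "tw_comp A E F F 1 n (tw_mat F) f = tw_comp A E F F 1 n (tw_q F) f"
      "tw_comp A E E F n 1 f (tw_mat E) = tw_comp A E E F n 1 f (tw_q E)"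
    by (rule tw_comp_cong[OF E' F' F' tw_q_closed[OF assms(2)] assms(3)]; simp)
      (rule tw_comp_cong[OF E' E' F' assms(3) tw_q_closed[OF assms(1)]]; simp)
  then show ?thesis using ij by (simp add: tw_hom_def)
qed

lemma tw_shift_twisted: "X \<in> dg_ob A \<Longrightarrow> tw_shift A X n \<in> twisted_complexes A"
  using tw_comp_apply_1[of "tw_shift A X n" "tw_shift A X n" "tw_shift A X n" "tw_q (tw_shift A X n)" 1 "tw_q (tw_shift A X n)" 1 0 0]
    tw_comp_cong[of "tw_shift A X n" "tw_shift A X n" "tw_shift A X n" "tw_q (tw_shift A X n)" 1 "tw_q (tw_shift A X n)" 1 "tw_mat (tw_shift A X n)" "tw_mat (tw_shift A X n)"]
  by (simp add: twisted_complexes_def tw_entry_def tw_base_diff_apply tw_hom_module_simps tw_pre_def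
      hom_group_closed diff_linear comp_linear_left signed_zero[OF hom_module] hom_group_simps)

lemma tw_shift_pre: "X \<in> dg_ob A \<Longrightarrow> tw_shift A X n \<in> tw_pre A"
  by (simp add: tw_pre_def)

lemma tw_cone_pre: "\<lbrakk>X \<in> dg_ob A; E \<in> dg_ob A\<rbrakk> \<Longrightarrow> tw_cone A X E f \<in> tw_pre A"
  by (simp add: tw_pre_def all_less_2)

text \<open>The only possibly nonzero entry of the twist is \<open>f\<close>, from the first summand
  to the second, so its square vanishes and the Maurer-Cartan equation says that \<open>f\<close> is
  closed.\<close>

lemma tw_cone_twisted:
  assumes "X \<in> dg_ob A" "E \<in> dg_ob A" "f \<in> cocycles (dg_hom A X E) 0"
  shows "tw_cone A X E f \<in> twisted_complexes A"
proof -
  let ?K = "tw_cone A X E f"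
  have K: "?K \<in> tw_pre A" using assms by (simp add: tw_cone_pre)
  have f: "f \<in> dg_mor A X E 0" "cdiff (dg_hom A X E) 0 f = \<zero>\<^bsub>grade (dg_hom A X E) 1\<^esub>"
    using assms by (auto simp: cocycles_def)
  have q: "tw_q ?K \<in> carrier (tw_hom_module A ?K ?K 1)"
    using assms f by (intro tw_hom_memI) (auto simp: less_Suc_eq tw_entry_def hom_group_closed)
  have c: "tw_comp A ?K ?K ?K 1 1 (tw_mat ?K) (tw_mat ?K) i j = tw_term ?K ?K ?K 1 1 (tw_q ?K) (tw_q ?K) i 0 j
      \<oplus>\<^bsub>tw_entry A 2 ?K ?K i j\<^esub> tw_term ?K ?K ?K 1 1 (tw_q ?K) (tw_q ?K) i (Suc 0) j" if "i < tw_len ?K" "j < tw_len ?K" for i j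
  proof -
    have "tw_comp A ?K ?K ?K 1 1 (tw_mat ?K) (tw_mat ?K) = tw_comp A ?K ?K ?K 1 1 (tw_q ?K) (tw_q ?K)"
      by (rule tw_comp_cong[OF K K K q q]) simp_all
    moreover have "tw_len ?K = Suc (Suc 0)" by simp
    ultimately show ?thesis using tw_comp_apply_2[OF K K K q q that] by (simp only: one_add_one)
  qed
  have "\<forall>i < Suc (Suc 0). \<forall>j < Suc (Suc 0). tw_base_diff A ?K ?K 1 (tw_mat ?K) i j \<oplus>\<^bsub>tw_entry A 2 ?K ?K i j\<^esub>
        tw_comp A ?K ?K ?K 1 1 (tw_mat ?K) (tw_mat ?K) i j = \<zero>\<^bsub>tw_entry A 2 ?K ?K i j\<^esub>"
    unfolding all_less_2 using assms f by (simp add: c tw_entry_def tw_base_diff_apply hom_group_closed diff_linear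
        comp_linear_left comp_linear_right signed_zero[OF hom_module] hom_group_simps)
  then show ?thesis using assms f
    by (simp add: twisted_complexes_def all_less_2 tw_entry_def hom_group_closed le_Suc_eq)
qed

text \<open>Both twists vanish; what is left is the differential of \<open>A\<close> with the sign
  of the target shift \<open>n\<close>.\<close>

lemma tw_diff_shift_shift:
  assumes "X \<in> dg_ob A" "Y \<in> dg_ob A" "f \<in> carrier (tw_hom_module A (tw_shift A X m) (tw_shift A Y n) k)"
  shows "cdiff (tw_hom A (tw_shift A X m) (tw_shift A Y n)) k f 0 0 =
    signed (grade (dg_hom A X Y) (k + 1 + n - m)) n (cdiff (dg_hom A X Y) (k + n - m) (f 0 0))"
proof -
  have f: "f 0 0 \<in> dg_mor A X Y (k + n - m)"
    using tw_hom_memD[OF assms(3), of 0 0] by (simp add: tw_entry_def)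
  have q: "tw_q (tw_shift A X m) \<in> carrier (tw_hom_module A (tw_shift A X m) (tw_shift A X m) 1)"
    "tw_q (tw_shift A Y n) \<in> carrier (tw_hom_module A (tw_shift A Y n) (tw_shift A Y n) 1)"
    using assms by (simp_all add: tw_q_closed tw_shift_twisted)
  note P = tw_shift_pre[OF assms(1), of m] tw_shift_pre[OF assms(2), of n]
  have [simp]: "1 + (k + n - m) = k + 1 + n - m" "k + n - m + 1 = k + 1 + n - m" by simp_all
  have s: "signed (grade (dg_hom A X Y) (k + 1 + n - m)) n (cdiff (dg_hom A X Y) (k + n - m) (f 0 0)) \<in> dg_mor A X Y (k + 1 + n - m)"
    using assms f by (intro signed_closed[OF hom_module] diff_closed) auto
  show ?thesis
    using assms f s by (simp add: tw_diff_apply[OF tw_shift_twisted tw_shift_twisted] tw_base_diff_apply tw_comp_apply_1[OF P(1) P(2) P(2) q(2)]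
        tw_comp_apply_1[OF P(1) P(1) P(2) _ q(1)] tw_entry_def comp_linear_left comp_linear_right signed_zero[OF hom_module] hom_group_simps)
qed

end

text \<open>The data of an isomorphism in the homotopy category between \<open>Z\<close> and the cone of \<open>f : X \<rightarrow> E\<close>: the
  components \<open>t0 : Z \<rightarrow> X[1]\<close>, \<open>t1 : Z \<rightarrow> E\<close> of the isomorphism, \<open>s0 : X[1] \<rightarrow> Z\<close>, \<open>s1 : E \<rightarrow> Z\<close> of its inverse, a
  homotopy \<open>w\<close> on \<open>Z\<close> and the components \<open>p : X \<rightarrow> X\<close>, \<open>q : E \<rightarrow> X\<close>, \<open>r : E \<rightarrow> E\<close> of a homotopy on the cone.
  Only degrees and equations occur, so a dg-functor preserves such data.\<close>

definition cone_data ::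
  "('o, 'r, 'm) dgcat \<Rightarrow> 'o \<Rightarrow> 'o \<Rightarrow> 'o \<Rightarrow> 'm \<Rightarrow> 'm \<Rightarrow> 'm \<Rightarrow> 'm \<Rightarrow> 'm \<Rightarrow> 'm \<Rightarrow> 'm \<Rightarrow> 'm \<Rightarrow> 'm \<Rightarrow> bool" where
  "cone_data A X E Z f t0 t1 s0 s1 p q r w \<longleftrightarrow>
    X \<in> dg_ob A \<and> E \<in> dg_ob A \<and> Z \<in> dg_ob A \<and>
    f \<in> dg_mor A X E 0 \<and> t0 \<in> dg_mor A Z X 1 \<and> t1 \<in> dg_mor A Z E 0 \<and> s0 \<in> dg_mor A X Z (- 1) \<and> s1 \<in> dg_mor A E Z 0 \<and>
    p \<in> dg_mor A X X (- 1) \<and> q \<in> dg_mor A E X 0 \<and> r \<in> dg_mor A E E (- 1) \<and> w \<in> dg_mor A Z Z (- 1) \<and>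
    cdiff (dg_hom A X E) 0 f = \<zero>\<^bsub>grade (dg_hom A X E) 1\<^esub> \<and>
    cdiff (dg_hom A Z X) 1 t0 = \<zero>\<^bsub>grade (dg_hom A Z X) 2\<^esub> \<and>
    cdiff (dg_hom A Z E) 0 t1 = \<ominus>\<^bsub>grade (dg_hom A Z E) 1\<^esub> dg_comp A Z X E 0 1 f t0 \<and>
    cdiff (dg_hom A X Z) (- 1) s0 = dg_comp A X E Z 0 0 s1 f \<and>
    cdiff (dg_hom A E Z) 0 s1 = \<zero>\<^bsub>grade (dg_hom A E Z) 1\<^esub> \<and>
    dg_comp A Z X Z (- 1) 1 s0 t0 \<oplus>\<^bsub>grade (dg_hom A Z Z) 0\<^esub> dg_comp A Z E Z 0 0 s1 t1 =
      cdiff (dg_hom A Z Z) (- 1) w \<oplus>\<^bsub>grade (dg_hom A Z Z) 0\<^esub> dg_id A Z \<and>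
    dg_comp A X Z X 1 (- 1) t0 s0 =
      \<ominus>\<^bsub>grade (dg_hom A X X) 0\<^esub> cdiff (dg_hom A X X) (- 1) p
      \<oplus>\<^bsub>grade (dg_hom A X X) 0\<^esub> dg_comp A X E X 0 0 q f \<oplus>\<^bsub>grade (dg_hom A X X) 0\<^esub> dg_id A X \<and>
    dg_comp A E Z X 1 0 t0 s1 = \<ominus>\<^bsub>grade (dg_hom A E X) 1\<^esub> cdiff (dg_hom A E X) 0 q \<and>
    dg_comp A E Z E 0 0 t1 s1 =
      cdiff (dg_hom A E E) (- 1) r
      \<oplus>\<^bsub>grade (dg_hom A E E) 0\<^esub> dg_comp A E X E 0 0 f q \<oplus>\<^bsub>grade (dg_hom A E E) 0\<^esub> dg_id A E"

section \<open>Differentials of morphisms into, out of and between cones\<close>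

context dg_category
begin

context
  fixes X E f
  assumes X: "X \<in> dg_ob A" and E: "E \<in> dg_ob A" and f: "f \<in> cocycles (dg_hom A X E) 0"
begin

abbreviation (input) "K \<equiv> tw_cone A X E f"

lemma f_degree_zero: "f \<in> dg_mor A X E 0"
  using f by (auto simp: cocycles_def)

lemma tw_hom_shift_cone_mem:
  "g \<in> carrier (tw_hom_module A (tw_shift A Z 0) K k) \<longleftrightarrow>
    g 0 0 \<in> dg_mor A Z X (k + 1) \<and> g 0 (Suc 0) \<in> dg_mor A Z E k \<and> tw_matrix (tw_shift A Z 0) K g = g"
  by (simp add: tw_hom_module_simps all_less_2 tw_entry_def)

lemma tw_hom_cone_shift_mem:
  "g \<in> carrier (tw_hom_module A K (tw_shift A Z n) k) \<longleftrightarrow>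
    g 0 0 \<in> dg_mor A X Z (k + n - 1) \<and> g (Suc 0) 0 \<in> dg_mor A E Z (k + n) \<and> tw_matrix K (tw_shift A Z n) g = g"
  by (simp add: tw_hom_module_simps all_less_2 tw_entry_def)

lemma tw_hom_cone_cone_mem:
  "g \<in> carrier (tw_hom_module A K K k) \<longleftrightarrow>
    g 0 0 \<in> dg_mor A X X k \<and> g 0 (Suc 0) \<in> dg_mor A X E (k - 1) \<and> g (Suc 0) 0 \<in> dg_mor A E X (k + 1)
    \<and> g (Suc 0) (Suc 0) \<in> dg_mor A E E k \<and> tw_matrix K K g = g"
  by (simp add: tw_hom_module_simps all_less_2 tw_entry_def conj_ac)

lemma cone_twisted: "K \<in> twisted_complexes A" and cone_pre: "K \<in> tw_pre A"
  and cone_q: "tw_q K \<in> carrier (tw_hom_module A K K 1)"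
  using X E f by (simp_all add: tw_cone_twisted tw_cone_pre tw_q_closed)

lemma shift_q: "Z \<in> dg_ob A \<Longrightarrow> tw_q (tw_shift A Z n) \<in> carrier (tw_hom_module A (tw_shift A Z n) (tw_shift A Z n) 1)"
  by (simp add: tw_q_closed tw_shift_twisted)

text \<open>The summand \<open>X[1]\<close> has shift \<open>1\<close>, whence the sign of its
  component. The twist of the target sends this component through \<open>f\<close> into the
  component at \<open>E\<close>.\<close>

lemma tw_diff_shift_cone:
  assumes Z: "Z \<in> dg_ob A" and g: "g \<in> carrier (tw_hom_module A (tw_shift A Z 0) K k)"
  shows "cdiff (tw_hom A (tw_shift A Z 0) K) k g 0 0 = \<ominus>\<^bsub>grade (dg_hom A Z X) (k + 2)\<^esub> cdiff (dg_hom A Z X) (k + 1) (g 0 0)"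
    and "cdiff (tw_hom A (tw_shift A Z 0) K) k g 0 (Suc 0) =
      cdiff (dg_hom A Z E) k (g 0 (Suc 0)) \<oplus>\<^bsub>grade (dg_hom A Z E) (k + 1)\<^esub> dg_comp A Z X E 0 (k + 1) f (g 0 0)"
proof -
  have g': "g 0 0 \<in> dg_mor A Z X (k + 1)" "g 0 (Suc 0) \<in> dg_mor A Z E k"
    using g by (simp_all add: tw_hom_shift_cone_mem)
  have [simp]: "1 + k = k + 1" "2 + k = k + 2" "1 + (k + 1) = k + 2" by simp_all
  note simps = X E Z f_degree_zero g g' tw_diff_apply[OF tw_shift_twisted cone_twisted] tw_base_diff_apply
    tw_comp_apply_2[OF tw_shift_pre cone_pre cone_pre cone_q] tw_comp_apply_1[OF tw_shift_pre tw_shift_pre cone_pre _ shift_q]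
    tw_entry_def comp_linear_left comp_linear_right signed_simps signed_zero[OF hom_module] diff_closed comp_closed
    hom_group_closed abelian_group.group_simps(8,9)[OF hom_abelian_group] abelian_group.group_simps(17)[OF hom_abelian_group]
  show "cdiff (tw_hom A (tw_shift A Z 0) K) k g 0 0 = \<ominus>\<^bsub>grade (dg_hom A Z X) (k + 2)\<^esub> cdiff (dg_hom A Z X) (k + 1) (g 0 0)"
    by (simp add: simps)
  show "cdiff (tw_hom A (tw_shift A Z 0) K) k g 0 (Suc 0) =
      cdiff (dg_hom A Z E) k (g 0 (Suc 0)) \<oplus>\<^bsub>grade (dg_hom A Z E) (k + 1)\<^esub> dg_comp A Z X E 0 (k + 1) f (g 0 0)"
    by (simp add: simps)
qed

text \<open>Here the twist of the source acts: it contributes the component at \<open>E\<close>,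
  precomposed with \<open>f\<close>, to the component at \<open>X[1]\<close>. The sign
  \<open>(-1)^n\<close> comes from the target shift, the sign \<open>(-1)^k\<close> from the
  degree.\<close>

lemma tw_diff_cone_shift:
  assumes Z: "Z \<in> dg_ob A" and g: "g \<in> carrier (tw_hom_module A K (tw_shift A Z n) k)"
  shows "cdiff (tw_hom A K (tw_shift A Z n)) k g 0 0 =
      signed (grade (dg_hom A X Z) (k + n)) n (cdiff (dg_hom A X Z) (k + n - 1) (g 0 0))
      \<ominus>\<^bsub>grade (dg_hom A X Z) (k + n)\<^esub> signed (grade (dg_hom A X Z) (k + n)) k (dg_comp A X E Z (k + n) 0 (g (Suc 0) 0) f)"
    and "cdiff (tw_hom A K (tw_shift A Z n)) k g (Suc 0) 0 =
      signed (grade (dg_hom A E Z) (k + n + 1)) n (cdiff (dg_hom A E Z) (k + n) (g (Suc 0) 0))"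
proof -
  have g': "g 0 0 \<in> dg_mor A X Z (k + n - 1)" "g (Suc 0) 0 \<in> dg_mor A E Z (k + n)"
    using g by (simp_all add: tw_hom_cone_shift_mem)
  have [simp]: "k + 1 + n - 1 = k + n" "k + 1 + n = k + n + 1" "1 + (k + n - 1) = k + n" "1 + (k + n) = k + n + 1"
    "2 + (k + n - 1) = k + n + 1" "k + n - 1 + 2 = k + n + 1" by simp_all
  note simps = X E Z f_degree_zero g g' tw_diff_apply[OF cone_twisted tw_shift_twisted] tw_base_diff_apply
    tw_comp_apply_2[OF cone_pre cone_pre tw_shift_pre _ cone_q] tw_comp_apply_1[OF cone_pre tw_shift_pre tw_shift_pre shift_q]
    tw_entry_def comp_linear_left comp_linear_right signed_zero[OF hom_module] diff_closed comp_closed signed_closed[OF hom_module]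
    hom_group_closed abelian_group.group_simps(8,9)[OF hom_abelian_group] abelian_group.group_simps(17)[OF hom_abelian_group]
  show "cdiff (tw_hom A K (tw_shift A Z n)) k g 0 0 =
      signed (grade (dg_hom A X Z) (k + n)) n (cdiff (dg_hom A X Z) (k + n - 1) (g 0 0))
      \<ominus>\<^bsub>grade (dg_hom A X Z) (k + n)\<^esub> signed (grade (dg_hom A X Z) (k + n)) k (dg_comp A X E Z (k + n) 0 (g (Suc 0) 0) f)"
    by (simp add: simps)
  show "cdiff (tw_hom A K (tw_shift A Z n)) k g (Suc 0) 0 =
      signed (grade (dg_hom A E Z) (k + n + 1)) n (cdiff (dg_hom A E Z) (k + n) (g (Suc 0) 0))"
    by (simp add: simps)
qed

text \<open>In degree \<open>-1\<close> the term with the source twist enters with a plus sign, so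
  both twists contribute positively; only the entries into \<open>X[1]\<close> carry the sign of the
  shift.\<close>

lemma tw_diff_cone_cone:
  assumes g: "g \<in> carrier (tw_hom_module A K K (- 1))"
  shows "cdiff (tw_hom A K K) (- 1) g 0 0 =
      \<ominus>\<^bsub>grade (dg_hom A X X) 0\<^esub> cdiff (dg_hom A X X) (- 1) (g 0 0) \<oplus>\<^bsub>grade (dg_hom A X X) 0\<^esub> dg_comp A X E X 0 0 (g (Suc 0) 0) f"
    and "cdiff (tw_hom A K K) (- 1) g 0 (Suc 0) =
      cdiff (dg_hom A X E) (- 2) (g 0 (Suc 0)) \<oplus>\<^bsub>grade (dg_hom A X E) (- 1)\<^esub> dg_comp A X X E 0 (- 1) f (g 0 0)
      \<oplus>\<^bsub>grade (dg_hom A X E) (- 1)\<^esub> dg_comp A X E E (- 1) 0 (g (Suc 0) (Suc 0)) f"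
    and "cdiff (tw_hom A K K) (- 1) g (Suc 0) 0 = \<ominus>\<^bsub>grade (dg_hom A E X) 1\<^esub> cdiff (dg_hom A E X) 0 (g (Suc 0) 0)"
    and "cdiff (tw_hom A K K) (- 1) g (Suc 0) (Suc 0) =
      cdiff (dg_hom A E E) (- 1) (g (Suc 0) (Suc 0)) \<oplus>\<^bsub>grade (dg_hom A E E) 0\<^esub> dg_comp A E X E 0 0 f (g (Suc 0) 0)"
proof -
  have g': "g 0 0 \<in> dg_mor A X X (- 1)" "g 0 (Suc 0) \<in> dg_mor A X E (- 2)" "g (Suc 0) 0 \<in> dg_mor A E X 0" "g (Suc 0) (Suc 0) \<in> dg_mor A E E (- 1)"
    using g by (simp_all add: tw_hom_cone_cone_mem)
  note simps = X E f_degree_zero g g' tw_diff_apply[OF cone_twisted cone_twisted] tw_base_diff_apply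
    tw_comp_apply_2[OF cone_pre cone_pre cone_pre _ cone_q] tw_comp_apply_2[OF cone_pre cone_pre cone_pre cone_q]
    tw_entry_def comp_linear_left comp_linear_right signed_simps signed_zero[OF hom_module] diff_closed comp_closed a_minus_def
    hom_group_closed abelian_group.group_simps(8,9)[OF hom_abelian_group] abelian_group.minus_minus[OF hom_abelian_group]
  show "cdiff (tw_hom A K K) (- 1) g 0 0 =
      \<ominus>\<^bsub>grade (dg_hom A X X) 0\<^esub> cdiff (dg_hom A X X) (- 1) (g 0 0) \<oplus>\<^bsub>grade (dg_hom A X X) 0\<^esub> dg_comp A X E X 0 0 (g (Suc 0) 0) f"
    "cdiff (tw_hom A K K) (- 1) g 0 (Suc 0) =
      cdiff (dg_hom A X E) (- 2) (g 0 (Suc 0)) \<oplus>\<^bsub>grade (dg_hom A X E) (- 1)\<^esub> dg_comp A X X E 0 (- 1) f (g 0 0)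
      \<oplus>\<^bsub>grade (dg_hom A X E) (- 1)\<^esub> dg_comp A X E E (- 1) 0 (g (Suc 0) (Suc 0)) f"
    "cdiff (tw_hom A K K) (- 1) g (Suc 0) 0 = \<ominus>\<^bsub>grade (dg_hom A E X) 1\<^esub> cdiff (dg_hom A E X) 0 (g (Suc 0) 0)"
    "cdiff (tw_hom A K K) (- 1) g (Suc 0) (Suc 0) =
      cdiff (dg_hom A E E) (- 1) (g (Suc 0) (Suc 0)) \<oplus>\<^bsub>grade (dg_hom A E E) 0\<^esub> dg_comp A E X E 0 0 f (g (Suc 0) 0)"
    by (simp_all add: simps)
qed

end

end

section \<open>Distinguished triangles\<close>

context dg_category
begin

interpretation P: dg_category R "pretr A"
  by (rule pretr_dg_category)

lemma leibniz':
  "\<lbrakk>X \<in> dg_ob A; Y \<in> dg_ob A; Z \<in> dg_ob A; f \<in> dg_mor A X Y p; g \<in> dg_mor A Y Z q; s = q + p\<rbrakk> \<Longrightarrow>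
    cdiff (dg_hom A X Z) s (dg_comp A X Y Z q p g f) =
      dg_comp A X Y Z (q + 1) p (cdiff (dg_hom A Y Z) q g) f \<oplus>\<^bsub>grade (dg_hom A X Z) (s + 1)\<^esub>
      signed (grade (dg_hom A X Z) (s + 1)) q (dg_comp A X Y Z q (p + 1) g (cdiff (dg_hom A X Y) p f))"
  by (simp add: leibniz)

lemma identity_class_witness:
  assumes "X \<in> dg_ob A" "x \<in> cohom_class (dg_hom A X X) 0 (dg_id A X)"
  obtains w where "w \<in> dg_mor A X X (- 1)" "x = cdiff (dg_hom A X X) (- 1) w \<oplus>\<^bsub>grade (dg_hom A X X) 0\<^esub> dg_id A X"
  using assms complex_of_modules.cohom_class_mem[OF hom_complex_of_modules[OF assms(1,1)]] by (auto simp: coboundaries_def)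

lemma identity_classI:
  assumes "X \<in> dg_ob A" "w \<in> dg_mor A X X (- 1)" "x = cdiff (dg_hom A X X) (- 1) w \<oplus>\<^bsub>grade (dg_hom A X X) 0\<^esub> dg_id A X"
  shows "x \<in> cohom_class (dg_hom A X X) 0 (dg_id A X)"
  using assms complex_of_modules.cohom_class_mem[OF hom_complex_of_modules[OF assms(1,1)]] by (auto simp: coboundaries_def)

text \<open>The matrices have a single entry, and their entries are the morphisms sought; the degree
  of an entry \<open>X[0] -> Y[n]\<close> is \<open>n\<close>.\<close>

lemma tw_shift_isoD:
  assumes ob: "X \<in> dg_ob A" "Y \<in> dg_ob A"
    and iso: "isomorphic (homotopy_category (pretr A)) (tw_shift A X 0) (tw_shift A Y n)"
  shows "shift_iso n X Y"
proof -
  let ?E = "tw_shift A X 0" and ?F = "tw_shift A Y n"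
  obtain t s where t: "t \<in> cocycles (tw_hom A ?E ?F) 0" and s: "s \<in> cocycles (tw_hom A ?F ?E) 0"
    and st: "tw_comp A ?E ?F ?E 0 0 s t \<in> cohom_class (tw_hom A ?E ?E) 0 (dg_id (pretr A) ?E)"
    and ts: "tw_comp A ?F ?E ?F 0 0 t s \<in> cohom_class (tw_hom A ?F ?F) 0 (dg_id (pretr A) ?F)"
    using iso unfolding isomorphic_def by (auto elim!: P.iso_arrow_homotopyD)
  have E: "?E \<in> tw_pre A" and F: "?F \<in> tw_pre A" using ob by (simp_all add: tw_shift_pre)
  have t': "t \<in> carrier (tw_hom_module A ?E ?F 0)" and s': "s \<in> carrier (tw_hom_module A ?F ?E 0)"
    using t s by (simp_all add: cocycles_def)
  have u: "t 0 0 \<in> dg_mor A X Y n" and v: "s 0 0 \<in> dg_mor A Y X (- n)"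
    using tw_hom_memD[OF t', of 0 0] tw_hom_memD[OF s', of 0 0] by (simp_all add: tw_entry_def)
  have "cdiff (tw_hom A ?E ?F) 0 t 0 0 = \<zero>\<^bsub>tw_hom_module A ?E ?F 1\<^esub> 0 0"
    "cdiff (tw_hom A ?F ?E) 0 s 0 0 = \<zero>\<^bsub>tw_hom_module A ?F ?E 1\<^esub> 0 0"
    using t s by (simp_all add: cocycles_def)
  then have d: "signed (grade (dg_hom A X Y) (1 + n)) n (cdiff (dg_hom A X Y) n (t 0 0)) = \<zero>\<^bsub>grade (dg_hom A X Y) (1 + n)\<^esub>"
    "cdiff (dg_hom A Y X) (- n) (s 0 0) = \<zero>\<^bsub>grade (dg_hom A Y X) (1 - n)\<^esub>"
    using tw_diff_shift_shift[OF ob t'] tw_diff_shift_shift[OF ob(2,1) s']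
    by (simp_all add: tw_hom_module_simps tw_entry_def signed_simps)
  \<comment> \<open>Closedness in \<open>pretr A\<close> controls the differential only up to the
    sign \<open>(-1)^n\<close> of the target shift; applying the sign twice removes it.\<close>
  have "cdiff (dg_hom A X Y) n (t 0 0) = signed (grade (dg_hom A X Y) (1 + n)) n (signed (grade (dg_hom A X Y) (1 + n)) n (cdiff (dg_hom A X Y) n (t 0 0)))"
    using ob u by (subst signed_signed[OF hom_module]) (simp_all add: diff_closed signed_simps)
  then have d': "cdiff (dg_hom A X Y) n (t 0 0) = \<zero>\<^bsub>grade (dg_hom A X Y) (n + 1)\<^esub>"
    using ob d(1) by (simp add: signed_zero[OF hom_module] add.commute)
  obtain W where W: "W \<in> carrier (tw_hom_module A ?E ?E (- 1))"
    "tw_comp A ?E ?F ?E 0 0 s t = cdiff (tw_hom A ?E ?E) (- 1) W \<oplus>\<^bsub>tw_hom_module A ?E ?E 0\<^esub> dg_id (pretr A) ?E"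
    using dg_category.identity_class_witness[OF pretr_dg_category, of ?E "tw_comp A ?E ?F ?E 0 0 s t"] st ob by (auto simp: tw_shift_twisted)
  obtain V where V: "V \<in> carrier (tw_hom_module A ?F ?F (- 1))"
    "tw_comp A ?F ?E ?F 0 0 t s = cdiff (tw_hom A ?F ?F) (- 1) V \<oplus>\<^bsub>tw_hom_module A ?F ?F 0\<^esub> dg_id (pretr A) ?F"
    using dg_category.identity_class_witness[OF pretr_dg_category, of ?F "tw_comp A ?F ?E ?F 0 0 t s"] ts ob by (auto simp: tw_shift_twisted)
  have W0: "W 0 0 \<in> dg_mor A X X (- 1)" and V0: "V 0 0 \<in> dg_mor A Y Y (- 1)"
    using tw_hom_memD[OF W(1), of 0 0] tw_hom_memD[OF V(1), of 0 0] by (simp_all add: tw_entry_def)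
  have vu: "dg_comp A X Y X (- n) n (s 0 0) (t 0 0) = cdiff (dg_hom A X X) (- 1) (W 0 0) \<oplus>\<^bsub>grade (dg_hom A X X) 0\<^esub> dg_id A X"
    using fun_cong[OF fun_cong[OF W(2)], of 0 0] tw_comp_apply_1[OF E F E s' t', of 0 0] tw_diff_shift_shift[OF ob(1,1) W(1)]
    by (simp add: tw_hom_module_simps tw_id_apply tw_entry_def signed_simps)
  have uv: "dg_comp A Y X Y n (- n) (t 0 0) (s 0 0) = signed (grade (dg_hom A Y Y) 0) n (cdiff (dg_hom A Y Y) (- 1) (V 0 0)) \<oplus>\<^bsub>grade (dg_hom A Y Y) 0\<^esub> dg_id A Y"
    using fun_cong[OF fun_cong[OF V(2)], of 0 0] tw_comp_apply_1[OF F E F t' s', of 0 0] tw_diff_shift_shift[OF ob(2,2) V(1)]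
    by (simp add: tw_hom_module_simps tw_id_apply tw_entry_def)
  interpret YY: complex_of_modules R "dg_hom A Y Y" using ob by (simp add: hom_complex_of_modules)
  \<comment> \<open>On \<open>Y[n]\<close> the homotopy \<open>V\<close> is differentiated with the
    sign \<open>(-1)^n\<close>, which is harmless since coboundaries are closed under signs.\<close>
  have "dg_comp A Y X Y n (- n) (t 0 0) (s 0 0) \<in> cohom_class (dg_hom A Y Y) 0 (dg_id A Y)"
    using V0 by (intro YY.cohom_class_memI[OF _ uv] YY.signed_coboundary YY.coboundaryI) simp_all
  moreover have "dg_comp A X Y X (- n) n (s 0 0) (t 0 0) \<in> cohom_class (dg_hom A X X) 0 (dg_id A X)"
    using ob(1) W0 vu by (rule identity_classI)
  ultimately show ?thesis
    unfolding shift_iso_def using ob u v d d' by (auto simp: cocycles_def)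
qed

text \<open>Up to homotopy \<open>f\<close>, \<open>s1\<close> and \<open>t0\<close> are the three
  morphisms of the triangle: \<open>s1\<close> is the inclusion of \<open>E\<close> into the cone
  followed by the inverse isomorphism, and \<open>t0\<close> is the isomorphism followed by the
  projection to \<open>X[1]\<close>. Hence \<open>g\<close> and \<open>h\<close> are not recorded
  separately.\<close>

lemma triangle_cone_data:
  assumes "triangle A X E Z"
  obtains f t0 t1 s0 s1 p q r w where "cone_data A X E Z f t0 t1 s0 s1 p q r w"
proof -
  obtain f g h where fgh: "distinguished A X E Z f g h"
    using assms by (auto simp: triangle_def)
  then have ob: "X \<in> dg_ob A" "E \<in> dg_ob A" "Z \<in> dg_ob A" and f: "f \<in> cocycles (dg_hom A X E) 0"
    by (auto simp: distinguished_def)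
  let ?Z = "tw_shift A Z 0" and ?K = "tw_cone A X E f"
  obtain \<theta> where \<theta>: "iso_arrow (homotopy_category (pretr A)) ?Z ?K \<theta>"
    using fgh by (auto simp: distinguished_def Let_def)
  then obtain t s where t: "t \<in> cocycles (tw_hom A ?Z ?K) 0" and s: "s \<in> cocycles (tw_hom A ?K ?Z) 0"
    and st: "tw_comp A ?Z ?K ?Z 0 0 s t \<in> cohom_class (tw_hom A ?Z ?Z) 0 (dg_id (pretr A) ?Z)"
    and ts: "tw_comp A ?K ?Z ?K 0 0 t s \<in> cohom_class (tw_hom A ?K ?K) 0 (dg_id (pretr A) ?K)"
    by (auto elim!: P.iso_arrow_homotopyD)
  have Z: "?Z \<in> tw_pre A" and K: "?K \<in> tw_pre A" using ob by (simp_all add: tw_shift_pre tw_cone_pre)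
  have t': "t \<in> carrier (tw_hom_module A ?Z ?K 0)" and s': "s \<in> carrier (tw_hom_module A ?K ?Z 0)"
    using t s by (simp_all add: cocycles_def)
  have tc: "t 0 0 \<in> dg_mor A Z X 1" "t 0 (Suc 0) \<in> dg_mor A Z E 0"
    using t' tw_hom_shift_cone_mem[OF ob(1,2) f] by simp_all
  have sc: "s 0 0 \<in> dg_mor A X Z (- 1)" "s (Suc 0) 0 \<in> dg_mor A E Z 0"
    using s' tw_hom_cone_shift_mem[OF ob(1,2) f] by simp_all
  obtain W where W: "W \<in> carrier (tw_hom_module A ?Z ?Z (- 1))"
    "tw_comp A ?Z ?K ?Z 0 0 s t = cdiff (tw_hom A ?Z ?Z) (- 1) W \<oplus>\<^bsub>tw_hom_module A ?Z ?Z 0\<^esub> dg_id (pretr A) ?Z"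
    using dg_category.identity_class_witness[OF pretr_dg_category, of ?Z "tw_comp A ?Z ?K ?Z 0 0 s t"] st ob by (auto simp: tw_shift_twisted)
  obtain H where H: "H \<in> carrier (tw_hom_module A ?K ?K (- 1))"
    "tw_comp A ?K ?Z ?K 0 0 t s = cdiff (tw_hom A ?K ?K) (- 1) H \<oplus>\<^bsub>tw_hom_module A ?K ?K 0\<^esub> dg_id (pretr A) ?K"
    using dg_category.identity_class_witness[OF pretr_dg_category, of ?K "tw_comp A ?K ?Z ?K 0 0 t s"] ts ob f by (auto simp: tw_cone_twisted)
  have Wc: "W 0 0 \<in> dg_mor A Z Z (- 1)"
    using tw_hom_memD[OF W(1), of 0 0] by (simp add: tw_entry_def)
  have Hc: "H 0 0 \<in> dg_mor A X X (- 1)" "H (Suc 0) 0 \<in> dg_mor A E X 0" "H (Suc 0) (Suc 0) \<in> dg_mor A E E (- 1)"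
    using H(1) tw_hom_cone_cone_mem[OF ob(1,2) f] by simp_all
  note ap = tw_hom_module_simps(2,3) tw_entry_def tw_id_apply signed_simps
  have dt: "cdiff (tw_hom A ?Z ?K) 0 t i j = \<zero>\<^bsub>tw_hom_module A ?Z ?K 1\<^esub> i j" for i j
    using t by (simp add: cocycles_def)
  have ds: "cdiff (tw_hom A ?K ?Z) 0 s i j = \<zero>\<^bsub>tw_hom_module A ?K ?Z 1\<^esub> i j" for i j
    using s by (simp add: cocycles_def)
  \<comment> \<open>Closedness of \<open>t\<close> and \<open>s\<close> and the two homotopies are
    read off entry by entry; in the cone, index \<open>0\<close> is \<open>X[1]\<close> and index
    \<open>Suc 0\<close> is \<open>E\<close>.\<close>
  have e1: "\<ominus>\<^bsub>grade (dg_hom A Z X) 2\<^esub> cdiff (dg_hom A Z X) 1 (t 0 0) = \<zero>\<^bsub>grade (dg_hom A Z X) 2\<^esub>"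
    using dt[of 0 0] tw_diff_shift_cone(1)[OF ob(1,2) f ob(3) t'] by (simp add: ap)
  have e2: "cdiff (dg_hom A Z E) 0 (t 0 (Suc 0)) \<oplus>\<^bsub>grade (dg_hom A Z E) 1\<^esub> dg_comp A Z X E 0 1 f (t 0 0) = \<zero>\<^bsub>grade (dg_hom A Z E) 1\<^esub>"
    using dt[of 0 "Suc 0"] tw_diff_shift_cone(2)[OF ob(1,2) f ob(3) t'] by (simp add: ap)
  have e3: "cdiff (dg_hom A X Z) (- 1) (s 0 0) \<ominus>\<^bsub>grade (dg_hom A X Z) 0\<^esub> dg_comp A X E Z 0 0 (s (Suc 0) 0) f = \<zero>\<^bsub>grade (dg_hom A X Z) 0\<^esub>"
    using ds[of 0 0] tw_diff_cone_shift(1)[OF ob(1,2) f ob(3) s'] by (simp add: ap)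
  have e4: "cdiff (dg_hom A E Z) 0 (s (Suc 0) 0) = \<zero>\<^bsub>grade (dg_hom A E Z) 1\<^esub>"
    using ds[of "Suc 0" 0] tw_diff_cone_shift(2)[OF ob(1,2) f ob(3) s'] by (simp add: ap)
  have e5: "dg_comp A Z X Z (- 1) 1 (s 0 0) (t 0 0) \<oplus>\<^bsub>grade (dg_hom A Z Z) 0\<^esub> dg_comp A Z E Z 0 0 (s (Suc 0) 0) (t 0 (Suc 0)) =
      cdiff (dg_hom A Z Z) (- 1) (W 0 0) \<oplus>\<^bsub>grade (dg_hom A Z Z) 0\<^esub> dg_id A Z"
    using fun_cong[OF fun_cong[OF W(2)], of 0 0] tw_comp_apply_2[OF Z K Z s' t', of 0 0] tw_diff_shift_shift[OF ob(3,3) W(1)]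
    by (simp add: ap)
  have e6: "dg_comp A X Z X 1 (- 1) (t 0 0) (s 0 0) =
      \<ominus>\<^bsub>grade (dg_hom A X X) 0\<^esub> cdiff (dg_hom A X X) (- 1) (H 0 0)
      \<oplus>\<^bsub>grade (dg_hom A X X) 0\<^esub> dg_comp A X E X 0 0 (H (Suc 0) 0) f \<oplus>\<^bsub>grade (dg_hom A X X) 0\<^esub> dg_id A X"
    using fun_cong[OF fun_cong[OF H(2)], of 0 0] tw_comp_apply_1[OF K Z K t' s', of 0 0] tw_diff_cone_cone(1)[OF ob(1,2) f H(1)]
    by (simp add: ap)
  have e7: "dg_comp A E Z X 1 0 (t 0 0) (s (Suc 0) 0) = \<ominus>\<^bsub>grade (dg_hom A E X) 1\<^esub> cdiff (dg_hom A E X) 0 (H (Suc 0) 0)"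
    using fun_cong[OF fun_cong[OF H(2)], of "Suc 0" 0] tw_comp_apply_1[OF K Z K t' s', of "Suc 0" 0] tw_diff_cone_cone(3)[OF ob(1,2) f H(1)]
      ob Hc by (simp add: ap diff_closed hom_group_closed abelian_group.group_simps(9)[OF hom_abelian_group])
  have e8: "dg_comp A E Z E 0 0 (t 0 (Suc 0)) (s (Suc 0) 0) =
      cdiff (dg_hom A E E) (- 1) (H (Suc 0) (Suc 0))
      \<oplus>\<^bsub>grade (dg_hom A E E) 0\<^esub> dg_comp A E X E 0 0 f (H (Suc 0) 0) \<oplus>\<^bsub>grade (dg_hom A E E) 0\<^esub> dg_id A E"
    using fun_cong[OF fun_cong[OF H(2)], of "Suc 0" "Suc 0"] tw_comp_apply_1[OF K Z K t' s', of "Suc 0" "Suc 0"] tw_diff_cone_cone(4)[OF ob(1,2) f H(1)]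
    by (simp add: ap)
  have f': "f \<in> dg_mor A X E 0" "cdiff (dg_hom A X E) 0 f = \<zero>\<^bsub>grade (dg_hom A X E) 1\<^esub>"
    using f by (auto simp: cocycles_def)
  have e1': "cdiff (dg_hom A Z X) 1 (t 0 0) = \<zero>\<^bsub>grade (dg_hom A Z X) 2\<^esub>"
    using e1 ob tc by (simp add: hom_group_simps diff_closed)
  have e2': "cdiff (dg_hom A Z E) 0 (t 0 (Suc 0)) = \<ominus>\<^bsub>grade (dg_hom A Z E) 1\<^esub> dg_comp A Z X E 0 1 f (t 0 0)"
    using e2 ob tc f' by (simp add: hom_group_simps diff_closed comp_closed)
  have e3': "cdiff (dg_hom A X Z) (- 1) (s 0 0) = dg_comp A X E Z 0 0 (s (Suc 0) 0) f"
    using e3 ob sc f' by (simp add: hom_group_simps diff_closed comp_closed)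
  show thesis
    by (rule that, unfold cone_data_def, intro conjI)
      (fact ob f' tc sc Wc Hc e1' e2' e3' e4 e5 e6 e7 e8)+
qed

end

section \<open>Exactness\<close>

context dg_category
begin

text \<open>This is the vanishing of \<open>Hom(X, Y[n])\<close> in the homotopy category, in a form
  that does not refer to an object \<open>Y[n]\<close>.\<close>

abbreviation null_at :: "int \<Rightarrow> 'o \<Rightarrow> 'o \<Rightarrow> bool" where
  "null_at n X Y \<equiv> cocycles (dg_hom A X Y) n \<subseteq> coboundaries (dg_hom A X Y) n"

lemma null_at_witness:
  assumes "null_at n X Y" "u \<in> dg_mor A X Y n" "cdiff (dg_hom A X Y) n u = \<zero>\<^bsub>grade (dg_hom A X Y) (n + 1)\<^esub>"
  obtains w where "w \<in> dg_mor A X Y (n - 1)" "cdiff (dg_hom A X Y) (n - 1) w = u"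
proof -
  have "u \<in> coboundaries (dg_hom A X Y) n" using assms by (auto simp: cocycles_def)
  then show thesis using that by (auto simp: coboundaries_def)
qed

lemmas dg_simps = comp_closed diff_closed hom_group_closed leibniz' diff_linear comp_linear_left comp_linear_right
  comp_id_left comp_id_right signed_simps id_degree_zero

text \<open>Exactness of \<open>Hom(-, T[-1])\<close> at \<open>E\<close>, with an explicit
  primitive. Since \<open>t f\<close> is exact, \<open>t\<close> extends to the cone; on
  \<open>Z\<close> the extension is exact, and restricting its primitive back to \<open>E\<close>
  recovers \<open>t\<close> up to the recorded homotopies.\<close>

lemma null_at_contravariant:
  assumes K: "cone_data A X E Z f t0 t1 s0 s1 p q r w" and T: "T \<in> dg_ob A"
    and nX: "null_at (- 1) X T" and nZ: "null_at (- 1) Z T"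
  shows "null_at (- 1) E T"
proof
  note K = K[unfolded cone_data_def]
  fix t assume "t \<in> cocycles (dg_hom A E T) (- 1)"
  then have t: "t \<in> dg_mor A E T (- 1)" "cdiff (dg_hom A E T) (- 1) t = \<zero>\<^bsub>grade (dg_hom A E T) 0\<^esub>"
    by (auto simp: cocycles_def)
  obtain u where u: "u \<in> dg_mor A X T (- 2)" "cdiff (dg_hom A X T) (- 2) u = dg_comp A X E T (- 1) 0 t f"
    using null_at_witness[OF nX, of "dg_comp A X E T (- 1) 0 t f"] K T t by (auto simp: dg_simps hom_group_simps)
  \<comment> \<open>The morphism from the cone with components \<open>-u\<close> on
    \<open>X[1]\<close> and \<open>t\<close> on \<open>E\<close>, pulled back to \<open>Z\<close>.
    It is closed because \<open>d t1 = - f t0\<close> and \<open>d u = t f\<close>.\<close>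
  define v where "v = dg_comp A Z E T (- 1) 0 t t1 \<ominus>\<^bsub>grade (dg_hom A Z T) (- 1)\<^esub> dg_comp A Z X T (- 2) 1 u t0"
  have "v \<in> dg_mor A Z T (- 1)" "cdiff (dg_hom A Z T) (- 1) v = \<zero>\<^bsub>grade (dg_hom A Z T) (- 1 + 1)\<^esub>"
    using K T t u by (simp_all add: v_def dg_simps comp_assoc' hom_group_simps)
  from null_at_witness[OF nZ this] obtain x where x: "x \<in> dg_mor A Z T (- 2)" "cdiff (dg_hom A Z T) (- 2) x = v"
    by auto
  \<comment> \<open>The differential of \<open>x s1\<close> is \<open>t t1 s1 - u t0 s1\<close>,
    which the cone equations rewrite as \<open>t + t (dr) + t f q + u (dq)\<close>. The differential
    of \<open>t r\<close> cancels the second summand, that of \<open>u q\<close> the last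
    two.\<close>
  let ?y = "dg_comp A E Z T (- 2) 0 x s1 \<oplus>\<^bsub>grade (dg_hom A E T) (- 2)\<^esub> dg_comp A E E T (- 1) (- 1) t r
      \<ominus>\<^bsub>grade (dg_hom A E T) (- 2)\<^esub> dg_comp A E X T (- 2) 0 u q"
  have "dg_comp A E Z T (- 1) 0 v s1 = dg_comp A E Z T (- 1) 0 (dg_comp A Z E T (- 1) 0 t t1) s1
      \<ominus>\<^bsub>grade (dg_hom A E T) (- 1)\<^esub> dg_comp A E Z T (- 1) 0 (dg_comp A Z X T (- 2) 1 u t0) s1"
    using K T t u by (simp add: v_def comp_closed comp_linear_left)
  then have "cdiff (dg_hom A E T) (- 2) ?y = t"
    using K T t u x by (simp add: dg_simps comp_assoc' hom_group_simps)
  moreover have "?y \<in> dg_mor A E T (- 2)"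
    using K T t u x by (simp add: dg_simps)
  ultimately show "t \<in> coboundaries (dg_hom A E T) (- 1)"
    unfolding coboundaries_def by force
qed

text \<open>Exactness of \<open>Hom(T, -)\<close> at \<open>E\<close>, with an explicit primitive.
  Since \<open>s1 t\<close> is exact, \<open>t\<close> lifts up to homotopy along \<open>f\<close>
  to a closed morphism into \<open>X\<close>, which is exact.\<close>

lemma null_at_covariant:
  assumes K: "cone_data A X E Z f t0 t1 s0 s1 p q r w" and T: "T \<in> dg_ob A"
    and nX: "null_at (- 1) T X" and nZ: "null_at (- 1) T Z"
  shows "null_at (- 1) T E"
proof
  note K = K[unfolded cone_data_def]
  fix t assume "t \<in> cocycles (dg_hom A T E) (- 1)"
  then have t: "t \<in> dg_mor A T E (- 1)" "cdiff (dg_hom A T E) (- 1) t = \<zero>\<^bsub>grade (dg_hom A T E) 0\<^esub>"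
    by (auto simp: cocycles_def)
  obtain u where u: "u \<in> dg_mor A T Z (- 2)" "cdiff (dg_hom A T Z) (- 2) u = dg_comp A T E Z 0 (- 1) s1 t"
    using null_at_witness[OF nZ, of "dg_comp A T E Z 0 (- 1) s1 t"] K T t by (auto simp: dg_simps hom_group_simps)
  \<comment> \<open>The lift of \<open>t\<close> to \<open>X\<close>. It is closed because both
    \<open>t0 u\<close> and \<open>q t\<close> have differential \<open>(dq) t\<close>, by
    \<open>d u = s1 t\<close> and \<open>t0 s1 = - dq\<close>.\<close>
  define v where "v = dg_comp A T Z X 1 (- 2) t0 u \<ominus>\<^bsub>grade (dg_hom A T X) (- 1)\<^esub> dg_comp A T E X 0 (- 1) q t"
  have t01: "dg_comp A T Z X 1 (- 1) t0 (dg_comp A T E Z 0 (- 1) s1 t) = dg_comp A T E X 1 (- 1) (dg_comp A E Z X 1 0 t0 s1) t"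
    "dg_comp A T Z E 0 (- 1) t1 (dg_comp A T E Z 0 (- 1) s1 t) = dg_comp A T E E 0 (- 1) (dg_comp A E Z E 0 0 t1 s1) t"
    using K T t comp_assoc[of T E Z X t "- 1" s1 0 t0 1] comp_assoc[of T E Z E t "- 1" s1 0 t1 0] by simp_all
  have "v \<in> dg_mor A T X (- 1)" "cdiff (dg_hom A T X) (- 1) v = \<zero>\<^bsub>grade (dg_hom A T X) (- 1 + 1)\<^esub>"
    using K T t u by (simp_all add: v_def dg_simps t01 hom_group_simps)
  from null_at_witness[OF nX this] obtain x where x: "x \<in> dg_mor A T X (- 2)" "cdiff (dg_hom A T X) (- 2) x = v"
    by auto
  \<comment> \<open>The first two summands have differential \<open>t - f v\<close>, by
    \<open>d t1 = - f t0\<close> and the formula for \<open>t1 s1\<close>; the last one contributes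
    \<open>f v\<close>.\<close>
  let ?y = "dg_comp A T Z E 0 (- 2) t1 u \<ominus>\<^bsub>grade (dg_hom A T E) (- 2)\<^esub> dg_comp A T E E (- 1) (- 1) r t
      \<oplus>\<^bsub>grade (dg_hom A T E) (- 2)\<^esub> dg_comp A T X E 0 (- 2) f x"
  have "dg_comp A T X E 0 (- 1) f v = dg_comp A T X E 0 (- 1) f (dg_comp A T Z X 1 (- 2) t0 u)
      \<ominus>\<^bsub>grade (dg_hom A T E) (- 1)\<^esub> dg_comp A T X E 0 (- 1) f (dg_comp A T E X 0 (- 1) q t)"
    using K T t u by (simp add: v_def comp_closed comp_linear_right)
  then have "cdiff (dg_hom A T E) (- 2) ?y = t"
    using K T t u x by (simp add: dg_simps t01 comp_assoc' hom_group_simps)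
  moreover have "?y \<in> dg_mor A T E (- 2)"
    using K T t u x by (simp add: dg_simps)
  ultimately show "t \<in> coboundaries (dg_hom A T E) (- 1)"
    unfolding coboundaries_def by force
qed

text \<open>If \<open>E -> Z\<close> is null-homotopic, then \<open>f\<close> has a right inverse up
  to homotopy; vanishing of \<open>H^-1(Hom(X, Z))\<close> makes it a left inverse as well.\<close>

lemma shift_iso_of_null_right:
  assumes K: "cone_data A X E Z f t0 t1 s0 s1 p q r w" and nE: "null_at 0 E Z" and nX: "null_at (- 1) X Z"
  shows "shift_iso 0 X E"
proof -
  note K = K[unfolded cone_data_def]
  obtain m where m: "m \<in> dg_mor A E Z (- 1)" "cdiff (dg_hom A E Z) (- 1) m = s1"
    using null_at_witness[OF nE, of s1] K by auto
  \<comment> \<open>The difference of two primitives of \<open>s1 f\<close>, hence closed; this is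
    where vanishing in degree \<open>-1\<close> is applied.\<close>
  define e where "e = dg_comp A X E Z (- 1) 0 m f \<ominus>\<^bsub>grade (dg_hom A X Z) (- 1)\<^esub> s0"
  have "e \<in> dg_mor A X Z (- 1)" "cdiff (dg_hom A X Z) (- 1) e = \<zero>\<^bsub>grade (dg_hom A X Z) (- 1 + 1)\<^esub>"
    using K m by (simp_all add: e_def dg_simps hom_group_simps)
  from null_at_witness[OF nX this] obtain l where l: "l \<in> dg_mor A X Z (- 2)" "cdiff (dg_hom A X Z) (- 2) l = e"
    by auto
  have t0e: "dg_comp A X Z X 1 (- 1) t0 e = dg_comp A X Z X 1 (- 1) t0 (dg_comp A X E Z (- 1) 0 m f)
      \<ominus>\<^bsub>grade (dg_hom A X X) 0\<^esub> dg_comp A X Z X 1 (- 1) t0 s0"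
    using K m by (simp add: e_def comp_closed comp_linear_right)
  \<comment> \<open>The correction by \<open>q\<close> makes \<open>t0 m\<close> closed, as
    \<open>d(t0 m) = - t0 s1 = dq\<close>.\<close>
  let ?\<rho> = "dg_comp A E Z X 1 (- 1) t0 m \<ominus>\<^bsub>grade (dg_hom A E X) 0\<^esub> q"
  have "?\<rho> \<in> dg_mor A E X 0" "cdiff (dg_hom A E X) 0 ?\<rho> = \<zero>\<^bsub>grade (dg_hom A E X) 1\<^esub>"
    using K m by (simp_all add: dg_simps hom_group_simps)
  moreover have "dg_comp A E X E 0 0 f ?\<rho> \<in> cohom_class (dg_hom A E E) 0 (dg_id A E)"
    by (rule identity_classI[where w = "r \<ominus>\<^bsub>grade (dg_hom A E E) (- 1)\<^esub> dg_comp A E Z E 0 (- 1) t1 m"])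
      (use K m in \<open>simp_all add: dg_simps comp_assoc' hom_group_simps\<close>)
  moreover have "dg_comp A X E X 0 0 ?\<rho> f \<in> cohom_class (dg_hom A X X) 0 (dg_id A X)"
    by (rule identity_classI[where w = "\<ominus>\<^bsub>grade (dg_hom A X X) (- 1)\<^esub> dg_comp A X Z X 1 (- 2) t0 l \<ominus>\<^bsub>grade (dg_hom A X X) (- 1)\<^esub> p"])
      (use K m l t0e in \<open>simp_all add: dg_simps comp_assoc' hom_group_simps\<close>)
  ultimately show ?thesis
    unfolding shift_iso_def using K by (auto simp: cocycles_def)
qed

text \<open>Dual situation: if \<open>f\<close> is null-homotopic, then \<open>s1\<close> has a left
  inverse up to homotopy, and vanishing of \<open>H^-1(Hom(X, Z))\<close> again makes it
  two-sided.\<close>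

lemma shift_iso_of_null_left:
  assumes K: "cone_data A X E Z f t0 t1 s0 s1 p q r w" and nE: "null_at 0 X E" and nX: "null_at (- 1) X Z"
  shows "shift_iso 0 E Z"
proof -
  note K = K[unfolded cone_data_def]
  obtain k where k: "k \<in> dg_mor A X E (- 1)" "cdiff (dg_hom A X E) (- 1) k = f"
    using null_at_witness[OF nE, of f] K by auto
  define e where "e = dg_comp A X E Z 0 (- 1) s1 k \<ominus>\<^bsub>grade (dg_hom A X Z) (- 1)\<^esub> s0"
  have "e \<in> dg_mor A X Z (- 1)" "cdiff (dg_hom A X Z) (- 1) e = \<zero>\<^bsub>grade (dg_hom A X Z) (- 1 + 1)\<^esub>"
    using K k by (simp_all add: e_def dg_simps hom_group_simps)
  from null_at_witness[OF nX this] obtain l where l: "l \<in> dg_mor A X Z (- 2)" "cdiff (dg_hom A X Z) (- 2) l = e"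
    by auto
  have et0: "dg_comp A Z X Z (- 1) 1 e t0 = dg_comp A Z E Z 0 0 s1 (dg_comp A Z X E (- 1) 1 k t0)
      \<ominus>\<^bsub>grade (dg_hom A Z Z) 0\<^esub> dg_comp A Z X Z (- 1) 1 s0 t0"
    using K k comp_assoc[of Z X E Z t0 1 k "- 1" s1 0] by (simp add: e_def comp_closed comp_linear_left)
  \<comment> \<open>The differential \<open>- f t0\<close> of \<open>t1\<close> is compensated by
    that of \<open>k t0\<close>, since \<open>d k = f\<close>.\<close>
  let ?\<rho> = "t1 \<oplus>\<^bsub>grade (dg_hom A Z E) 0\<^esub> dg_comp A Z X E (- 1) 1 k t0"
  have "?\<rho> \<in> dg_mor A Z E 0" "cdiff (dg_hom A Z E) 0 ?\<rho> = \<zero>\<^bsub>grade (dg_hom A Z E) 1\<^esub>"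
    using K k by (simp_all add: dg_simps hom_group_simps)
  moreover have "dg_comp A E Z E 0 0 ?\<rho> s1 \<in> cohom_class (dg_hom A E E) 0 (dg_id A E)"
    by (rule identity_classI[where w = "r \<oplus>\<^bsub>grade (dg_hom A E E) (- 1)\<^esub> dg_comp A E X E (- 1) 0 k q"])
      (use K k in \<open>simp_all add: dg_simps comp_assoc' hom_group_simps\<close>)
  moreover have "dg_comp A Z E Z 0 0 s1 ?\<rho> \<in> cohom_class (dg_hom A Z Z) 0 (dg_id A Z)"
  proof (rule identity_classI[where w = "w \<oplus>\<^bsub>grade (dg_hom A Z Z) (- 1)\<^esub> dg_comp A Z X Z (- 2) 1 l t0"])
    have eq: "dg_comp A Z E Z 0 0 s1 t1 = cdiff (dg_hom A Z Z) (- 1) w \<oplus>\<^bsub>grade (dg_hom A Z Z) 0\<^esub> dg_id A Z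
        \<ominus>\<^bsub>grade (dg_hom A Z Z) 0\<^esub> dg_comp A Z X Z (- 1) 1 s0 t0"
    proof -
      have "Z \<in> dg_ob A" "cdiff (dg_hom A Z Z) (- 1) w \<in> dg_mor A Z Z 0" "dg_comp A Z E Z 0 0 s1 t1 \<in> dg_mor A Z Z 0"
        "dg_comp A Z X Z (- 1) 1 s0 t0 \<in> dg_mor A Z Z 0" "dg_id A Z \<in> dg_mor A Z Z 0"
        using K by (simp_all add: dg_simps)
      moreover have "dg_comp A Z X Z (- 1) 1 s0 t0 \<oplus>\<^bsub>grade (dg_hom A Z Z) 0\<^esub> dg_comp A Z E Z 0 0 s1 t1 =
          cdiff (dg_hom A Z Z) (- 1) w \<oplus>\<^bsub>grade (dg_hom A Z Z) 0\<^esub> dg_id A Z"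
        using K by blast
      ultimately show ?thesis by (simp add: hom_group_simps)
    qed
    have "dg_comp A Z E Z 0 0 s1 ?\<rho> = dg_comp A Z E Z 0 0 s1 t1 \<oplus>\<^bsub>grade (dg_hom A Z Z) 0\<^esub> dg_comp A Z E Z 0 0 s1 (dg_comp A Z X E (- 1) 1 k t0)"
      using K k by (simp add: comp_closed comp_linear_right)
    also have "\<dots> = cdiff (dg_hom A Z Z) (- 1) w \<oplus>\<^bsub>grade (dg_hom A Z Z) 0\<^esub> dg_id A Z
        \<ominus>\<^bsub>grade (dg_hom A Z Z) 0\<^esub> dg_comp A Z X Z (- 1) 1 s0 t0
        \<oplus>\<^bsub>grade (dg_hom A Z Z) 0\<^esub> dg_comp A Z E Z 0 0 s1 (dg_comp A Z X E (- 1) 1 k t0)"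
      by (simp only: eq)
    finally show "dg_comp A Z E Z 0 0 s1 ?\<rho> = cdiff (dg_hom A Z Z) (- 1) (w \<oplus>\<^bsub>grade (dg_hom A Z Z) (- 1)\<^esub> dg_comp A Z X Z (- 2) 1 l t0)
        \<oplus>\<^bsub>grade (dg_hom A Z Z) 0\<^esub> dg_id A Z"
      using K k l et0 by (simp add: dg_simps hom_group_simps)
  qed (use K k l in \<open>simp_all add: dg_simps\<close>)
  ultimately show ?thesis
    unfolding shift_iso_def using K by (auto simp: cocycles_def)
qed

section \<open>Vanishing of morphisms under shifts and for zero objects\<close>

lemma hom_vanishes_iff:
  assumes "X \<in> dg_ob A" "Y \<in> dg_ob A"
  shows "hom_vanishes (homotopy_category A) X Y \<longleftrightarrow> null_at 0 X Y"
proof -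
  interpret XY: complex_of_modules R "dg_hom A X Y" using assms by (rule hom_complex_of_modules)
  have "cohom_class (dg_hom A X Y) 0 u = cohom_class (dg_hom A X Y) 0 \<zero>\<^bsub>grade (dg_hom A X Y) 0\<^esub> \<longleftrightarrow>
      u \<in> coboundaries (dg_hom A X Y) 0" if "u \<in> cocycles (dg_hom A X Y) 0" for u
    using XY.cocycles_carrier[OF that] by (simp add: XY.cohom_class_eq_iff XY.grade.diff_zero)
  moreover have "hom_vanishes (homotopy_category A) X Y \<longleftrightarrow>
      (\<forall>u \<in> cocycles (dg_hom A X Y) 0. cohom_class (dg_hom A X Y) 0 u = cohom_class (dg_hom A X Y) 0 \<zero>\<^bsub>grade (dg_hom A X Y) 0\<^esub>)"
    using XY.zero_cocycle[of 0] unfolding hom_vanishes_def homotopy_category_simps XY.cohomology_carrier XY.cohomology_zero by blast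
  ultimately show ?thesis by blast
qed

text \<open>With \<open>Y'\<close> isomorphic to \<open>Y[k]\<close>, degree \<open>n\<close> into
  \<open>Y'\<close> corresponds to degree \<open>k + n\<close> into \<open>Y\<close>: up to a
  coboundary \<open>t\<close> equals \<open>u (v t)\<close>, and \<open>v t\<close> is exact by
  assumption.\<close>

lemma shift_iso_null_right:
  assumes s: "shift_iso k Y' Y" and X: "X \<in> dg_ob A" and n: "null_at n X Y'"
  shows "null_at (k + n) X Y"
proof
  fix t assume t: "t \<in> cocycles (dg_hom A X Y) (k + n)"
  have ob: "Y \<in> dg_ob A" "Y' \<in> dg_ob A" using s by (auto simp: shift_iso_def)
  interpret XY: complex_of_modules R "dg_hom A X Y" using X ob by (intro hom_complex_of_modules)
  interpret YY: complex_of_modules R "dg_hom A Y Y" using X ob by (intro hom_complex_of_modules)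
  obtain u v where u: "u \<in> cocycles (dg_hom A Y' Y) k" and v: "v \<in> cocycles (dg_hom A Y Y') (- k)"
    and uv: "dg_comp A Y Y' Y k (- k) u v \<in> cohom_class (dg_hom A Y Y) 0 (dg_id A Y)"
    using s by (auto simp: shift_iso_def)
  have "dg_comp A X Y Y' (- k) (k + n) v t \<in> cocycles (dg_hom A X Y') n"
    using X ob t v by (intro comp_cocycle) auto
  then have vt: "dg_comp A X Y Y' (- k) (k + n) v t \<in> coboundaries (dg_hom A X Y') n" using n by auto
  have uvt: "dg_comp A X Y' Y k n u (dg_comp A X Y Y' (- k) (k + n) v t) \<in> coboundaries (dg_hom A X Y) (k + n)"
    by (rule comp_coboundary_right[OF X ob(2,1) u vt]) simp
  obtain b where b: "b \<in> coboundaries (dg_hom A Y Y) 0" "dg_comp A Y Y' Y k (- k) u v = b \<oplus>\<^bsub>grade (dg_hom A Y Y) 0\<^esub> dg_id A Y"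
    using uv by (auto simp: YY.cohom_class_mem)
  have bt: "dg_comp A X Y Y 0 (k + n) b t \<in> coboundaries (dg_hom A X Y) (k + n)"
    by (rule comp_coboundary_left[OF X ob(1,1) b(1) t]) simp
  have c: "u \<in> dg_mor A Y' Y k" "v \<in> dg_mor A Y Y' (- k)" "t \<in> dg_mor A X Y (k + n)" "b \<in> dg_mor A Y Y 0"
    using u v t YY.coboundary_carrier[OF b(1)] by (auto simp: cocycles_def)
  have "dg_comp A X Y' Y k n u (dg_comp A X Y Y' (- k) (k + n) v t) = dg_comp A X Y Y 0 (k + n) (dg_comp A Y Y' Y k (- k) u v) t"
    using comp_assoc[of X Y Y' Y t "k + n" v "- k" u k] X ob c by simp
  also have "\<dots> = dg_comp A X Y Y 0 (k + n) b t \<oplus>\<^bsub>grade (dg_hom A X Y) (k + n)\<^esub> t"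
    using X ob c by (simp add: b(2) comp_linear_left id_degree_zero comp_id_left)
  finally have "t = dg_comp A X Y' Y k n u (dg_comp A X Y Y' (- k) (k + n) v t)
      \<ominus>\<^bsub>grade (dg_hom A X Y) (k + n)\<^esub> dg_comp A X Y Y 0 (k + n) b t"
    using c XY.coboundary_carrier[OF bt] by (simp add: XY.grade.group_simps)
  then show "t \<in> coboundaries (dg_hom A X Y) (k + n)"
    using XY.diff_coboundary[OF uvt bt] by simp
qed

text \<open>Vanishing of the endomorphisms of \<open>Z\<close> in degree \<open>0\<close> makes its
  identity a coboundary; composing closed morphisms of any degree with it makes them exact.\<close>

lemma zero_object_null:
  assumes Z: "zero_object (homotopy_category A) Z" and T: "T \<in> dg_ob A"
  shows "null_at n Z T" and "null_at n T Z"
proof -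
  have Zob: "Z \<in> dg_ob A" using Z by (simp add: zero_object_def)
  have "null_at 0 Z Z" using Z Zob by (simp add: zero_object_def hom_vanishes_iff)
  then have b: "dg_id A Z \<in> coboundaries (dg_hom A Z Z) 0" using id_closed[OF Zob] by auto
  show "null_at n Z T"
  proof
    fix t assume t: "t \<in> cocycles (dg_hom A Z T) n"
    then have "dg_comp A Z Z T n 0 t (dg_id A Z) \<in> coboundaries (dg_hom A Z T) n"
      using Zob T b by (intro comp_coboundary_right[OF Zob Zob T t b]) simp
    then show "t \<in> coboundaries (dg_hom A Z T) n"
      using Zob T t by (simp add: comp_id_right cocycles_def)
  qed
  show "null_at n T Z"
  proof
    fix t assume t: "t \<in> cocycles (dg_hom A T Z) n"
    then have "dg_comp A T Z Z 0 n (dg_id A Z) t \<in> coboundaries (dg_hom A T Z) n"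
      by (intro comp_coboundary_left[OF T Zob Zob b t]) simp
    then show "t \<in> coboundaries (dg_hom A T Z) n"
      using Zob T t by (simp add: comp_id_left cocycles_def)
  qed
qed

section \<open>The two aisles of a t-structure\<close>

lemma shift_exists:
  assumes "pretriangulated A" "X \<in> dg_ob A"
  obtains Y where "Y \<in> dg_ob A" "isomorphic (homotopy_category (pretr A)) (tw_shift A Y 0) (tw_shift A X n)"
  using assms tw_shift_twisted[of X n] by (auto simp: pretriangulated_def)

lemma shift_classD:
  assumes "Y \<in> shift_class A n S" "S \<subseteq> dg_ob A"
  obtains X where "X \<in> S" "shift_iso n Y X"
  using assms tw_shift_isoD by (auto simp: shift_class_def)

context
  fixes L G
  assumes pt: "pretriangulated A" and ts: "t_structure A L G"
begin

lemma aisles_objects: "L \<subseteq> dg_ob A" "G \<subseteq> dg_ob A"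
  using ts by (auto simp: t_structure_def)

lemma aisle_truncation:
  assumes "E \<in> dg_ob A"
  obtains X Z W where "X \<in> L" "Z \<in> dg_ob A" "Z \<in> G" "W \<in> G" "shift_iso (- 1) Z W" "triangle A X E Z"
proof -
  obtain X Z where XZ: "X \<in> L" "Z \<in> shift_class A (- 1) G" "triangle A X E Z"
    using ts assms by (auto simp: t_structure_def)
  moreover from XZ have "Z \<in> G" using ts by (auto simp: t_structure_def)
  moreover obtain W where "W \<in> G" "shift_iso (- 1) Z W"
    using shift_classD[OF XZ(2) aisles_objects(2)] .
  ultimately show thesis using that aisles_objects by blast
qed

text \<open>Orthogonality is assumed against objects isomorphic to \<open>Y[-1]\<close>. Such an
  object exists because \<open>A\<close> is pre-triangulated, and transport along the shift turns
  degree \<open>0\<close> into degree \<open>-1\<close>.\<close>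

lemma aisles_null:
  assumes "X \<in> L" "Y \<in> G"
  shows "null_at (- 1) X Y"
proof -
  have ob: "X \<in> dg_ob A" "Y \<in> dg_ob A" using assms aisles_objects by auto
  obtain Y' where Y': "Y' \<in> dg_ob A" "isomorphic (homotopy_category (pretr A)) (tw_shift A Y' 0) (tw_shift A Y (- 1))"
    using shift_exists[OF pt ob(2)] .
  then have "Y' \<in> shift_class A (- 1) G" using assms by (auto simp: shift_class_def)
  then have "null_at 0 X Y'"
    using ts assms(1) ob(1) Y'(1) hom_vanishes_iff[of X Y'] by (auto simp: t_structure_def)
  then show ?thesis
    using shift_iso_null_right[OF tw_shift_isoD[OF Y'(1) ob(2) Y'(2)] ob(1), of 0] by simp
qed

text \<open>For the converse take the truncation triangle \<open>X -> E -> Z\<close>. As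
  \<open>Z\<close> is isomorphic to \<open>W[-1]\<close> with \<open>W\<close> in \<open>G\<close>,
  the assumption kills \<open>E -> Z\<close>, so \<open>X\<close> and \<open>E\<close> are
  isomorphic.\<close>

lemma lower_aisle_iff: "E \<in> L \<longleftrightarrow> E \<in> dg_ob A \<and> (\<forall>Y \<in> G. null_at (- 1) E Y)"
proof
  assume "E \<in> L"
  then show "E \<in> dg_ob A \<and> (\<forall>Y \<in> G. null_at (- 1) E Y)" using aisles_objects aisles_null by auto
next
  assume E: "E \<in> dg_ob A \<and> (\<forall>Y \<in> G. null_at (- 1) E Y)"
  then obtain X Z W where XZ: "X \<in> L" "Z \<in> dg_ob A" "Z \<in> G" "W \<in> G" "shift_iso (- 1) Z W" "triangle A X E Z"
    using aisle_truncation by blast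
  have "null_at 0 E Z"
    using shift_iso_null_right[OF shift_iso_sym[OF XZ(5)], of E "- 1"] E XZ(4) by simp
  moreover have "null_at (- 1) X Z" using XZ aisles_null by simp
  ultimately have "shift_iso 0 X E"
    using XZ(6) by (elim triangle_cone_data) (rule shift_iso_of_null_right)
  then have "isomorphic (homotopy_category A) X E" by (rule shift_iso_isomorphic)
  then show "E \<in> L" using ts XZ(1) unfolding t_structure_def by blast
qed

text \<open>For the converse the truncation is applied to \<open>E[-1]\<close>, because its third
  term lies in the shifted aisle: with \<open>X -> E[-1]\<close> null, \<open>E[-1]\<close> is
  isomorphic to that term, which is some \<open>W[-1]\<close>, and hence \<open>E\<close> to
  \<open>W\<close>.\<close>

lemma upper_aisle_iff: "E \<in> G \<longleftrightarrow> E \<in> dg_ob A \<and> (\<forall>X \<in> L. null_at (- 1) X E)"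
proof
  assume "E \<in> G"
  then show "E \<in> dg_ob A \<and> (\<forall>X \<in> L. null_at (- 1) X E)" using aisles_objects aisles_null by auto
next
  assume E: "E \<in> dg_ob A \<and> (\<forall>X \<in> L. null_at (- 1) X E)"
  obtain E' where E': "E' \<in> dg_ob A" "shift_iso (- 1) E' E"
    using shift_exists[OF pt conjunct1[OF E], of "- 1"] tw_shift_isoD[OF _ conjunct1[OF E]] by metis
  obtain X Z W where XZ: "X \<in> L" "Z \<in> dg_ob A" "Z \<in> G" "W \<in> G" "shift_iso (- 1) Z W" "triangle A X E' Z"
    using aisle_truncation[OF E'(1)] .
  have "null_at 0 X E'"
    using shift_iso_null_right[OF shift_iso_sym[OF E'(2)], of X "- 1"] E XZ(1) aisles_objects by auto
  moreover have "null_at (- 1) X Z" using XZ aisles_null by simp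
  ultimately have "shift_iso 0 E' Z"
    using XZ(6) by (elim triangle_cone_data) (rule shift_iso_of_null_left)
  from shift_iso_trans[OF shift_iso_sym[OF XZ(5)] shift_iso_sym[OF this]] have "shift_iso 1 W E'" by simp
  from shift_iso_trans[OF this E'(2)] have "isomorphic (homotopy_category A) W E"
    using shift_iso_isomorphic by simp
  then show "E \<in> G" using ts XZ(4) unfolding t_structure_def by blast
qed

lemma heart_zero_object:
  assumes "zero_object (homotopy_category A) Z"
  shows "Z \<in> heart L G"
proof -
  have "Z \<in> dg_ob A" using assms by (simp add: zero_object_def)
  then have "Z \<in> L" "Z \<in> G"
    using lower_aisle_iff[of Z] upper_aisle_iff[of Z] zero_object_null[OF assms] aisles_objects by blast+
  then show ?thesis by (simp add: heart_def)
qed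

lemma heart_extension:
  assumes K: "cone_data A X E Z f t0 t1 s0 s1 p q r w" and XZ: "X \<in> heart L G" "Z \<in> heart L G"
  shows "E \<in> heart L G"
proof -
  have E: "E \<in> dg_ob A" using K by (simp add: cone_data_def)
  have "null_at (- 1) E Y" if "Y \<in> G" for Y
    using that XZ aisles_objects by (intro null_at_contravariant[OF K] aisles_null) (auto simp: heart_def)
  then have "E \<in> L" using E lower_aisle_iff[of E] by blast
  have "null_at (- 1) Y E" if "Y \<in> L" for Y
    using that XZ aisles_objects by (intro null_at_covariant[OF K] aisles_null) (auto simp: heart_def)
  then have "E \<in> G" using E upper_aisle_iff[of E] by blast
  with \<open>E \<in> L\<close> show ?thesis by (simp add: heart_def)
qed

end

end

section \<open>Construction of distinguished triangles\<close>

context dg_category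
begin

interpretation P: dg_category R "pretr A"
  by (rule pretr_dg_category)

lemma tw_shift_refl:
  assumes X: "X \<in> dg_ob A"
  shows "isomorphic (homotopy_category (pretr A)) (tw_shift A X n) (tw_shift A X n)"
proof -
  interpret H: linear_category R "homotopy_category (pretr A)" by (rule P.homotopy_category_linear)
  have E: "tw_shift A X n \<in> lob (homotopy_category (pretr A))" using X by (simp add: tw_shift_twisted)
  note id = H.id_closed[OF E]
  show ?thesis unfolding isomorphic_def iso_arrow_def
    using E id H.comp_id_left[OF E E id] by blast
qed

text \<open>The inverse of the isomorphism with the cone is \<open>g\<close>, extended by zero to \<open>X[1]\<close>.\<close>

lemma distinguishedI:
  assumes ob: "X \<in> dg_ob A" "E \<in> dg_ob A" "Z \<in> dg_ob A"
    and f: "f \<in> cocycles (dg_hom A X E) 0" and g: "g \<in> cocycles (dg_hom A E Z) 0" and h: "h \<in> cocycles (dg_hom A Z X) 1"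
    and t: "t \<in> dg_mor A Z E 0" "cdiff (dg_hom A Z E) 0 t = \<ominus>\<^bsub>grade (dg_hom A Z E) 1\<^esub> dg_comp A Z X E 0 1 f h"
    and gf: "dg_comp A X E Z 0 0 g f = \<zero>\<^bsub>grade (dg_hom A X Z) 0\<^esub>"
    and w: "w \<in> dg_mor A Z Z (- 1)" "dg_comp A Z E Z 0 0 g t = cdiff (dg_hom A Z Z) (- 1) w \<oplus>\<^bsub>grade (dg_hom A Z Z) 0\<^esub> dg_id A Z"
    and p: "p \<in> dg_mor A X X (- 1)" "cdiff (dg_hom A X X) (- 1) p = dg_comp A X E X 0 0 q f \<oplus>\<^bsub>grade (dg_hom A X X) 0\<^esub> dg_id A X"
      "dg_comp A X X E 0 (- 1) f p = \<zero>\<^bsub>grade (dg_hom A X E) (- 1)\<^esub>"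
    and q: "q \<in> dg_mor A E X 0" "dg_comp A E Z X 1 0 h g = \<ominus>\<^bsub>grade (dg_hom A E X) 1\<^esub> cdiff (dg_hom A E X) 0 q"
      "dg_comp A E Z E 0 0 t g = dg_comp A E X E 0 0 f q \<oplus>\<^bsub>grade (dg_hom A E E) 0\<^esub> dg_id A E"
  shows "distinguished A X E Z f g h"
proof -
  let ?Z = "tw_shift A Z 0" and ?E = "tw_shift A E 0" and ?X = "tw_shift A X 1" and ?K = "tw_cone A X E f"
  let ?H = "homotopy_category (pretr A)"
  \<comment> \<open>\<open>T\<close> is the isomorphism with the cone and \<open>S\<close> its
    inverse. \<open>W\<close> and \<open>N\<close> are the homotopies for the two composites, and
    \<open>V\<close> is the one identifying \<open>T\<close> after \<open>g\<close> with the
    inclusion of \<open>E\<close>; compatibility with the projection \<open>J\<close> holds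
    strictly.\<close>
  define T where "T = tw_matrix ?Z ?K (\<lambda>i j. if j = 0 then h else t)"
  define S where "S = tw_matrix ?K ?Z (\<lambda>i j. if i = 0 then \<zero>\<^bsub>grade (dg_hom A X Z) (- 1)\<^esub> else g)"
  define W where "W = tw_matrix ?Z ?Z (\<lambda>i j. w)"
  define N where "N = tw_matrix ?K ?K (\<lambda>i j. if j = 0 then if i = 0 then p else q
    else if i = 0 then \<zero>\<^bsub>grade (dg_hom A X E) (- 2)\<^esub> else \<zero>\<^bsub>grade (dg_hom A E E) (- 1)\<^esub>)"
  define V where "V = tw_matrix ?E ?K (\<lambda>i j. if j = 0 then q else \<zero>\<^bsub>grade (dg_hom A E E) (- 1)\<^esub>)"
  define G where "G = tw_matrix ?E ?Z (\<lambda>i j. g)"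
  define J where "J = cone_proj A X E f"
  note fgh = cocycles_def[of "dg_hom A X E"] cocycles_def[of "dg_hom A E Z"] cocycles_def[of "dg_hom A Z X"]
  have c: "f \<in> dg_mor A X E 0" "g \<in> dg_mor A E Z 0" "h \<in> dg_mor A Z X 1"
    and d: "cdiff (dg_hom A X E) 0 f = \<zero>\<^bsub>grade (dg_hom A X E) 1\<^esub>" "cdiff (dg_hom A E Z) 0 g = \<zero>\<^bsub>grade (dg_hom A E Z) 1\<^esub>"
      "cdiff (dg_hom A Z X) 1 h = \<zero>\<^bsub>grade (dg_hom A Z X) 2\<^esub>"
    using f g h by (auto simp: fgh)
  note [simp] = hom_group_closed id_degree_zero comp_closed diff_closed
  note cl = ob c t(1) w(1) p(1) q(1)
  note mem = tw_hom_shift_cone_mem[OF ob(1,2) f] tw_hom_cone_shift_mem[OF ob(1,2) f] tw_hom_cone_cone_mem[OF ob(1,2) f]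
  note ap = tw_hom_module_simps(2,3) tw_entry_def tw_id_apply signed_simps
  have tc: "?Z \<in> twisted_complexes A" "?E \<in> twisted_complexes A" "?X \<in> twisted_complexes A" "?K \<in> twisted_complexes A"
    using ob f by (simp_all add: tw_shift_twisted tw_cone_twisted)
  note pre = tc[THEN twisted_complexes_pre]
  have T: "T \<in> carrier (tw_hom_module A ?Z ?K 0)" and S: "S \<in> carrier (tw_hom_module A ?K ?Z 0)"
    and N: "N \<in> carrier (tw_hom_module A ?K ?K (- 1))" and V: "V \<in> carrier (tw_hom_module A ?E ?K (- 1))"
    and J: "J \<in> carrier (tw_hom_module A ?K ?X 0)"
    using cl by (simp_all add: mem T_def S_def N_def V_def J_def cone_proj_def)
  have W: "W \<in> carrier (tw_hom_module A ?Z ?Z (- 1))" and G: "G \<in> carrier (tw_hom_module A ?E ?Z 0)"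
    using cl by (simp_all add: W_def G_def tw_hom_module_simps tw_entry_def)
  have ent [simp]: "T 0 0 = h" "T 0 (Suc 0) = t" "S 0 0 = \<zero>\<^bsub>grade (dg_hom A X Z) (- 1)\<^esub>" "S (Suc 0) 0 = g" "W 0 0 = w"
    "N 0 0 = p" "N 0 (Suc 0) = \<zero>\<^bsub>grade (dg_hom A X E) (- 2)\<^esub>" "N (Suc 0) 0 = q" "N (Suc 0) (Suc 0) = \<zero>\<^bsub>grade (dg_hom A E E) (- 1)\<^esub>"
    "V 0 0 = q" "V 0 (Suc 0) = \<zero>\<^bsub>grade (dg_hom A E E) (- 1)\<^esub>" "G 0 0 = g"
    "J 0 0 = dg_id A X" "J (Suc 0) 0 = \<zero>\<^bsub>grade (dg_hom A E X) 1\<^esub>"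
    "cone_incl A X E f 0 0 = \<zero>\<^bsub>grade (dg_hom A E X) 1\<^esub>" "cone_incl A X E f 0 (Suc 0) = dg_id A E"
    by (simp_all add: T_def S_def W_def N_def V_def G_def J_def cone_proj_def cone_incl_def)
  note D = tw_diff_shift_cone[OF ob(1,2) f] tw_diff_cone_shift[OF ob(1,2) f] tw_diff_cone_cone[OF ob(1,2) f]
  note mat = tw_hom_module_simps(2,3)
  have matrices: "tw_matrix E F (cdiff (tw_hom A E F) n x) = cdiff (tw_hom A E F) n x" for E F n x
    by (simp add: tw_hom_def)
  have TZ: "T \<in> cocycles (tw_hom A ?Z ?K) 0"
  proof -
    have "cdiff (tw_hom A ?Z ?K) 0 T = \<zero>\<^bsub>tw_hom_module A ?Z ?K 1\<^esub>"
      by (rule tw_matrix_eqI[of ?Z ?K])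
        (use ob c d t(2) in \<open>auto simp: matrices mat less_Suc_eq D(1,2)[OF ob(3) T] tw_entry_def hom_group_simps comp_closed\<close>)
    then show ?thesis using T by (simp add: cocycles_def)
  qed
  have SZ: "S \<in> cocycles (tw_hom A ?K ?Z) 0"
  proof -
    have "cdiff (tw_hom A ?K ?Z) 0 S = \<zero>\<^bsub>tw_hom_module A ?K ?Z 1\<^esub>"
      by (rule tw_matrix_eqI[of ?K ?Z])
        (use ob c d gf in \<open>auto simp: matrices mat less_Suc_eq D(3,4)[OF ob(3) S] tw_entry_def hom_group_simps signed_simps diff_linear\<close>)
    then show ?thesis using S by (simp add: cocycles_def)
  qed
  have JZ: "J \<in> cocycles (tw_hom A ?K ?X) 0"
  proof -
    have "cdiff (tw_hom A ?K ?X) 0 J = \<zero>\<^bsub>tw_hom_module A ?K ?X 1\<^esub>"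
      by (rule tw_matrix_eqI[of ?K ?X])
        (use ob c d id_closed[OF ob(1)] in \<open>auto simp: matrices mat less_Suc_eq D(3,4)[OF ob(1) J] cocycles_def
          tw_entry_def hom_group_simps signed_simps diff_linear comp_linear_left\<close>)
    then show ?thesis using J by (simp add: cocycles_def)
  qed
  have GZ: "G \<in> cocycles (tw_hom A ?E ?Z) 0"
  proof -
    have "cdiff (tw_hom A ?E ?Z) 0 G = \<zero>\<^bsub>tw_hom_module A ?E ?Z 1\<^esub>"
      by (rule tw_matrix_eqI[of ?E ?Z])
        (use ob c d in \<open>auto simp: matrices mat tw_diff_shift_shift[OF ob(2,3) G] tw_entry_def signed_simps\<close>)
    then show ?thesis using G by (simp add: cocycles_def)
  qed
  have ST: "tw_comp A ?Z ?K ?Z 0 0 S T = cdiff (tw_hom A ?Z ?Z) (- 1) W \<oplus>\<^bsub>tw_hom_module A ?Z ?Z 0\<^esub> dg_id (pretr A) ?Z"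
  proof (rule tw_matrix_eqI[of ?Z ?Z])
    have "tw_comp A ?Z ?K ?Z 0 0 S T 0 0 = cdiff (dg_hom A Z Z) (- 1) w \<oplus>\<^bsub>grade (dg_hom A Z Z) 0\<^esub> dg_id A Z"
      using tw_comp_apply_2[OF pre(1) pre(4) pre(1) S T, of 0 0] cl w(2)
      by (simp add: tw_entry_def comp_linear_left abelian_group.group_simps(8)[OF hom_abelian_group])
    then show "tw_comp A ?Z ?K ?Z 0 0 S T i j =
      (cdiff (tw_hom A ?Z ?Z) (- 1) W \<oplus>\<^bsub>tw_hom_module A ?Z ?Z 0\<^esub> dg_id (pretr A) ?Z) i j" if "i < tw_len ?Z" "j < tw_len ?Z" for i j
      using that by (simp add: mat tw_diff_shift_shift[OF ob(3,3) W] tw_entry_def tw_id_apply signed_simps)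
  qed (simp_all add: mat)
  have TS: "tw_comp A ?K ?Z ?K 0 0 T S = cdiff (tw_hom A ?K ?K) (- 1) N \<oplus>\<^bsub>tw_hom_module A ?K ?K 0\<^esub> dg_id (pretr A) ?K"
  proof (rule tw_matrix_eqI[of ?K ?K])
    have z: "\<ominus>\<^bsub>grade (dg_hom A X X) 0\<^esub> cdiff (dg_hom A X X) (- 1) p
        \<oplus>\<^bsub>grade (dg_hom A X X) 0\<^esub> dg_comp A X E X 0 0 q f \<oplus>\<^bsub>grade (dg_hom A X X) 0\<^esub> dg_id A X = \<zero>\<^bsub>grade (dg_hom A X X) 0\<^esub>"
    proof -
      interpret XX: module R "grade (dg_hom A X X) 0" using ob(1) by (intro hom_module)
      have "dg_comp A X E X 0 0 q f \<in> dg_mor A X X 0" "dg_id A X \<in> dg_mor A X X 0" using cl by simp_all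
      then show ?thesis unfolding p(2) by (simp add: XX.a_assoc XX.l_neg)
    qed
    note simps = tw_comp_apply_1[OF pre(4) pre(1) pre(4) T S] D(5-8)[OF N] mat tw_entry_def tw_id_apply comp_linear_left comp_linear_right diff_linear
      abelian_group.group_simps(8,9)[OF hom_abelian_group]
    fix i j assume "i < tw_len ?K" "j < tw_len ?K"
    then consider "i = 0" "j = 0" | "i = 0" "j = Suc 0" | "i = Suc 0" "j = 0" | "i = Suc 0" "j = Suc 0"
      by (auto simp: less_Suc_eq)
    then show "tw_comp A ?K ?Z ?K 0 0 T S i j =
        (cdiff (tw_hom A ?K ?K) (- 1) N \<oplus>\<^bsub>tw_hom_module A ?K ?K 0\<^esub> dg_id (pretr A) ?K) i j"
    proof cases
      case 1
      then show ?thesis using cl z by (simp add: simps)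
    next
      \<comment> \<open>Here \<open>T S\<close> has entry \<open>0\<close>, while the differential
        of \<open>N\<close> contributes \<open>f p\<close>; this is the origin of the hypothesis
        that \<open>f p\<close> vanishes.\<close>
      case 2
      then show ?thesis using cl p(3) by (simp add: simps)
    next
      case 3
      then show ?thesis using cl q(2) by (simp add: simps)
    next
      case 4
      then show ?thesis using cl q(3) by (simp add: simps)
    qed
  qed (simp_all add: mat)
  have TG: "tw_comp A ?E ?Z ?K 0 0 T G = cdiff (tw_hom A ?E ?K) (- 1) V \<oplus>\<^bsub>tw_hom_module A ?E ?K 0\<^esub> cone_incl A X E f"
  proof (rule tw_matrix_eqI[of ?E ?K])
    note simps = tw_comp_apply_1[OF pre(2) pre(1) pre(4) T G] D(1,2)[OF ob(2) V] mat tw_entry_def diff_linear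
      abelian_group.group_simps(8,9)[OF hom_abelian_group]
    fix i j assume "i < tw_len ?E" "j < tw_len ?K"
    then consider "i = 0" "j = 0" | "i = 0" "j = Suc 0"
      by (auto simp: less_Suc_eq)
    then show "tw_comp A ?E ?Z ?K 0 0 T G i j =
        (cdiff (tw_hom A ?E ?K) (- 1) V \<oplus>\<^bsub>tw_hom_module A ?E ?K 0\<^esub> cone_incl A X E f) i j"
    proof cases
      case 1
      then show ?thesis using cl q(2) by (simp add: simps)
    next
      case 2
      then show ?thesis using cl q(3) by (simp add: simps)
    qed
  qed (simp_all add: mat)
  have JT: "tw_comp A ?Z ?K ?X 0 0 J T = tw_matrix ?Z ?X (\<lambda>i j. h)"
  proof (rule tw_matrix_eqI[of ?Z ?X])
    fix i j assume "i < tw_len ?Z" "j < tw_len ?X"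
    then show "tw_comp A ?Z ?K ?X 0 0 J T i j = tw_matrix ?Z ?X (\<lambda>i j. h) i j"
      using tw_comp_apply_2[OF pre(1) pre(4) pre(3) J T, of 0 0] cl
      by (simp add: tw_entry_def comp_linear_left comp_id_left abelian_group.group_simps(9)[OF hom_abelian_group])
  qed simp_all
  interpret EK: complex_of_modules R "tw_hom A ?E ?K"
    using P.hom_complex_of_modules[of ?E ?K] tc by simp
  have iso: "iso_arrow ?H ?Z ?K (cohom_class (tw_hom A ?Z ?K) 0 T)"
    using P.iso_arrow_homotopyI[of ?Z ?K T S] tc TZ SZ ST TS W N
      dg_category.identity_classI[OF pretr_dg_category, of ?Z W] dg_category.identity_classI[OF pretr_dg_category, of ?K N] by simp
  have "lcomp ?H ?E ?Z ?K (cohom_class (tw_hom A ?Z ?K) 0 T) (tw_single A E Z 0 g) = tw_class A ?E ?K (cone_incl A X E f)"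
  proof -
    have "cone_incl A X E f \<in> carrier (tw_hom_module A ?E ?K 0)"
      using cl by (simp add: mem cone_incl_def)
    then have "cohom_class (tw_hom A ?E ?K) 0 (tw_comp A ?E ?Z ?K 0 0 T G) = cohom_class (tw_hom A ?E ?K) 0 (cone_incl A X E f)"
      using V TG by (intro EK.cohom_class_eqI[OF EK.coboundaryI[of V "- 1"]]) simp_all
    then show ?thesis
      using P.homotopy_comp[of ?E ?Z ?K T G] tc TZ GZ by (simp add: tw_single_def tw_class_def Let_def G_def)
  qed
  moreover have "lcomp ?H ?Z ?K ?X (tw_class A ?K ?X (cone_proj A X E f)) (cohom_class (tw_hom A ?Z ?K) 0 T) = tw_single A Z X 1 h"
    using P.homotopy_comp[of ?Z ?K ?X J T] tc TZ JZ JT by (simp add: tw_single_def tw_class_def Let_def J_def)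
  ultimately show ?thesis
    unfolding distinguished_def Let_def using ob f g h iso by blast
qed

end

text \<open>One map \<open>Fm\<close> serves all morphism complexes and degrees, as is the case for
  the projections of triples.\<close>

lemma cone_data_functor:
  fixes Fo :: "'o \<Rightarrow> 'p" and Fm :: "'m \<Rightarrow> 'n"
  assumes A: "dg_category R A" and B: "dg_category R B"
    and ob: "\<And>X. X \<in> dg_ob A \<Longrightarrow> Fo X \<in> dg_ob B"
    and lin: "\<And>X Y n. \<lbrakk>X \<in> dg_ob A; Y \<in> dg_ob A\<rbrakk> \<Longrightarrow> Fm \<in> mod_hom R (grade (dg_hom A X Y) n) (grade (dg_hom B (Fo X) (Fo Y)) n)"
    and diff: "\<And>X Y n f. \<lbrakk>X \<in> dg_ob A; Y \<in> dg_ob A; f \<in> dg_mor A X Y n\<rbrakk> \<Longrightarrow>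
      cdiff (dg_hom B (Fo X) (Fo Y)) n (Fm f) = Fm (cdiff (dg_hom A X Y) n f)"
    and comp: "\<And>X Y Z q p f g. \<lbrakk>X \<in> dg_ob A; Y \<in> dg_ob A; Z \<in> dg_ob A; f \<in> dg_mor A X Y p; g \<in> dg_mor A Y Z q\<rbrakk> \<Longrightarrow>
      dg_comp B (Fo X) (Fo Y) (Fo Z) q p (Fm g) (Fm f) = Fm (dg_comp A X Y Z q p g f)"
    and id: "\<And>X. X \<in> dg_ob A \<Longrightarrow> dg_id B (Fo X) = Fm (dg_id A X)"
    and K: "cone_data A X E Z f t0 t1 s0 s1 p q r w"
  shows "cone_data B (Fo X) (Fo E) (Fo Z) (Fm f) (Fm t0) (Fm t1) (Fm s0) (Fm s1) (Fm p) (Fm q) (Fm r) (Fm w)"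
proof -
  interpret A: dg_category R A by fact
  interpret B: dg_category R B by fact
  note hm = A.hom_module B.hom_module[OF ob ob]
  note [simp] = ob diff comp id mod_hom_closed[OF lin] mod_hom_add[OF lin, symmetric] mod_hom_neg[OF hm lin, symmetric] mod_hom_zero[OF hm lin]
    A.comp_closed A.diff_closed A.hom_group_closed A.id_degree_zero
  show ?thesis using K unfolding cone_data_def by simp
qed

section \<open>Abelian gluing\<close>

lemma module_restrict_carrier:
  assumes M: "module R M" and S: "S \<subseteq> carrier M" "\<zero>\<^bsub>M\<^esub> \<in> S"
    and add: "\<And>x y. \<lbrakk>x \<in> S; y \<in> S\<rbrakk> \<Longrightarrow> x \<oplus>\<^bsub>M\<^esub> y \<in> S" and smult: "\<And>r x. \<lbrakk>r \<in> carrier R; x \<in> S\<rbrakk> \<Longrightarrow> r \<odot>\<^bsub>M\<^esub> x \<in> S"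
  shows "module R (M\<lparr>carrier := S\<rparr>)"
proof -
  interpret M: module R M by fact
  have S' [simp]: "x \<in> carrier M" if "x \<in> S" for x using that S by blast
  have neg: "\<ominus>\<^bsub>M\<^esub> x \<in> S" if x: "x \<in> S" for x
    using smult[of "\<ominus>\<^bsub>R\<^esub> \<one>\<^bsub>R\<^esub>" x] x by (simp add: M.smult_l_minus)
  show ?thesis
  proof (rule moduleI)
    show "abelian_group (M\<lparr>carrier := S\<rparr>)"
    proof (rule abelian_groupI)
      fix x assume "x \<in> carrier (M\<lparr>carrier := S\<rparr>)"
      then show "\<exists>y \<in> carrier (M\<lparr>carrier := S\<rparr>). y \<oplus>\<^bsub>M\<lparr>carrier := S\<rparr>\<^esub> x = \<zero>\<^bsub>M\<lparr>carrier := S\<rparr>\<^esub>"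
        by (intro bexI[of _ "\<ominus>\<^bsub>M\<^esub> x"]) (simp_all add: M.l_neg neg)
    qed (simp_all add: S(2) add M.a_ac)
  qed (simp_all add: M.R.is_cring smult M.smult_l_distr M.smult_r_distr M.smult_assoc1)
qed

context abelian_bimodule
begin

text \<open>Both sides are the joint action of \<open>f\<close> and \<open>g\<close> on
  \<open>\<mu>\<close>, factored in the two possible orders.\<close>

lemma mor_split:
  assumes "X \<in> lob C" "X' \<in> lob C" "Y \<in> lob D" "Y' \<in> lob D" "f \<in> carrier (lhom C X X')" "g \<in> carrier (lhom D Y Y')" "\<mu> \<in> carrier (ab_ob N X' Y)"
  shows "ab_mor N X X Y Y' (lid C X) g (ab_mor N X X' Y Y f (lid D Y) \<mu>) = ab_mor N X X' Y' Y' f (lid D Y') (ab_mor N X' X' Y Y' (lid C X') g \<mu>)"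
  using ab_mor_comp[of X X X' Y Y Y' "lid C X" f "lid D Y" g \<mu>] ab_mor_comp[of X X' X' Y Y' Y' f "lid C X'" g "lid D Y'" \<mu>] assms
  by (simp add: source_op.comp_id_left source_op.comp_id_right source.comp_id_left source.comp_id_right source_op.id_closed source.id_closed)

lemma abelian_glued_simps [simp]:
  "(X, Y, \<mu>) \<in> lob (abelian_glued C D N) \<longleftrightarrow> X \<in> lob C \<and> Y \<in> lob D \<and> \<mu> \<in> carrier (ab_ob N X Y)"
  "lhom (abelian_glued C D N) (X, Y, \<mu>) (X', Y', \<mu>') = (module_sum (lhom C X X') (lhom D Y Y'))\<lparr>carrier :=
     {(f, g). f \<in> carrier (lhom C X X') \<and> g \<in> carrier (lhom D Y Y') \<and>
        ab_mor N X X Y Y' (lid C X) g \<mu> = ab_mor N X X' Y' Y' f (lid D Y') \<mu>'}\<rparr>"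
  "lcomp (abelian_glued C D N) (X, Y, \<mu>) (X', Y', \<mu>') (X'', Y'', \<mu>'') (f', g') (f, g) =
     (lcomp C X X' X'' f' f, lcomp D Y Y' Y'' g' g)"
  "lid (abelian_glued C D N) (X, Y, \<mu>) = (lid C X, lid D Y)"
  by (simp_all add: abelian_glued_def)

lemma abelian_glued_linear: "linear_category R (abelian_glued C D N)"
proof (rule linear_category.intro)
  note [simp] = source_op.comp_closed source.comp_closed source_op.id_closed source.id_closed
  note cb = bilinear_mapD[OF source_op.comp_bilinear] and db = bilinear_mapD[OF source.comp_bilinear]
  show "cring R" by (rule source.base_ring)
  {
    fix P Q assume "P \<in> lob (abelian_glued C D N)" "Q \<in> lob (abelian_glued C D N)"
    moreover obtain X Y \<mu> X' Y' \<mu>' where P: "P = (X, Y, \<mu>)" "Q = (X', Y', \<mu>')" by (metis prod_cases3)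
    ultimately have ob [simp]: "X \<in> lob C" "Y \<in> lob D" "X' \<in> lob C" "Y' \<in> lob D" "\<mu> \<in> carrier (ab_ob N X Y)" "\<mu>' \<in> carrier (ab_ob N X' Y')"
      by auto
    interpret X: module R "lhom C X X'" by (simp add: source_op.hom_module)
    interpret Y: module R "lhom D Y Y'" by (simp add: source.hom_module)
    interpret N: module R "ab_ob N X Y'" by (simp add: ab_module)
    have l: "(\<lambda>g. ab_mor N X X Y Y' (lid C X) g \<mu>) \<in> mod_hom R (lhom D Y Y') (ab_ob N X Y')"
      by (rule bilinear_mapD(1)[OF ab_mor_bilinear]) simp_all
    have r: "(\<lambda>f. ab_mor N X X' Y' Y' f (lid D Y') \<mu>') \<in> mod_hom R (lhom C X X') (ab_ob N X Y')"
      by (rule bilinear_mapD(2)[OF ab_mor_bilinear]) simp_all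
    show "module R (lhom (abelian_glued C D N) P Q)"
      unfolding P abelian_glued_simps
      by (rule module_restrict_carrier[OF module_sum_module[OF X.is_module Y.is_module]])
        (auto simp: mod_hom_zero[OF X.is_module N.is_module r] mod_hom_zero[OF Y.is_module N.is_module l]
          mod_hom_add[OF r] mod_hom_add[OF l] mod_hom_smult[OF r] mod_hom_smult[OF l])
  }
  {
    fix P Q S assume "P \<in> lob (abelian_glued C D N)" "Q \<in> lob (abelian_glued C D N)" "S \<in> lob (abelian_glued C D N)"
    moreover obtain X Y \<mu> X' Y' \<mu>' X'' Y'' \<mu>'' where P: "P = (X, Y, \<mu>)" "Q = (X', Y', \<mu>')" "S = (X'', Y'', \<mu>'')" by (metis prod_cases3)
    ultimately have ob [simp]: "X \<in> lob C" "Y \<in> lob D" "X' \<in> lob C" "Y' \<in> lob D" "X'' \<in> lob C" "Y'' \<in> lob D"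
      "\<mu> \<in> carrier (ab_ob N X Y)" "\<mu>' \<in> carrier (ab_ob N X' Y')" "\<mu>'' \<in> carrier (ab_ob N X'' Y'')"
      by auto
    \<comment> \<open>Two compatibility squares are pasted: \<open>(g' g) \<mu> = g' (\<mu>' f) =
      (g' \<mu>') f = (\<mu>'' f') f = \<mu>'' (f' f)\<close>, the second equality being
      \<open>mor_split\<close>.\<close>
    have compat: "ab_mor N X X Y Y'' (lid C X) (lcomp D Y Y' Y'' g' g) \<mu> = ab_mor N X X'' Y'' Y'' (lcomp C X X' X'' f' f) (lid D Y'') \<mu>''"
      if f: "f \<in> carrier (lhom C X X')" "g \<in> carrier (lhom D Y Y')" "f' \<in> carrier (lhom C X' X'')" "g' \<in> carrier (lhom D Y' Y'')"
        and e: "ab_mor N X X Y Y' (lid C X) g \<mu> = ab_mor N X X' Y' Y' f (lid D Y') \<mu>'"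
          "ab_mor N X' X' Y' Y'' (lid C X') g' \<mu>' = ab_mor N X' X'' Y'' Y'' f' (lid D Y'') \<mu>''" for f g f' g'
    proof -
      have "ab_mor N X X Y Y'' (lid C X) (lcomp D Y Y' Y'' g' g) \<mu> = ab_mor N X X Y' Y'' (lid C X) g' (ab_mor N X X Y Y' (lid C X) g \<mu>)"
        using ab_mor_comp[of X X X Y Y' Y'' "lid C X" "lid C X" g g' \<mu>] f by (simp add: source_op.comp_id_left)
      also have "\<dots> = ab_mor N X X' Y'' Y'' f (lid D Y'') (ab_mor N X' X' Y' Y'' (lid C X') g' \<mu>')"
        unfolding e(1) using f by (intro mor_split) simp_all
      also have "\<dots> = ab_mor N X X'' Y'' Y'' (lcomp C X X' X'' f' f) (lid D Y'') \<mu>''"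
        unfolding e(2) using ab_mor_comp[of X X' X'' Y'' Y'' Y'' f f' "lid D Y''" "lid D Y''" \<mu>''] f by (simp add: source.comp_id_left)
      finally show ?thesis .
    qed
    show "bilinear_map R (lhom (abelian_glued C D N) Q S) (lhom (abelian_glued C D N) P Q) (lhom (abelian_glued C D N) P S) (lcomp (abelian_glued C D N) P Q S)"
      unfolding P by (rule bilinear_mapI)
        (auto simp: compat mod_hom_add[OF cb(1)] mod_hom_add[OF cb(2)] mod_hom_add[OF db(1)] mod_hom_add[OF db(2)]
          mod_hom_smult[OF cb(1)] mod_hom_smult[OF cb(2)] mod_hom_smult[OF db(1)] mod_hom_smult[OF db(2)])
  }
  {
    fix P assume "P \<in> lob (abelian_glued C D N)"
    then show "lid (abelian_glued C D N) P \<in> carrier (lhom (abelian_glued C D N) P P)" by (cases P) auto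
  }
  {
    fix P Q S T f g h assume "P \<in> lob (abelian_glued C D N)" "Q \<in> lob (abelian_glued C D N)" "S \<in> lob (abelian_glued C D N)" "T \<in> lob (abelian_glued C D N)"
      "f \<in> carrier (lhom (abelian_glued C D N) P Q)" "g \<in> carrier (lhom (abelian_glued C D N) Q S)" "h \<in> carrier (lhom (abelian_glued C D N) S T)"
    then show "lcomp (abelian_glued C D N) P S T h (lcomp (abelian_glued C D N) P Q S g f) =
      lcomp (abelian_glued C D N) P Q T (lcomp (abelian_glued C D N) Q S T h g) f"
      by (cases P; cases Q; cases S; cases T) (auto simp: source_op.comp_assoc source.comp_assoc)
  }
  {
    fix P Q f assume "P \<in> lob (abelian_glued C D N)" "Q \<in> lob (abelian_glued C D N)" "f \<in> carrier (lhom (abelian_glued C D N) P Q)"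
    then show "lcomp (abelian_glued C D N) P Q Q (lid (abelian_glued C D N) Q) f = f" "lcomp (abelian_glued C D N) P P Q f (lid (abelian_glued C D N) P) = f"
      by (cases P; cases Q; auto simp: source_op.comp_id_left source_op.comp_id_right source.comp_id_left source.comp_id_right)+
  }
qed

end

section \<open>Objects of the glued heart\<close>

context dg_bimodule_data
begin

interpretation G: dg_category R GL
  by (rule glued_dg_category)

lemma glued_cone_data_left:
  assumes "cone_data GL X E Z f t0 t1 s0 s1 p q r w"
  shows "cone_data A (fst X) (fst E) (fst Z) (fst f) (fst t0) (fst t1) (fst s0) (fst s1) (fst p) (fst q) (fst r) (fst w)"
proof (rule cone_data_functor[OF glued_dg_category A.dg_category_axioms _ _ _ _ _ assms])
  show "fst \<in> mod_hom R (grade (dg_hom GL X Y) n) (grade (dg_hom A (fst X) (fst Y)) n)"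
    if "X \<in> dg_ob GL" "Y \<in> dg_ob GL" for X Y n
    using that by (cases X; cases Y) (auto intro!: mod_homI)
qed (auto split: prod.splits)

lemma glued_cone_data_right:
  assumes "cone_data GL X E Z f t0 t1 s0 s1 p q r w"
  shows "cone_data B (fst (snd X)) (fst (snd E)) (fst (snd Z)) (fst (snd f)) (fst (snd t0)) (fst (snd t1)) (fst (snd s0))
    (fst (snd s1)) (fst (snd p)) (fst (snd q)) (fst (snd r)) (fst (snd w))"
proof (rule cone_data_functor[OF glued_dg_category B.dg_category_axioms _ _ _ _ _ assms, where Fo = "\<lambda>X. fst (snd X)" and Fm = "\<lambda>x. fst (snd x)"])
  show "(\<lambda>x. fst (snd x)) \<in> mod_hom R (grade (dg_hom GL X Y) n) (grade (dg_hom B (fst (snd X)) (fst (snd Y))) n)"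
    if "X \<in> dg_ob GL" "Y \<in> dg_ob GL" for X Y n
    using that by (cases X; cases Y) (auto intro!: mod_homI)
qed (auto split: prod.splits)

text \<open>The triangle \<open>(0, Y, 0) \<rightarrow> (X, Y, \<phi>) \<rightarrow> (X, 0, 0) \<rightarrow> (0, Y, 0)[1]\<close>, whose connecting morphism is \<open>- \<phi>\<close>.\<close>

lemma glued_triangle:
  assumes X: "(X, Y, \<phi>) \<in> dg_ob GL"
    and V: "zero_object (homotopy_category A) V" and W: "zero_object (homotopy_category B) W"
  shows "triangle GL (V, Y, \<zero>\<^bsub>grade (bf_ob M V Y) 0\<^esub>) (X, Y, \<phi>) (X, W, \<zero>\<^bsub>grade (bf_ob M X W) 0\<^esub>)"
proof -
  have ob [simp]: "X \<in> dg_ob A" "Y \<in> dg_ob B" "V \<in> dg_ob A" "W \<in> dg_ob B"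
    using X V W by (auto simp: zero_object_def)
  have \<phi> [simp]: "\<phi> \<in> carrier (grade (bf_ob M X Y) 0)" "cdiff (bf_ob M X Y) 0 \<phi> = \<zero>\<^bsub>grade (bf_ob M X Y) 1\<^esub>"
    using X by (auto simp: cocycles_def)
  have zero_cocycle: "\<zero>\<^bsub>grade (bf_ob M V' Y') 0\<^esub> \<in> cocycles (bf_ob M V' Y') 0" if "V' \<in> dg_ob A" "Y' \<in> dg_ob B" for V' Y'
    using complex_of_modules.zero_cocycle[OF M_complex[OF that]] .
  \<comment> \<open>A zero object of the homotopy category is contractible, and \<open>v\<close>,
    below likewise \<open>w\<close>, is a contraction; these absorb the identities of
    \<open>V\<close> and \<open>W\<close>.\<close>
  obtain v where v [simp]: "v \<in> dg_mor A V V (- 1)" "cdiff (dg_hom A V V) (- 1) v = dg_id A V"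
    using A.null_at_witness[of V V 0 "dg_id A V"] A.zero_object_null(1)[OF V ob(3), where n = 0] A.id_closed[of V]
    by (auto simp: cocycles_def)
  obtain w where w [simp]: "w \<in> dg_mor B W W (- 1)" "cdiff (dg_hom B W W) (- 1) w = dg_id B W"
    using B.null_at_witness[of W W 0 "dg_id B W"] B.zero_object_null(1)[OF W ob(4), where n = 0] B.id_closed[of W]
    by (auto simp: cocycles_def)
  have id0 [simp]: "cdiff (dg_hom A X X) 0 (dg_id A X) = \<zero>\<^bsub>grade (dg_hom A X X) 1\<^esub>"
    "cdiff (dg_hom B Y Y) 0 (dg_id B Y) = \<zero>\<^bsub>grade (dg_hom B Y Y) 1\<^esub>"
    using A.id_closed[of X] B.id_closed[of Y] by (auto simp: cocycles_def)
  note [simp] = A.hom_group_closed B.hom_group_closed M_group_closed A_id B_id M_diff_linear A.diff_linear B.diff_linear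
    left_linear right_linear id_act A.comp_linear_left A.comp_linear_right B.comp_linear_left B.comp_linear_right
    A.comp_id_left A.comp_id_right B.comp_id_left B.comp_id_right signed_simps signed_zero[OF M_module] zero_cocycle
    module_sum_neg[OF A.hom_module module_sum_module[OF B.hom_module M_module]] module_sum_neg[OF B.hom_module M_module]
  let ?P = "(V, Y, \<zero>\<^bsub>grade (bf_ob M V Y) 0\<^esub>)" and ?E = "(X, Y, \<phi>)" and ?Q = "(X, W, \<zero>\<^bsub>grade (bf_ob M X W) 0\<^esub>)"
  define f where "f = (\<zero>\<^bsub>grade (dg_hom A V X) 0\<^esub>, dg_id B Y, \<zero>\<^bsub>grade (bf_ob M V Y) (- 1)\<^esub>)"
  define g where "g = (dg_id A X, \<zero>\<^bsub>grade (dg_hom B Y W) 0\<^esub>, \<zero>\<^bsub>grade (bf_ob M X W) (- 1)\<^esub>)"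
  \<comment> \<open>The sign is forced: the strict splitting \<open>t\<close> has differential with
    \<open>M\<close>-component \<open>\<phi>\<close>, and this has to equal
    \<open>- f h\<close>.\<close>
  define h where "h = (\<zero>\<^bsub>grade (dg_hom A X V) 1\<^esub>, \<zero>\<^bsub>grade (dg_hom B W Y) 1\<^esub>, \<ominus>\<^bsub>grade (bf_ob M X Y) 0\<^esub> \<phi>)"
  define t where "t = (dg_id A X, \<zero>\<^bsub>grade (dg_hom B W Y) 0\<^esub>, \<zero>\<^bsub>grade (bf_ob M X Y) (- 1)\<^esub>)"
  \<comment> \<open>Determined by \<open>t g = f q + id\<close>, where \<open>t g\<close> is the
    identity on \<open>X\<close> and zero elsewhere.\<close>
  define q where "q = (\<zero>\<^bsub>grade (dg_hom A X V) 0\<^esub>, \<ominus>\<^bsub>grade (dg_hom B Y Y) 0\<^esub> dg_id B Y, \<zero>\<^bsub>grade (bf_ob M X Y) (- 1)\<^esub>)"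
  \<comment> \<open>In \<open>q f + id\<close> the identity of \<open>Y\<close> cancels and that of
    \<open>V\<close> survives, whose primitive is \<open>v\<close>. Similarly
    \<open>g t - id\<close> is minus the identity of \<open>W\<close>, whose primitive is
    \<open>- w\<close>.\<close>
  define p where "p = (v, \<zero>\<^bsub>grade (dg_hom B Y Y) (- 1)\<^esub>, \<zero>\<^bsub>grade (bf_ob M V Y) (- 2)\<^esub>)"
  define u where "u = (\<zero>\<^bsub>grade (dg_hom A X X) (- 1)\<^esub>, \<ominus>\<^bsub>grade (dg_hom B W W) (- 1)\<^esub> w, \<zero>\<^bsub>grade (bf_ob M X W) (- 2)\<^esub>)"
  note defs = f_def g_def h_def t_def q_def p_def u_def
  have "distinguished GL ?P ?E ?Q f g h"
  proof (rule G.distinguishedI[where t = t and w = u and p = p and q = q])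
    show "?P \<in> dg_ob GL" "?E \<in> dg_ob GL" "?Q \<in> dg_ob GL" using X by simp_all
  qed (simp_all add: defs cocycles_def A.hom_group_simps B.hom_group_simps M_group_simps)
  then show ?thesis unfolding triangle_def by blast
qed

section \<open>Extension-closed classes containing the zero objects\<close>

context
  fixes A0 :: "'a set" and B0 :: "'b set"
  assumes A0: "A0 \<subseteq> dg_ob A" "\<And>Z. zero_object (homotopy_category A) Z \<Longrightarrow> Z \<in> A0"
      "\<And>X E Z f t0 t1 s0 s1 p q r w. \<lbrakk>cone_data A X E Z f t0 t1 s0 s1 p q r w; X \<in> A0; Z \<in> A0\<rbrakk> \<Longrightarrow> E \<in> A0"
    and B0: "B0 \<subseteq> dg_ob B" "\<And>Z. zero_object (homotopy_category B) Z \<Longrightarrow> Z \<in> B0"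
      "\<And>X E Z f t0 t1 s0 s1 p q r w. \<lbrakk>cone_data B X E Z f t0 t1 s0 s1 p q r w; X \<in> B0; Z \<in> B0\<rbrakk> \<Longrightarrow> E \<in> B0"
    and zeros: "\<exists>Z. zero_object (homotopy_category A) Z" "\<exists>Z. zero_object (homotopy_category B) Z"
begin

lemma glued_heart_objects:
  "extension_closure GL (glue_left B M A0 \<union> glue_right A M B0) =
    {(X, Y, \<phi>). X \<in> A0 \<and> Y \<in> B0 \<and> \<phi> \<in> cocycles (bf_ob M X Y) 0}"
proof (intro equalityI subsetI)
  fix P assume "P \<in> extension_closure GL (glue_left B M A0 \<union> glue_right A M B0)"
  then have "P \<in> dg_ob GL \<and> fst P \<in> A0 \<and> fst (snd P) \<in> B0"
  proof (induction rule: extension_closure.induct)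
    case (base P)
    then obtain X Y where "P = (X, Y, \<zero>\<^bsub>grade (bf_ob M X Y) 0\<^esub>)" "X \<in> A0" "Y \<in> B0"
      using A0(2) B0(2) by (auto simp: glue_left_def glue_right_def)
    moreover from this have "X \<in> dg_ob A" "Y \<in> dg_ob B" using A0(1) B0(1) by auto
    ultimately show ?case using complex_of_modules.zero_cocycle[OF M_complex, of X Y 0] by simp
  next
    case (extension X Z E)
    obtain f t0 t1 s0 s1 p q r w where K: "cone_data GL X E Z f t0 t1 s0 s1 p q r w"
      using G.triangle_cone_data[OF extension.hyps(3)] .
    then have "E \<in> dg_ob GL" by (simp add: cone_data_def)
    with extension.IH A0(3)[OF glued_cone_data_left[OF K]] B0(3)[OF glued_cone_data_right[OF K]] show ?case by simp
  qed
  then show "P \<in> {(X, Y, \<phi>). X \<in> A0 \<and> Y \<in> B0 \<and> \<phi> \<in> cocycles (bf_ob M X Y) 0}" by (cases P) auto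
next
  fix P assume "P \<in> {(X, Y, \<phi>). X \<in> A0 \<and> Y \<in> B0 \<and> \<phi> \<in> cocycles (bf_ob M X Y) 0}"
  then obtain X Y \<phi> where P: "P = (X, Y, \<phi>)" "X \<in> A0" "Y \<in> B0" "\<phi> \<in> cocycles (bf_ob M X Y) 0" by auto
  obtain V W where VW: "zero_object (homotopy_category A) V" "zero_object (homotopy_category B) W" using zeros by auto
  have "(V, Y, \<zero>\<^bsub>grade (bf_ob M V Y) 0\<^esub>) \<in> glue_right A M B0" "(X, W, \<zero>\<^bsub>grade (bf_ob M X W) 0\<^esub>) \<in> glue_left B M A0"
    using P VW by (auto simp: glue_left_def glue_right_def)
  moreover have "(X, Y, \<phi>) \<in> dg_ob GL" using P A0(1) B0(1) by auto
  ultimately show "P \<in> extension_closure GL (glue_left B M A0 \<union> glue_right A M B0)"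
    unfolding P(1) using glued_triangle[OF _ VW] by (blast intro: extension_closure.intros)
qed

text \<open>A morphism \<open>(X, 0, 0) -> (0, Y, 0)\<close> of degree \<open>0\<close> has its
  component in \<open>M\<close> in degree \<open>-1\<close>. The case \<open>i = 0\<close> of the
  gluing condition makes closed morphisms of this kind exact.\<close>

lemma glue_cohomology_vanishes:
  assumes glue: "t_structures_glue A B M A0 B0" and XY: "X \<in> A0" "Y \<in> B0"
  shows "cocycles (bf_ob M X Y) (- 1) \<subseteq> coboundaries (bf_ob M X Y) (- 1)"
proof
  fix c assume "c \<in> cocycles (bf_ob M X Y) (- 1)"
  then have c: "c \<in> carrier (grade (bf_ob M X Y) (- 1))" "cdiff (bf_ob M X Y) (- 1) c = \<zero>\<^bsub>grade (bf_ob M X Y) 0\<^esub>"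
    by (auto simp: cocycles_def)
  obtain V W where VW: "zero_object (homotopy_category A) V" "zero_object (homotopy_category B) W" using zeros by auto
  have ob [simp]: "X \<in> dg_ob A" "Y \<in> dg_ob B" "V \<in> dg_ob A" "W \<in> dg_ob B"
    using XY A0(1) B0(1) VW by (auto simp: zero_object_def)
  let ?P = "(X, W, \<zero>\<^bsub>grade (bf_ob M X W) 0\<^esub>)" and ?Q = "(V, Y, \<zero>\<^bsub>grade (bf_ob M V Y) 0\<^esub>)"
  have P: "?P \<in> glue_left B M A0" and Q: "?Q \<in> glue_right A M B0"
    using XY VW by (auto simp: glue_left_def glue_right_def)
  have PQ: "?P \<in> dg_ob GL" "?Q \<in> dg_ob GL"
    using complex_of_modules.zero_cocycle[OF M_complex] by simp_all
  \<comment> \<open>The gluing condition quantifies over all objects isomorphic to a shift of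
    \<open>?Q\<close>; for \<open>i = 0\<close> this includes \<open>?Q\<close> itself.\<close>
  have "?Q \<in> shift_class GL 0 {?Q}" using PQ(2) G.tw_shift_refl[OF PQ(2)] by (simp add: shift_class_def)
  then have "hom_vanishes (homotopy_category GL) ?P ?Q"
    using glue P Q unfolding t_structures_glue_def by blast
  then have null: "G.null_at 0 ?P ?Q" using PQ G.hom_vanishes_iff by blast
  note [simp] = A.hom_group_closed B.hom_group_closed M_group_closed M_diff_linear A.diff_linear B.diff_linear
    left_linear right_linear
  have "(\<zero>\<^bsub>grade (dg_hom A X V) 0\<^esub>, \<zero>\<^bsub>grade (dg_hom B W Y) 0\<^esub>, c) \<in> cocycles (dg_hom GL ?P ?Q) 0"
    using c by (simp add: cocycles_def M_group_simps)
  then have "(\<zero>\<^bsub>grade (dg_hom A X V) 0\<^esub>, \<zero>\<^bsub>grade (dg_hom B W Y) 0\<^esub>, c) \<in> coboundaries (dg_hom GL ?P ?Q) 0"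
    using null by auto
  then obtain a b e where abe: "a \<in> dg_mor A X V (- 1)" "b \<in> dg_mor B W Y (- 1)" "e \<in> carrier (grade (bf_ob M X Y) (- 2))"
    "c = \<ominus>\<^bsub>grade (bf_ob M X Y) (- 1)\<^esub> cdiff (bf_ob M X Y) (- 2) e
        \<ominus>\<^bsub>grade (bf_ob M X Y) (- 1)\<^esub> left_act A M X W Y (- 1) 0 b \<zero>\<^bsub>grade (bf_ob M X W) 0\<^esub>
        \<oplus>\<^bsub>grade (bf_ob M X Y) (- 1)\<^esub> right_act B M X V Y 0 (- 1) \<zero>\<^bsub>grade (bf_ob M V Y) 0\<^esub> a"
    by (auto simp: coboundaries_def simp del: left_linear right_linear)
  \<comment> \<open>Both gluing data are zero, so the actions contribute nothing to the primitive
    and only the negated differential of \<open>e\<close> remains.\<close>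
  then have "c = cdiff (bf_ob M X Y) (- 2) (\<ominus>\<^bsub>grade (bf_ob M X Y) (- 2)\<^esub> e)"
    by (simp add: M_group_simps M_diff_closed)
  with abe(3) show "c \<in> coboundaries (bf_ob M X Y) (- 1)"
    unfolding coboundaries_def by (intro image_eqI[of _ _ "\<ominus>\<^bsub>grade (bf_ob M X Y) (- 2)\<^esub> e"]) simp_all
qed

end

end

section \<open>The equivalence\<close>

context dg_bimodule_data
begin

interpretation G: dg_category R GL
  by (rule glued_dg_category)

text \<open>Closedness makes \<open>c\<close> a homotopy for the square formed by \<open>a\<close>,
  \<open>b\<close>, \<open>\<phi>1\<close> and \<open>\<phi>2\<close>; the square need not commute
  strictly.\<close>

lemma glued_cocycle_iff:
  assumes P: "(X1, Y1, \<phi>1) \<in> dg_ob GL" and Q: "(X2, Y2, \<phi>2) \<in> dg_ob GL"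
  shows "(a, b, c) \<in> cocycles (dg_hom GL (X1, Y1, \<phi>1) (X2, Y2, \<phi>2)) 0 \<longleftrightarrow>
    a \<in> cocycles (dg_hom A X1 X2) 0 \<and> b \<in> cocycles (dg_hom B Y1 Y2) 0 \<and> c \<in> carrier (grade (bf_ob M X1 Y2) (- 1)) \<and>
    right_act B M X1 X2 Y2 0 0 \<phi>2 a \<ominus>\<^bsub>grade (bf_ob M X1 Y2) 0\<^esub> left_act A M X1 Y1 Y2 0 0 b \<phi>1 = cdiff (bf_ob M X1 Y2) (- 1) c"
proof -
  have ob: "X1 \<in> dg_ob A" "X2 \<in> dg_ob A" "Y1 \<in> dg_ob B" "Y2 \<in> dg_ob B"
    and \<phi>: "\<phi>1 \<in> carrier (grade (bf_ob M X1 Y1) 0)" "\<phi>2 \<in> carrier (grade (bf_ob M X2 Y2) 0)"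
    using P Q by (auto simp: cocycles_def)
  have "\<ominus>\<^bsub>grade (bf_ob M X1 Y2) 0\<^esub> x \<ominus>\<^bsub>grade (bf_ob M X1 Y2) 0\<^esub> y \<oplus>\<^bsub>grade (bf_ob M X1 Y2) 0\<^esub> z = \<zero>\<^bsub>grade (bf_ob M X1 Y2) 0\<^esub> \<longleftrightarrow>
      z \<ominus>\<^bsub>grade (bf_ob M X1 Y2) 0\<^esub> y = x"
    if "x \<in> carrier (grade (bf_ob M X1 Y2) 0)" "y \<in> carrier (grade (bf_ob M X1 Y2) 0)" "z \<in> carrier (grade (bf_ob M X1 Y2) 0)" for x y z
    using ob that by (simp add: M_group_simps)
  then show ?thesis
    using ob \<phi> by (auto simp: cocycles_def M_diff_closed left_closed right_closed)
qed

text \<open>A projection commutes with differentials, which gives one inclusion. For the other, a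
  coboundary \<open>dw\<close> lifts to the differential of \<open>w\<close> extended by zero, since
  the projection forgets the resulting component in \<open>M\<close>.\<close>

lemma glued_class_projections:
  assumes P: "(X1, Y1, \<phi>1) \<in> dg_ob GL" and Q: "(X2, Y2, \<phi>2) \<in> dg_ob GL"
    and abc: "(a, b, c) \<in> cocycles (dg_hom GL (X1, Y1, \<phi>1) (X2, Y2, \<phi>2)) 0"
  shows "fst ` cohom_class (dg_hom GL (X1, Y1, \<phi>1) (X2, Y2, \<phi>2)) 0 (a, b, c) = cohom_class (dg_hom A X1 X2) 0 a"
    and "(\<lambda>x. fst (snd x)) ` cohom_class (dg_hom GL (X1, Y1, \<phi>1) (X2, Y2, \<phi>2)) 0 (a, b, c) = cohom_class (dg_hom B Y1 Y2) 0 b"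
proof -
  let ?K = "dg_hom GL (X1, Y1, \<phi>1) (X2, Y2, \<phi>2)"
  have ob: "X1 \<in> dg_ob A" "X2 \<in> dg_ob A" "Y1 \<in> dg_ob B" "Y2 \<in> dg_ob B" using P Q by auto
  interpret K: complex_of_modules R ?K using P Q by (rule G.hom_complex_of_modules)
  interpret KA: complex_of_modules R "dg_hom A X1 X2" using ob by (simp add: A.hom_complex_of_modules)
  interpret KB: complex_of_modules R "dg_hom B Y1 Y2" using ob by (simp add: B.hom_complex_of_modules)
  note [simp] = A.hom_group_closed B.hom_group_closed M_group_closed
  show "fst ` cohom_class ?K 0 (a, b, c) = cohom_class (dg_hom A X1 X2) 0 a"
  proof (intro equalityI subsetI)
    fix x assume "x \<in> fst ` cohom_class ?K 0 (a, b, c)"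
    then show "x \<in> cohom_class (dg_hom A X1 X2) 0 a"
      by (auto simp: K.cohom_class_mem KA.cohom_class_mem coboundaries_def)
  next
    fix x assume "x \<in> cohom_class (dg_hom A X1 X2) 0 a"
    then obtain w where w: "w \<in> dg_mor A X1 X2 (- 1)" "x = cdiff (dg_hom A X1 X2) (- 1) w \<oplus>\<^bsub>grade (dg_hom A X1 X2) 0\<^esub> a"
      by (auto simp: KA.cohom_class_mem coboundaries_def)
    let ?z = "(w, \<zero>\<^bsub>grade (dg_hom B Y1 Y2) (- 1)\<^esub>, \<zero>\<^bsub>grade (bf_ob M X1 Y2) (- 2)\<^esub>)"
    have "cdiff ?K (- 1) ?z \<oplus>\<^bsub>grade ?K 0\<^esub> (a, b, c) \<in> cohom_class ?K 0 (a, b, c)"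
      using ob w by (intro K.cohom_class_memI[OF K.coboundaryI refl]) simp_all
    then show "x \<in> fst ` cohom_class ?K 0 (a, b, c)"
      by (rule image_eqI[rotated]) (simp add: w(2))
  qed
  show "(\<lambda>x. fst (snd x)) ` cohom_class ?K 0 (a, b, c) = cohom_class (dg_hom B Y1 Y2) 0 b"
  proof (intro equalityI subsetI)
    fix x assume "x \<in> (\<lambda>x. fst (snd x)) ` cohom_class ?K 0 (a, b, c)"
    then show "x \<in> cohom_class (dg_hom B Y1 Y2) 0 b"
      by (auto simp: K.cohom_class_mem KB.cohom_class_mem coboundaries_def)
  next
    fix x assume "x \<in> cohom_class (dg_hom B Y1 Y2) 0 b"
    then obtain w where w: "w \<in> dg_mor B Y1 Y2 (- 1)" "x = cdiff (dg_hom B Y1 Y2) (- 1) w \<oplus>\<^bsub>grade (dg_hom B Y1 Y2) 0\<^esub> b"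
      by (auto simp: KB.cohom_class_mem coboundaries_def)
    let ?z = "(\<zero>\<^bsub>grade (dg_hom A X1 X2) (- 1)\<^esub>, w, \<zero>\<^bsub>grade (bf_ob M X1 Y2) (- 2)\<^esub>)"
    have "cdiff ?K (- 1) ?z \<oplus>\<^bsub>grade ?K 0\<^esub> (a, b, c) \<in> cohom_class ?K 0 (a, b, c)"
      using ob w by (intro K.cohom_class_memI[OF K.coboundaryI refl]) simp_all
    then show "x \<in> (\<lambda>x. fst (snd x)) ` cohom_class ?K 0 (a, b, c)"
      by (rule image_eqI[rotated]) (simp add: w(2))
  qed
qed

text \<open>Primitives \<open>a'\<close> and \<open>b'\<close> already account for the first two
  components. The defect in the third is a cocycle of degree \<open>-1\<close> in
  \<open>M(X1, Y2)\<close>, hence exact, and its primitive completes the triple.\<close>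

lemma glued_coboundaryI:
  assumes P: "(X1, Y1, \<phi>1) \<in> dg_ob GL" and Q: "(X2, Y2, \<phi>2) \<in> dg_ob GL"
    and abc: "(a, b, c) \<in> cocycles (dg_hom GL (X1, Y1, \<phi>1) (X2, Y2, \<phi>2)) 0"
    and a: "a \<in> coboundaries (dg_hom A X1 X2) 0" and b: "b \<in> coboundaries (dg_hom B Y1 Y2) 0"
    and vanish: "cocycles (bf_ob M X1 Y2) (- 1) \<subseteq> coboundaries (bf_ob M X1 Y2) (- 1)"
  shows "(a, b, c) \<in> coboundaries (dg_hom GL (X1, Y1, \<phi>1) (X2, Y2, \<phi>2)) 0"
proof -
  let ?N = "grade (bf_ob M X1 Y2) (- 1)"
  have ob: "X1 \<in> dg_ob A" "X2 \<in> dg_ob A" "Y1 \<in> dg_ob B" "Y2 \<in> dg_ob B"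
    and \<phi>: "\<phi>1 \<in> carrier (grade (bf_ob M X1 Y1) 0)" "cdiff (bf_ob M X1 Y1) 0 \<phi>1 = \<zero>\<^bsub>grade (bf_ob M X1 Y1) 1\<^esub>"
      "\<phi>2 \<in> carrier (grade (bf_ob M X2 Y2) 0)" "cdiff (bf_ob M X2 Y2) 0 \<phi>2 = \<zero>\<^bsub>grade (bf_ob M X2 Y2) 1\<^esub>"
    using P Q by (auto simp: cocycles_def)
  note abc = abc[unfolded glued_cocycle_iff[OF P Q]]
  obtain a' where a': "a' \<in> dg_mor A X1 X2 (- 1)" "a = cdiff (dg_hom A X1 X2) (- 1) a'"
    using a by (auto simp: coboundaries_def)
  obtain b' where b': "b' \<in> dg_mor B Y1 Y2 (- 1)" "b = cdiff (dg_hom B Y1 Y2) (- 1) b'"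
    using b by (auto simp: coboundaries_def)
  define l where "l = left_act A M X1 Y1 Y2 (- 1) 0 b' \<phi>1"
  define r where "r = right_act B M X1 X2 Y2 0 (- 1) \<phi>2 a'"
  have lr: "l \<in> carrier ?N" "r \<in> carrier ?N" and c: "c \<in> carrier ?N"
    using ob \<phi> a' b' abc by (auto simp: l_def r_def left_closed right_closed)
  have dl: "cdiff (bf_ob M X1 Y2) (- 1) l = left_act A M X1 Y1 Y2 0 0 b \<phi>1"
    using diff_left[of X1 Y1 Y2 b' "- 1" \<phi>1 0 "- 1"] ob \<phi> b'
    by (simp add: l_def left_linear left_closed B.diff_closed signed_zero[OF M_module] M_group_simps(9))
  have dr: "cdiff (bf_ob M X1 Y2) (- 1) r = right_act B M X1 X2 Y2 0 0 \<phi>2 a"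
    using diff_right[of X1 X2 Y2 a' "- 1" \<phi>2 0 "- 1"] ob \<phi> a'
    by (simp add: r_def right_linear right_closed A.diff_closed signed_simps M_group_simps(8))
  \<comment> \<open>The defect: the actions of \<open>a'\<close> and \<open>b'\<close> put
    \<open>r - l\<close> into the third component. It is closed because \<open>d l\<close> and
    \<open>d r\<close> are the two terms whose difference is \<open>d c\<close>.\<close>
  have "c \<oplus>\<^bsub>?N\<^esub> l \<ominus>\<^bsub>?N\<^esub> r \<in> cocycles (bf_ob M X1 Y2) (- 1)"
  proof -
    have "left_act A M X1 Y1 Y2 0 0 b \<phi>1 \<in> carrier (grade (bf_ob M X1 Y2) 0)" "right_act B M X1 X2 Y2 0 0 \<phi>2 a \<in> carrier (grade (bf_ob M X1 Y2) 0)"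
      using M_diff_closed[OF ob(1,4) lr(1)] M_diff_closed[OF ob(1,4) lr(2)] by (simp_all add: dl dr)
    moreover have "cdiff (bf_ob M X1 Y2) (- 1) c =
        right_act B M X1 X2 Y2 0 0 \<phi>2 a \<ominus>\<^bsub>grade (bf_ob M X1 Y2) 0\<^esub> left_act A M X1 Y1 Y2 0 0 b \<phi>1"
      using abc by simp
    ultimately show ?thesis
      using ob lr c by (simp add: cocycles_def M_group_closed M_diff_linear dl dr) (simp add: M_group_simps)
  qed
  then obtain e where e: "e \<in> carrier (grade (bf_ob M X1 Y2) (- 2))" "cdiff (bf_ob M X1 Y2) (- 2) e = c \<oplus>\<^bsub>?N\<^esub> l \<ominus>\<^bsub>?N\<^esub> r"
    using vanish by (force simp: coboundaries_def)
  \<comment> \<open>The differential of a triple contains the third component with a minus sign, so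
    \<open>- e\<close> contributes \<open>c + l - r\<close>, and the actions add
    \<open>r - l\<close>.\<close>
  let ?z = "(a', b', \<ominus>\<^bsub>grade (bf_ob M X1 Y2) (- 2)\<^esub> e)"
  have "cdiff (dg_hom GL (X1, Y1, \<phi>1) (X2, Y2, \<phi>2)) (- 1) ?z = (a, b, c)"
    using ob e(1) lr c by (simp add: a'(2)[symmetric] b'(2)[symmetric] l_def[symmetric] r_def[symmetric] M_diff_linear e(2) M_group_simps)
  moreover have "?z \<in> dg_mor GL (X1, Y1, \<phi>1) (X2, Y2, \<phi>2) (- 1)"
    using ob a' b' e by (simp add: M_group_closed)
  ultimately show ?thesis unfolding coboundaries_def by force
qed

context
  fixes A0 :: "'a set" and B0 :: "'b set"
  assumes A0: "A0 \<subseteq> dg_ob A" and B0: "B0 \<subseteq> dg_ob B"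
begin

abbreviation (input) "CA0 \<equiv> full_subcategory (homotopy_category A) A0"
abbreviation (input) "CB0 \<equiv> full_subcategory (homotopy_category B) B0"
abbreviation (input) "gl0 \<equiv> {(X, Y, \<phi>). X \<in> A0 \<and> Y \<in> B0 \<and> \<phi> \<in> cocycles (bf_ob M X Y) 0}"

text \<open>On morphisms the class is projected as a set, so no representative has to be
  chosen.\<close>

definition heart_functor ::
  "('a \<times> 'b \<times> 'x, 'a \<times> 'b \<times> 'x set, ('m \<times> 'n \<times> 'x) set, 'm set \<times> 'n set) functor_data" where
  "heart_functor = \<lparr>fun_ob = (\<lambda>(X, Y, \<phi>). (X, Y, cohom_class (bf_ob M X Y) 0 \<phi>)),
     fun_mor = (\<lambda>P Q \<xi>. (fst ` \<xi>, (\<lambda>x. fst (snd x)) ` \<xi>))\<rparr>"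

lemma heart_functor_ob: "fun_ob heart_functor (X, Y, \<phi>) = (X, Y, cohom_class (bf_ob M X Y) 0 \<phi>)"
  by (simp add: heart_functor_def)

lemma heart_abelian_bimodule: "abelian_bimodule R CA0 CB0 (H0_bimodule M)"
  using A0 B0 by (intro abelian_bimodule_full_subcategory[OF H0_abelian_bimodule]) simp_all

interpretation N: abelian_bimodule R CA0 CB0 "H0_bimodule M"
  by (rule heart_abelian_bimodule)

lemma heart_functor_mor:
  assumes "(X1, Y1, \<phi>1) \<in> gl0" "(X2, Y2, \<phi>2) \<in> gl0" "(a, b, c) \<in> cocycles (dg_hom GL (X1, Y1, \<phi>1) (X2, Y2, \<phi>2)) 0"
  shows "fun_mor heart_functor P Q (cohom_class (dg_hom GL (X1, Y1, \<phi>1) (X2, Y2, \<phi>2)) 0 (a, b, c)) =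
    (cohom_class (dg_hom A X1 X2) 0 a, cohom_class (dg_hom B Y1 Y2) 0 b)"
proof -
  have P: "(X1, Y1, \<phi>1) \<in> dg_ob GL" and Q: "(X2, Y2, \<phi>2) \<in> dg_ob GL" using assms A0 B0 by auto
  show ?thesis using glued_class_projections[OF P Q assms(3)] by (simp add: heart_functor_def)
qed

text \<open>Both conditions say that \<open>\<phi>2 a - b \<phi>1\<close> is a coboundary in
  \<open>M(X1, Y2)\<close>: on the left as an equality of classes, on the right with
  \<open>c\<close> as primitive.\<close>

lemma abelian_glued_compat_iff:
  assumes P: "(X1, Y1, \<phi>1) \<in> gl0" and Q: "(X2, Y2, \<phi>2) \<in> gl0"
    and a: "a \<in> cocycles (dg_hom A X1 X2) 0" and b: "b \<in> cocycles (dg_hom B Y1 Y2) 0"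
  shows "(cohom_class (dg_hom A X1 X2) 0 a, cohom_class (dg_hom B Y1 Y2) 0 b) \<in>
      carrier (lhom (abelian_glued CA0 CB0 (H0_bimodule M)) (fun_ob heart_functor (X1, Y1, \<phi>1)) (fun_ob heart_functor (X2, Y2, \<phi>2))) \<longleftrightarrow>
    (\<exists>c. (a, b, c) \<in> cocycles (dg_hom GL (X1, Y1, \<phi>1) (X2, Y2, \<phi>2)) 0)"
proof -
  have ob: "X1 \<in> dg_ob A" "X2 \<in> dg_ob A" "Y1 \<in> dg_ob B" "Y2 \<in> dg_ob B"
    and \<phi>: "\<phi>1 \<in> cocycles (bf_ob M X1 Y1) 0" "\<phi>2 \<in> cocycles (bf_ob M X2 Y2) 0"
    using P Q A0 B0 by auto
  interpret M12: complex_of_modules R "bf_ob M X1 Y2" using ob by (simp add: M_complex)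
  have lr: "left_act A M X1 Y1 Y2 0 0 b \<phi>1 \<in> cocycles (bf_ob M X1 Y2) 0" "right_act B M X1 X2 Y2 0 0 \<phi>2 a \<in> cocycles (bf_ob M X1 Y2) 0"
    using ob \<phi> a b by (auto intro: left_cocycle right_cocycle)
  have \<phi>': "\<phi>1 \<in> carrier (grade (bf_ob M X1 Y1) 0)" "right_act B M X1 X2 Y2 0 0 \<phi>2 a \<in> carrier (grade (bf_ob M X1 Y2) 0)"
    using \<phi> lr by (auto simp: cocycles_def)
  have "(cohom_class (dg_hom A X1 X2) 0 a, cohom_class (dg_hom B Y1 Y2) 0 b) \<in>
      carrier (lhom (abelian_glued CA0 CB0 (H0_bimodule M)) (fun_ob heart_functor (X1, Y1, \<phi>1)) (fun_ob heart_functor (X2, Y2, \<phi>2))) \<longleftrightarrow>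
      cohom_class (bf_ob M X1 Y2) 0 (left_act A M X1 Y1 Y2 0 0 b \<phi>1) = cohom_class (bf_ob M X1 Y2) 0 (right_act B M X1 X2 Y2 0 0 \<phi>2 a)"
    using ob \<phi> \<phi>' a b by (simp add: heart_functor_ob H0_bimodule_mor A.id_closed B.id_closed id_act
        complex_of_modules.cohomology_carrier[OF A.hom_complex_of_modules] complex_of_modules.cohomology_carrier[OF B.hom_complex_of_modules])
  also have "\<dots> \<longleftrightarrow> right_act B M X1 X2 Y2 0 0 \<phi>2 a \<ominus>\<^bsub>grade (bf_ob M X1 Y2) 0\<^esub> left_act A M X1 Y1 Y2 0 0 b \<phi>1 \<in> coboundaries (bf_ob M X1 Y2) 0"
    using M12.cohom_class_eq_iff[OF M12.cocycles_carrier[OF lr(2)] M12.cocycles_carrier[OF lr(1)]] by metis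
  also have "\<dots> \<longleftrightarrow> (\<exists>c. (a, b, c) \<in> cocycles (dg_hom GL (X1, Y1, \<phi>1) (X2, Y2, \<phi>2)) 0)"
    using ob \<phi> a b by (subst glued_cocycle_iff) (auto simp: coboundaries_def)
  finally show ?thesis .
qed

lemma gl0_objects: "gl0 \<subseteq> dg_ob GL"
  using A0 B0 by auto

lemma gl0_cases:
  assumes "P \<in> gl0"
  obtains X Y \<phi> where "P = (X, Y, \<phi>)" "(X, Y, \<phi>) \<in> gl0" "(X, Y, \<phi>) \<in> dg_ob GL" "X \<in> dg_ob A" "Y \<in> dg_ob B"
    "\<phi> \<in> cocycles (bf_ob M X Y) 0"
  using assms A0 B0 that by (cases P) auto

lemma glued_class_cases:
  assumes "P \<in> dg_ob GL" "Q \<in> dg_ob GL" "\<xi> \<in> carrier (lhom (homotopy_category GL) P Q)"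
  obtains a b c where "(a, b, c) \<in> cocycles (dg_hom GL P Q) 0" "\<xi> = cohom_class (dg_hom GL P Q) 0 (a, b, c)"
  using assms that by (auto simp: complex_of_modules.cohomology_carrier[OF G.hom_complex_of_modules])

lemma heart_functor_linear:
  "linear_functor R (full_subcategory (homotopy_category GL) gl0) (abelian_glued CA0 CB0 (H0_bimodule M)) heart_functor"
proof (intro linear_functor.intro linear_functor_axioms.intro)
  show "linear_category R (full_subcategory (homotopy_category GL) gl0)"
    using gl0_objects by (intro linear_category_full_subcategory[OF G.homotopy_category_linear]) simp
  show "linear_category R (abelian_glued CA0 CB0 (H0_bimodule M))" by (rule N.abelian_glued_linear)
next
  fix P assume "P \<in> lob (full_subcategory (homotopy_category GL) gl0)"
  then have "P \<in> gl0" by simp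
  then show "fun_ob heart_functor P \<in> lob (abelian_glued CA0 CB0 (H0_bimodule M))"
    by (rule gl0_cases)
      (simp add: heart_functor_ob complex_of_modules.cohomology_carrier[OF M_complex])
next
  fix P Q assume "P \<in> lob (full_subcategory (homotopy_category GL) gl0)" "Q \<in> lob (full_subcategory (homotopy_category GL) gl0)"
  then have "P \<in> gl0" "Q \<in> gl0" by simp_all
  obtain X1 Y1 \<phi>1 where P: "P = (X1, Y1, \<phi>1)" "(X1, Y1, \<phi>1) \<in> gl0" "(X1, Y1, \<phi>1) \<in> dg_ob GL"
      "X1 \<in> dg_ob A" "Y1 \<in> dg_ob B" "\<phi>1 \<in> cocycles (bf_ob M X1 Y1) 0"
    using \<open>P \<in> gl0\<close> by (rule gl0_cases)
  obtain X2 Y2 \<phi>2 where Q: "Q = (X2, Y2, \<phi>2)" "(X2, Y2, \<phi>2) \<in> gl0" "(X2, Y2, \<phi>2) \<in> dg_ob GL"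
      "X2 \<in> dg_ob A" "Y2 \<in> dg_ob B" "\<phi>2 \<in> cocycles (bf_ob M X2 Y2) 0"
    using \<open>Q \<in> gl0\<close> by (rule gl0_cases)
  interpret K: complex_of_modules R "dg_hom GL P Q" unfolding P(1) Q(1) using P(3) Q(3) by (rule G.hom_complex_of_modules)
  interpret KA: complex_of_modules R "dg_hom A X1 X2" using P Q by (simp add: A.hom_complex_of_modules)
  interpret KB: complex_of_modules R "dg_hom B Y1 Y2" using P Q by (simp add: B.hom_complex_of_modules)
  note mor = heart_functor_mor[OF P(2) Q(2), folded P(1) Q(1)]
  have carr: "a \<in> dg_mor A X1 X2 0" "b \<in> dg_mor B Y1 Y2 0" if "(a, b, c) \<in> cocycles (dg_hom GL P Q) 0" for a b c
    using that by (auto simp: P(1) Q(1) cocycles_def)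
  show "fun_mor heart_functor P Q \<in> mod_hom R (lhom (full_subcategory (homotopy_category GL) gl0) P Q)
      (lhom (abelian_glued CA0 CB0 (H0_bimodule M)) (fun_ob heart_functor P) (fun_ob heart_functor Q))"
    unfolding full_subcategory_simps
  proof (rule mod_homI)
    fix \<xi> assume "\<xi> \<in> carrier (lhom (homotopy_category GL) P Q)"
    then obtain a b c where abc: "(a, b, c) \<in> cocycles (dg_hom GL P Q) 0" "\<xi> = cohom_class (dg_hom GL P Q) 0 (a, b, c)"
      using P(1,3) Q(1,3) by (elim glued_class_cases[rotated 2]) simp_all
    have ab: "a \<in> cocycles (dg_hom A X1 X2) 0" "b \<in> cocycles (dg_hom B Y1 Y2) 0"
      using abc(1) glued_cocycle_iff[OF P(3) Q(3)] by (simp_all add: P(1) Q(1))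
    show "fun_mor heart_functor P Q \<xi> \<in> carrier (lhom (abelian_glued CA0 CB0 (H0_bimodule M)) (fun_ob heart_functor P) (fun_ob heart_functor Q))"
      using abelian_glued_compat_iff[OF P(2) Q(2) ab] abc(1) mor[OF abc(1)] unfolding abc(2) P(1) Q(1) by auto
    {
      fix r assume r: "r \<in> carrier R"
      let ?s = "r \<odot>\<^bsub>grade (dg_hom GL P Q) 0\<^esub> (a, b, c)"
      have s: "?s = (r \<odot>\<^bsub>grade (dg_hom A X1 X2) 0\<^esub> a, r \<odot>\<^bsub>grade (dg_hom B Y1 Y2) 0\<^esub> b, r \<odot>\<^bsub>grade (bf_ob M X1 Y2) (- 1)\<^esub> c)"
        by (simp add: P(1) Q(1))
      have "r \<odot>\<^bsub>lhom (homotopy_category GL) P Q\<^esub> \<xi> = cohom_class (dg_hom GL P Q) 0 ?s"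
        using abc r by (simp add: K.cohomology_smult K.cocycles_carrier)
      then show "fun_mor heart_functor P Q (r \<odot>\<^bsub>lhom (homotopy_category GL) P Q\<^esub> \<xi>) =
          r \<odot>\<^bsub>lhom (abelian_glued CA0 CB0 (H0_bimodule M)) (fun_ob heart_functor P) (fun_ob heart_functor Q)\<^esub> fun_mor heart_functor P Q \<xi>"
        using K.smult_cocycle[OF r abc(1)] r carr[OF abc(1)] abc unfolding s
        by (simp add: heart_functor_mor[OF P(2) Q(2)] P(1) Q(1) heart_functor_ob KA.cohomology_smult KB.cohomology_smult)
    }
    fix \<xi>' assume "\<xi>' \<in> carrier (lhom (homotopy_category GL) P Q)"
    then obtain a' b' c' where abc': "(a', b', c') \<in> cocycles (dg_hom GL P Q) 0" "\<xi>' = cohom_class (dg_hom GL P Q) 0 (a', b', c')"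
      using P(1,3) Q(1,3) by (elim glued_class_cases[rotated 2]) simp_all
    let ?t = "(a, b, c) \<oplus>\<^bsub>grade (dg_hom GL P Q) 0\<^esub> (a', b', c')"
    have t: "?t = (a \<oplus>\<^bsub>grade (dg_hom A X1 X2) 0\<^esub> a', b \<oplus>\<^bsub>grade (dg_hom B Y1 Y2) 0\<^esub> b', c \<oplus>\<^bsub>grade (bf_ob M X1 Y2) (- 1)\<^esub> c')"
      by (simp add: P(1) Q(1))
    have "\<xi> \<oplus>\<^bsub>lhom (homotopy_category GL) P Q\<^esub> \<xi>' = cohom_class (dg_hom GL P Q) 0 ?t"
      using abc abc' by (simp add: K.cohomology_add K.cocycles_carrier)
    then show "fun_mor heart_functor P Q (\<xi> \<oplus>\<^bsub>lhom (homotopy_category GL) P Q\<^esub> \<xi>') =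
        fun_mor heart_functor P Q \<xi> \<oplus>\<^bsub>lhom (abelian_glued CA0 CB0 (H0_bimodule M)) (fun_ob heart_functor P) (fun_ob heart_functor Q)\<^esub>
          fun_mor heart_functor P Q \<xi>'"
      using K.add_cocycle[OF abc(1) abc'(1)] carr[OF abc(1)] carr[OF abc'(1)] abc abc' unfolding t
      by (simp add: heart_functor_mor[OF P(2) Q(2)] P(1) Q(1) heart_functor_ob KA.cohomology_add KB.cohomology_add)
  qed
next
  fix P assume "P \<in> lob (full_subcategory (homotopy_category GL) gl0)"
  then have "P \<in> gl0" by simp
  then show "fun_mor heart_functor P P (lid (full_subcategory (homotopy_category GL) gl0) P) =
      lid (abelian_glued CA0 CB0 (H0_bimodule M)) (fun_ob heart_functor P)"
  proof (rule gl0_cases)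
    fix X Y \<phi> assume P: "P = (X, Y, \<phi>)" "(X, Y, \<phi>) \<in> gl0" "(X, Y, \<phi>) \<in> dg_ob GL"
    show ?thesis
      using heart_functor_mor[OF P(2) P(2), of "dg_id A X" "dg_id B Y" "\<zero>\<^bsub>grade (bf_ob M X Y) (- 1)\<^esub>" P P] G.id_closed[OF P(3)]
      by (simp add: P(1) heart_functor_ob)
  qed
next
  fix P Q S \<xi> \<zeta> assume "P \<in> lob (full_subcategory (homotopy_category GL) gl0)" "Q \<in> lob (full_subcategory (homotopy_category GL) gl0)"
    "S \<in> lob (full_subcategory (homotopy_category GL) gl0)"
    and "\<xi> \<in> carrier (lhom (full_subcategory (homotopy_category GL) gl0) P Q)"
      "\<zeta> \<in> carrier (lhom (full_subcategory (homotopy_category GL) gl0) Q S)"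
  then have \<xi>: "\<xi> \<in> carrier (lhom (homotopy_category GL) P Q)" and \<zeta>: "\<zeta> \<in> carrier (lhom (homotopy_category GL) Q S)"
    and "P \<in> gl0" "Q \<in> gl0" "S \<in> gl0"
    by simp_all
  obtain X1 Y1 \<phi>1 where P: "P = (X1, Y1, \<phi>1)" "(X1, Y1, \<phi>1) \<in> gl0" "(X1, Y1, \<phi>1) \<in> dg_ob GL"
      "X1 \<in> dg_ob A" "Y1 \<in> dg_ob B" "\<phi>1 \<in> cocycles (bf_ob M X1 Y1) 0"
    using \<open>P \<in> gl0\<close> by (rule gl0_cases)
  obtain X2 Y2 \<phi>2 where Q: "Q = (X2, Y2, \<phi>2)" "(X2, Y2, \<phi>2) \<in> gl0" "(X2, Y2, \<phi>2) \<in> dg_ob GL"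
      "X2 \<in> dg_ob A" "Y2 \<in> dg_ob B" "\<phi>2 \<in> cocycles (bf_ob M X2 Y2) 0"
    using \<open>Q \<in> gl0\<close> by (rule gl0_cases)
  obtain X3 Y3 \<phi>3 where S: "S = (X3, Y3, \<phi>3)" "(X3, Y3, \<phi>3) \<in> gl0" "(X3, Y3, \<phi>3) \<in> dg_ob GL"
      "X3 \<in> dg_ob A" "Y3 \<in> dg_ob B" "\<phi>3 \<in> cocycles (bf_ob M X3 Y3) 0"
    using \<open>S \<in> gl0\<close> by (rule gl0_cases)
  have G: "P \<in> dg_ob GL" "Q \<in> dg_ob GL" "S \<in> dg_ob GL" using P(1,3) Q(1,3) S(1,3) by simp_all
  obtain a b c where abc: "(a, b, c) \<in> cocycles (dg_hom GL P Q) 0" "\<xi> = cohom_class (dg_hom GL P Q) 0 (a, b, c)"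
    using G(1,2) \<xi> by (rule glued_class_cases)
  obtain a' b' c' where abc': "(a', b', c') \<in> cocycles (dg_hom GL Q S) 0" "\<zeta> = cohom_class (dg_hom GL Q S) 0 (a', b', c')"
    using G(2,3) \<zeta> by (rule glued_class_cases)
  have ab: "a \<in> cocycles (dg_hom A X1 X2) 0" "b \<in> cocycles (dg_hom B Y1 Y2) 0"
    "a' \<in> cocycles (dg_hom A X2 X3) 0" "b' \<in> cocycles (dg_hom B Y2 Y3) 0"
    using abc(1) abc'(1) P(3) Q(3) S(3) unfolding P(1) Q(1) S(1) by (simp_all only: glued_cocycle_iff)
  have *: "dg_comp GL P Q S 0 0 (a', b', c') (a, b, c) \<in> cocycles (dg_hom GL P S) 0"
    using G.comp_cocycle[OF G abc'(1) abc(1)] by simp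
  have "lcomp (homotopy_category GL) P Q S \<zeta> \<xi> = cohom_class (dg_hom GL P S) 0 (dg_comp GL P Q S 0 0 (a', b', c') (a, b, c))"
    unfolding abc abc' using G abc'(1) abc(1) by (rule G.homotopy_comp)
  then have "fun_mor heart_functor P S (lcomp (homotopy_category GL) P Q S \<zeta> \<xi>) =
      (cohom_class (dg_hom A X1 X3) 0 (dg_comp A X1 X2 X3 0 0 a' a), cohom_class (dg_hom B Y1 Y3) 0 (dg_comp B Y1 Y2 Y3 0 0 b' b))"
    using heart_functor_mor[OF P(2) S(2)] * unfolding P(1) Q(1) S(1) glued_simps by simp
  moreover have "fun_mor heart_functor P Q \<xi> = (cohom_class (dg_hom A X1 X2) 0 a, cohom_class (dg_hom B Y1 Y2) 0 b)"
    using heart_functor_mor[OF P(2) Q(2)] abc by (simp add: P(1) Q(1))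
  moreover have "fun_mor heart_functor Q S \<zeta> = (cohom_class (dg_hom A X2 X3) 0 a', cohom_class (dg_hom B Y2 Y3) 0 b')"
    using heart_functor_mor[OF Q(2) S(2)] abc' by (simp add: S(1) Q(1))
  ultimately show "fun_mor heart_functor P S (lcomp (full_subcategory (homotopy_category GL) gl0) P Q S \<zeta> \<xi>) =
      lcomp (abelian_glued CA0 CB0 (H0_bimodule M)) (fun_ob heart_functor P) (fun_ob heart_functor Q) (fun_ob heart_functor S)
        (fun_mor heart_functor Q S \<zeta>) (fun_mor heart_functor P Q \<xi>)"
    using ab P Q S by (simp add: heart_functor_ob A.homotopy_comp B.homotopy_comp)
qed

lemma heart_equivalence:
  assumes vanish: "\<And>X Y. \<lbrakk>X \<in> A0; Y \<in> B0\<rbrakk> \<Longrightarrow> cocycles (bf_ob M X Y) (- 1) \<subseteq> coboundaries (bf_ob M X Y) (- 1)"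
  shows "equivalent_categories R (full_subcategory (homotopy_category GL) gl0) (abelian_glued CA0 CB0 (H0_bimodule M))"
proof (rule linear_functor.equivalenceI[OF heart_functor_linear])
  fix T assume T: "T \<in> lob (abelian_glued CA0 CB0 (H0_bimodule M))"
  obtain X Y \<mu> where XY: "T = (X, Y, \<mu>)" by (rule prod_cases3)
  with T A0 B0 have "X \<in> A0" "Y \<in> B0" "X \<in> dg_ob A" "Y \<in> dg_ob B" "\<mu> \<in> carrier (cohomology (bf_ob M X Y) 0)" by auto
  moreover from this obtain \<phi> where "\<phi> \<in> cocycles (bf_ob M X Y) 0" "\<mu> = cohom_class (bf_ob M X Y) 0 \<phi>"
    by (auto simp: complex_of_modules.cohomology_carrier[OF M_complex])
  ultimately show "\<exists>P \<in> lob (full_subcategory (homotopy_category GL) gl0). fun_ob heart_functor P = T"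
    by (intro bexI[of _ "(X, Y, \<phi>)"]) (simp_all add: XY heart_functor_ob)
next
  fix P Q assume "P \<in> lob (full_subcategory (homotopy_category GL) gl0)" "Q \<in> lob (full_subcategory (homotopy_category GL) gl0)"
  then have "P \<in> gl0" "Q \<in> gl0" by simp_all
  obtain X1 Y1 \<phi>1 where P: "P = (X1, Y1, \<phi>1)" "(X1, Y1, \<phi>1) \<in> gl0" "(X1, Y1, \<phi>1) \<in> dg_ob GL"
      "X1 \<in> dg_ob A" "Y1 \<in> dg_ob B" "\<phi>1 \<in> cocycles (bf_ob M X1 Y1) 0"
    using \<open>P \<in> gl0\<close> by (rule gl0_cases)
  obtain X2 Y2 \<phi>2 where Q: "Q = (X2, Y2, \<phi>2)" "(X2, Y2, \<phi>2) \<in> gl0" "(X2, Y2, \<phi>2) \<in> dg_ob GL"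
      "X2 \<in> dg_ob A" "Y2 \<in> dg_ob B" "\<phi>2 \<in> cocycles (bf_ob M X2 Y2) 0"
    using \<open>Q \<in> gl0\<close> by (rule gl0_cases)
  have PG: "P \<in> dg_ob GL" and QG: "Q \<in> dg_ob GL" using P(1,3) Q(1,3) by simp_all
  let ?K = "dg_hom GL P Q"
  interpret K: complex_of_modules R ?K using PG QG by (rule G.hom_complex_of_modules)
  interpret KA: complex_of_modules R "dg_hom A X1 X2" using P Q by (simp add: A.hom_complex_of_modules)
  interpret KB: complex_of_modules R "dg_hom B Y1 Y2" using P Q by (simp add: B.hom_complex_of_modules)
  note mor = heart_functor_mor[OF P(2) Q(2), folded P(1) Q(1)]
  note cocycle_iff = glued_cocycle_iff[OF P(3) Q(3), folded P(1) Q(1)]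
  have "inj_on (fun_mor heart_functor P Q) (carrier (lhom (homotopy_category GL) P Q))"
  proof (rule inj_onI)
    fix \<xi> \<zeta> assume \<xi>: "\<xi> \<in> carrier (lhom (homotopy_category GL) P Q)" and \<zeta>: "\<zeta> \<in> carrier (lhom (homotopy_category GL) P Q)"
      and eq: "fun_mor heart_functor P Q \<xi> = fun_mor heart_functor P Q \<zeta>"
    obtain a b c where abc: "(a, b, c) \<in> cocycles ?K 0" "\<xi> = cohom_class ?K 0 (a, b, c)"
      using PG QG \<xi> by (rule glued_class_cases)
    obtain a' b' c' where abc': "(a', b', c') \<in> cocycles ?K 0" "\<zeta> = cohom_class ?K 0 (a', b', c')"
      using PG QG \<zeta> by (rule glued_class_cases)
    have carr: "a \<in> dg_mor A X1 X2 0" "b \<in> dg_mor B Y1 Y2 0" "a' \<in> dg_mor A X1 X2 0" "b' \<in> dg_mor B Y1 Y2 0"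
      and c: "c \<in> carrier (grade (bf_ob M X1 Y2) (- 1))" "c' \<in> carrier (grade (bf_ob M X1 Y2) (- 1))"
      using abc(1) abc'(1) by (auto simp: P(1) Q(1) cocycles_def)
    have "a \<ominus>\<^bsub>grade (dg_hom A X1 X2) 0\<^esub> a' \<in> coboundaries (dg_hom A X1 X2) 0" "b \<ominus>\<^bsub>grade (dg_hom B Y1 Y2) 0\<^esub> b' \<in> coboundaries (dg_hom B Y1 Y2) 0"
      using eq carr by (simp_all add: abc(2) abc'(2) mor[OF abc(1)] mor[OF abc'(1)] KA.cohom_class_eq_iff KB.cohom_class_eq_iff)
    \<comment> \<open>Equality of the images controls only the first two components of the
      difference; the third stays an unspecified \<open>e\<close>, to be handled by the vanishing
      hypothesis.\<close>
    moreover obtain e where e: "(a, b, c) \<ominus>\<^bsub>grade ?K 0\<^esub> (a', b', c') =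
        (a \<ominus>\<^bsub>grade (dg_hom A X1 X2) 0\<^esub> a', b \<ominus>\<^bsub>grade (dg_hom B Y1 Y2) 0\<^esub> b', e)"
      using carr c P(4,5) Q(4,5)
      by (simp add: P(1) Q(1) a_minus_def module_sum_neg[where R = R] module_sum_module A.hom_module B.hom_module M_module)
    moreover have "(a, b, c) \<ominus>\<^bsub>grade ?K 0\<^esub> (a', b', c') \<in> cocycles ?K 0"
      unfolding a_minus_def using abc(1) abc'(1) by (intro K.add_cocycle K.neg_cocycle)
    ultimately have "(a, b, c) \<ominus>\<^bsub>grade ?K 0\<^esub> (a', b', c') \<in> coboundaries ?K 0"
      using glued_coboundaryI[OF P(3) Q(3), folded P(1) Q(1)] vanish P(2) Q(2) by auto
    then show "\<xi> = \<zeta>"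
      unfolding abc(2) abc'(2) K.cohom_class_eq_iff[OF K.cocycles_carrier[OF abc(1)] K.cocycles_carrier[OF abc'(1)]] .
  qed
  moreover have "fun_mor heart_functor P Q ` carrier (lhom (homotopy_category GL) P Q) =
      carrier (lhom (abelian_glued CA0 CB0 (H0_bimodule M)) (fun_ob heart_functor P) (fun_ob heart_functor Q))" (is "?I = ?T")
  proof (intro equalityI subsetI)
    fix \<tau> assume "\<tau> \<in> ?I"
    then obtain \<xi> where \<xi>: "\<xi> \<in> carrier (lhom (homotopy_category GL) P Q)" "\<tau> = fun_mor heart_functor P Q \<xi>" by (rule imageE)
    show "\<tau> \<in> ?T"
      unfolding \<xi>(2)
      by (rule mod_hom_closed[OF linear_functor.fun_mor_linear[OF heart_functor_linear, unfolded full_subcategory_simps,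
          OF \<open>P \<in> gl0\<close> \<open>Q \<in> gl0\<close>] \<xi>(1)])
  next
    fix \<tau> assume \<tau>: "\<tau> \<in> ?T"
    then obtain a b where ab: "a \<in> cocycles (dg_hom A X1 X2) 0" "b \<in> cocycles (dg_hom B Y1 Y2) 0"
      "\<tau> = (cohom_class (dg_hom A X1 X2) 0 a, cohom_class (dg_hom B Y1 Y2) 0 b)"
      by (auto simp: P(1) Q(1) heart_functor_ob KA.cohomology_carrier KB.cohomology_carrier)
    then obtain c where c: "(a, b, c) \<in> cocycles ?K 0"
      using \<tau> abelian_glued_compat_iff[OF P(2) Q(2) ab(1,2), folded P(1) Q(1)] by blast
    then have "cohom_class ?K 0 (a, b, c) \<in> carrier (lhom (homotopy_category GL) P Q)"
      by (simp add: K.cohomology_carrier)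
    then show "\<tau> \<in> ?I"
      by (intro image_eqI[of _ _ "cohom_class ?K 0 (a, b, c)"]) (simp_all only: mor[OF c] ab(3))
  qed
  ultimately show "bij_betw (fun_mor heart_functor P Q) (carrier (lhom (full_subcategory (homotopy_category GL) gl0) P Q))
      (carrier (lhom (abelian_glued CA0 CB0 (H0_bimodule M)) (fun_ob heart_functor P) (fun_ob heart_functor Q)))"
    by (simp add: bij_betw_def)
qed

end

end

theorem corollary1p5:
  fixes R :: "'r ring"
    and A :: "('a, 'r, 'm) dgcat" and B :: "('b, 'r, 'n) dgcat"
    and M :: "('a, 'b, 'r, 'm, 'n, 'x) bimodule_data"
    and A_le A_ge :: "'a set" and B_le B_ge :: "'b set"
  assumes "cring R"
    and "dg_category R A" and "additive_category R (homotopy_category A)" and "pretriangulated A"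
    and "dg_category R B" and "additive_category R (homotopy_category B)" and "pretriangulated B"
    and "t_structure A A_le A_ge" and "t_structure B B_le B_ge"
    and "dg_bimodule R A B M"
  defines "A0 \<equiv> heart A_le A_ge" and "B0 \<equiv> heart B_le B_ge"
  defines "CA0 \<equiv> full_subcategory (homotopy_category A) A0"
    and "CB0 \<equiv> full_subcategory (homotopy_category B) B0"
  shows "abelian_bimodule R CA0 CB0 (H0_bimodule M) \<and>
    (t_structures_glue A B M A0 B0 \<longrightarrow>
       equivalent_categories R (glued_heart A B M A0 B0) (abelian_glued CA0 CB0 (H0_bimodule M)))"
proof (intro conjI impI)
  interpret dg_bimodule_data R A B M
    using assms(2,5,10) by (intro dg_bimodule_data.intro dg_bimodule_data_axioms.intro)
  have A0: "A0 \<subseteq> dg_ob A" and B0: "B0 \<subseteq> dg_ob B"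
    using A.aisles_objects[OF assms(4,8)] B.aisles_objects[OF assms(7,9)] by (auto simp: A0_def B0_def heart_def)
  show "abelian_bimodule R CA0 CB0 (H0_bimodule M)"
    unfolding CA0_def CB0_def using A0 B0 by (rule heart_abelian_bimodule)
  have zeros: "\<exists>Z. zero_object (homotopy_category A) Z" "\<exists>Z. zero_object (homotopy_category B) Z"
    using assms(3,6) by (simp_all add: additive_category_def)
  \<comment> \<open>The hearts enter the gluing as classes that contain the zero objects and are
    closed under cone data; additivity supplies the existence of zero objects.\<close>
  note closure = A0 A.heart_zero_object[OF assms(4,8), folded A0_def] A.heart_extension[OF assms(4,8), folded A0_def]
    B0 B.heart_zero_object[OF assms(7,9), folded B0_def] B.heart_extension[OF assms(7,9), folded B0_def] zeros
  assume glue: "t_structures_glue A B M A0 B0"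
  have objects: "extension_closure GL (glue_left B M A0 \<union> glue_right A M B0) =
      {(X, Y, \<phi>). X \<in> A0 \<and> Y \<in> B0 \<and> \<phi> \<in> cocycles (bf_ob M X Y) 0}"
    by (rule glued_heart_objects) (fact closure)+
  have vanish: "cocycles (bf_ob M X Y) (- 1) \<subseteq> coboundaries (bf_ob M X Y) (- 1)" if "X \<in> A0" "Y \<in> B0" for X Y
    by (rule glue_cohomology_vanishes[OF _ _ _ _ _ _ _ _ glue that]) (fact closure)+
  show "equivalent_categories R (glued_heart A B M A0 B0) (abelian_glued CA0 CB0 (H0_bimodule M))"
    unfolding glued_heart_def objects CA0_def CB0_def using A0 B0 vanish by (rule heart_equivalence)
qed

end
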